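(* Let $n\ge 5$ and $r=n-1$. Then the inner Hurwitz space $\mathcal H(A_n,\mathbf C_{3^{n-1}})^{\mathrm{in}}$ has exactly one connected component. Further, the natural map $\Psi^{\mathrm{in}}_{\mathrm{abs}}:\mathcal H(A_n,\mathbf C_{3^{n-1}})^{\mathrm{in}}\to\mathcal H(A_n,\mathbf C_{3^{n-1}})^{\mathrm{abs}}$ has degree 2.
   Context: Permutations act on the right of integers. For $n\ge5$, $\mathbf C_{3^r}$ denotes $r$ repetitions of the conjugacy class of 3-cycles in $A_n$. The Nielsen class $\mathrm{Ni}(A_n,\mathbf C_{3^r})$ is the set of $r$-tuples $(g_1,\dots,g_r)$ of 3-cycles in $A_n$ with $g_1\cdots g_r=1$ and $\langle g_1,\dots,g_r\rangle=A_n$. The absolute Hurwitz space $\mathcal H(A_n,\mathbf C_{3^r})^{\mathrm{abs}}$ parametrizes isomorphism classes (over $\mathbb P^1_z$) of degree $n$ covers $\phi:X\to\mathbb P^1_z$ by compact connected Riemann surfaces with $r$ branch points whose branch cycles (the images of a set of classical generators of the fundamental group of the punctured sphere in the monodromy group) form an element of $\mathrm{Ni}(A_n,\mathbf C_{3^r})$; it is an unramified cover of the space $U_r$ of $r$-element subsets of $\mathbb P^1$. The inner Hurwitz space $\mathcal H(A_n,\mathbf C_{3^r})^{\mathrm{in}}$ parametrizes equivalence classes of pairs (Galois cover $\hat X\to\mathbb P^1_z$ with branch cycles in this Nielsen class, isomorphism of $A_n$ with its automorphism group); $\Psi^{\mathrm{in}}_{\mathrm{abs}}$ sends such a pair to the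 quotient of $\hat X$ by the stabilizer of a letter, a degree $n$ cover. Components of the inner (resp. absolute) space correspond to braid group orbits on $\mathrm{Ni}(A_n,\mathbf C_{3^r})/A_n$ (resp. modulo conjugation by $S_n$). *)

theory Defs
  imports
    "HOL-Complex_Analysis.Complex_Analysis"
    "HOL-Algebra.Sym_Groups"
begin

section \<open>The Riemann sphere\<close>

text \<open>The projective line is the unit sphere, with the complex plane embedded by stereographic
  projection from the north pole.\<close>

type_synonym point = "complex \<times> real"

definition P1 :: "point set" where
  "P1 = sphere 0 1"

definition infty :: point where
  "infty = (0, 1)"

definition stereo :: "complex \<Rightarrow> point" where
  "stereo z = ((2 / (1 + (cmod z)\<^sup>2)) *\<^sub>R z, ((cmod z)\<^sup>2 - 1) / ((cmod z)\<^sup>2 + 1))"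

definition affine_coord :: "point \<Rightarrow> complex" where
  "affine_coord s = (1 / (1 - snd s)) *\<^sub>R fst s"

text \<open>The inverse of a holomorphic coordinate centred at \<open>s\<close>: of \<open>z - s\<close> for finite \<open>s\<close> and of
  \<open>1 / z\<close> at infinity. It serves to orient small circles around \<open>s\<close>.\<close>

definition local_param :: "point \<Rightarrow> complex \<Rightarrow> point" where
  "local_param s w =
     (if s = infty then (if w = 0 then infty else stereo (1 / w))
      else stereo (affine_coord s + w))"

definition small_circle :: "point \<Rightarrow> real \<Rightarrow> real \<Rightarrow> point" where
  "small_circle s e = local_param s \<circ> circlepath 0 e"


section \<open>Loops and classical generators\<close>

definition loops_at :: "'a::topological_space set \<Rightarrow> 'a \<Rightarrow> (real \<Rightarrow> 'a) set" where
  "loops_at Y b = {\<gamma>. path \<gamma> \<and> path_image \<gamma> \<subseteq> Y \<and> pathstart \<gamma> = b \<and> pathfinish \<gamma> = b}"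

definition path_prod :: "point \<Rightarrow> (real \<Rightarrow> point) list \<Rightarrow> real \<Rightarrow> point" where
  "path_prod b \<gamma>s = foldr (+++) \<gamma>s (linepath b b)"

text \<open>\<open>\<gamma>\<close> runs from \<open>b\<close> to a small circle around \<open>s\<close>, once around it counterclockwise, and back.\<close>

definition meridian :: "point set \<Rightarrow> point \<Rightarrow> point \<Rightarrow> (real \<Rightarrow> point) \<Rightarrow> bool" where
  "meridian S b s \<gamma> \<longleftrightarrow>
     (\<exists>e \<delta>. e > 0 \<and> local_param s ` cball 0 e \<inter> S = {s} \<and>
        path \<delta> \<and> path_image \<delta> \<subseteq> P1 - S \<and> pathstart \<delta> = b \<and>
        pathfinish \<delta> = pathstart (small_circle s e) \<and>
        homotopic_paths (P1 - S) \<gamma> (\<delta> +++ small_circle s e +++ reversepath \<delta>))"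

definition classical_generators ::
  "point set \<Rightarrow> point \<Rightarrow> (real \<Rightarrow> point) list \<Rightarrow> bool" where
  "classical_generators S b \<gamma>s \<longleftrightarrow>
     set \<gamma>s \<subseteq> loops_at (P1 - S) b \<and>
     (\<exists>ss. distinct ss \<and> set ss = S \<and> list_all2 (meridian S b) ss \<gamma>s) \<and>
     homotopic_paths (P1 - S) (path_prod b \<gamma>s) (linepath b b) \<and>
     (\<forall>\<gamma> \<in> loops_at (P1 - S) b.
        \<exists>ws. set ws \<subseteq> set \<gamma>s \<union> reversepath ` set \<gamma>s \<and>
             homotopic_paths (P1 - S) \<gamma> (path_prod b ws))"


section \<open>Nielsen classes\<close>

text \<open>Permutations act on the right, so the product \<open>g\<^sub>1 \<cdots> g\<^sub>r\<close> is the function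
  \<open>g\<^sub>r \<circ> \<cdots> \<circ> g\<^sub>1\<close>.\<close>

definition right_prod :: "(nat \<Rightarrow> nat) list \<Rightarrow> nat \<Rightarrow> nat" where
  "right_prod gs = fold (\<circ>) gs id"

definition nielsen_class :: "nat \<Rightarrow> nat \<Rightarrow> (nat \<Rightarrow> nat) list set" where
  "nielsen_class n r =
     {gs. length gs = r \<and> set gs \<subseteq> three_cycles n \<and> right_prod gs = id \<and>
          generate (alt_group n) (set gs) = carrier (alt_group n)}"


section \<open>Hurwitz spaces\<close>

text \<open>A homomorphism from the fundamental group of \<open>Y\<close> at \<open>b\<close> to \<open>A\<^sub>n\<close>, as a function on loops;
  its values off \<^term>\<open>loops_at Y b\<close> are irrelevant.\<close>

definition pi1_hom ::
  "nat \<Rightarrow> 'a::topological_space set \<Rightarrow> 'a \<Rightarrow> ((real \<Rightarrow> 'a) \<Rightarrow> nat \<Rightarrow> nat) \<Rightarrow> bool" where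
  "pi1_hom n Y b \<rho> \<longleftrightarrow>
     (\<forall>\<gamma> \<in> loops_at Y b. \<rho> \<gamma> \<in> carrier (alt_group n)) \<and>
     (\<forall>\<gamma> \<in> loops_at Y b. \<forall>\<gamma>' \<in> loops_at Y b. homotopic_paths Y \<gamma> \<gamma>' \<longrightarrow> \<rho> \<gamma> = \<rho> \<gamma>') \<and>
     (\<forall>\<gamma> \<in> loops_at Y b. \<forall>\<gamma>' \<in> loops_at Y b. \<rho> (\<gamma> +++ \<gamma>') = right_prod [\<rho> \<gamma>, \<rho> \<gamma>'])"

type_synonym datum = "point set \<times> point \<times> ((real \<Rightarrow> point) \<Rightarrow> nat \<Rightarrow> nat)"

text \<open>A branch point set \<open>S\<close>, a base point \<open>b\<close> and the monodromy homomorphism \<open>\<rho>\<close> of a cover of the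
  sphere branched over \<open>S\<close>, with branch cycles in the Nielsen class. A degree \<open>n\<close> cover yields \<open>\<rho>\<close>
  once the points over \<open>b\<close> are numbered by \<open>1, \<dots>, n\<close>; a Galois cover with an identification of its
  automorphism group with \<open>A\<^sub>n\<close> yields \<open>\<rho>\<close> once a point over \<open>b\<close> is chosen.\<close>

definition hurwitz_data :: "nat \<Rightarrow> nat \<Rightarrow> datum set" where
  "hurwitz_data n r =
     {(S, b, \<rho>). S \<subseteq> P1 \<and> finite S \<and> card S = r \<and> b \<in> P1 - S \<and> pi1_hom n (P1 - S) b \<rho> \<and>
        (\<exists>\<gamma>s. classical_generators S b \<gamma>s \<and> map \<rho> \<gamma>s \<in> nielsen_class n r)}"

text \<open>Change of base point along \<open>\<delta>\<close>, and conjugation by \<open>a \<in> A\<close> (in right notation,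
  \<open>\<rho>' \<gamma> = a\<inverse> \<rho>(\<delta> \<gamma> \<delta>\<inverse>) a\<close>). Taking \<open>A = S\<^sub>n\<close> gives isomorphism of degree \<open>n\<close> covers, where
  \<open>a\<close> renumbers the fibre; \<open>A = A\<^sub>n\<close> gives isomorphism of Galois covers together with the
  identification of the automorphism group, where \<open>a\<close> changes the point chosen over \<open>b\<close>.\<close>

definition cover_equiv ::
  "nat \<Rightarrow> nat \<Rightarrow> (nat \<Rightarrow> nat) set \<Rightarrow> (datum \<times> datum) set" where
  "cover_equiv n r A =
     {((S, b, \<rho>), (S', b', \<rho>')).
        (S, b, \<rho>) \<in> hurwitz_data n r \<and> (S', b', \<rho>') \<in> hurwitz_data n r \<and> S' = S \<and>
        (\<exists>\<delta>. path \<delta> \<and> path_image \<delta> \<subseteq> P1 - S \<and> pathstart \<delta> = b \<and> pathfinish \<delta> = b' \<and>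
          (\<exists>a \<in> A. \<forall>\<gamma> \<in> loops_at (P1 - S) b'.
             a \<circ> \<rho> (\<delta> +++ \<gamma> +++ reversepath \<delta>) = \<rho>' \<gamma> \<circ> a))}"

text \<open>The basic neighbourhood of the class of \<open>(S, b, \<rho>)\<close> in the topology making the Hurwitz space
  an unramified cover of the space of \<open>r\<close>-element subsets of the sphere: each branch point moves
  inside its own disc, and the cover does not change over the complement of the discs.\<close>

definition hurwitz_nbhd ::
  "nat \<Rightarrow> nat \<Rightarrow> (nat \<Rightarrow> nat) set \<Rightarrow> datum \<Rightarrow> real \<Rightarrow> datum set set" where
  "hurwitz_nbhd n r A = (\<lambda>(S, b, \<rho>) e.
     {cover_equiv n r A `` {(S', b, \<rho>')} | S' \<rho>'.
        (S', b, \<rho>') \<in> hurwitz_data n r \<and>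
        S' \<subseteq> (\<Union>s\<in>S. ball s e) \<and> (\<forall>s\<in>S. \<exists>!s'. s' \<in> S' \<inter> ball s e) \<and>
        (\<forall>\<gamma> \<in> loops_at (P1 - (\<Union>s\<in>S. ball s e)) b. \<rho>' \<gamma> = \<rho> \<gamma>)})"

definition admissible_radius :: "datum \<Rightarrow> real \<Rightarrow> bool" where
  "admissible_radius = (\<lambda>(S, b, \<rho>) e.
     e > 0 \<and> (\<forall>s\<in>S. e < dist s b) \<and> (\<forall>s\<in>S. \<forall>s'\<in>S. s \<noteq> s' \<longrightarrow> 2 * e < dist s s'))"

definition hurwitz_space ::
  "nat \<Rightarrow> nat \<Rightarrow> (nat \<Rightarrow> nat) set \<Rightarrow> datum set topology" where
  "hurwitz_space n r A = topology_generated_by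
     {hurwitz_nbhd n r A d e | d e. d \<in> hurwitz_data n r \<and> admissible_radius d e}"

definition hurwitz_in :: "nat \<Rightarrow> nat \<Rightarrow> datum set topology" where
  "hurwitz_in n r = hurwitz_space n r (carrier (alt_group n))"

definition hurwitz_abs :: "nat \<Rightarrow> nat \<Rightarrow> datum set topology" where
  "hurwitz_abs n r = hurwitz_space n r (carrier (sym_group n))"

text \<open>The quotient of the Galois cover by the stabilizer of a letter has as monodromy the same
  \<open>\<rho>\<close>, acting on the letters; so an inner class goes to the absolute class containing it.\<close>

definition psi_in_abs :: "nat \<Rightarrow> nat \<Rightarrow> datum set \<Rightarrow> datum set" where
  "psi_in_abs n r c = cover_equiv n r (carrier (sym_group n)) `` c"

definition has_map_degree :: "'a topology \<Rightarrow> 'b topology \<Rightarrow> ('a \<Rightarrow> 'b) \<Rightarrow> nat \<Rightarrow> bool" where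
  "has_map_degree X Y f d \<longleftrightarrow>
     continuous_map X Y f \<and> (\<forall>y \<in> topspace Y. card {x \<in> topspace X. f x = y} = d)"

lemma topspace_hurwitz_space:
  "topspace (hurwitz_space n r A) = hurwitz_data n r // cover_equiv n r A"
proof -
  let ?B = "{hurwitz_nbhd n r A d e | d e. d \<in> hurwitz_data n r \<and> admissible_radius d e}"
  have "c \<in> hurwitz_data n r // cover_equiv n r A" if "c \<in> \<Union> ?B" for c
  proof -
    obtain S b \<rho> e where "c \<in> hurwitz_nbhd n r A (S, b, \<rho>) e"
      using \<open>c \<in> \<Union> ?B\<close> by (elim UnionE CollectE exE conjE) (metis prod_cases3)
    then obtain S' \<rho>' where "c = cover_equiv n r A `` {(S', b, \<rho>')}" "(S', b, \<rho>') \<in> hurwitz_data n r"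
      unfolding hurwitz_nbhd_def prod.case by blast
    then show ?thesis
      by (simp add: quotientI)
  qed
  moreover have "c \<in> \<Union> ?B" if c: "c \<in> hurwitz_data n r // cover_equiv n r A" for c
  proof -
    obtain S b \<rho> where d: "(S, b, \<rho>) \<in> hurwitz_data n r"
      and c: "c = cover_equiv n r A `` {(S, b, \<rho>)}"
      using c by (auto simp: quotient_def)
    have fin: "finite S" and b: "b \<notin> S"
      using d by (auto simp: hurwitz_data_def)
    define M where "M = insert 1 ((\<lambda>s. dist s b) ` S \<union> (\<lambda>(s, s'). dist s s') ` (S \<times> S - Id))"
    have M: "finite M" "M \<noteq> {}" "\<forall>m\<in>M. m > 0"
      using fin b by (auto simp: M_def)
    define e where "e = Min M / 3"
    have e: "e > 0" "\<And>m. m \<in> M \<Longrightarrow> 3 * e \<le> m"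
      using M by (auto simp: e_def)
    have 1: "e < dist s b" if "s \<in> S" for s
      using e(1) e(2)[of "dist s b"] that by (auto simp: M_def)
    have 2: "2 * e < dist s s'" if "s \<in> S" "s' \<in> S" "s \<noteq> s'" for s s'
      using e(1) e(2)[of "dist s s'"] that by (force simp: M_def)
    have adm: "admissible_radius (S, b, \<rho>) e"
      using e(1) 1 2 by (auto simp: admissible_radius_def)
    have near: "s' = s" if "s \<in> S" "s' \<in> S" "dist s s' < e" for s s'
    proof (rule ccontr)
      assume "s' \<noteq> s"
      then have "2 * e < dist s s'"
        using 2 that(1,2) by blast
      with that(3) e(1) show False
        by linarith
    qed
    have one: "\<exists>!s'. s' \<in> S \<inter> ball s e" if s: "s \<in> S" for s
    proof (rule ex1I[of _ s])
      show "s \<in> S \<inter> ball s e"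
        using s e(1) by simp
      show "s' = s" if "s' \<in> S \<inter> ball s e" for s'
        using near[of s s'] s that unfolding Int_iff mem_ball by blast
    qed
    have sub: "S \<subseteq> (\<Union>s\<in>S. ball s e)"
      using e(1) by (meson UN_I centre_in_ball subsetI)
    have "c \<in> hurwitz_nbhd n r A (S, b, \<rho>) e"
      unfolding hurwitz_nbhd_def c prod.case mem_Collect_eq
      by (intro exI[of _ S] exI[of _ \<rho>] conjI refl d sub ballI one)
    moreover have "hurwitz_nbhd n r A (S, b, \<rho>) e \<in> ?B"
      using d adm by blast
    ultimately show ?thesis
      by (rule UnionI[rotated])
  qed
  ultimately show ?thesis
    unfolding hurwitz_space_def topology_generated_by_topspace by blast
qed

end

theory Submission
 imports Defs
begin

text \<open>The cover is recovered from its branch cycles with respect to generators of the fundamental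
 group, so both claims are about tuples of three-cycles. A product-one transitive tuple of \<open>n - 1\<close>
 three-cycles on \<open>n\<close> letters describes a cover of genus zero. Counting incidences gives a letter
 that only two entries move; braiding these next to each other splits off a pair of mutually inverse
 three-cycles with two letters of its own, and induction shows that all tuples agree up to braids and
 conjugation by the symmetric group. The two letters of such a pair can be exchanged by a braid, so
 conjugation by the alternating group suffices and the inner and the absolute space are both connected.

 Shears of the plane are isotopies of the sphere that move any branch point set to \<open>{1, \<dots>, r}\<close>
 and exchange two neighbours; they stay inside a component, and they act on the standard branch cycles
 by the elementary braids. That every tuple in the Nielsen class occurs follows by gluing a covering
 space over the complement of the segment from 1 to \<open>r\<close> and the strips between the branch points.
 The degree is the index of the alternating group in the symmetric group, since no odd permutation
 centralizes the monodromy group.\<close>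

section \<open>Hurwitz moves on tuples, and how whole blocks of entries pass each other\<close>

section \<open>Braid equivalence of tuples of permutations\<close>

text \<open>The number \<open>n - 1\<close> makes the genus zero: a three-cycle has index 2, so
  Riemann-Hurwitz reads \<open>2 (n + g - 1) = 2 r\<close>. The combinatorial obstacle is that four
  letters are exceptional: no genus-zero tuple there has an inverse pair with letters of its own,
  and two letters admit no tuple at all. Deleting a letter or a pair may run into these cases, which
  forces explicit braids for five letters and for two blocks of four letters that share one. When a
  letter is deleted by merging two entries, the induction hypothesis speaks of the merged tuple, and
  its braid is lifted by letting blocks of entries cross like cables. On the geometric side the base
  point is put at infinity, which every shear fixes, and the loops are vertical lines, which
  vertical shears slide along themselves; so only a horizontal shear can change the branch cycles. A
  branch point at infinity is moved away beforehand by a parabolic map. Since a datum provides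
  merely some system of classical generators, conjugacy of meridians is needed before the standard
  system can be used to read off a Nielsen tuple.\<close>

definition cj :: "(nat => nat) => (nat => nat) => nat => nat" where
 "cj s g = s \<circ> g \<circ> inv' s"

lemma cj_id [simp]: "cj id g = g"
 by (simp add: cj_def)

lemma cj_cj: "bij s ==> bij s' ==> cj s (cj s' g) = cj (s \<circ> s') g"
 by (simp add: cj_def o_inv_distrib o_assoc)

lemma cj_comp: "bij s ==> cj s (g \<circ> h) = cj s g \<circ> cj s h"
 by (auto simp: cj_def fun_eq_iff bij_is_inj)

lemma cj_of_id: "bij s ==> cj s id = id"
 by (auto simp: cj_def fun_eq_iff bij_is_surj surj_f_inv_f)

lemma bij_cj [simp]: "bij s ==> bij g ==> bij (cj s g)"
 unfolding cj_def by (intro bij_comp bij_imp_bij_inv)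

lemma bij_inv' [simp]: "bij s ==> bij (inv' s)"
 by (rule bij_imp_bij_inv)

lemma cj_inv_cancel [simp]: "bij s ==> cj s (cj (inv' s) g) = g" "bij s ==> cj (inv' s) (cj s g) = g"
 by (auto simp: cj_def fun_eq_iff bij_is_surj surj_f_inv_f bij_is_inj inv_inv_eq)

lemma cj_inv: "bij s ==> bij g ==> inv' (cj s g) = cj s (inv' g)"
 by (simp add: cj_def o_inv_distrib bij_comp o_assoc inv_inv_eq)

lemma cj_self: "bij g ==> cj g g = g" "bij g ==> cj (inv' g) g = g"
 by (auto simp: cj_def fun_eq_iff bij_is_surj surj_f_inv_f bij_is_inj inv_inv_eq)

lemma cj_apply: "bij s ==> cj s g (s x) = s (g x)"
 by (simp add: cj_def bij_is_inj)

lemma cj_fix_iff: "bij s ==> s x = x ==> cj s g x = x \<longleftrightarrow> g x = x"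
 by (metis bij_is_inj cj_apply injD)

lemma cj_commute: "bij s ==> s \<circ> g = g \<circ> s ==> cj s g = g"
 by (simp add: cj_def fun_eq_iff bij_is_surj surj_f_inv_f)

lemma right_prod_Nil [simp]: "right_prod [] = id"
 by (simp add: right_prod_def)

lemma fold_comp_id:
 fixes gs :: "('a => 'a) list" and h :: "'a => 'a"
 shows "fold (\<circ>) gs h = fold (\<circ>) gs id \<circ> h"
proof (induction gs arbitrary: h)
 case (Cons g gs)
 show ?case using Cons[of "g \<circ> h"] Cons[of g] by (simp add: o_assoc)
qed auto

lemma right_prod_Cons [simp]: "right_prod (g # gs) = right_prod gs \<circ> g"
 using fold_comp_id[of gs g] by (simp add: right_prod_def)

lemma right_prod_append [simp]: "right_prod (xs @ ys) = right_prod ys \<circ> right_prod xs"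
 by (induction xs) (auto simp: o_assoc)

lemma bij_right_prod: "(\<And>g. g \<in> set t ==> bij g) ==> bij (right_prod t)"
 by (induction t) (auto intro: bij_comp)

lemma right_prod_cj: "bij s ==> right_prod (map (cj s) t) = cj s (right_prod t)"
 by (induction t) (auto simp: cj_of_id cj_comp)

lemma right_prod_fix: "\<forall>g\<in>set t. g x = x ==> right_prod t x = x"
 by (induction t) auto

text \<open>In right notation the elementary move is \<open>(a, b) \<mapsto> (a b a\<inverse>, a)\<close>.\<close>

inductive bstep :: "(nat => nat) list => (nat => nat) list => bool" where
 "bij a ==> bij b ==> bstep (xs @ a # b # ys) (xs @ cj (inv' a) b # a # ys)"

text \<open>The equivalence closure stands in for the braid group: on tuples of bijections its
  classes are the orbits of the group generated by the elementary moves.\<close>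

abbreviation braid :: "(nat => nat) list => (nat => nat) list => bool" (infix "\<sim>\<^sub>b" 50) where
 "braid \<equiv> equivclp bstep"

lemma braid_refl [simp]: "t \<sim>\<^sub>b t"
 by simp

lemma braid_sym: "t \<sim>\<^sub>b t' ==> t' \<sim>\<^sub>b t"
 by (rule equivclp_sym)

lemma braid_trans [trans]: "t \<sim>\<^sub>b t' ==> t' \<sim>\<^sub>b t'' ==> t \<sim>\<^sub>b t''"
 by (rule equivclp_trans)

lemma braid_eq_trans [trans]: "t \<sim>\<^sub>b t' ==> t' = t'' ==> t \<sim>\<^sub>b t''" "t = t' ==> t' \<sim>\<^sub>b t'' ==> t \<sim>\<^sub>b t''"
 by simp_all

lemma braid_step: "bij a ==> bij b ==> xs @ a # b # ys \<sim>\<^sub>b xs @ cj (inv' a) b # a # ys"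
 by (intro r_into_equivclp bstep.intros)

lemma braid_step_back: "bij a ==> bij b ==> xs @ a # b # ys \<sim>\<^sub>b xs @ b # cj b a # ys"
 using braid_step[of b "cj b a" xs ys] by (simp add: braid_sym)

text \<open>A step of the closure may go either way. The backward case is restated as the inverse
  move \<open>(a, b) \<mapsto> (b, cj b a)\<close>, so that both cases act on an explicit adjacent
  pair.\<close>

lemma braid_induct [consumes 1, case_names refl step backward]:
 assumes "t \<sim>\<^sub>b t'" and "P t"
  and "\<And>xs a b ys. t \<sim>\<^sub>b xs @ a # b # ys ==> bij a ==> bij b ==> P (xs @ a # b # ys) ==>
   P (xs @ cj (inv' a) b # a # ys)"
  and "\<And>xs a b ys. t \<sim>\<^sub>b xs @ a # b # ys ==> bij a ==> bij b ==> P (xs @ a # b # ys) ==>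
   P (xs @ b # cj b a # ys)" shows "P t'" using assms(1)
proof (induction rule: equivclp_induct)
 case base
 then show ?case by (rule assms(2))
next
 case (step y z)
 from step.hyps(2) show ?case
 proof
  assume "bstep y z"
  then show ?thesis using step.IH step.hyps(1) assms(3) by (auto elim!: bstep.cases)
 next
  assume "bstep z y"
  then obtain xs a b ys where "bij a" "bij b" "z = xs @ a # b # ys"
    "y = xs @ cj (inv' a) b # a # ys" by (auto elim!: bstep.cases)
  then show ?thesis using step.IH step.hyps(1) assms(4)[of xs "cj (inv' a) b" a ys] by simp
 qed
qed

lemma braid_append: "t \<sim>\<^sub>b t' ==> xs @ t @ ys \<sim>\<^sub>b xs @ t' @ ys"
proof (induction rule: braid_induct)
 case (step us a b vs)
 then show ?case
  using braid_trans[of "xs @ t @ ys" "xs @ (us @ a # b # vs) @ ys"] braid_step[of a b "xs @ us" "vs @ ys"] by simp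
next
 case (backward us a b vs)
 then show ?case
  using braid_trans[of "xs @ t @ ys" "xs @ (us @ a # b # vs) @ ys"] braid_step_back[of a b "xs @ us" "vs @ ys"] by simp
qed simp

lemma braid_append2: "t \<sim>\<^sub>b t' ==> u \<sim>\<^sub>b u' ==> t @ u \<sim>\<^sub>b t' @ u'"
 using braid_append[of t t' "[]" u] braid_append[of u u' t' "[]"] braid_trans by fastforce

lemma braid_length: "t \<sim>\<^sub>b t' ==> length t' = length t"
 by (induction rule: braid_induct) auto

lemma braid_Ball:
 assumes "t \<sim>\<^sub>b t'" "\<And>g. g \<in> set t ==> g \<in> G" "\<And>a b. a \<in> G ==> b \<in> G ==> cj a b \<in> G \<and> cj (inv' a) b \<in> G"
 shows "set t' \<subseteq> G"
 using assms by (induction rule: braid_induct) auto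

lemma braid_bij: "t \<sim>\<^sub>b t' ==> \<forall>g\<in>set t. bij g ==> \<forall>g\<in>set t'. bij g"
 by (induction rule: braid_induct) auto

lemma braid_right_prod: "t \<sim>\<^sub>b t' ==> right_prod t' = right_prod t"
proof (induction rule: braid_induct)
 case (step xs a b ys)
 have "a \<circ> cj (inv' a) b = b \<circ> a"
  using \<open>bij a\<close> by (auto simp: fun_eq_iff cj_def inv_inv_eq bij_is_surj surj_f_inv_f)
 then show ?case using step by (auto simp: fun_eq_iff)
next
 case (backward xs a b ys)
 have "cj b a \<circ> b = b \<circ> a" using \<open>bij b\<close> by (auto simp: fun_eq_iff cj_def bij_is_inj)
 then show ?case using backward by (auto simp: fun_eq_iff)
qed simp

lemma cj_cj_cj:
 assumes "bij s" "bij a" shows "cj s (cj a b) = cj (cj s a) (cj s b)"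
proof
 fix x
 obtain y where y: "x = s (a y)" using assms by (metis bij_pointE)
 have "cj (cj s a) (cj s b) (cj s a (s y)) = cj s a (cj s b (s y))" using assms by (intro cj_apply) auto
 then show "cj s (cj a b) x = cj (cj s a) (cj s b) x" using assms by (simp add: y cj_apply)
qed

lemma braid_cj: "t \<sim>\<^sub>b t' ==> bij s ==> map (cj s) t \<sim>\<^sub>b map (cj s) t'"
proof (induction rule: braid_induct)
 case (step xs a b ys)
 have "map (cj s) xs @ cj s a # cj s b # map (cj s) ys \<sim>\<^sub>b
  map (cj s) xs @ cj (inv' (cj s a)) (cj s b) # cj s a # map (cj s) ys" using step by (intro braid_step) auto
 then show ?case using step braid_trans[of "map (cj s) t"] cj_cj_cj[of s "inv' a" b] by (simp add: cj_inv)
next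
 case (backward xs a b ys)
 have "map (cj s) xs @ cj s a # cj s b # map (cj s) ys \<sim>\<^sub>b
  map (cj s) xs @ cj s b # cj (cj s b) (cj s a) # map (cj s) ys" using backward by (intro braid_step_back) auto
 then show ?case using backward braid_trans[of "map (cj s) t"] cj_cj_cj[of s b a] by simp
qed simp

text \<open>Each single move conjugates by one entry, and these conjugations compose to the one by
  the product of the block.\<close>

lemma braid_block1:
 assumes "bij b" "\<forall>g\<in>set A. bij g"
 shows "A @ [b] \<sim>\<^sub>b cj (inv' (right_prod A)) b # A"
 using assms(2)
proof (induction A)
 case (Cons a A)
 then have bA: "bij (right_prod A)" by (intro bij_right_prod) auto
 have "a # A @ [b] \<sim>\<^sub>b a # cj (inv' (right_prod A)) b # A"
  using Cons braid_append[of "A @ [b]" _ "[a]" "[]"] by simp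
 also have "\<dots> \<sim>\<^sub>b cj (inv' a) (cj (inv' (right_prod A)) b) # a # A"
  using braid_step[of a "cj (inv' (right_prod A)) b" "[]" A] Cons assms bA by simp
 also have "\<dots> = cj (inv' (right_prod (a # A))) b # a # A" using Cons bA by (simp add: cj_cj o_inv_distrib)
 finally show ?case unfolding append_Cons .
qed (simp add: )

lemma braid_block:
 assumes "\<forall>g\<in>set B. bij g" "\<forall>g\<in>set A. bij g"
 shows "A @ B \<sim>\<^sub>b map (cj (inv' (right_prod A))) B @ A"
 using assms(1)
proof (induction B)
 case (Cons b B)
 have "A @ b # B \<sim>\<^sub>b cj (inv' (right_prod A)) b # A @ B"
  using braid_append[OF braid_block1[of b A], of "[]" B] Cons assms by simp
 also have "\<dots> \<sim>\<^sub>b cj (inv' (right_prod A)) b # map (cj (inv' (right_prod A))) B @ A"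
  using braid_append[of "A @ B" _ "[cj (inv' (right_prod A)) b]" "[]"] Cons by simp
 finally show ?case by simp
qed simp

lemma braid_block_back:
 assumes "\<forall>g\<in>set B. bij g" "\<forall>g\<in>set A. bij g"
 shows "A @ B \<sim>\<^sub>b B @ map (cj (right_prod B)) A"
proof -
 have "bij (right_prod B)" using assms by (auto intro: bij_right_prod)
 then have "map (cj (inv' (right_prod B))) (map (cj (right_prod B)) A) = A" by (simp add: comp_def)
 then show ?thesis using braid_block[of "map (cj (right_prod B)) A" B] assms \<open>bij (right_prod B)\<close>
  by (metis (no_types, lifting) bij_cj braid_sym image_iff list.set_map)
qed

text \<open>When two blocks cross, one of them is conjugated by the product of the other, and the
  direction of the moves decides which one. If either product is trivial, the direction can be
  chosen so that nothing changes.\<close>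

lemma braid_swap_one:
 assumes "\<forall>g\<in>set A. bij g" "\<forall>g\<in>set B. bij g" "right_prod A = id \<or> right_prod B = id"
 shows "A @ B \<sim>\<^sub>b B @ A"
 using braid_block[of B A] braid_block_back[of B A] assms by (auto simp: map_idI)

text \<open>In a product-one tuple the tail has the product inverse to the head, so carrying the
  head to the end conjugates it by its own inverse and leaves it alone.\<close>

lemma braid_rotate:
 assumes "\<forall>g\<in>set (xs @ ys). bij g" "right_prod (xs @ ys) = id"
 shows "xs @ ys \<sim>\<^sub>b ys @ xs"
 using assms
proof (induction xs arbitrary: ys)
 case (Cons a xs)
 have b: "bij (right_prod (xs @ ys))" "bij a" using Cons.prems by (auto intro!: bij_right_prod simp del: right_prod_append)
 have "right_prod (xs @ ys) \<circ> a = id" using Cons.prems(2) by (simp add: fun_eq_iff)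
 then have r: "right_prod (xs @ ys) = inv' a" using b by (metis bij_is_surj comp_assoc comp_id id_comp surj_iff)
 have "a # xs @ ys \<sim>\<^sub>b (xs @ ys) @ map (cj (right_prod (xs @ ys))) [a]"
  using Cons.prems braid_block_back[of "xs @ ys" "[a]"] by auto
 also have "\<dots> = xs @ (ys @ [a])" unfolding r using b by (simp add: cj_self)
 also have "\<dots> \<sim>\<^sub>b (ys @ [a]) @ xs"
 proof (rule Cons.IH)
  have "a \<circ> right_prod (xs @ ys) = id" unfolding r using b(2) by (simp add: bij_is_surj surj_iff[symmetric])
  then show "right_prod (xs @ ys @ [a]) = id" by (simp add: fun_eq_iff)
 qed (use Cons.prems in auto)
 finally show ?case by simp
qed simp

text \<open>Rotating a product-one tuple by one place can be done in two ways; they differ by a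
 conjugation.\<close>

lemma braid_cj_member:
 assumes "\<forall>g\<in>set t. bij g" "right_prod t = id" "a \<in> set t"
 shows "map (cj a) t \<sim>\<^sub>b t"
proof -
 obtain xs ys where t: "t = xs @ a # ys" using assms(3) by (auto simp: in_set_conv_decomp)
 define u where "u = ys @ xs"
 have a: "bij a" and u: "\<forall>g\<in>set u. bij g" using assms(1) by (auto simp: t u_def)
 have ta: "t \<sim>\<^sub>b a # u" using braid_rotate[of xs "a # ys"] assms by (simp add: t u_def)
 then have 1: "right_prod (a # u) = id" using braid_right_prod[OF ta] assms by simp
 have "a # u \<sim>\<^sub>b map (cj (inv' a)) u @ [a]" using braid_block[of u "[a]"] a u by simp
 also have "\<dots> = map (cj (inv' a)) (u @ [a])" using a by (simp add: cj_self)
 also have "\<dots> \<sim>\<^sub>b map (cj (inv' a)) (a # u)"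
  using braid_cj[OF braid_rotate[of "[a]" u]] a u 1 by (simp add: braid_sym)
 finally have "map (cj a) (a # u) \<sim>\<^sub>b map (cj a) (map (cj (inv' a)) (a # u))" using a by (intro braid_cj)
 then have "map (cj a) (a # u) \<sim>\<^sub>b a # u" using a by (simp add: comp_def)
 then show ?thesis using braid_cj[OF ta a] ta by (meson braid_sym braid_trans)
qed

text \<open>Only multiplication by entries is generated, a monoid; for permutations of a finite set
  this is the generated group. The inductive form lets a conjugation be carried out one entry at a
  time.\<close>

inductive_set grp :: "(nat => nat) list => (nat => nat) set" for t where
 grp_id: "id \<in> grp t"
| grp_step: "h \<in> grp t ==> g \<in> set t ==> g \<circ> h \<in> grp t"

lemma grp_bij: "h \<in> grp t ==> \<forall>g\<in>set t. bij g ==> bij h"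
 by (induction rule: grp.induct) (auto intro: bij_comp)

lemma grp_permutes: "h \<in> grp t ==> \<forall>g\<in>set t. g permutes A ==> h permutes A"
 by (induction rule: grp.induct) (auto intro: permutes_compose permutes_id)

lemma grp_mult: "h \<in> grp t ==> k \<in> grp t ==> h \<circ> k \<in> grp t"
 by (induction rule: grp.induct) (auto simp: comp_assoc intro: grp_step)

lemma grp_member: "g \<in> set t ==> g \<in> grp t"
 using grp_step[OF grp_id] by simp

lemma braid_cj_grp:
 assumes "h \<in> grp t" "\<forall>g\<in>set t. bij g" "right_prod t = id"
 shows "map (cj h) t \<sim>\<^sub>b t"
 using assms
proof (induction rule: grp.induct)
 case (grp_step h g)
 have b: "bij g" "bij h" using grp_step grp_bij by auto
 have "map (cj g) (map (cj h) t) \<sim>\<^sub>b map (cj g) t" using grp_step b by (intro braid_cj) auto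
 also have "\<dots> \<sim>\<^sub>b t" using grp_step by (intro braid_cj_member) auto
 finally show ?case using b by (simp add: cj_cj comp_def)
qed (simp add: map_idI)

text \<open>A block of product one travels freely. Carrying \<open>P\<close> up to an entry
  \<open>g\<close> of \<open>R\<close>, across \<open>g\<close> by the move that conjugates
  \<open>P\<close>, and back by the move that conjugates nothing, replaces \<open>P\<close> by its
  conjugate and restores \<open>R\<close>. This later corrects the letter at which a pair is
  attached.\<close>

lemma braid_cj_part:
 assumes "h \<in> grp R" "\<forall>g\<in>set R. bij g" "\<forall>g\<in>set P. bij g" "right_prod P = id"
 shows "map (cj h) P @ R \<sim>\<^sub>b P @ R"
 using assms
proof (induction rule: grp.induct)
 case (grp_step h g)
 have b: "bij g" "bij h" using grp_step grp_bij by auto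
 define Q where "Q = map (cj h) P"
 have Q: "\<forall>g\<in>set Q. bij g" "right_prod Q = id"
  using grp_step.prems b cj_of_id by (auto simp: Q_def right_prod_cj simp del: id_apply)
 obtain xs ys where R: "R = xs @ g # ys" using grp_step by (auto simp: in_set_conv_decomp)
 have bb: "\<forall>g\<in>set xs. bij g" "\<forall>g\<in>set ys. bij g" "\<forall>f\<in>set (map (cj g) Q). bij f"
  using grp_step b Q by (auto simp: R)
 have "Q @ xs @ g # ys \<sim>\<^sub>b xs @ Q @ g # ys"
  using braid_append[OF braid_swap_one[of Q xs], of "[]" "g # ys"] Q bb by simp
 also have "\<dots> \<sim>\<^sub>b xs @ (g # map (cj g) Q) @ ys"
  using braid_append[OF braid_block_back[of "[g]" Q], of xs ys] Q b by simp
 also have "\<dots> = (xs @ [g]) @ map (cj g) Q @ ys" by simp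
 also have "\<dots> \<sim>\<^sub>b map (cj g) Q @ (xs @ [g]) @ ys"
  using braid_append[OF braid_swap_one[of "xs @ [g]" "map (cj g) Q"], of "[]" ys] Q bb b
  by (simp add: right_prod_cj cj_of_id)
 finally have "map (cj g) Q @ R \<sim>\<^sub>b Q @ R" by (simp add: R braid_sym)
 moreover have "Q @ R \<sim>\<^sub>b P @ R" using grp_step by (simp add: Q_def)
 ultimately show ?case using b by (simp add: Q_def cj_cj comp_def) (meson braid_trans)
qed (simp add: map_idI)

text \<open>A move of the products is realized by moving whole blocks across each other, which
  conjugates one block by the product of the other. The invariant \<open>I\<close> has to survive
  such conjugations, and the multiset of lengths keeps track of how many blocks have more than one
  entry. Thus a braid of a tuple in which two entries were merged lifts to the unmerged
  tuple.\<close>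

lemma braid_cabling:
 assumes "t \<sim>\<^sub>b t'" "map right_prod L = t" "\<forall>B\<in>set L. I B"
  and bijI: "\<And>B g. I B ==> g \<in> set B ==> bij g"
  and cjI: "\<And>A B. I A ==> I B ==> I (map (cj (right_prod A)) B) \<and> I (map (cj (inv' (right_prod A))) B)"
 shows "\<exists>L'. map right_prod L' = t' \<and> (\<forall>B\<in>set L'. I B) \<and> concat L \<sim>\<^sub>b concat L' \<and>
  mset (map length L') = mset (map length L)" using assms(1)
proof (induction rule: braid_induct)
 case refl
 then show ?case using assms by auto
next
 case (step xs a b ys)
 then obtain L' where L': "map right_prod L' = xs @ a # b # ys" "\<forall>B\<in>set L'. I B"
  "concat L \<sim>\<^sub>b concat L'" "mset (map length L') = mset (map length L)" by blast
 then obtain X A B Y where X: "L' = X @ A # B # Y" "map right_prod X = xs" "right_prod A = a"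
  "right_prod B = b" "map right_prod Y = ys" by (auto simp: map_eq_append_conv map_eq_Cons_conv)
 have I: "I A" "I B" using L' X by auto
 define B' where "B' = map (cj (inv' a)) B"
 have "I B'" using cjI[OF I] X by (simp add: B'_def)
 moreover have "right_prod B' = cj (inv' a) b" using X \<open>bij a\<close> by (simp add: B'_def right_prod_cj)
 moreover have "concat L' \<sim>\<^sub>b concat (X @ B' # A # Y)"
  using braid_append[OF braid_block[of B A], of "concat X" "concat Y"] bijI I X by (simp add: B'_def)
 moreover have "mset (map length (X @ B' # A # Y)) = mset (map length L)"
  using L'(4) by (simp add: B'_def X add_mset_commute)
 ultimately show ?case using L' X by (intro exI[of _ "X @ B' # A # Y"]) (auto intro: braid_trans)
next
 case (backward xs a b ys)
 then obtain L' where L': "map right_prod L' = xs @ a # b # ys" "\<forall>B\<in>set L'. I B"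
  "concat L \<sim>\<^sub>b concat L'" "mset (map length L') = mset (map length L)" by blast
 then obtain X A B Y where X: "L' = X @ A # B # Y" "map right_prod X = xs" "right_prod A = a"
  "right_prod B = b" "map right_prod Y = ys" by (auto simp: map_eq_append_conv map_eq_Cons_conv)
 have I: "I A" "I B" using L' X by auto
 define A' where "A' = map (cj b) A"
 have "I A'" using cjI[OF I(2,1)] X by (simp add: A'_def)
 moreover have "right_prod A' = cj b a" using X \<open>bij b\<close> by (simp add: A'_def right_prod_cj)
 moreover have "concat L' \<sim>\<^sub>b concat (X @ B # A' # Y)"
  using braid_append[OF braid_block_back[of B A], of "concat X" "concat Y"] bijI I X by (simp add: A'_def)
 moreover have "mset (map length (X @ B # A' # Y)) = mset (map length L)"
  using L'(4) by (simp add: A'_def X add_mset_commute)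
 ultimately show ?case using L' X by (intro exI[of _ "X @ B # A' # Y"]) (auto intro: braid_trans)
qed

section \<open>Calculus of three-cycles and the combinatorics of genus-zero tuples\<close>

section \<open>Tuples of three-cycles\<close>

definition tc :: "nat => nat => nat => nat => nat" where
 "tc a b c = (\<lambda>x. if x = a then b else if x = b then c else if x = c then a else x)"

definition tc3 :: "nat set => (nat => nat) set" where
 "tc3 A = {tc a b c | a b c. distinct [a, b, c] \<and> {a, b, c} \<subseteq> A}"

lemma tc3I: "distinct [a, b, c] ==> {a, b, c} \<subseteq> A ==> tc a b c \<in> tc3 A"
 unfolding tc3_def by blast

lemma tc3_mono: "A \<subseteq> B ==> tc3 A \<subseteq> tc3 B"
 unfolding tc3_def by blast

lemma tc_apply: "tc a b c x = (if x = a then b else if x = b then c else if x = c then a else x)"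
 by (simp add: tc_def)

lemma tc_rot: "distinct [a, b, c] ==> tc b c a = tc a b c"
 by (auto simp: tc_def fun_eq_iff)

lemma tc_comp_inverse: "distinct [a, b, c] ==> tc c b a \<circ> tc a b c = id"
 by (auto simp: tc_def fun_eq_iff)

lemma bij_tc: "distinct [a, b, c] ==> bij (tc a b c)"
 using tc_comp_inverse[of a b c] tc_comp_inverse[of c b a] by (intro o_bij[of "tc c b a"]) auto

lemma tc_permutes: "distinct [a, b, c] ==> {a, b, c} \<subseteq> A ==> tc a b c permutes A"
 using bij_tc[of a b c] by (auto simp: permutes_def bij_iff tc_def)

lemma inv_tc: "distinct [a, b, c] ==> inv' (tc a b c) = tc c b a"
 using tc_comp_inverse[of a b c] tc_comp_inverse[of c b a] by (intro inv_unique_comp) auto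

lemma cj_tc: "bij s ==> cj s (tc a b c) = tc (s a) (s b) (s c)"
proof
 fix x assume s: "bij s"
 then obtain y where "x = s y" by (metis bij_pointE)
 then show "cj s (tc a b c) x = tc (s a) (s b) (s c) x" using s by (auto simp: cj_apply tc_def bij_is_inj inj_eq)
qed

lemma tc3_bij: "g \<in> tc3 A ==> bij g"
 by (auto simp: tc3_def intro: bij_tc)

lemma tc3_permutes: "g \<in> tc3 A ==> g permutes A"
 by (auto simp: tc3_def intro!: tc_permutes)

lemma tc3_outside: "g \<in> tc3 A ==> x \<notin> A ==> g x = x"
 by (auto simp: tc3_def tc_def)

lemma cj_tc3: "s permutes A ==> g \<in> tc3 A ==> cj s g \<in> tc3 A"
proof -
 assume s: "s permutes A" and "g \<in> tc3 A"
 then obtain a b c where "g = tc a b c" "distinct [a, b, c]" "{a, b, c} \<subseteq> A" by (auto simp: tc3_def)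
 then show ?thesis using s permutes_bij[OF s] permutes_inj[OF s] by (auto simp: cj_tc inj_eq permutes_in_image intro!: tc3I)
qed

lemma cj_tc3_image:
 assumes "bij s" "g \<in> tc3 A" shows "cj s g \<in> tc3 (s ` A)"
proof -
 obtain a b c where "g = tc a b c" "distinct [a, b, c]" "{a, b, c} \<subseteq> A" using assms by (auto simp: tc3_def)
 then show ?thesis using assms by (auto simp: cj_tc inj_eq bij_is_inj intro!: tc3I)
qed

lemma tc3_moved:
 assumes "g \<in> tc3 A" "g x \<noteq> x"
 obtains y z where "g = tc x y z" "distinct [x, y, z]" "{x, y, z} \<subseteq> A"
proof -
 obtain a b c where g: "g = tc a b c" "distinct [a, b, c]" "{a, b, c} \<subseteq> A" using assms by (auto simp: tc3_def)
 then consider "x = a" | "x = b" | "x = c" using assms(2) by (auto simp: tc_def split: if_splits)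
 then show ?thesis
 proof cases
  case 1 then show ?thesis using that g by blast
 next
  case 2 then show ?thesis using that[of c a] g tc_rot[of a b c] by auto
 next
  case 3 then show ?thesis using that[of a b] g tc_rot[of c a b] by auto
 qed
qed

lemma tc3_fixed: "g \<in> tc3 A ==> g x = x ==> g \<in> tc3 (A - {x})"
proof -
 assume "g \<in> tc3 A" and x: "g x = x"
 then obtain a b c where g: "g = tc a b c" "distinct [a, b, c]" "{a, b, c} \<subseteq> A" by (auto simp: tc3_def)
 moreover have "x \<notin> {a, b, c}" using x g by (auto simp: tc_def split: if_splits)
 ultimately show ?thesis by (auto intro!: tc3I)
qed

lemma card_tc3_moved: "finite A ==> g \<in> tc3 A ==> card {x \<in> A. g x \<noteq> x} = 3"
proof -
 assume "g \<in> tc3 A"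
 then obtain a b c where g: "g = tc a b c" "distinct [a, b, c]" "{a, b, c} \<subseteq> A" by (auto simp: tc3_def)
 then have "{x \<in> A. g x \<noteq> x} = {a, b, c}" by (auto simp: tc_def)
 then show ?thesis using g by simp
qed

lemma tc3_conj_closed:
 assumes "a \<in> tc3 A" "b \<in> tc3 A"
 shows "cj a b \<in> tc3 A" "cj (inv' a) b \<in> tc3 A"
 using assms by (auto intro: cj_tc3 tc3_permutes permutes_inv)

lemma braid_tc3: "t \<sim>\<^sub>b t' ==> set t \<subseteq> tc3 A ==> set t' \<subseteq> tc3 A"
 by (erule braid_Ball) (auto simp: tc3_conj_closed)

section \<open>Transitive product-one tuples and the genus\<close>

definition acts_trans :: "nat set => (nat => nat) list => bool" where
 "acts_trans A t \<longleftrightarrow> (\<forall>B. B \<subseteq> A \<longrightarrow> B \<noteq> {} \<longrightarrow> (\<forall>g\<in>set t. g ` B \<subseteq> B) \<longrightarrow> B = A)"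

lemma acts_transD: "acts_trans A t ==> B \<subseteq> A ==> B \<noteq> {} ==> (\<And>g x. g \<in> set t ==> x \<in> B ==> g x \<in> B) ==> B = A"
 unfolding acts_trans_def by blast

lemma acts_transI: "(\<And>B. B \<subseteq> A ==> B \<noteq> {} ==> (\<And>g x. g \<in> set t ==> x \<in> B ==> g x \<in> B) ==> A \<subseteq> B) ==> acts_trans A t"
 unfolding acts_trans_def by blast

lemma finite_bij_image_eq:
 fixes g :: "'a => 'a"
 assumes "finite B" "bij g" "g ` B \<subseteq> B"
 shows "g ` B = B" "inv' g ` B \<subseteq> B"
proof -
 show eq: "g ` B = B" using assms by (metis bij_is_inj card_image card_subset_eq inj_on_subset subset_UNIV)
 then show "inv' g ` B \<subseteq> B" using assms(2) by (metis bij_is_inj image_inv_f_f order_refl)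
qed

text \<open>A bijection that maps a finite set into itself maps it onto itself, so the inverse
  preserves it as well, and with it every conjugate. This is why transitivity is phrased by
  invariant subsets: they pass through braid moves without recourse to the generated group.\<close>

lemma braid_invariant:
 assumes "t \<sim>\<^sub>b t'" "finite B" "\<forall>g\<in>set t. bij g" "\<forall>g\<in>set t. g ` B \<subseteq> B"
 shows "\<forall>g\<in>set t'. g ` B \<subseteq> B"
proof -
 have "set t' \<subseteq> {g. bij g \<and> g ` B \<subseteq> B}"
 proof (rule braid_Ball[OF assms(1)])
  fix a b :: "nat => nat"
  assume "a \<in> {g. bij g \<and> g ` B \<subseteq> B}" "b \<in> {g. bij g \<and> g ` B \<subseteq> B}"
  then have ab: "bij a" "bij b" "a ` B \<subseteq> B" "b ` B \<subseteq> B" by auto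
  moreover have "inv' a ` B \<subseteq> B" using ab assms(2) by (intro finite_bij_image_eq)
  ultimately have "cj a b ` B \<subseteq> B" "cj (inv' a) b ` B \<subseteq> B"
   by (auto simp: cj_def inv_inv_eq image_subset_iff)
  then show "cj a b \<in> {g. bij g \<and> g ` B \<subseteq> B} \<and> cj (inv' a) b \<in> {g. bij g \<and> g ` B \<subseteq> B}"
   using ab by simp
 qed (use assms in auto)
 then show ?thesis by auto
qed

lemma braid_acts_trans:
 assumes "t \<sim>\<^sub>b t'" "finite A" "\<forall>g\<in>set t. bij g" "acts_trans A t"
 shows "acts_trans A t'"
 unfolding acts_trans_def
proof (intro allI impI)
 fix B assume B: "B \<subseteq> A" "B \<noteq> {}" "\<forall>g\<in>set t'. g ` B \<subseteq> B"
 then have "\<forall>g\<in>set t. g ` B \<subseteq> B"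
  using assms braid_invariant[of t' t B] braid_bij[OF assms(1)] by (auto simp: braid_sym finite_subset)
 then show "B = A" using assms(4) B unfolding acts_trans_def by blast
qed

text \<open>The letters form an arbitrary finite set because the inductions delete letters.\<close>

definition pt :: "nat set => (nat => nat) list => bool" where
 "pt A t \<longleftrightarrow> finite A \<and> A \<noteq> {} \<and> set t \<subseteq> tc3 A \<and> right_prod t = id \<and> acts_trans A t"

text \<open>By Riemann-Hurwitz the genus is \<open>length t + 1 - card A\<close>; the equation says
  that it is zero.\<close>

definition ni :: "nat set => (nat => nat) list => bool" where
 "ni A t \<longleftrightarrow> pt A t \<and> Suc (length t) = card A"

lemma pt_bij: "pt A t ==> \<forall>g\<in>set t. bij g"
 unfolding pt_def using tc3_bij by blast

lemma braid_pt: "t \<sim>\<^sub>b t' ==> pt A t ==> pt A t'"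
 using braid_tc3 braid_right_prod braid_acts_trans pt_bij unfolding pt_def by metis

lemma braid_ni: "t \<sim>\<^sub>b t' ==> ni A t ==> ni A t'"
 using braid_pt braid_length unfolding ni_def by metis

lemma acts_trans_grp:
 assumes "acts_trans A t" "u \<in> A" "u' \<in> A" "\<forall>g\<in>set t. g permutes A"
 obtains h where "h \<in> grp t" "h u = u'"
proof -
 have "(\<lambda>h. h u) ` grp t = A"
 proof (rule acts_transD[OF assms(1)])
  show "(\<lambda>h. h u) ` grp t \<subseteq> A"
   using grp_permutes[OF _ assms(4)] assms(2) by (auto simp: permutes_in_image)
  show "g x \<in> (\<lambda>h. h u) ` grp t" if "g \<in> set t" "x \<in> (\<lambda>h. h u) ` grp t" for g x
  proof -
   obtain h where "h \<in> grp t" "x = h u" using \<open>x \<in> (\<lambda>h. h u) ` grp t\<close> by blast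
   then show ?thesis
    using grp_step[OF _ \<open>g \<in> set t\<close>, of h] by (intro image_eqI[of _ _ "g \<circ> h"]) auto
  qed
 qed (use grp_id in auto)
 then show ?thesis using that assms(3) by blast
qed

text \<open>Every letter occurs in at least two entries of a transitive product-one tuple, so a count of
 incidences produces a letter occurring exactly twice as soon as there are fewer entries than
 letters.\<close>

lemma sum_moved:
 assumes "finite A" "set t \<subseteq> tc3 A"
 shows "(\<Sum>x\<in>A. length (filter (\<lambda>g. g x \<noteq> x) t)) = 3 * length t"
 using assms(2)
proof (induction t)
 case (Cons g t)
 have "(\<Sum>x\<in>A. length (filter (\<lambda>g. g x \<noteq> x) (g # t))) =
  (\<Sum>x\<in>A. (if g x \<noteq> x then 1 else 0) + length (filter (\<lambda>g. g x \<noteq> x) t))"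
  by (intro sum.cong) auto
 also have "\<dots> = card {x \<in> A. g x \<noteq> x} + 3 * length t"
  using Cons assms(1) by (simp add: sum.distrib sum.If_cases Int_def)
 finally show ?case using Cons.prems assms(1) card_tc3_moved by simp
qed simp

lemma filter_eq_ConsE:
 assumes "filter P t = g # gs"
 obtains us vs where "t = us @ g # vs" "P g" "\<forall>u\<in>set us. \<not> P u" "filter P vs = gs"
 using filter_eq_ConsD[OF assms] that by metis

lemma letter_twice:
 assumes "pt A t" "length t < card A" "card A \<ge> 2"
 obtains x where "x \<in> A" "length (filter (\<lambda>g. g x \<noteq> x) t) = 2"
proof -
 let ?n = "\<lambda>x. length (filter (\<lambda>g. g x \<noteq> x) t)"
 have A: "finite A" "set t \<subseteq> tc3 A" "right_prod t = id" "acts_trans A t" using assms by (auto simp: pt_def)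
 have "\<exists>x\<in>A. ?n x \<le> 2"
 proof (rule ccontr)
  assume "\<not> ?thesis"
  then have "(\<Sum>x\<in>A. 3) \<le> (\<Sum>x\<in>A. ?n x)" by (intro sum_mono) force
  then show False using sum_moved[OF A(1,2)] assms(2) by simp
 qed
 then obtain x where x: "x \<in> A" "?n x \<le> 2" by blast
 have "?n x \<noteq> 0"
 proof
  assume "?n x = 0"
  then have "{x} = A" using A(4) x by (intro acts_transD[OF A(4)]) (auto simp: filter_empty_conv)
  then show False using assms(3) by auto
 qed
 moreover have "?n x \<noteq> 1"
 proof
  assume "?n x = 1"
  then obtain g where "filter (\<lambda>g. g x \<noteq> x) t = [g]" by (metis One_nat_def length_0_conv length_Suc_conv)
  then obtain us vs where "t = us @ g # vs" "g x \<noteq> x" "\<forall>u\<in>set us. \<not> u x \<noteq> x"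
   "filter (\<lambda>g. g x \<noteq> x) vs = []" by (rule filter_eq_ConsE)
  then have t: "t = us @ g # vs" "g x \<noteq> x" "\<forall>u\<in>set us. u x = x" "\<forall>u\<in>set vs. u x = x"
   by (auto simp: filter_empty_conv)
  have "right_prod vs (g x) = x" using fun_cong[OF A(3), of x] t right_prod_fix[of us x] by simp
  moreover have "right_prod vs x = x" using t right_prod_fix by blast
  moreover have "bij (right_prod vs)" using t A tc3_bij by (auto intro!: bij_right_prod)
  ultimately show False using t(2) by (metis bij_is_inj injD)
 qed
 ultimately have "?n x = 2" using x by linarith
 then show ?thesis using that x by blast
qed

section \<open>Shortening a tuple at a letter that exactly two entries move\<close>

lemma braid_to_front:
 assumes "\<forall>g\<in>set xs. bij g" "bij g" "\<forall>g\<in>set xs. g x = x" "g x \<noteq> x"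
 obtains g' where "xs @ g # ys \<sim>\<^sub>b g' # xs @ ys" "g' x \<noteq> x"
proof -
 have b: "bij (right_prod xs)" "right_prod xs x = x" using assms bij_right_prod right_prod_fix by auto
 then have "inv' (right_prod xs) x = x" by (metis bij_inv_eq_iff)
 then have "cj (inv' (right_prod xs)) g x \<noteq> x" using assms b by (simp add: cj_fix_iff)
 moreover have "xs @ g # ys \<sim>\<^sub>b cj (inv' (right_prod xs)) g # xs @ ys"
  using braid_append[OF braid_block1[of g xs], of "[]" ys] assms by simp
 ultimately show ?thesis using that by blast
qed

text \<open>The remaining entries fix \<open>x\<close>, so by the product relation the two front
  entries together fix \<open>x\<close> too: the second one undoes at \<open>x\<close> what the
  first one does. Two three-cycles in this position are mutually inverse or have exactly
  \<open>x\<close> and \<open>y\<close> in common.\<close>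

lemma front_cases [consumes 3, case_names pair split]:
 assumes "pt A t" "length t < card A" "card A \<ge> 2"
 obtains
  (pair) x y z R where "distinct [x, y, z]" "{x, y, z} \<subseteq> A" "t \<sim>\<^sub>b tc x y z # tc z y x # R"
   "set R \<subseteq> tc3 (A - {x})"
 | (split) x y z w R where "distinct [x, y, z, w]" "{x, y, z, w} \<subseteq> A"
   "t \<sim>\<^sub>b tc x y z # tc y x w # R" "set R \<subseteq> tc3 (A - {x})"
proof -
 have A: "finite A" "set t \<subseteq> tc3 A" "right_prod t = id" "acts_trans A t" using assms by (auto simp: pt_def)
 obtain x where x: "x \<in> A" "length (filter (\<lambda>g. g x \<noteq> x) t) = 2" using letter_twice[OF assms] .
 then obtain g g' where "filter (\<lambda>g. g x \<noteq> x) t = [g, g']" by (auto simp: numeral_2_eq_2 length_Suc_conv)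
 then obtain us rs where 1: "t = us @ g # rs" "g x \<noteq> x" "\<forall>u\<in>set us. \<not> u x \<noteq> x"
  "filter (\<lambda>g. g x \<noteq> x) rs = [g']" by (rule filter_eq_ConsE)
 obtain vs ws where "rs = vs @ g' # ws" "g' x \<noteq> x" "\<forall>u\<in>set vs. \<not> u x \<noteq> x"
  "filter (\<lambda>g. g x \<noteq> x) ws = []" using 1(4) by (rule filter_eq_ConsE)
 with 1 have t: "t = us @ g # vs @ g' # ws" "g x \<noteq> x" "g' x \<noteq> x"
  and fx: "\<forall>u\<in>set us. u x = x" "\<forall>u\<in>set vs. u x = x" "\<forall>u\<in>set ws. u x = x"
  by (auto simp: filter_empty_conv)
 have b: "\<forall>g\<in>set t. bij g" using A tc3_bij by blast
 obtain g1 where g1: "us @ g # vs @ g' # ws \<sim>\<^sub>b g1 # us @ vs @ g' # ws" "g1 x \<noteq> x"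
  using braid_to_front[of us g x "vs @ g' # ws"] b t fx by auto
 obtain g2 where g2: "(us @ vs) @ g' # ws \<sim>\<^sub>b g2 # (us @ vs) @ ws" "g2 x \<noteq> x"
  by (rule braid_to_front[of "us @ vs" g' x ws]) (use b t fx in auto)
 define R where "R = us @ vs @ ws"
 have tR: "t \<sim>\<^sub>b g1 # g2 # R"
  using braid_append[OF g2(1), of "[g1]" "[]"] g1(1) braid_trans by (fastforce simp: t R_def)
 have R0: "set (g1 # g2 # R) \<subseteq> tc3 A" "right_prod (g1 # g2 # R) = id"
  using braid_tc3[OF tR A(2)] braid_right_prod[OF tR] A by auto
 have Rx: "\<forall>u\<in>set R. u x = x" using fx by (auto simp: R_def)
 have R: "set R \<subseteq> tc3 (A - {x})" using R0 Rx tc3_fixed by auto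
 obtain y z where g1': "g1 = tc x y z" "distinct [x, y, z]" "{x, y, z} \<subseteq> A"
  using tc3_moved[of g1 A x] R0 g1 by auto
 obtain p q where g2': "g2 = tc x p q" "distinct [x, p, q]" "{x, p, q} \<subseteq> A"
  using tc3_moved[of g2 A x] R0 g2 by auto
 have "right_prod R (g2 (g1 x)) = x" using fun_cong[OF R0(2), of x] by simp
 moreover have "right_prod R x = x" using Rx by (intro right_prod_fix) auto
 moreover have "bij (right_prod R)" using R tc3_bij by (auto intro!: bij_right_prod)
 ultimately have "g2 (g1 x) = x" by (metis bij_is_inj injD)
 \<comment> \<open>\<open>g1\<close> takes \<open>x\<close> to \<open>y\<close>, hence
   \<open>g2\<close> has to take \<open>y\<close> back to \<open>x\<close>.\<close>
 then have q: "q = y" using g1' g2' by (auto simp: tc_def split: if_splits)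
 then have g2'': "g2 = tc y x p" using g2' tc_rot[of y x p] by auto
 show ?thesis
 proof (cases "p = z")
  case True
  then have "g2 = tc z y x" using g2'' g1' tc_rot[of z y x] by auto
  then show ?thesis using pair[of x y z R] g1' tR R by auto
 next
  case False
  then show ?thesis using split[of x y z p R] g1' g2' g2'' q tR R by auto
 qed
qed

text \<open>The merged three-cycle \<open>(y z w)\<close> does the work of the two entries that move
  \<open>x\<close>. One letter and one entry are lost, so the genus is unchanged. A set invariant
  under the short tuple is invariant under the long one, after \<open>x\<close> has been added if it
  meets \<open>{y, z, w}\<close>.\<close>

lemma split_pt:
 assumes "pt A (tc x y z # tc y x w # R)" "distinct [x, y, z, w]" "{x, y, z, w} \<subseteq> A"
  "set R \<subseteq> tc3 (A - {x})" shows "pt (A - {x}) (tc y z w # R)" "tc y x w \<circ> tc x y z = tc y z w"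
proof -
 show eq: "tc y x w \<circ> tc x y z = tc y z w" using assms(2) by (auto simp: tc_def fun_eq_iff)
 have A: "finite A" "right_prod R \<circ> tc y x w \<circ> tc x y z = id" "acts_trans A (tc x y z # tc y x w # R)"
  using assms(1) by (auto simp: pt_def)
 have "acts_trans (A - {x}) (tc y z w # R)"
 proof (rule acts_transI)
  fix B assume B: "B \<subseteq> A - {x}" "B \<noteq> {}" "\<And>g u. g \<in> set (tc y z w # R) ==> u \<in> B ==> g u \<in> B"
  have h: "tc y z w u \<in> B" if "u \<in> B" for u using B(3) that by auto
  have R: "g x = x" if "g \<in> set R" for g using assms(4) that tc3_outside by blast
  show "A - {x} \<subseteq> B"
  proof (cases "y \<in> B")
   case True
   then have "z \<in> B" "w \<in> B" using h[of y] h[of z] assms(2) by (auto simp: tc_def split: if_splits)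
   then have "insert x B = A"
    using True B assms(2,3) R by (intro acts_transD[OF A(3)]) (auto simp: tc_apply split: if_splits)
   then show ?thesis by blast
  next
   case False
   then have "w \<notin> B" "z \<notin> B" using h[of w] h[of z] assms(2) by (auto simp: tc_def split: if_splits)
   then have "B = A" using False B assms(2,3) R by (intro acts_transD[OF A(3)]) (auto simp: tc_apply split: if_splits)
   then show ?thesis by blast
  qed
 qed
 moreover have "right_prod (tc y z w # R) = id" using A(2) eq by (simp add: comp_assoc)
 moreover have "tc y z w \<in> tc3 (A - {x})" using assms(2,3) by (intro tc3I) auto
 ultimately show "pt (A - {x}) (tc y z w # R)" using A assms by (auto simp: pt_def)
qed

lemma braid_partition:
 assumes "\<forall>g\<in>set t. bij g" "\<And>p q. p \<in> set t ==> q \<in> set t ==> P p ==> \<not> P q ==> q \<circ> p = p \<circ> q"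
 shows "t \<sim>\<^sub>b filter P t @ filter (\<lambda>g. \<not> P g) t"
 using assms
proof (induction t)
 case (Cons a t)
 let ?F = "filter P t" and ?N = "filter (\<lambda>g. \<not> P g) t"
 have *: "a # t \<sim>\<^sub>b a # ?F @ ?N" using Cons braid_append[of t "?F @ ?N" "[a]" "[]"] by simp
 show ?case
 proof (cases "P a")
  case False
  have a: "bij a" using Cons by simp
  have "cj (inv' a) p = p" if "p \<in> set ?F" for p
  proof -
   have "a \<circ> p = p \<circ> a" using False that by (intro Cons.prems(2)) auto
   then have "cj a p = p" using a by (simp add: cj_commute)
   then show ?thesis using a by (metis cj_inv_cancel(2))
  qed
  then have "map (cj (inv' a)) ?F = ?F" by (intro map_idI)
  then have "a # ?F \<sim>\<^sub>b ?F @ [a]" using braid_block[of ?F "[a]"] Cons.prems by simp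
  then have "a # ?F @ ?N \<sim>\<^sub>b ?F @ a # ?N" using braid_append[of "a # ?F" "?F @ [a]" "[]" ?N] by simp
  then show ?thesis using * False braid_trans by fastforce
 qed (use * in simp)
qed simp

text \<open>Dropping a mutually inverse pair keeps the product, but the orbits may fall apart. If
  the rest is still transitive, the genus has gone down by one; if it splits, the genus is the sum
  of the genera of the two parts. A part may be a single letter with the empty tuple.\<close>

lemma pair_decompose:
 assumes "pt A (tc x y z # tc z y x # R)" "distinct [x, y, z]" "{x, y, z} \<subseteq> A"
  "set R \<subseteq> tc3 (A - {x})"
 shows "pt (A - {x}) R \<or> (\<exists>Y Z RY RZ. y \<in> Y \<and> z \<in> Z \<and> Y \<inter> Z = {} \<and> Y \<union> Z = A - {x} \<and>
  pt Y RY \<and> pt Z RZ \<and> R \<sim>\<^sub>b RY @ RZ)"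
proof -
 have A: "finite A" "acts_trans A (tc x y z # tc z y x # R)" using assms(1) by (auto simp: pt_def)
 have "right_prod R \<circ> (tc z y x \<circ> tc x y z) = id" using assms(1) by (simp add: pt_def comp_assoc)
 then have R1: "right_prod R = id" using tc_comp_inverse[OF assms(2)] by simp
 define A' where "A' = A - {x}"
 have A': "finite A'" "y \<in> A'" "z \<in> A'" using A assms by (auto simp: A'_def)
 have Rp: "\<forall>g\<in>set R. g permutes A'" and Rb: "\<forall>g\<in>set R. bij g"
  using assms(4) tc3_permutes tc3_bij by (auto simp: A'_def)
 have Rx: "g x = x" if "g \<in> set R" for g using assms(4) that tc3_outside by blast
 define orb where "orb v = (\<lambda>h. h v) ` grp R" for v
 have orb_sub: "orb v \<subseteq> A'" if "v \<in> A'" for v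
  using grp_permutes[OF _ Rp] that by (auto simp: orb_def permutes_in_image)
 have orb_inv: "g u \<in> orb v" if "g \<in> set R" "u \<in> orb v" for g u v
 proof -
  obtain h where "h \<in> grp R" "u = h v" using \<open>u \<in> orb v\<close> by (auto simp: orb_def)
  then show ?thesis
   using grp_step[OF _ \<open>g \<in> set R\<close>, of h] unfolding orb_def by (intro image_eqI[of _ _ "g \<circ> h"]) auto
 qed
 have orb_self: "v \<in> orb v" for v unfolding orb_def using grp_id by (intro image_eqI[of _ _ id]) auto
 \<comment> \<open>Orbits are minimal invariant sets: once some \<open>h\<close> takes
   \<open>v\<close> into the finite invariant set \<open>B\<close>, it permutes \<open>B\<close>,
   and so \<open>v\<close> itself lies in \<open>B\<close>.\<close>
 have orb_min: "B = orb v" if B: "B \<subseteq> orb v" "B \<noteq> {}" "v \<in> A'"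
  "\<And>g u. g \<in> set R ==> u \<in> B ==> g u \<in> B" for B v
 proof -
  have inv: "h ` B \<subseteq> B" if "h \<in> grp R" for h using that by induction (auto intro: B(4))
  obtain h where h: "h \<in> grp R" "h v \<in> B" using B(1,2) unfolding orb_def by blast
  have "finite B" using B orb_sub A' by (meson finite_subset)
  then have "h ` B = B" using inv h grp_bij Rb by (intro finite_bij_image_eq) auto
  then have "v \<in> B" using h grp_bij[OF h(1) Rb] by (metis bij_is_inj imageE injD)
  then show "B = orb v" using B(1) inv by (auto simp: orb_def)
 qed
 \<comment> \<open>The rest fixes \<open>x\<close>, so only the pair connects the letters
   \<open>x\<close>, \<open>y\<close> and \<open>z\<close>; every orbit of the rest inside
   \<open>A - {x}\<close> therefore contains \<open>y\<close> or \<open>z\<close>.\<close>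
 have cov: "insert x (orb y \<union> orb z) = A" using A' orb_sub orb_inv orb_self Rx assms(2,3)
  by (intro acts_transD[OF A(2)]) (auto simp: tc_apply A'_def split: if_splits)
 have xo: "x \<notin> orb y" "x \<notin> orb z" using orb_sub A' by (auto simp: A'_def)
 show ?thesis
 proof (cases "z \<in> orb y")
  case True
  then have "orb z \<subseteq> orb y" using orb_min[of "orb y \<inter> orb z" z] orb_inv orb_self A' by blast
  then have "A' = orb y" using cov xo by (auto simp: A'_def)
  then have "acts_trans A' R" using orb_min A' by (intro acts_transI) blast
  then show ?thesis using A' R1 assms(4) by (auto simp: pt_def A'_def)
 next
  case False
  have disj: "orb y \<inter> orb z = {}"
  proof (rule ccontr)
   assume "orb y \<inter> orb z \<noteq> {}"
   then have "orb y \<inter> orb z = orb y" "orb y \<inter> orb z = orb z" using orb_inv A' by (intro orb_min; blast)+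
   then show False using False orb_self by blast
  qed
  have un: "orb y \<union> orb z = A'" using cov xo by (auto simp: A'_def)
  have RYZ: "g \<in> tc3 (orb y) \<or> g \<in> tc3 (orb z)" if g: "g \<in> set R" for g
  proof -
   obtain a b c where abc: "g = tc a b c" "distinct [a, b, c]" "{a, b, c} \<subseteq> A'"
    using assms(4) g by (auto simp: tc3_def A'_def)
   have gab: "g a = b" "g b = c" using abc by (auto simp: tc_def)
   have "{a, b, c} \<subseteq> orb v" if "a \<in> orb v" for v
    using orb_inv[OF g that] orb_inv[OF g, of b v] that gab by auto
   then show ?thesis using abc un by (auto intro!: tc3I)
  qed
  define P where "P g \<longleftrightarrow> g \<in> tc3 (orb y)" for g
  define RY where "RY = filter P R"
  define RZ where "RZ = filter (\<lambda>g. \<not> P g) R"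
  have sY: "set RY \<subseteq> tc3 (orb y)" and sZ: "set RZ \<subseteq> tc3 (orb z)"
   using RYZ by (auto simp: RY_def RZ_def P_def)
  have comm: "q \<circ> p = p \<circ> q" if "p \<in> tc3 (orb y)" "q \<in> tc3 (orb z)" for p q
  proof
   fix u
   have pq: "p permutes orb y" "q permutes orb z" using that tc3_permutes by auto
   show "(q \<circ> p) u = (p \<circ> q) u"
   proof (cases "u \<in> orb y")
    case True
    then have "p u \<in> orb y" using pq by (simp add: permutes_in_image)
    then show ?thesis using True disj pq by (simp add: permutes_def disjoint_iff)
   next
    case False
    then have "p u = u" "q u \<notin> orb y"
     using pq disj by (metis permutes_def, metis disjoint_iff permutes_def permutes_in_image)
    then show ?thesis using pq by (simp add: permutes_def)
   qed
  qed
  have split: "R \<sim>\<^sub>b RY @ RZ"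
   unfolding RY_def RZ_def using Rb comm RYZ by (intro braid_partition) (auto simp: P_def)
  have prod: "right_prod RZ \<circ> right_prod RY = id" using braid_right_prod[OF split] R1 by simp
  have Yp: "right_prod RY permutes orb y" and Zp: "right_prod RZ permutes orb z"
  proof -
   have *: "right_prod t permutes V" if "set t \<subseteq> tc3 V" for t V
    using that by (induction t) (auto simp: permutes_id intro: permutes_compose[OF tc3_permutes])
   show "right_prod RY permutes orb y" "right_prod RZ permutes orb z" using * sY sZ by auto
  qed
  \<comment> \<open>The supports are disjoint, so the two products can cancel only if each of them
    is trivial.\<close>
  have Y1: "right_prod RY = id"
  proof
   fix u
   show "right_prod RY u = id u"
   proof (cases "u \<in> orb y")
    case True
    then have "right_prod RY u \<notin> orb z" using Yp disj by (metis disjoint_iff permutes_in_image)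
    then have "right_prod RZ (right_prod RY u) = right_prod RY u" using Zp by (metis permutes_def)
    then show ?thesis using prod by (metis comp_apply)
   next
    case False
    then show ?thesis using Yp by (simp add: permutes_def)
   qed
  qed
  then have Z1: "right_prod RZ = id" using prod by simp
  have "acts_trans (orb y) RY"
  proof (rule acts_transI)
   fix B assume B: "B \<subseteq> orb y" "B \<noteq> {}" "\<And>g u. g \<in> set RY ==> u \<in> B ==> g u \<in> B"
   have "g u \<in> B" if "g \<in> set R" "u \<in> B" for g u
   proof (cases "P g")
    case False
    then have "g u = u" using RYZ[OF that(1)] that B disj by (auto simp: P_def intro!: tc3_outside)
    then show ?thesis using that by simp
   qed (use that B in \<open>auto simp: RY_def\<close>)
   then show "orb y \<subseteq> B" using orb_min[OF B(1,2)] A' by blast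
  qed
  moreover have "acts_trans (orb z) RZ"
  proof (rule acts_transI)
   fix B assume B: "B \<subseteq> orb z" "B \<noteq> {}" "\<And>g u. g \<in> set RZ ==> u \<in> B ==> g u \<in> B"
   have "g u \<in> B" if "g \<in> set R" "u \<in> B" for g u
   proof (cases "P g")
    case True
    then have "g u = u" using that B disj by (auto simp: P_def intro!: tc3_outside)
    then show ?thesis using that by simp
   qed (use that B in \<open>auto simp: RZ_def\<close>)
   then show "orb z \<subseteq> B" using orb_min[OF B(1,2)] A' by blast
  qed
  ultimately have "pt (orb y) RY" "pt (orb z) RZ"
   using sY sZ Y1 Z1 orb_self[of y] orb_self[of z] finite_subset[OF orb_sub] A' unfolding pt_def by auto
  then show ?thesis using orb_self disj un split unfolding A'_def by blast
 qed
qed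

text \<open>The genus of a connected cover is nonnegative.\<close>

lemma pt_card_le: "pt A t ==> card A \<le> Suc (length t)"
proof (induction "card A" arbitrary: A t rule: less_induct)
 case less
 have fin: "finite A" "A \<noteq> {}" using less.prems by (auto simp: pt_def)
 show ?case
 proof (cases "length t < card A \<and> card A \<ge> 2")
  case True
  then have "length t < card A" "card A \<ge> 2" by auto
  with less.prems show ?thesis
  proof (cases rule: front_cases)
   case (pair x y z R)
   have p: "pt A (tc x y z # tc z y x # R)" using braid_pt[OF pair(3) less.prems] .
   have len: "length t = Suc (Suc (length R))" using braid_length[OF pair(3)] by simp
   have cx: "card A = Suc (card (A - {x}))" using fin pair card.remove[of A x] by auto
   from pair_decompose[OF p pair(1,2,4)] show ?thesis
   proof (elim disjE exE conjE)
    assume "pt (A - {x}) R"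
    then show ?thesis using less.hyps[of "A - {x}" R] len cx by simp
   next
    fix Y Z RY RZ
    assume *: "y \<in> Y" "z \<in> Z" "Y \<inter> Z = {}" "Y \<union> Z = A - {x}" "pt Y RY" "pt Z RZ" "R \<sim>\<^sub>b RY @ RZ"
    have "finite Y" "finite Z" using * by (auto simp: pt_def)
    then have "card (A - {x}) = card Y + card Z" using * card_Un_disjoint by metis
    moreover have "card Y \<le> Suc (length RY)" "card Z \<le> Suc (length RZ)"
     using * cx calculation by (intro less.hyps; simp)+
    ultimately show ?thesis using braid_length[OF *(7)] len cx by simp
   qed
  next
   case (split x y z w R)
   have "pt (A - {x}) (tc y z w # R)" using split_pt(1)[OF braid_pt[OF split(3) less.prems] split(1,2,4)] .
   moreover have "card A = Suc (card (A - {x}))" using fin split card.remove[of A x] by auto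
   ultimately show ?thesis using less.hyps[of "A - {x}" "tc y z w # R"] braid_length[OF split(3)] by simp
  qed
 qed auto
qed

text \<open>The elementary move written out on letters, which reduces the explicit braids for small
  tuples to evaluating \<open>tc\<close>.\<close>

lemma tc_move:
 assumes "distinct [a, b, c]" "distinct [d, e, f]"
 shows "xs @ tc a b c # tc d e f # ys \<sim>\<^sub>b
  xs @ tc (tc c b a d) (tc c b a e) (tc c b a f) # tc a b c # ys"
 using braid_step[of "tc a b c" "tc d e f" xs ys] assms bij_tc[of c b a] by (simp add: bij_tc inv_tc cj_tc)

lemma tc_move_back:
 assumes "distinct [a, b, c]" "distinct [d, e, f]"
 shows "xs @ tc a b c # tc d e f # ys \<sim>\<^sub>b
  xs @ tc d e f # tc (tc d e f a) (tc d e f b) (tc d e f c) # ys"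
 using braid_step_back[of "tc a b c" "tc d e f" xs ys] assms by (simp add: bij_tc cj_tc)

lemma tc_mem_tc3D: "tc a b c \<in> tc3 B ==> distinct [a, b, c] ==> {a, b, c} \<subseteq> B"
proof -
 assume "tc a b c \<in> tc3 B" "distinct [a, b, c]"
 then have "v \<in> B" if "tc a b c v \<noteq> v" for v using tc3_outside[of "tc a b c" B v] that by blast
 from this[of a] this[of b] this[of c] show ?thesis using \<open>distinct [a, b, c]\<close> by (auto simp: tc_apply)
qed

lemma tc_pair_rot:
 assumes "distinct [x, y, z]"
 shows "tc x y z = tc y z x" "tc z y x = tc x z y" "tc x y z = tc z x y" "tc z y x = tc y x z"
 using assms by (auto simp: tc_def fun_eq_iff)

lemma tc_inverse_unique:
 assumes "distinct [a, b, c]" "g \<circ> tc a b c = id"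
 shows "g = tc c b a"
proof -
 have "tc a b c \<circ> tc c b a = id" using tc_comp_inverse[of c b a] assms by simp
 then show ?thesis using assms(2) by (metis comp_assoc comp_id id_comp)
qed

section \<open>Leaves: inverse pairs of three-cycles with two letters of their own\<close>

definition leaf :: "nat set => (nat => nat) list => bool" where
 "leaf A t \<longleftrightarrow> (\<exists>u p q R. distinct [u, p, q] \<and> {u, p, q} \<subseteq> A \<and> t \<sim>\<^sub>b tc u p q # tc q p u # R \<and>
  set R \<subseteq> tc3 (A - {p, q}))"

lemma leafI: "distinct [u, p, q] ==> {u, p, q} \<subseteq> A ==> t \<sim>\<^sub>b tc u p q # tc q p u # R ==>
  set R \<subseteq> tc3 (A - {p, q}) ==> leaf A t" unfolding leaf_def by blast

lemma leaf_braid: "t \<sim>\<^sub>b t' ==> leaf A t' ==> leaf A t"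
 unfolding leaf_def by (meson braid_trans)

text \<open>Two letters and two entries go together, so the genus stays zero; an orbit that contains
  \<open>u\<close> picks up \<open>p\<close> and \<open>q\<close> again, and no other orbit notices
  the pair.\<close>

lemma ni_remove_leaf:
 assumes "ni A (tc u p q # tc q p u # R)" "distinct [u, p, q]" "{u, p, q} \<subseteq> A"
  "set R \<subseteq> tc3 (A - {p, q})" shows "ni (A - {p, q}) R"
proof -
 have A: "finite A" "right_prod R \<circ> (tc q p u \<circ> tc u p q) = id" "acts_trans A (tc u p q # tc q p u # R)"
  and len: "Suc (Suc (Suc (length R))) = card A"
  using assms(1) by (auto simp: ni_def pt_def comp_assoc)
 have R1: "right_prod R = id" using A(2) tc_comp_inverse[OF assms(2)] by simp
 have fx: "g p = p" "g q = q" if "g \<in> set R" for g using that assms(4) tc3_outside[of g "A - {p, q}"] by auto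
 have "acts_trans (A - {p, q}) R"
 proof (rule acts_transI)
  fix B assume B: "B \<subseteq> A - {p, q}" "B \<noteq> {}" "\<And>g x. g \<in> set R ==> x \<in> B ==> g x \<in> B"
  show "A - {p, q} \<subseteq> B"
  proof (cases "u \<in> B")
   case True
   then have "B \<union> {p, q} = A"
    using B assms(2,3) fx by (intro acts_transD[OF A(3)]) (auto simp: tc_apply split: if_splits)
   then show ?thesis by blast
  next
   case False
   then have "B = A" using B assms(2,3) by (intro acts_transD[OF A(3)]) (auto simp: tc_apply split: if_splits)
   then show ?thesis by blast
  qed
 qed
 moreover have "card (A - {p, q}) = card A - 2" using assms A by (subst card_Diff_subset) auto
 ultimately show ?thesis using A R1 assms len by (auto simp: ni_def pt_def)
qed

lemma ni_add_leaf:
 assumes "ni A R" "distinct [u, p, q]" "u \<in> A" "p \<notin> A" "q \<notin> A"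
 shows "ni (A \<union> {p, q}) (tc u p q # tc q p u # R)"
proof -
 have A: "finite A" "right_prod R = id" "acts_trans A R" "Suc (length R) = card A" "set R \<subseteq> tc3 A"
  using assms(1) by (auto simp: ni_def pt_def)
 have "acts_trans (A \<union> {p, q}) (tc u p q # tc q p u # R)"
 proof (rule acts_transI)
  fix B assume B: "B \<subseteq> A \<union> {p, q}" "B \<noteq> {}"
   "\<And>g x. g \<in> set (tc u p q # tc q p u # R) ==> x \<in> B ==> g x \<in> B"
  have t: "tc u p q x \<in> B" if "x \<in> B" for x using B(3) that by auto
  have cyc: "u \<in> B ==> p \<in> B" "p \<in> B ==> q \<in> B" "q \<in> B ==> u \<in> B"
   using t[of u] t[of p] t[of q] assms(2) by (auto simp: tc_apply)
  then have "B \<inter> A \<noteq> {}" using B(1,2) assms(3) by blast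
  moreover have "g x \<in> B \<inter> A" if "g \<in> set R" "x \<in> B \<inter> A" for g x
   using that B(3) A(5) tc3_permutes[of g A] by (auto simp: permutes_in_image)
  ultimately have "B \<inter> A = A" by (intro acts_transD[OF A(3)]) auto
  then have "u \<in> B" using assms(3) by blast
  then show "A \<union> {p, q} \<subseteq> B" using cyc \<open>B \<inter> A = A\<close> by blast
 qed
 moreover have "right_prod (tc u p q # tc q p u # R) = id" using A(2) tc_comp_inverse[OF assms(2)] by (simp add: comp_assoc)
 moreover have "set (tc u p q # tc q p u # R) \<subseteq> tc3 (A \<union> {p, q})"
  using A(5) tc3_mono[of A "A \<union> {p, q}"] assms by (auto intro!: tc3I)
 moreover have "card (A \<union> {p, q}) = card A + 2" using A(1) assms by (subst card_Un_disjoint) auto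
 ultimately show ?thesis using A assms by (auto simp: ni_def pt_def)
qed

lemma ni_permutes: "ni A t ==> \<forall>g\<in>set t. g permutes A"
 unfolding ni_def pt_def using tc3_permutes by blast

lemma ni_bij: "ni A t ==> \<forall>g\<in>set t. bij g"
 unfolding ni_def using pt_bij by blast

lemma ni_right_prod: "ni A t ==> right_prod t = id"
 by (simp add: ni_def pt_def)

text \<open>The generated group is transitive and conjugation by its elements is a braid. Hence
  letters may be renamed, with the new name of one of them prescribed, inside the same braid
  class.\<close>

lemma ni_cj_transitive:
 assumes "ni A t" "u \<in> A" "v \<in> A"
 obtains h where "h permutes A" "h u = v" "map (cj h) t \<sim>\<^sub>b t"
proof -
 obtain h where h: "h \<in> grp t" "h u = v"
  by (rule acts_trans_grp[of A t u v]) (use assms ni_permutes[OF assms(1)] in \<open>auto simp: ni_def pt_def\<close>)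
 then show ?thesis using that[of h] grp_permutes[OF h(1)] braid_cj_grp[OF h(1)] assms ni_permutes ni_bij ni_right_prod
  by blast
qed

lemma leaf_at:
 assumes "leaf A t" "ni A t" "v \<in> A"
 obtains p q R where "distinct [v, p, q]" "{v, p, q} \<subseteq> A" "t \<sim>\<^sub>b tc v p q # tc q p v # R"
  "set R \<subseteq> tc3 (A - {p, q})"
proof -
 obtain u p q R where *: "distinct [u, p, q]" "{u, p, q} \<subseteq> A" "t \<sim>\<^sub>b tc u p q # tc q p u # R"
  "set R \<subseteq> tc3 (A - {p, q})" using assms(1) unfolding leaf_def by blast
 let ?t = "tc u p q # tc q p u # R"
 have n: "ni A ?t" using braid_ni[OF *(3) assms(2)] .
 obtain h where h: "h permutes A" "h u = v" "map (cj h) ?t \<sim>\<^sub>b ?t"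
  using ni_cj_transitive[OF n, of u v] * assms(3) by auto
 have b: "bij h" "inj h" using h permutes_bij permutes_inj by auto
 have "t \<sim>\<^sub>b map (cj h) ?t" using *(3) h(3) braid_sym braid_trans by blast
 then have "t \<sim>\<^sub>b tc v (h p) (h q) # tc (h q) (h p) v # map (cj h) R" using b h by (simp add: cj_tc)
 moreover have "h ` (A - {p, q}) = A - {h p, h q}" using h b permutes_image[OF h(1)] by (simp add: image_set_diff)
 then have "set (map (cj h) R) \<subseteq> tc3 (A - {h p, h q})" using *(4) cj_tc3_image[OF b(1)] by force
 ultimately show ?thesis using that[of "h p" "h q" "map (cj h) R"] * h b by (auto simp: inj_eq permutes_in_image)
qed

text \<open>Hanging the leaf of \<open>T\<close> at the common letter \<open>v\<close> keeps its two
  free letters out of \<open>W\<close>, so the entries on \<open>W\<close> do not disturb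
  it.\<close>

lemma leaf_append:
 assumes "leaf B T" "ni B T" "v \<in> B" "set S \<subseteq> tc3 W" "W \<inter> B \<subseteq> {v}" "B \<union> W \<subseteq> A"
 shows "leaf A (T @ S)"
proof -
 obtain p q R where *: "distinct [v, p, q]" "{v, p, q} \<subseteq> B" "T \<sim>\<^sub>b tc v p q # tc q p v # R"
  "set R \<subseteq> tc3 (B - {p, q})" using leaf_at[OF assms(1-3)] .
 have "T @ S \<sim>\<^sub>b tc v p q # tc q p v # (R @ S)" using braid_append[OF *(3), of "[]" S] by simp
 moreover have "set (R @ S) \<subseteq> tc3 (A - {p, q})"
 proof -
  have "tc3 (B - {p, q}) \<subseteq> tc3 (A - {p, q})" "tc3 W \<subseteq> tc3 (A - {p, q})"
   using assms(5,6) *(1,2) by (intro tc3_mono; auto)+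
  then show ?thesis using *(4) assms(4) by auto
 qed
 ultimately show ?thesis using leafI[of v p q A "T @ S" "R @ S"] * assms(6) by auto
qed

section \<open>Tuples on three, four and five letters, and joins of small blocks\<close>

lemma leaf3:
 assumes "ni A t" "card A = 3" shows "leaf A t"
proof -
 have "length t = 2" using assms by (simp add: ni_def)
 then obtain g g' where t: "t = [g, g']" by (auto simp: numeral_2_eq_2 length_Suc_conv)
 have "g \<in> tc3 A" "g' \<circ> g = id" using assms t by (auto simp: ni_def pt_def)
 then obtain a b c where abc: "g = tc a b c" "distinct [a, b, c]" "{a, b, c} \<subseteq> A" by (auto simp: tc3_def)
 then have "g' = tc c b a" using tc_inverse_unique \<open>g' \<circ> g = id\<close> by blast
 then show ?thesis using leafI[of a b c A t "[]"] abc t by auto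
qed

text \<open>An inverse pair would leave a single entry of product one, which is no three-cycle. So
  on four letters only the split case occurs, a leaf never exists, and this normal form takes its
  place.\<close>

lemma ni4_form:
 assumes "ni A t" "card A = 4"
 obtains x y z w where "distinct [x, y, z, w]" "A = {x, y, z, w}" "t \<sim>\<^sub>b [tc x y z, tc y x w, tc w z y]"
proof -
 have n: "pt A t" "length t < card A" "card A \<ge> 2" "length t = 3" "finite A" using assms by (auto simp: ni_def pt_def)
 show ?thesis
 proof (rule front_cases[OF n(1-3)])
  fix x y z R
  assume *: "distinct [x, y, z]" "{x, y, z} \<subseteq> A" "t \<sim>\<^sub>b tc x y z # tc z y x # R"
   "set R \<subseteq> tc3 (A - {x})"
  have "length R = 1" using braid_length[OF *(3)] n by simp
  then obtain g where R: "R = [g]" by (metis One_nat_def length_0_conv length_Suc_conv)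
  have "g \<circ> tc z y x \<circ> tc x y z = id" using braid_pt[OF *(3) n(1)] R by (simp add: pt_def)
  then have "g = id" using tc_comp_inverse[OF *(1)] by (simp add: comp_assoc)
  moreover have "g \<in> tc3 A" using * R tc3_mono[of "A - {x}" A] by auto
  ultimately have False using card_tc3_moved[of A g] n by simp
  then show ?thesis ..
 next
  fix x y z w R
  assume *: "distinct [x, y, z, w]" "{x, y, z, w} \<subseteq> A" "t \<sim>\<^sub>b tc x y z # tc y x w # R"
   "set R \<subseteq> tc3 (A - {x})"
  have "length R = 1" using braid_length[OF *(3)] n by simp
  then obtain g where R: "R = [g]" by (metis One_nat_def length_0_conv length_Suc_conv)
  have p: "pt A (tc x y z # tc y x w # R)" using braid_pt[OF *(3) n(1)] .
  have "g \<circ> tc y z w = id" using split_pt(1)[OF p *(1,2,4)] R by (simp add: pt_def)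
  then have "g = tc w z y" using tc_inverse_unique *(1) by auto
  moreover have "{x, y, z, w} = A" using * n assms(2) by (intro card_subset_eq) auto
  ultimately show ?thesis using that[of x y z w] * R by auto
 qed
qed

lemma ni4:
 assumes "distinct [x, y, z, w]" shows "ni {x, y, z, w} [tc x y z, tc y x w, tc w z y]"
proof -
 have "acts_trans {x, y, z, w} [tc x y z, tc y x w, tc w z y]"
 proof (rule acts_transI)
  fix B assume B: "B \<subseteq> {x, y, z, w}" "B \<noteq> {}"
   "\<And>g u. g \<in> set [tc x y z, tc y x w, tc w z y] ==> u \<in> B ==> g u \<in> B"
  have 1: "tc x y z u \<in> B" "tc y x w u \<in> B" if "u \<in> B" for u using that B(3) by auto
  have "x \<in> B ==> y \<in> B" "y \<in> B ==> z \<in> B" "z \<in> B ==> x \<in> B" "x \<in> B ==> w \<in> B" "w \<in> B ==> y \<in> B"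
   using 1(1)[of x] 1(1)[of y] 1(1)[of z] 1(2)[of x] 1(2)[of w] assms by (auto simp: tc_apply)
  then show "{x, y, z, w} \<subseteq> B" using B(1,2) by blast
 qed
 moreover have "right_prod [tc x y z, tc y x w, tc w z y] = id" using assms by (auto simp: fun_eq_iff tc_apply)
 moreover have "set [tc x y z, tc y x w, tc w z y] \<subseteq> tc3 {x, y, z, w}" using assms by (auto intro!: tc3I)
 ultimately show ?thesis using assms by (simp add: ni_def pt_def)
qed

text \<open>When two four-letter blocks are joined at \<open>v\<close>, this form serves for the
  first block and \<open>ni4_at'\<close>, with \<open>v\<close> at another place of the normal form,
  for the second.\<close>

lemma ni4_at:
 assumes "ni A t" "card A = 4" "v \<in> A"
 obtains x z w where "distinct [x, v, z, w]" "A = {x, v, z, w}" "t \<sim>\<^sub>b [tc x v z, tc v x w, tc w z v]"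
proof -
 obtain x y z w where *: "distinct [x, y, z, w]" "A = {x, y, z, w}" "t \<sim>\<^sub>b [tc x y z, tc y x w, tc w z y]"
  using ni4_form[OF assms(1,2)] .
 obtain h where h: "h permutes A" "h y = v"
  "map (cj h) [tc x y z, tc y x w, tc w z y] \<sim>\<^sub>b [tc x y z, tc y x w, tc w z y]"
  using ni_cj_transitive[OF braid_ni[OF *(3) assms(1)], of y v] assms(3) * by auto
 have b: "bij h" "inj h" using h permutes_bij permutes_inj by auto
 have "A = h ` {x, y, z, w}" using permutes_image[OF h(1)] *(2) by simp
 then show ?thesis using that[of "h x" "h z" "h w"] h * b braid_sym braid_trans[OF *(3)] by (auto simp: cj_tc inj_eq)
qed

lemma ni4_at':
 assumes "ni A t" "card A = 4" "v \<in> A"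
 obtains y z w where "distinct [v, y, z, w]" "A = {v, y, z, w}" "t \<sim>\<^sub>b [tc v y z, tc y v w, tc w z y]"
proof -
 obtain x y z w where *: "distinct [x, y, z, w]" "A = {x, y, z, w}" "t \<sim>\<^sub>b [tc x y z, tc y x w, tc w z y]"
  using ni4_form[OF assms(1,2)] .
 obtain h where h: "h permutes A" "h x = v"
  "map (cj h) [tc x y z, tc y x w, tc w z y] \<sim>\<^sub>b [tc x y z, tc y x w, tc w z y]"
  using ni_cj_transitive[OF braid_ni[OF *(3) assms(1)], of x v] assms(3) * by auto
 have b: "bij h" "inj h" using h permutes_bij permutes_inj by auto
 have "A = h ` {x, y, z, w}" using permutes_image[OF h(1)] *(2) by simp
 then show ?thesis using that[of "h y" "h z" "h w"] h * b braid_sym braid_trans[OF *(3)] by (auto simp: cj_tc inj_eq)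
qed

text \<open>Neither block has a leaf, so one has to be produced by hand. Four moves across the
  common letter \<open>v\<close> make \<open>(a b c)\<close> and its inverse adjacent while
  \<open>a\<close> and \<open>c\<close> disappear from all other entries; the pair then slides to
  the front because its product is one.\<close>

lemma leaf_two_blocks4:
 assumes d: "distinct [v, x, z, w, a, b, c]"
 shows "leaf {v, x, z, w, a, b, c} [tc x v z, tc v x w, tc w z v, tc v a b, tc a v c, tc c b a]"
proof -
 let ?h = "[tc x v z, tc v x w]"
 have "[tc x v z, tc v x w, tc w z v, tc v a b, tc a v c, tc c b a] \<sim>\<^sub>b
   ?h @ tc z a b # tc w z v # [tc a v c, tc c b a]"
  using tc_move[of w z v v a b ?h "[tc a v c, tc c b a]"] d by (auto simp: tc_apply)
 also have "\<dots> \<sim>\<^sub>b ?h @ tc w b v # tc z a b # [tc a v c, tc c b a]"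
  using tc_move[of z a b w z v ?h "[tc a v c, tc c b a]"] d by (auto simp: tc_apply)
 also have "\<dots> \<sim>\<^sub>b ?h @ tc w b v # tc a v c # tc z v b # [tc c b a]"
  using tc_move_back[of z a b a v c "?h @ [tc w b v]" "[tc c b a]"] d by (auto simp: tc_apply)
 also have "\<dots> \<sim>\<^sub>b ?h @ tc w b v # tc z v b # tc a b c # [tc c b a]"
  using tc_move_back[of a v c z v b "?h @ [tc w b v]" "[tc c b a]"] d by (auto simp: tc_apply)
 also have "\<dots> = (?h @ [tc w b v, tc z v b]) @ [tc b c a, tc a c b]" using d by (simp add: tc_pair_rot[of a b c])
 also have "\<dots> \<sim>\<^sub>b [tc b c a, tc a c b] @ (?h @ [tc w b v, tc z v b])"
  using d tc_comp_inverse[of b c a] by (intro braid_swap_one) (auto intro: bij_tc)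
 finally show ?thesis using d by (intro leafI[of b c a]) (auto intro!: tc3I)
qed

text \<open>Since \<open>u\<close> is the only shared letter, a leaf of \<open>R\<close> hung at
  \<open>u\<close> survives beside \<open>T\<close>. It is missing only if \<open>R\<close> lives on
  four letters, and then the explicit computation applies.\<close>

lemma leaf_join:
 assumes "ni {x, u, p, q} T" "distinct [x, u, p, q]" "ni B R" "B \<inter> {x, u, p, q} = {u}"
  and "card B \<ge> 3" "card B \<noteq> 4 ==> leaf B R"
 shows "leaf (B \<union> {x, u, p, q}) (T @ R)"
proof (cases "card B = 4")
 case False
 have "T @ R \<sim>\<^sub>b R @ T" using assms ni_bij ni_right_prod by (intro braid_swap_one) auto
 moreover have "leaf (B \<union> {x, u, p, q}) (R @ T)"
 proof (rule leaf_append)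
  show "leaf B R" "ni B R" using assms False by auto
  show "set T \<subseteq> tc3 {x, u, p, q}" using assms(1) by (simp add: ni_def pt_def)
 qed (use assms in auto)
 ultimately show ?thesis using leaf_braid by blast
next
 case True
 have "card {x, u, p, q} = 4" "u \<in> {x, u, p, q}" "u \<in> B" using assms by auto
 obtain a b c where 1: "distinct [a, u, b, c]" "{x, u, p, q} = {a, u, b, c}"
  "T \<sim>\<^sub>b [tc a u b, tc u a c, tc c b u]"
  using ni4_at[OF assms(1) \<open>card {x, u, p, q} = 4\<close> \<open>u \<in> {x, u, p, q}\<close>] .
 obtain a' b' c' where 2: "distinct [u, a', b', c']" "B = {u, a', b', c'}"
  "R \<sim>\<^sub>b [tc u a' b', tc a' u c', tc c' b' a']" using ni4_at'[OF assms(3) True \<open>u \<in> B\<close>] .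
 have d: "distinct [u, a, b, c, a', b', c']" using 1 2 assms(4) by auto
 have "T @ R \<sim>\<^sub>b [tc a u b, tc u a c, tc c b u, tc u a' b', tc a' u c', tc c' b' a']"
  using braid_append2[OF 1(3) 2(3)] by simp
 moreover have "B \<union> {x, u, p, q} = {u, a, b, c, a', b', c'}" unfolding 1(2) 2(2) by auto
 ultimately show ?thesis using leaf_two_blocks4[OF d] leaf_braid by simp
qed

lemma tc_triple:
 assumes "distinct [v, a, b, c]" shows "tc v b a \<circ> (tc v a c \<circ> tc a b c) = id"
proof
 fix u
 consider "u = v" | "u = a" | "u = b" | "u = c" | "u \<notin> {v, a, b, c}" by blast
 then show "(tc v b a \<circ> (tc v a c \<circ> tc a b c)) u = id u" using assms by cases (auto simp: tc_apply)
qed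

text \<open>The product relation determines \<open>g'\<close> from \<open>g\<close>, and a
  three-cycle on four letters fixes one of them. This admits three of the six possible three-cycles
  \<open>g\<close> that move \<open>v\<close>.\<close>

lemma ni4_partner:
 assumes d: "distinct [y, z, w, v]" and g: "g \<in> tc3 {y, z, w, v}" "g' \<in> tc3 {y, z, w, v}"
  and p: "g' \<circ> g \<circ> tc y z w = id" and v: "g v \<noteq> v"
 shows "(g, g') \<in> {(tc v y w, tc v z y), (tc v z y, tc v w z), (tc v w z, tc v y w)}"
proof -
 obtain i j where ij: "g = tc v i j" "distinct [v, i, j]" "{v, i, j} \<subseteq> {y, z, w, v}" using tc3_moved[OF g(1) v] .
 have b: "bij (g \<circ> tc y z w)" using d g tc3_bij bij_tc by (intro bij_comp) auto
 have uniq: "g' = k" if "k \<circ> (g \<circ> tc y z w) = id" for k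
  using b p that by (metis (no_types) comp_assoc comp_id bij_is_surj surj_iff)
 have "\<exists>l\<in>{y, z, w, v}. g' l = l"
 proof (rule ccontr)
  assume "\<not> ?thesis"
  then have "{x \<in> {y, z, w, v}. g' x \<noteq> x} = {y, z, w, v}" by auto
  then show False using card_tc3_moved[OF _ g(2)] d by simp
 qed
 then obtain l where l: "l \<in> {y, z, w, v}" "g' l = l" by blast
 have "g (tc y z w l) = l"
 proof -
  have "g' (g (tc y z w l)) = l" using p by (metis comp_apply id_apply)
  then show ?thesis using l(2) tc3_bij[OF g(2)] by (metis bij_is_inj injD)
 qed
 then have l': "tc v i j (tc y z w l) = l" using ij(1) by simp
 \<comment> \<open>In these three orders \<open>g\<close> after \<open>(y z w)\<close> is a double
   transposition and has no fixed letter.\<close>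
 have "\<not> (i = y \<and> j = z)" "\<not> (i = z \<and> j = w)" "\<not> (i = w \<and> j = y)"
  using l(1) l' d by (auto simp: tc_apply)
 moreover have "(i, j) \<in> {(y, w), (z, y), (w, z), (y, z), (z, w), (w, y)}" using ij(2,3) by auto
 ultimately have "(i, j) \<in> {(y, w), (z, y), (w, z)}" by auto
 moreover have "g' = tc v z y" if "i = y" "j = w" using that ij(1) d tc_triple[of v y z w] by (intro uniq) auto
 moreover have "g' = tc v w z" if "i = z" "j = y"
  using that ij(1) d tc_triple[of v z w y] tc_rot[of y z w] by (intro uniq) auto
 moreover have "g' = tc v y w" if "i = w" "j = z"
  using that ij(1) d tc_triple[of v w y z] tc_rot[of w y z] by (intro uniq) auto
 ultimately show ?thesis using ij by auto
qed

lemma braid_pair_front: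
 assumes "distinct [u, p, q]" "bij g"
 shows "[g] @ [tc u p q, tc q p u] @ ys \<sim>\<^sub>b [tc u p q, tc q p u] @ [g] @ ys"
proof -
 have "[g] @ [tc u p q, tc q p u] \<sim>\<^sub>b [tc u p q, tc q p u] @ [g]"
  using assms bij_tc[of u p q] bij_tc[of q p u] tc_comp_inverse[of u p q] by (intro braid_swap_one) auto
 from braid_append[OF this, of "[]" ys] show ?thesis by simp
qed

text \<open>Deleting a letter here would lead to the exceptional four letters. So each of the three
  possible continuations is braided by hand until an inverse pair appears, which passes to the front
  since its product is one.\<close>

lemma leaf5_split:
 assumes d: "distinct [x, y, z, w, v]"
  and gg: "(g, g') \<in> {(tc v y w, tc v z y), (tc v z y, tc v w z), (tc v w z, tc v y w)}"
 shows "leaf {x, y, z, w, v} [tc x y z, tc y x w, g, g']"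
 using gg
proof (elim insertE emptyE)
 assume "(g, g') = (tc v y w, tc v z y)"
 then have "[tc x y z, tc y x w, g, g'] = [] @ tc x y z # tc y x w # [tc v y w, tc v z y]" by simp
 also have "\<dots> \<sim>\<^sub>b tc x z w # tc x y z # [tc v y w, tc v z y]"
  using tc_move[of x y z y x w "[]" "[tc v y w, tc v z y]"] d by (auto simp: tc_apply)
 also have "\<dots> = [tc x z w] @ tc x y z # tc v y w # [tc v z y]" by simp
 also have "\<dots> \<sim>\<^sub>b [tc x z w] @ tc v y w # tc x w z # [tc v z y]"
  using tc_move_back[of x y z v y w "[tc x z w]" "[tc v z y]"] d by (auto simp: tc_apply)
 also have "\<dots> = [] @ tc x z w # tc v y w # [tc x w z, tc v z y]" by simp
 also have "\<dots> \<sim>\<^sub>b [] @ tc v y z # tc x z w # [tc x w z, tc v z y]"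
  using tc_move[of x z w v y w "[]" "[tc x w z, tc v z y]"] d by (auto simp: tc_apply)
 also have "\<dots> = [tc v y z] @ [tc z w x, tc x w z] @ [tc v z y]" using d tc_pair_rot(1)[of x z w] by auto
 also have "\<dots> \<sim>\<^sub>b [tc z w x, tc x w z] @ [tc v y z] @ [tc v z y]"
  using d by (intro braid_pair_front bij_tc) auto
 finally show ?thesis using d by (intro leafI[of z w x]) (auto intro!: tc3I)
next
 assume "(g, g') = (tc v z y, tc v w z)"
 then have "[tc x y z, tc y x w, g, g'] = [tc x y z] @ tc y x w # tc v z y # [tc v w z]" by simp
 also have "\<dots> \<sim>\<^sub>b [tc x y z] @ tc v z w # tc y x w # [tc v w z]"
  using tc_move[of y x w v z y "[tc x y z]" "[tc v w z]"] d by (auto simp: tc_apply)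
 also have "\<dots> = [] @ tc x y z # tc v z w # [tc y x w, tc v w z]" by simp
 also have "\<dots> \<sim>\<^sub>b [] @ tc v z w # tc x y w # [tc y x w, tc v w z]"
  using tc_move_back[of x y z v z w "[]" "[tc y x w, tc v w z]"] d by (auto simp: tc_apply)
 also have "\<dots> = [tc v z w] @ [tc w x y, tc y x w] @ [tc v w z]" using d tc_pair_rot(3)[of x y w] by auto
 also have "\<dots> \<sim>\<^sub>b [tc w x y, tc y x w] @ [tc v z w] @ [tc v w z]"
  using d by (intro braid_pair_front bij_tc) auto
 finally show ?thesis using d by (intro leafI[of w x y]) (auto intro!: tc3I)
next
 assume "(g, g') = (tc v w z, tc v y w)"
 then have "[tc x y z, tc y x w, g, g'] = [tc x y z] @ tc y x w # tc v w z # [tc v y w]" by simp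
 also have "\<dots> \<sim>\<^sub>b [tc x y z] @ tc v w z # tc y x z # [tc v y w]"
  using tc_move_back[of y x w v w z "[tc x y z]" "[tc v y w]"] d by (auto simp: tc_apply)
 also have "\<dots> = [] @ tc x y z # tc v w z # [tc y x z, tc v y w]" by simp
 also have "\<dots> \<sim>\<^sub>b [] @ tc v w y # tc x y z # [tc y x z, tc v y w]"
  using tc_move[of x y z v w z "[]" "[tc y x z, tc v y w]"] d by (auto simp: tc_apply)
 also have "\<dots> = [tc v w y] @ [tc y z x, tc x z y] @ [tc v y w]"
  using d tc_pair_rot(1)[of x y z] tc_rot[of x z y] tc_rot[of y x z] by auto
 also have "\<dots> \<sim>\<^sub>b [tc y z x, tc x z y] @ [tc v w y] @ [tc v y w]"
  using d by (intro braid_pair_front bij_tc) auto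
 finally show ?thesis using d by (intro leafI[of y z x]) (auto intro!: tc3I)
qed

text \<open>\<open>L\<close> lifts, block by block, a tuple with a leaf; its only block of length
  two holds the entries that move \<open>x\<close>. If that block belongs to the rest, the leaf
  survives. If it covers one entry of the leaf, the two front blocks form a tuple on
  \<open>{x, u, p, q}\<close> that meets the rest only in \<open>u\<close>, and joining these two
  yields a leaf.\<close>

lemma ni_leaf_split:
 assumes n: "ni A' (tc u p q # tc q p u # R')" and x: "x \<notin> A'"
  and d: "distinct [u, p, q]" "{u, p, q} \<subseteq> A'" and R': "set R' \<subseteq> tc3 (A' - {p, q})"
  and L: "map right_prod L = tc u p q # tc q p u # R'"
  and I: "\<forall>B\<in>set L. (\<exists>g\<in>tc3 A'. B = [g]) \<or>
   (\<exists>y z w. distinct [y, z, w] \<and> {y, z, w} \<subseteq> A' \<and> B = [tc x y z, tc y x w])"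
  and ms: "mset (map length L) = add_mset 2 (replicate_mset k 1)"
  and c: "card A' \<ge> 5" and IH: "\<And>B R. card B < card A' ==> ni B R ==> card B \<ge> 5 ==> leaf B R"
 shows "leaf (insert x A') (concat L)"
proof -
 have xd: "x \<notin> {u, p, q}" using x d by auto
 obtain B1 B2 L' where L': "L = B1 # B2 # L'" "right_prod B1 = tc u p q" "right_prod B2 = tc q p u"
  "map right_prod L' = R'" using L by (auto simp: map_eq_Cons_conv)
 have one: "B = [right_prod B]" if "B \<in> set L" "length B \<noteq> 2" for B
 proof -
  from I that(1) consider g where "B = [g]" | y z w where "B = [tc x y z, tc y x w]" by blast
  then show ?thesis using that(2) by cases auto
 qed
 have two: "\<exists>y z w. distinct [x, y, z, w] \<and> {y, z, w} \<subseteq> A' \<and> B = [tc x y z, tc y x w] \<and> right_prod B = tc y z w"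
  if B: "B \<in> set L" "length B = 2" for B
 proof -
  obtain y z w where *: "distinct [y, z, w]" "{y, z, w} \<subseteq> A'" "B = [tc x y z, tc y x w]"
  proof -
   from I B(1) consider g where "B = [g]"
    | y z w where "distinct [y, z, w]" "{y, z, w} \<subseteq> A'" "B = [tc x y z, tc y x w]" by blast
   then show thesis using B(2) that by cases auto
  qed
  moreover have "distinct [x, y, z, w]" using * x by auto
  moreover have "tc y x w \<circ> tc x y z = tc y z w"
   using \<open>distinct [x, y, z, w]\<close> by (auto simp: tc_def fun_eq_iff)
  ultimately show ?thesis by auto
 qed
 have concat_one: "concat M = map right_prod M" if "set M \<subseteq> set L" "\<forall>B\<in>set M. length B \<noteq> 2" for M
  using that
 proof (induction M)
  case (Cons B M)
  then show ?case using one[of B] by (metis append_Cons append_Nil concat.simps(2) insert_subset list.map(2)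
     list.set(2) list.set_intros(1,2))
 qed simp
 define W where "W = A' - {p, q}"
 have W: "ni W R'" "card W = card A' - 2" "W \<inter> {x, u, p, q} = {u}" "W \<union> {x, u, p, q} = insert x A'"
 proof -
  show "ni W R'" unfolding W_def using ni_remove_leaf[OF n d R'] .
  show "card W = card A' - 2" using d n by (simp add: W_def card_Diff_subset ni_def pt_def)
 qed (use d x in \<open>auto simp: W_def\<close>)
 have leafW: "leaf W R'" if "card W \<noteq> 4"
 proof (cases "card W = 3")
  case False
  then show ?thesis using that W c by (intro IH) auto
 qed (use leaf3 W in auto)
 have join: "leaf (insert x A') (T @ R')" if "ni {x, u, p, q} T" for T
 proof -
  have "distinct [x, u, p, q]" using d xd by auto
  from leaf_join[OF that this W(1,3) _ leafW] show ?thesis using W(2,4) c by simp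
 qed
 have cnt: "length (filter (\<lambda>B. length B = 2) L) = 1"
 proof -
  have "length (filter (\<lambda>B. length B = 2) M) = count (mset (map length M)) 2" for M :: "(nat => nat) list list"
   by (induction M) auto
  from this[of L] show ?thesis unfolding ms by simp
 qed
 consider "length B1 = 2" "length B2 \<noteq> 2" "\<forall>B\<in>set L'. length B \<noteq> 2"
  | "length B1 \<noteq> 2" "length B2 = 2" "\<forall>B\<in>set L'. length B \<noteq> 2"
  | "length B1 \<noteq> 2" "length B2 \<noteq> 2" using cnt by (auto simp: L' filter_empty_conv split: if_splits)
 then show ?thesis
 proof cases
  case 1
  obtain y z w where *: "distinct [x, y, z, w]" "B1 = [tc x y z, tc y x w]" "tc u p q = tc y z w"
   using two[of B1] 1 L' by auto
  have "tc q p u \<circ> tc y z w = id" using tc_comp_inverse[OF d(1)] *(3) by simp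
  then have qpu: "tc q p u = tc w z y" using *(1) by (intro tc_inverse_unique) auto
  have "{y, z, w} \<subseteq> {u, p, q}" "{u, p, q} \<subseteq> {y, z, w}"
   using tc_mem_tc3D[of y z w "{u, p, q}"] tc_mem_tc3D[of u p q "{y, z, w}"] *(1,3) d(1)
    tc3I[of u p q "{u, p, q}"] tc3I[of y z w "{y, z, w}"] by auto
  then have eq: "{x, u, p, q} = {x, y, z, w}" by auto
  have "concat L = [tc x y z, tc y x w, tc w z y] @ R'" using one[of B2] 1 L' * qpu concat_one[of L'] by auto
  then show ?thesis using join[unfolded eq, OF ni4[OF *(1)]] by simp
 next
  case 2
  obtain y z w where *: "distinct [x, y, z, w]" "B2 = [tc x y z, tc y x w]" "tc q p u = tc y z w"
   using two[of B2] 2 L' by auto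
  have "tc u p q \<circ> tc y z w = id" using tc_comp_inverse[of q p u] d(1) *(3) by simp
  then have upq: "tc u p q = tc w z y" using *(1) by (intro tc_inverse_unique) auto
  have "{y, z, w} \<subseteq> {u, p, q}" "{u, p, q} \<subseteq> {y, z, w}"
   using tc_mem_tc3D[of y z w "{u, p, q}"] tc_mem_tc3D[of q p u "{y, z, w}"] *(1,3) d(1)
    tc3I[of q p u "{u, p, q}"] tc3I[of y z w "{y, z, w}"] by auto
  then have eq: "{x, u, p, q} = {x, y, z, w}" by auto
  have "[tc x y z, tc y x w, tc w z y] \<sim>\<^sub>b [tc w z y, tc x y z, tc y x w]"
   using braid_rotate[of "[tc x y z, tc y x w]" "[tc w z y]"] ni_bij[OF ni4[OF *(1)]]
    ni_right_prod[OF ni4[OF *(1)]] by simp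
  from braid_ni[OF this ni4[OF *(1)]] have "ni {x, u, p, q} [tc w z y, tc x y z, tc y x w]" unfolding eq .
  moreover have "concat L = [tc w z y, tc x y z, tc y x w] @ R'" using one[of B1] 2 L' * upq concat_one[of L'] by auto
  ultimately show ?thesis using join[of "[tc w z y, tc x y z, tc y x w]"] by simp
 next
  case 3
  have "concat L = tc u p q # tc q p u # concat L'" using one[of B1] one[of B2] 3 L' by auto
  moreover have "set (concat L') \<subseteq> tc3 (insert x A' - {p, q})"
  proof
   fix g assume "g \<in> set (concat L')"
   then obtain B where B: "B \<in> set L'" "g \<in> set B" by auto
   have BR: "right_prod B \<in> tc3 (A' - {p, q})" using B L' R' by auto
   show "g \<in> tc3 (insert x A' - {p, q})"
   proof (cases "length B = 2")
    case True
    obtain y z w where *: "distinct [x, y, z, w]" "{y, z, w} \<subseteq> A'" "B = [tc x y z, tc y x w]"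
     "right_prod B = tc y z w" using two[of B] True B L' by auto
    \<comment> \<open>The merged three-cycle avoids \<open>p\<close> and \<open>q\<close>, so its
      two unmerged entries do as well: besides \<open>y\<close>, \<open>z\<close> and
      \<open>w\<close> they move only \<open>x\<close>.\<close>
    have "{y, z, w} \<subseteq> A' - {p, q}" using tc_mem_tc3D[of y z w "A' - {p, q}"] BR * by auto
    then show ?thesis using * B xd by (auto intro!: tc3I)
   next
    case False
    then have "g = right_prod B" using one[of B] B L' by (metis empty_iff list.set(1) list.set_intros(2) set_ConsD)
    then show ?thesis using BR tc3_mono[of "A' - {p, q}" "insert x A' - {p, q}"] by auto
   qed
  qed
  ultimately show ?thesis using d by (intro leafI[of u p q _ _ "concat L'"]) auto
 qed
qed

lemma ni_card_ne_2: "ni A t ==> card A \<noteq> 2"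
proof
 assume *: "ni A t" "card A = 2"
 then obtain g where "t = [g]" "g \<in> tc3 A" by (auto simp: ni_def pt_def length_Suc_conv)
 then have "card {x \<in> A. g x \<noteq> x} = 3" using * card_tc3_moved[of A g] by (auto simp: ni_def pt_def)
 moreover have "card {x \<in> A. g x \<noteq> x} \<le> card A" using * by (intro card_mono) (auto simp: ni_def pt_def)
 ultimately show False using * by simp
qed

text \<open>With an inverse pair at \<open>x\<close> the rest splits into two genus-zero tuples. A
  trivial one turns the pair into a leaf; otherwise one side together with the pair has at least
  five letters and has a leaf by induction. In the split case the merged tuple has one letter less
  and its leaf is lifted by cabling; only five letters, of which four would remain, are treated
  separately.\<close>

lemma ni_leaf: "ni A t ==> card A \<ge> 5 ==> leaf A t"
proof (induction "card A" arbitrary: A t rule: less_induct)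
 case less
 have n: "pt A t" "length t < card A" "card A \<ge> 2" "finite A" "Suc (length t) = card A"
  using less.prems by (auto simp: ni_def pt_def)
 from n(1-3) show ?case
 proof (cases rule: front_cases)
  case (pair x y z R)
  have p: "ni A (tc x y z # tc z y x # R)" using braid_ni[OF pair(3) less.prems(1)] .
  have len: "length t = Suc (Suc (length R))" using braid_length[OF pair(3)] by simp
  have cx: "card A = Suc (card (A - {x}))" using n pair card.remove[of A x] by auto
  have rots: "tc x y z = tc y z x" "tc z y x = tc x z y" "tc x y z = tc z x y" "tc z y x = tc y x z"
   using tc_pair_rot[OF pair(1)] by auto
  \<comment> \<open>A transitive rest would have genus minus one.\<close>
  have "\<not> pt (A - {x}) R"
  proof
   assume "pt (A - {x}) R"
   from pt_card_le[OF this] show False using cx len n by simp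
  qed
  then obtain Y Z RY RZ where *: "y \<in> Y" "z \<in> Z" "Y \<inter> Z = {}" "Y \<union> Z = A - {x}" "pt Y RY" "pt Z RZ"
   "R \<sim>\<^sub>b RY @ RZ" using pair_decompose[of A x y z R] p pair by (auto simp: ni_def)
  have fin: "finite Y" "finite Z" using * by (auto simp: pt_def)
  then have cYZ: "card (A - {x}) = card Y + card Z" using * card_Un_disjoint by metis
  have "card Y \<le> Suc (length RY)" "card Z \<le> Suc (length RZ)" using pt_card_le * by auto
  \<comment> \<open>The two genera are nonnegative with sum zero, so both vanish.\<close>
  then have lens: "card Y = Suc (length RY)" "card Z = Suc (length RZ)" using braid_length[OF *(7)] cYZ cx len n by auto
  have niYZ: "ni Y RY" "ni Z RZ" using lens * by (auto simp: ni_def)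
  have t: "t \<sim>\<^sub>b tc x y z # tc z y x # RY @ RZ"
   using braid_append[OF *(7), of "[tc x y z, tc z y x]" "[]"] pair(3) braid_trans by auto
  have x: "x \<notin> Y" "x \<notin> Z" using * by auto
  consider "card Y = 1" | "card Z = 1" | "card Y \<ge> 3" "card Z \<ge> 3"
   using ni_card_ne_2[OF niYZ(1)] ni_card_ne_2[OF niYZ(2)] lens by linarith
  then show ?thesis
  proof cases
   case 1
   then have "RY = []" "Y = {y}" using lens * by (auto simp: card_1_singleton_iff)
   then have "t \<sim>\<^sub>b tc z x y # tc y x z # RZ" using t unfolding rots(3,4) by simp
   moreover have "tc3 Z \<subseteq> tc3 (A - {x, y})" using * x \<open>Y = {y}\<close> by (intro tc3_mono) auto
   then have "set RZ \<subseteq> tc3 (A - {x, y})" using * by (auto simp: pt_def)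
   ultimately show ?thesis using pair by (intro leafI[of z x y A t RZ]) auto
  next
   case 2
   then have "RZ = []" "Z = {z}" using lens * by (auto simp: card_1_singleton_iff)
   then have "t \<sim>\<^sub>b tc y z x # tc x z y # RY" using t unfolding rots(1,2) by simp
   moreover have "tc3 Y \<subseteq> tc3 (A - {z, x})" using * x \<open>Z = {z}\<close> by (intro tc3_mono) auto
   then have "set RY \<subseteq> tc3 (A - {z, x})" using * by (auto simp: pt_def)
   ultimately show ?thesis using pair by (intro leafI[of y z x A t RY]) auto
  next
   case 3
   \<comment> \<open>The pair is assigned to the side of \<open>y\<close>; the enlarged side meets
     the side of \<open>z\<close> in \<open>z\<close> alone.\<close>
   define T where "T = tc y z x # tc x z y # RY"
   have T: "ni (Y \<union> {z, x}) T" unfolding T_def using pair niYZ * x by (intro ni_add_leaf) auto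
   have cT: "card (Y \<union> {z, x}) = card Y + 2" using fin x * pair by (subst card_Un_disjoint) auto
   have lT: "leaf (Y \<union> {z, x}) T" using less.hyps[OF _ T] cT 3 cx cYZ by linarith
   have "leaf A (T @ RZ)"
   proof (rule leaf_append[OF lT T])
    show "set RZ \<subseteq> tc3 Z" using * by (simp add: pt_def)
    show "Y \<union> {z, x} \<union> Z \<subseteq> A" using *(4) pair(2) by auto
    show "Z \<inter> (Y \<union> {z, x}) \<subseteq> {z}" using *(3) x by blast
   qed auto
   moreover have "t \<sim>\<^sub>b T @ RZ" using t unfolding T_def rots(1,2) by simp
   ultimately show ?thesis using leaf_braid by blast
  qed
 next
  case (split x y z w R)
  define A' where "A' = A - {x}"
  have A': "A = insert x A'" "x \<notin> A'" "finite A'" "{y, z, w} \<subseteq> A'" using split n by (auto simp: A'_def)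
  have len: "length t = Suc (Suc (length R))" using braid_length[OF split(3)] by simp
  have cA: "card A = Suc (card A')" using A' by simp
  have p: "pt A (tc x y z # tc y x w # R)" using braid_pt[OF split(3) n(1)] .
  have n': "ni A' (tc y z w # R)" using split_pt(1)[OF p split(1,2,4)] len cA n by (simp add: ni_def A'_def)
  have prod: "tc y x w \<circ> tc x y z = tc y z w" using split_pt(2)[OF p split(1,2,4)] .
  have R: "set R \<subseteq> tc3 A'" using split by (simp add: A'_def)
  show ?thesis
  proof (cases "card A = 5")
   case True
   then have "length R = 2" "card A' = 4" using len n cA by auto
   then obtain g g' where gg: "R = [g, g']" by (auto simp: numeral_2_eq_2 length_Suc_conv)
   have "card (A' - {y, z, w}) = 1" using split A' \<open>card A' = 4\<close> by (subst card_Diff_subset) auto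
   then obtain v where v: "A' - {y, z, w} = {v}" by (auto simp: card_1_singleton_iff)
   then have A'eq: "A' = {y, z, w, v}" and dv: "distinct [x, y, z, w, v]" using A' split by auto
   have at: "acts_trans A' (tc y z w # R)" and pr: "g' \<circ> g \<circ> tc y z w = id"
    using n' gg by (auto simp: ni_def pt_def)
   have "g v \<noteq> v"
   proof
    assume gv: "g v = v"
    have "tc y z w v = v" using dv by (auto simp: tc_apply)
    then have "g' v = v" using fun_cong[OF pr, of v] gv by simp
    then have "{v} = A'" using gv gg \<open>tc y z w v = v\<close> A'eq by (intro acts_transD[OF at]) auto
    then show False using \<open>card A' = 4\<close> by auto
   qed
   then have "(g, g') \<in> {(tc v y w, tc v z y), (tc v z y, tc v w z), (tc v w z, tc v y w)}"
    using ni4_partner[of y z w v g g'] dv R pr gg A'eq by auto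
   then have "leaf {x, y, z, w, v} [tc x y z, tc y x w, g, g']" using leaf5_split[OF dv] by blast
   moreover have "t \<sim>\<^sub>b [tc x y z, tc y x w, g, g']" "A = {x, y, z, w, v}" using split gg A' A'eq by auto
   ultimately show ?thesis using leaf_braid by simp
  next
   case False
   then have cA': "card A' \<ge> 5" "card A' < card A" using less.prems cA by auto
   obtain u p q R' where *: "distinct [u, p, q]" "{u, p, q} \<subseteq> A'"
    "tc y z w # R \<sim>\<^sub>b tc u p q # tc q p u # R'" "set R' \<subseteq> tc3 (A' - {p, q})"
    using less.hyps[OF cA'(2) n' cA'(1)] unfolding leaf_def by blast
   \<comment> \<open>A block is a three-cycle away from \<open>x\<close> or an unmerged pair through
     \<open>x\<close>. Products of such blocks permute \<open>A'\<close> and fix \<open>x\<close>,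
     so conjugation by them preserves the shape.\<close>
   define I where "I B \<longleftrightarrow> (\<exists>g\<in>tc3 A'. B = [g]) \<or>
    (\<exists>y z w. distinct [y, z, w] \<and> {y, z, w} \<subseteq> A' \<and> B = [tc x y z, tc y x w])" for B
   define L where "L = [tc x y z, tc y x w] # map (\<lambda>g. [g]) R"
   have I_bij: "bij g" if "I B" "g \<in> set B" for B g using that A'(2) tc3_bij unfolding I_def by (auto intro!: bij_tc)
   have I_prod: "right_prod B permutes A'" if "I B" for B using that unfolding I_def
   proof (elim disjE bexE exE conjE)
    fix a b c assume "distinct [a, b, c]" "{a, b, c} \<subseteq> A'" "B = [tc x a b, tc a x c]"
    moreover have "tc a x c \<circ> tc x a b = tc a b c" using calculation A'(2) by (auto simp: tc_def fun_eq_iff)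
    ultimately show ?thesis by (simp add: tc_permutes)
   qed (auto simp: tc3_permutes)
   have I_cj: "I (map (cj s) B)" if "s permutes A'" "I B" for s B using that(2) unfolding I_def
   proof (elim disjE bexE exE conjE)
    fix g assume "g \<in> tc3 A'" "B = [g]"
    then show "(\<exists>g\<in>tc3 A'. map (cj s) B = [g]) \<or> (\<exists>y z w. distinct [y, z, w] \<and> {y, z, w} \<subseteq> A' \<and>
     map (cj s) B = [tc x y z, tc y x w])" using cj_tc3[OF that(1)] by auto
   next
    fix a b c assume abc: "distinct [a, b, c]" "{a, b, c} \<subseteq> A'" "B = [tc x a b, tc a x c]"
    have "s x = x" "bij s" "inj s" using that(1) A'(2) permutes_bij permutes_inj by (auto simp: permutes_def)
    then have "map (cj s) B = [tc x (s a) (s b), tc (s a) x (s c)]" "distinct [s a, s b, s c]"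
     "{s a, s b, s c} \<subseteq> A'" using abc that(1) by (auto simp: cj_tc inj_eq permutes_in_image)
    then show "(\<exists>g\<in>tc3 A'. map (cj s) B = [g]) \<or> (\<exists>y z w. distinct [y, z, w] \<and> {y, z, w} \<subseteq> A' \<and>
     map (cj s) B = [tc x y z, tc y x w])" by (intro disjI2 exI[of _ "s a"] exI[of _ "s b"] exI[of _ "s c"] conjI)
   qed
   have I_L: "\<forall>B\<in>set L. I B" using R split A'(4) unfolding L_def I_def by auto
   have "map right_prod L = tc y z w # R" using prod by (simp add: L_def comp_def)
   then have "\<exists>L'. map right_prod L' = tc u p q # tc q p u # R' \<and> (\<forall>B\<in>set L'. I B) \<and>
     concat L \<sim>\<^sub>b concat L' \<and> mset (map length L') = mset (map length L)"
   proof (rule braid_cabling[OF *(3) _ I_L])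
    show "bij g" if "I B" "g \<in> set B" for B g using I_bij that .
    show "I (map (cj (right_prod A)) B) \<and> I (map (cj (inv' (right_prod A))) B)" if "I A" "I B" for A B
     using I_cj[OF I_prod] I_cj[OF permutes_inv[OF I_prod]] that by blast
   qed
   then obtain L' where L': "map right_prod L' = tc u p q # tc q p u # R'" "\<forall>B\<in>set L'. I B"
    "concat L \<sim>\<^sub>b concat L'" "mset (map length L') = mset (map length L)" by (elim exE conjE)
   have "mset (map length L) = add_mset 2 (replicate_mset (length R) 1)"
   proof -
    have "mset (map length (map (\<lambda>g. [g]) R)) = replicate_mset (length R) 1" by (induction R) auto
    then show ?thesis by (simp add: L_def)
   qed
   then have ms: "mset (map length L') = add_mset 2 (replicate_mset (length R) 1)" using L'(4) by simp
   have "leaf (insert x A') (concat L')"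
    by (rule ni_leaf_split[OF braid_ni[OF *(3) n'] A'(2) *(1,2,4) L'(1) L'(2)[unfolded I_def] ms cA'(1)])
     (use less.hyps cA'(2) in auto)
   moreover have "concat L = tc x y z # tc y x w # R" by (simp add: L_def)
   ultimately show ?thesis using leaf_braid[OF split(3)] leaf_braid[OF L'(3)] A'(1) by simp
  qed
 qed
qed

section \<open>Uniqueness of genus-zero tuples up to braids and conjugation\<close>

lemma ex_permutes_map:
 assumes "distinct xs" "distinct ys" "length xs = length ys" "set xs \<subseteq> A" "set ys \<subseteq> A"
 obtains s where "s permutes A" "map s xs = ys"
 using assms
proof (induction xs arbitrary: ys thesis)
 case Nil
 then show ?case using permutes_id by fastforce
next
 case (Cons x xs)
 obtain y ys' where ys: "ys = y # ys'" using Cons.prems(4) by (cases ys) auto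
 obtain s where s: "s permutes A" "map s xs = ys'" using Cons.IH[of ys'] Cons.prems ys by auto
 define s' where "s' = Transposition.transpose (s x) y \<circ> s"
 have "s' permutes A" unfolding s'_def using s Cons.prems ys
  by (intro permutes_compose permutes_swap_id) (auto simp: permutes_in_image)
 moreover have "s' v = s v" if "v \<in> set xs" for v
 proof -
  have "s v \<noteq> s x" "s v \<noteq> y" using that Cons.prems s ys permutes_inj[OF s(1)] by (auto simp: inj_eq)
  then show ?thesis by (simp add: s'_def)
 qed
 then have "map s' (x # xs) = ys" using s ys by (auto simp: s'_def)
 ultimately show ?case using Cons.prems(1) by blast
qed

lemma ni_cj_iff:
 assumes "s permutes A" "ni A t" shows "ni A (map (cj s) t)"
proof -
 have b: "bij s" using assms permutes_bij by blast
 have A: "finite A" "A \<noteq> {}" "set t \<subseteq> tc3 A" "right_prod t = id" "acts_trans A t" "Suc (length t) = card A"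
  using assms by (auto simp: ni_def pt_def)
 have "acts_trans A (map (cj s) t)"
 proof (rule acts_transI)
  fix B assume B: "B \<subseteq> A" "B \<noteq> {}" "\<And>g x. g \<in> set (map (cj s) t) ==> x \<in> B ==> g x \<in> B"
  have "{x. s x \<in> B} = A"
  proof (rule acts_transD[OF A(5)])
   show "{x. s x \<in> B} \<subseteq> A" using B assms by (auto simp: permutes_in_image)
   show "{x. s x \<in> B} \<noteq> {}" using B b by (metis (mono_tags) bij_pointE empty_iff equals0I mem_Collect_eq)
   show "g x \<in> {x. s x \<in> B}" if "g \<in> set t" "x \<in> {x. s x \<in> B}" for g x
    using B(3)[of "cj s g" "s x"] that b by (auto simp: cj_apply)
  qed
  then have "s ` A \<subseteq> B" by auto
  then show "A \<subseteq> B" using permutes_image[OF assms(1)] by simp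
 qed
 then show ?thesis using A assms b cj_tc3 by (auto simp: ni_def pt_def right_prod_cj cj_of_id)
qed

lemma braid_pair_swap:
 assumes "distinct [u, p, q]"
 shows "tc u p q # tc q p u # R \<sim>\<^sub>b tc q p u # tc u p q # R"
proof -
 have "[tc u p q] @ [tc q p u] \<sim>\<^sub>b [tc q p u] @ [tc u p q]"
  using assms tc_comp_inverse[OF assms] bij_tc[of u p q] bij_tc[of q p u] by (intro braid_rotate) auto
 from braid_append[OF this, of "[]" R] show ?thesis by simp
qed

text \<open>A conjugation makes the leaves of both tuples equal, and induction matches the rests by
  some \<open>k\<close>. But \<open>k\<close> may displace the letter \<open>u\<close> that carries
  the leaf; this is repaired by conjugating the leaf alone by an element of the group generated by
  the rest. On four letters the normal form decides.\<close>

lemma ni_transitive_abs: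
 "ni A t ==> ni A t' ==> card A \<ge> 3 ==> \<exists>s. s permutes A \<and> t \<sim>\<^sub>b map (cj s) t'"
proof (induction "card A" arbitrary: A t t' rule: less_induct)
 case less
 have fin: "finite A" using less.prems by (auto simp: ni_def pt_def)
 show ?case
 proof (cases "card A = 4")
  case True
  obtain x y z w where 1: "distinct [x, y, z, w]" "A = {x, y, z, w}" "t \<sim>\<^sub>b [tc x y z, tc y x w, tc w z y]"
   using ni4_form[OF less.prems(1) True] .
  obtain x' y' z' w' where 2: "distinct [x', y', z', w']" "A = {x', y', z', w'}"
   "t' \<sim>\<^sub>b [tc x' y' z', tc y' x' w', tc w' z' y']" using ni4_form[OF less.prems(2) True] .
  obtain s where s: "s permutes A" "map s [x', y', z', w'] = [x, y, z, w]"
   by (rule ex_permutes_map[OF 2(1) 1(1), of A]) (use 1(2) 2(2) in auto)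
  have "map (cj s) t' \<sim>\<^sub>b map (cj s) [tc x' y' z', tc y' x' w', tc w' z' y']"
   using braid_cj[OF 2(3)] permutes_bij[OF s(1)] by blast
  also have "\<dots> = [tc x y z, tc y x w, tc w z y]" using s permutes_bij[OF s(1)] by (simp add: cj_tc)
  finally show ?thesis using s(1) 1(3) by (meson braid_sym braid_trans)
 next
  case False
  then have "card A = 3 \<or> card A \<ge> 5" using less.prems(3) by linarith
  then have lf: "leaf A t" "leaf A t'" using leaf3 ni_leaf less.prems by blast+
  obtain u p q R where 1: "distinct [u, p, q]" "{u, p, q} \<subseteq> A" "t \<sim>\<^sub>b tc u p q # tc q p u # R"
   "set R \<subseteq> tc3 (A - {p, q})" using lf(1) unfolding leaf_def by blast
  obtain u' p' q' R' where 2: "distinct [u', p', q']" "{u', p', q'} \<subseteq> A" "t' \<sim>\<^sub>b tc u' p' q' # tc q' p' u' # R'"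
   "set R' \<subseteq> tc3 (A - {p', q'})" using lf(2) unfolding leaf_def by blast
  obtain s where s: "s permutes A" "map s [u', p', q'] = [u, p, q]"
   by (rule ex_permutes_map[OF 2(1) 1(1), of A]) (use 1(2) 2(2) in auto)
  have b: "bij s" using permutes_bij[OF s(1)] .
  define R2 where "R2 = map (cj s) R'"
  have t2: "map (cj s) t' \<sim>\<^sub>b tc u p q # tc q p u # R2" using braid_cj[OF 2(3) b] s b by (simp add: cj_tc R2_def)
  have "s ` (A - {p', q'}) = A - {p, q}" using s permutes_image[OF s(1)] bij_is_inj[OF b] by (simp add: image_set_diff)
  then have R2: "set R2 \<subseteq> tc3 (A - {p, q})" using 2(4) cj_tc3_image[OF b] by (force simp: R2_def)
  define W where "W = A - {p, q}"
  have nR: "ni W R" "ni W R2" unfolding W_def using ni_remove_leaf[OF braid_ni[OF 1(3) less.prems(1)] 1(1,2,4)]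
    ni_remove_leaf[OF braid_ni[OF t2 ni_cj_iff[OF s(1) less.prems(2)]] 1(1,2) R2] by auto
  have cW: "card W = card A - 2" using 1 fin by (simp add: W_def card_Diff_subset)
  have "\<exists>k. k permutes W \<and> R \<sim>\<^sub>b map (cj k) R2"
  proof (cases "card A = 3")
   case True
   then have "length R = 0" "length R2 = 0" using nR cW by (auto simp: ni_def)
   then show ?thesis using permutes_id by fastforce
  next
   case False
   then have "card W \<ge> 3" "card W < card A" using cW \<open>card A = 3 \<or> card A \<ge> 5\<close> by auto
   then show ?thesis using less.hyps nR by blast
  qed
  then obtain k where k: "k permutes W" "R \<sim>\<^sub>b map (cj k) R2" by blast
  have uW: "u \<in> W" using 1 by (auto simp: W_def)
  have kb: "bij k" and kA: "k permutes A" and ku: "k u \<in> W"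
   using k uW permutes_bij permutes_subset[OF k(1), of A] permutes_in_image[OF k(1)] by (auto simp: W_def)
  have kpq: "k p = p" "k q = q" using k(1) by (auto simp: permutes_def W_def)
  have nk: "ni W (map (cj k) R2)" using ni_cj_iff[OF k(1) nR(2)] .
  have "map (cj k) (map (cj s) t') \<sim>\<^sub>b [tc (k u) p q, tc q p (k u)] @ map (cj k) R2"
   using braid_cj[OF t2 kb] kb kpq by (simp add: cj_tc)
  also have "\<dots> \<sim>\<^sub>b [tc u p q, tc q p u] @ map (cj k) R2"
  proof -
   obtain h where h: "h \<in> grp (map (cj k) R2)" "h u = k u" by (rule acts_trans_grp[of W "map (cj k) R2" u "k u"])
     (use nk uW ku ni_permutes[OF nk] in \<open>auto simp: ni_def pt_def\<close>)
   have "h permutes W" "bij h" using grp_permutes[OF h(1)] ni_permutes[OF nk] permutes_bij by auto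
   then have "h p = p" "h q = q" by (auto simp: permutes_def W_def)
   then have "map (cj h) [tc u p q, tc q p u] = [tc (k u) p q, tc q p (k u)]"
    using h \<open>bij h\<close> by (simp add: cj_tc)
   moreover have "map (cj h) [tc u p q, tc q p u] @ map (cj k) R2 \<sim>\<^sub>b [tc u p q, tc q p u] @ map (cj k) R2"
    using h(1) ni_bij[OF nk] 1(1) bij_tc[of u p q] bij_tc[of q p u] tc_comp_inverse[OF 1(1)] by (intro braid_cj_part) auto
   ultimately show ?thesis by simp
  qed
  also have "\<dots> \<sim>\<^sub>b [tc u p q, tc q p u] @ R"
   using braid_append[OF braid_sym[OF k(2)], of "[tc u p q, tc q p u]" "[]"] by simp
  also have "\<dots> \<sim>\<^sub>b t" using 1(3) by (simp add: braid_sym)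
  finally have "t \<sim>\<^sub>b map (cj (k \<circ> s)) t'" using kb b by (simp add: cj_cj braid_sym comp_def)
  moreover have "k \<circ> s permutes A" using permutes_compose[OF s(1) kA] .
  ultimately show ?thesis by blast
 qed
qed

text \<open>The two free letters of a leaf can be exchanged by a braid, so odd conjugations come for free.\<close>

lemma ni_transitive:
 assumes "ni A t" "ni A t'" "card A \<ge> 5"
 obtains s where "s permutes A" "evenperm s" "t \<sim>\<^sub>b map (cj s) t'"
proof -
 obtain u p q R where 1: "distinct [u, p, q]" "{u, p, q} \<subseteq> A" "t' \<sim>\<^sub>b tc u p q # tc q p u # R"
   "set R \<subseteq> tc3 (A - {p, q})" using ni_leaf[OF assms(2,3)] unfolding leaf_def by blast
 define \<tau> where "\<tau> = Transposition.transpose p q"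
 have \<tau>: "\<tau> permutes A" "bij \<tau>" "\<tau> u = u" "\<tau> p = q" "\<tau> q = p"
  using 1 by (auto simp: \<tau>_def permutes_swap_id)
 have "cj \<tau> g = g" if "g \<in> set R" for g
 proof -
  have "g \<in> tc3 (A - {p, q})" using that 1 by blast
  then obtain a b c where "g = tc a b c" "{a, b, c} \<subseteq> A - {p, q}" by (auto simp: tc3_def)
  then show ?thesis using \<tau>(2) by (auto simp: cj_tc \<tau>_def Transposition.transpose_def)
 qed
 then have R: "map (cj \<tau>) R = R" by (intro map_idI)
 have "map (cj \<tau>) t' \<sim>\<^sub>b tc u q p # tc p q u # R"
  using braid_cj[OF 1(3) \<tau>(2)] R \<tau> by (simp add: cj_tc)
 \<comment> \<open>Exchanging \<open>p\<close> and \<open>q\<close> inverts both entries of the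
   pair, that is, it merely reverses their order.\<close>
 also have "\<dots> = tc q p u # tc u p q # R" using 1 by (auto simp: tc_def fun_eq_iff)
 also have "\<dots> \<sim>\<^sub>b tc u p q # tc q p u # R" using braid_pair_swap[OF 1(1)] braid_sym by blast
 also have "\<dots> \<sim>\<^sub>b t'" using 1(3) braid_sym by blast
 finally have \<tau>t: "map (cj \<tau>) t' \<sim>\<^sub>b t'" .
 obtain s where s: "s permutes A" "t \<sim>\<^sub>b map (cj s) t'" using ni_transitive_abs[OF assms(1,2)] assms(3) by auto
 show ?thesis
 proof (cases "evenperm s")
  case False
  have bs: "bij s" using s permutes_bij by blast
  have "permutation s" "permutation \<tau>"
   using s \<tau> assms unfolding permutation_permutes by (auto simp: ni_def pt_def)
  then have "evenperm (s \<circ> \<tau>)" using False 1(1) by (simp add: evenperm_comp \<tau>_def evenperm_swap)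
  moreover have "map (cj s) (map (cj \<tau>) t') \<sim>\<^sub>b map (cj s) t'" using braid_cj[OF \<tau>t bs] .
  moreover have "map (cj s) (map (cj \<tau>) t') = map (cj (s \<circ> \<tau>)) t'" using bs \<tau> by (simp add: cj_cj)
  ultimately have "evenperm (s \<circ> \<tau>)" "t \<sim>\<^sub>b map (cj (s \<circ> \<tau>)) t'"
   using braid_trans[OF s(2) braid_sym] by metis+
  moreover have "s \<circ> \<tau> permutes A" using permutes_compose[OF \<tau>(1) s(1)] .
  ultimately show ?thesis using that by blast
 qed (use that s in blast)
qed

section \<open>Nielsen classes as sets of transitive product-one tuples\<close>

lemma cycle_of_list_tc: "distinct [a, b, c] ==> cycle_of_list [a, b, c] = tc a b c"
 by (auto simp: tc_def fun_eq_iff Transposition.transpose_def)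

lemma three_cycles_eq_tc3: "three_cycles n = tc3 {1..n}"
proof -
 have 3: "\<exists>a b c. cs = [a, b, c]" if "length cs = 3" for cs :: "nat list"
  using that by (auto simp: numeral_3_eq_3 length_Suc_conv)
 show ?thesis
 proof (rule subset_antisym; rule subsetI)
  fix g assume "g \<in> three_cycles n"
  then obtain cs where "g = cycle_of_list cs" "distinct cs" "length cs = 3" "set cs \<subseteq> {1..n}" by blast
  moreover from this 3 obtain a b c where "cs = [a, b, c]" by blast
  ultimately show "g \<in> tc3 {1..n}" using cycle_of_list_tc[of a b c] tc3I[of a b c "{1..n}"] by simp
 next
  fix g assume "g \<in> tc3 {1..n}"
  then obtain a b c where *: "g = tc a b c" "distinct [a, b, c]" "{a, b, c} \<subseteq> {1..n}" unfolding tc3_def by blast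
  have "g = cycle_of_list [a, b, c]" "length [a, b, c] = 3" "set [a, b, c] \<subseteq> {1..n}"
   using * cycle_of_list_tc[OF *(2)] by auto
  with *(2) show "g \<in> three_cycles n" by blast
 qed
qed

text \<open>A three-cycle has order three, so its inverse is its square, which lies in the monoid
  \<open>grp t\<close>.\<close>

lemma grp_tc_inverse:
 assumes "tc a b c \<in> grp t" "distinct [a, b, c]" shows "tc c b a \<in> grp t"
proof -
 have "tc c b a = tc a b c \<circ> tc a b c" using assms(2) by (auto simp: tc_def fun_eq_iff)
 then show ?thesis using grp_mult[OF assms(1,1)] by simp
qed

lemma grp_tc_conj:
 assumes "tc a b c \<in> grp t" "distinct [a, b, c]" "m \<in> grp t" shows "cj (tc a b c) m \<in> grp t"
 unfolding cj_def inv_tc[OF assms(2)] using assms grp_tc_inverse by (intro grp_mult) auto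

text \<open>Enlarge a set of letters all of whose three-cycles are generated.\<close>

lemma grp_three_cycles:
 assumes "finite A" "acts_trans A t" "set t \<subseteq> tc3 A" "t \<noteq> []"
 shows "tc3 A \<subseteq> grp t"
proof -
 define P where "P B \<longleftrightarrow> B \<subseteq> A \<and> card B \<ge> 3 \<and> tc3 B \<subseteq> grp t" for B
 obtain g where g: "g \<in> set t" using assms(4) by (cases t) auto
 obtain p q s where pqs: "g = tc p q s" "distinct [p, q, s]" "{p, q, s} \<subseteq> A"
  using assms(3) g by (auto simp: tc3_def)
 have 1: "tc p q s \<in> grp t" "tc s q p \<in> grp t" using grp_tc_inverse[of p q s t] grp_member[OF g] pqs by auto
 have "tc3 {p, q, s} \<subseteq> {tc p q s, tc s q p}"
 proof
  fix m assume m: "m \<in> tc3 {p, q, s}"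
  have "m p \<noteq> p"
  proof
   assume "m p = p"
   then have "m \<in> tc3 ({p, q, s} - {p})" using m tc3_fixed by blast
   then obtain a b c where "distinct [a, b, c]" "{a, b, c} \<subseteq> {q, s}" by (auto simp: tc3_def)
   then show False by auto
  qed
  then obtain y z where yz: "m = tc p y z" "distinct [p, y, z]" "{p, y, z} \<subseteq> {p, q, s}"
   using tc3_moved[OF m] by metis
  then have "(y = q \<and> z = s) \<or> (y = s \<and> z = q)" by auto
  moreover have "tc p s q = tc s q p" using pqs(2) by (auto simp: tc_def fun_eq_iff)
  ultimately show "m \<in> {tc p q s, tc s q p}" using yz by auto
 qed
 then have "P {p, q, s}" using 1 pqs by (auto simp: P_def)
 \<comment> \<open>A largest set of letters whose three-cycles are all generated. An entry leading
   out of it will enlarge it.\<close>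
 define B where "B = (ARG_MAX card B. P B)"
 have B: "P B" "\<And>B'. P B' ==> card B' \<le> card B"
 proof -
  have *: "\<forall>B. P B \<longrightarrow> card B < Suc (card A)"
   using assms(1) by (auto simp: P_def card_mono less_Suc_eq_le)
  show "P B" unfolding B_def by (rule arg_max_natI[of P _ card, OF \<open>P {p, q, s}\<close> *])
  show "card B' \<le> card B" if "P B'" for B' unfolding B_def by (rule arg_max_nat_le[of P _ card, OF that *])
 qed
 have finB: "finite B" using B(1) assms(1) by (auto simp: P_def intro: finite_subset)
 have tcB: "tc a b c \<in> grp t" if "distinct [a, b, c]" "{a, b, c} \<subseteq> B" for a b c
  using tc3I[OF that] B(1) by (auto simp: P_def)
 have "B = A"
 proof (rule ccontr)
  assume "B \<noteq> A"
  have "B \<subseteq> A" "B \<noteq> {}" using B(1) by (auto simp: P_def)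
  then obtain g x where gx: "g \<in> set t" "x \<in> B" "g x \<notin> B"
   using acts_transD[OF assms(2)] \<open>B \<noteq> A\<close> by blast
  then have "g x \<noteq> x" by auto
  then obtain y z where g: "g = tc x y z" "distinct [x, y, z]" "{x, y, z} \<subseteq> A"
   using tc3_moved[of g A x] assms(3) gx by auto
  have yB: "y \<notin> B" using gx g by (auto simp: tc_apply)
  have gg: "tc x y z \<in> grp t" using grp_member[OF gx(1)] g by simp
  have "card (B - {x}) \<ge> 2" using B(1) gx finB by (auto simp: P_def)
  then have "\<not> card (B - {x}) \<le> Suc 0" by simp
  then obtain a0 c0 where ac0: "a0 \<in> B - {x}" "c0 \<in> B - {x}" "a0 \<noteq> c0"
   using card_le_Suc0_iff_eq[of "B - {x}"] finB by auto
  \<comment> \<open>The generated three-cycles through the new letter \<open>y\<close>. A single one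
    is enough, since conjugation by three-cycles on \<open>B\<close> reaches every ordered
    pair.\<close>
  define Q where "Q a c \<longleftrightarrow> tc y a c \<in> grp t" for a c
  obtain a c where ac: "a \<in> B" "c \<in> B" "a \<noteq> c" "Q a c"
  proof (cases "z \<in> B")
   case True
   have "tc y z x = tc x y z" using g(2) tc_rot[of x y z] by simp
   then show ?thesis using that[of z x] True gx gg g(2) by (auto simp: Q_def)
  next
   \<comment> \<open>Here \<open>g\<close> fixes \<open>a0\<close> and \<open>c0\<close> and takes
     \<open>x\<close> to \<open>y\<close>, so it conjugates a three-cycle of \<open>B\<close>
     through \<open>x\<close> into one through \<open>y\<close>.\<close>
   case False
   have "tc x a0 c0 \<in> grp t" using ac0 gx by (intro tcB) auto
   then have "cj (tc x y z) (tc x a0 c0) \<in> grp t" using grp_tc_conj[OF gg g(2)] by blast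
   moreover have "tc x y z a0 = a0" "tc x y z c0 = c0" "tc x y z x = y" using ac0 False yB by (auto simp: tc_apply)
   ultimately have "tc y a0 c0 \<in> grp t" using bij_tc[OF g(2)] by (simp add: cj_tc)
   then show ?thesis using that[of a0 c0] ac0 by (auto simp: Q_def)
  qed
  have Q_sym: "Q c a" if "Q a c" "a \<in> B" "c \<in> B" "a \<noteq> c" for a c
  proof -
   have d: "distinct [y, a, c]" using that yB by auto
   have "tc y c a = tc c a y" using d by (auto simp: tc_def fun_eq_iff)
   then show ?thesis using grp_tc_inverse[of y a c t] that d by (simp add: Q_def)
  qed
  have Q_step: "Q c e" if "Q a c" "a \<in> B" "c \<in> B" "e \<in> B" "distinct [a, c, e]" for a c e
  proof -
   have "tc a c e \<in> grp t" using that by (intro tcB) auto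
   then have "cj (tc a c e) (tc y a c) \<in> grp t" using that grp_tc_conj[of a c e] by (auto simp: Q_def)
   moreover have "tc a c e y = y" "tc a c e a = c" "tc a c e c = e" using that yB by (auto simp: tc_apply)
   ultimately show ?thesis using bij_tc[OF that(5)] by (simp add: Q_def cj_tc)
  qed
  have Q_all: "Q a' c'" if "a' \<in> B" "c' \<in> B" "a' \<noteq> c'" for a' c'
  proof -
   consider "a' = a" "c' = c" | "a' = a" "c' \<noteq> c" | "a' = c" "c' = a" | "a' = c" "c' \<noteq> a"
    | "a' \<noteq> a" "a' \<noteq> c" "c' = c" | "a' \<noteq> a" "a' \<noteq> c" "c' \<noteq> c" by blast
   then show ?thesis
   proof cases
    case 2
    then show ?thesis using Q_step[of c a c'] Q_sym[of a c] ac that by auto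
   next
    case 3
    then show ?thesis using Q_sym[of a c] ac by auto
   next
    case 4
    then show ?thesis using Q_step[of a c c'] ac that by auto
   next
    case 5
    then show ?thesis using Q_step[of a c a'] Q_sym[of c a'] ac that by auto
   next
    case 6
    then show ?thesis using Q_step[of a c a'] Q_step[of c a' c'] ac that by auto
   qed (use ac in auto)
  qed
  have "tc3 (insert y B) \<subseteq> grp t"
  proof
   fix m assume m: "m \<in> tc3 (insert y B)"
   show "m \<in> grp t"
   proof (cases "m y = y")
    case True
    then have "m \<in> tc3 (insert y B - {y})" using m tc3_fixed by blast
    then show ?thesis using B(1) yB by (auto simp: P_def)
   next
    case False
    then obtain a' c' where "m = tc y a' c'" "distinct [y, a', c']" "{y, a', c'} \<subseteq> insert y B"
     using tc3_moved[OF m] by metis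
    then show ?thesis using Q_all[of a' c'] by (auto simp: Q_def)
   qed
  qed
  then have "P (insert y B)" using B(1) g(3) finB yB by (auto simp: P_def)
  from B(2)[OF this] show False using finB yB by simp
 qed
 then show ?thesis using B(1) by (simp add: P_def)
qed

lemma grp_subset_generate: "grp t \<subseteq> generate (alt_group n) (set t)"
proof
 fix h assume "h \<in> grp t"
 then show "h \<in> generate (alt_group n) (set t)"
 proof induction
  case grp_id
  then show ?case using generate.one[of "alt_group n" "set t"] unfolding alt_group_one .
 next
  case (grp_step h g)
  have "g \<otimes>\<^bsub>alt_group n\<^esub> h \<in> generate (alt_group n) (set t)"
   by (rule generate.eng[OF generate.incl[OF grp_step.hyps(2)] grp_step.IH])
  then show ?case unfolding alt_group_mult .
 qed
qed

text \<open>A transitive group generated by three-cycles contains all three-cycles and hence is the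
  alternating group; conversely three-cycles carry any letter to any other. Generation thus becomes
  transitivity, which the braid arguments can handle.\<close>

lemma nielsen_class_iff:
 assumes "n \<ge> 3"
 shows "t \<in> nielsen_class n r \<longleftrightarrow> length t = r \<and> pt {1..n} t"
proof (cases "length t = r \<and> set t \<subseteq> tc3 {1..n} \<and> right_prod t = id")
 case True
 interpret A: group "alt_group n" by (rule alt_group_is_group)
 have sub: "set t \<subseteq> carrier (alt_group n)" using True three_cycles_incl[of n] three_cycles_eq_tc3[of n] by auto
 have "generate (alt_group n) (set t) = carrier (alt_group n) \<longleftrightarrow> acts_trans {1..n} t"
 proof
  assume gen: "generate (alt_group n) (set t) = carrier (alt_group n)"
  show "acts_trans {1..n} t"
  proof (rule acts_transI)
   fix B assume B: "B \<subseteq> {1..n}" "B \<noteq> {}" "\<And>g x. g \<in> set t ==> x \<in> B ==> g x \<in> B"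
   have finB: "finite B" using B finite_subset by blast
   have inv: "h ` B \<subseteq> B" if "h \<in> generate (alt_group n) (set t)" for h using that
   proof induction
    case one
    then show ?case by (simp add: alt_group_one)
   next
    case (incl h)
    then show ?case using B(3) by auto
   next
    case (inv h)
    have "h \<in> carrier (alt_group n)" "h ` B \<subseteq> B" "bij h" using inv sub B(3) True tc3_bij by auto
    then show ?case using finite_bij_image_eq(2)[OF finB, of h] by (simp add: alt_group_inv_equality)
   next
    case (eng h1 h2)
    then show ?case by (auto simp: alt_group_mult)
   qed
   obtain u where u: "u \<in> B" using B by blast
   show "{1..n} \<subseteq> B"
   proof
    fix v assume v: "v \<in> {1..n}"
    show "v \<in> B"
    proof (cases "v = u")
     case False
     have "\<not> {1..n} \<subseteq> {u, v}"
      using card_mono[of "{u, v}" "{1..n}"] assms card_2_iff[of "{u, v}"] False by auto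
     then obtain w where "w \<in> {1..n}" "w \<noteq> u" "w \<noteq> v" by blast
     then have "tc u v w \<in> tc3 {1..n}" using u v B False by (intro tc3I) auto
     then have "tc u v w \<in> generate (alt_group n) (set t)"
      using gen three_cycles_incl[of n] three_cycles_eq_tc3[of n] by auto
     from inv[OF this] show ?thesis using u by (auto simp: tc_apply image_subset_iff)
    qed (use u in simp)
   qed
  qed
 next
  assume at: "acts_trans {1..n} t"
  have "t \<noteq> []"
  proof
   assume "t = []"
   then have "{1} = {1..n}" using assms by (intro acts_transD[OF at]) auto
   moreover have "2 \<in> {1..n}" using assms by simp
   ultimately have "2 \<in> {1::nat}" by metis
   then show False by simp
  qed
  then have "three_cycles n \<subseteq> generate (alt_group n) (set t)"
   using grp_three_cycles[OF _ at] True grp_subset_generate unfolding three_cycles_eq_tc3 by blast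
  then have "generate (alt_group n) (three_cycles n) \<subseteq> generate (alt_group n) (set t)"
   by (rule A.generate_subgroup_incl[OF _ A.generate_is_subgroup[OF sub]])
  moreover have "generate (alt_group n) (set t) \<subseteq> carrier (alt_group n)" using A.generate_incl[OF sub] .
  ultimately show "generate (alt_group n) (set t) = carrier (alt_group n)"
   using alt_group_carrier_as_three_cycles[of n] by blast
 qed
 then show ?thesis using True assms unfolding nielsen_class_def three_cycles_eq_tc3 pt_def by auto
next
 case False
 then show ?thesis unfolding nielsen_class_def three_cycles_eq_tc3 pt_def by blast
qed

lemma nielsen_class_ni:
 assumes "n \<ge> 3" shows "t \<in> nielsen_class n (n - 1) \<longleftrightarrow> ni {1..n} t"
 using nielsen_class_iff[OF assms] assms by (auto simp: ni_def)

lemma nielsen_class_braid: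
 assumes "n \<ge> 3" "t \<in> nielsen_class n r" "t \<sim>\<^sub>b t'" shows "t' \<in> nielsen_class n r"
 using assms nielsen_class_iff braid_pt braid_length by metis

lemma nielsen_transitive:
 assumes "n \<ge> 5" "t \<in> nielsen_class n (n - 1)" "t' \<in> nielsen_class n (n - 1)"
 obtains s where "s \<in> carrier (alt_group n)" "t \<sim>\<^sub>b map (cj s) t'"
proof -
 have "ni {1..n} t" "ni {1..n} t'" "card {1..n} \<ge> 5" using assms nielsen_class_ni[of n] by auto
 then obtain s where "s permutes {1..n}" "evenperm s" "t \<sim>\<^sub>b map (cj s) t'" by (rule ni_transitive)
 then show ?thesis using that by (simp add: alt_group_carrier)
qed

text \<open>Leaves are added to a single letter or to the normal form on four letters. Two letters
  admit no tuple, so the four-letter case cannot arise by adding a leaf.\<close>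

lemma ex_ni: "finite A ==> card A = 1 \<or> card A \<ge> 3 ==> \<exists>t. ni A t"
proof (induction "card A" arbitrary: A rule: less_induct)
 case less
 consider "card A = 1" | "card A = 4" | "card A \<noteq> 4" "card A \<ge> 3" using less.prems by linarith
 then show ?case
 proof cases
  case 1
  then obtain u where "A = {u}" by (auto simp: card_1_singleton_iff)
  then have "ni A []" by (auto simp: ni_def pt_def acts_trans_def)
  then show ?thesis ..
 next
  case 2
  obtain xs where xs: "set xs = A" "distinct xs" using finite_distinct_list[OF less.prems(1)] by blast
  then have "length xs = 4" using 2 distinct_card by fastforce
  then obtain x y z w where "xs = [x, y, z, w]" by (auto simp: numeral_eq_Suc length_Suc_conv)
  then show ?thesis using ni4[of x y z w] xs by auto
 next
  case 3
  obtain xs where xs: "set xs = A" "distinct xs" using finite_distinct_list[OF less.prems(1)] by blast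
  then have "length xs = card A" using distinct_card by fastforce
  then obtain u p q ys where xs': "xs = u # p # q # ys" using 3 by (metis Suc_le_length_iff numeral_3_eq_3)
  have c: "card (A - {p, q}) = card A - 2" using xs xs' by (subst card_Diff_subset) auto
  then have "\<exists>t. ni (A - {p, q}) t" using 3 less.prems by (intro less.hyps) auto
  then obtain R where "ni (A - {p, q}) R" ..
  from ni_add_leaf[OF this, of u p q] have "ni (A - {p, q} \<union> {p, q}) (tc u p q # tc q p u # R)" using xs xs' by auto
  moreover have "A - {p, q} \<union> {p, q} = A" using xs xs' by auto
  ultimately show ?thesis by metis
 qed
qed

lemma nielsen_class_nonempty: "n \<ge> 3 ==> \<exists>t. t \<in> nielsen_class n (n - 1)"
 using ex_ni[of "{1..n}"] nielsen_class_ni by auto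

lemma nielsen_class_cj:
 assumes "n \<ge> 3" "s permutes {1..n}" "t \<in> nielsen_class n r" shows "map (cj s) t \<in> nielsen_class n r"
proof -
 have p: "pt {1..n} t" "length t = r" using nielsen_class_iff assms by auto
 have b: "bij s" using assms permutes_bij by blast
 have "acts_trans {1..n} (map (cj s) t)"
 proof (rule acts_transI)
  fix B assume B: "B \<subseteq> {1..n}" "B \<noteq> {}" "\<And>g x. g \<in> set (map (cj s) t) ==> x \<in> B ==> g x \<in> B"
  have "{x. s x \<in> B} = {1..n}"
  proof (rule acts_transD[of _ t])
   show "acts_trans {1..n} t" using p by (simp add: pt_def)
   show "{x. s x \<in> B} \<subseteq> {1..n}" using B permutes_in_image[OF assms(2)] by blast
   show "{x. s x \<in> B} \<noteq> {}" using B b by (metis (mono_tags) bij_pointE empty_iff equals0I mem_Collect_eq)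
   show "g x \<in> {x. s x \<in> B}" if "g \<in> set t" "x \<in> {x. s x \<in> B}" for g x
    using B(3)[of "cj s g" "s x"] that b by (auto simp: cj_apply)
  qed
  then have "s ` {1..n} \<subseteq> B" by auto
  then show "{1..n} \<subseteq> B" using permutes_image[OF assms(2)] by simp
 qed
 then have "pt {1..n} (map (cj s) t)" using p b cj_tc3[OF assms(2)] by (auto simp: pt_def right_prod_cj cj_of_id)
 then show ?thesis using nielsen_class_iff assms p by simp
qed

section \<open>Points of the sphere as homogeneous pairs, with one chart at each pole\<close>

section \<open>Homogeneous coordinates on the sphere\<close>

text \<open>The point \<open>[p : q]\<close> of the projective line on the sphere:
  \<open>stereo z\<close> is \<open>[z : 1]\<close> and \<open>infty\<close> is
  \<open>[1 : 0]\<close>. Formulas in \<open>p\<close> and \<open>q\<close> remain continuous where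
  an affine coordinate would blow up.\<close>

definition hpt :: "complex => complex => point" where
 "hpt p q = ((2 / ((cmod p)\<^sup>2 + (cmod q)\<^sup>2)) *\<^sub>R (p * cnj q),
       ((cmod p)\<^sup>2 - (cmod q)\<^sup>2) / ((cmod p)\<^sup>2 + (cmod q)\<^sup>2))"

lemma stereo_hpt: "stereo z = hpt z 1"
 by (simp add: stereo_def hpt_def add.commute)

lemma hpt_scale: "c \<noteq> 0 ==> hpt (c * p) (c * q) = hpt p q"
proof -
 assume "c \<noteq> 0"
 then have c: "(cmod c)\<^sup>2 \<noteq> 0" by simp
 have "c * p * cnj (c * q) = of_real ((cmod c)\<^sup>2) * (p * cnj q)"
  using complex_norm_square[of c] by (simp add: ac_simps)
 then have 1: "c * p * cnj (c * q) = (cmod c)\<^sup>2 *\<^sub>R (p * cnj q)" by (simp only: scaleR_conv_of_real)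
 have 2: "(cmod (c * p))\<^sup>2 + (cmod (c * q))\<^sup>2 = (cmod c)\<^sup>2 * ((cmod p)\<^sup>2 + (cmod q)\<^sup>2)"
  "(cmod (c * p))\<^sup>2 - (cmod (c * q))\<^sup>2 = (cmod c)\<^sup>2 * ((cmod p)\<^sup>2 - (cmod q)\<^sup>2)"
  by (simp_all add: norm_mult power_mult_distrib algebra_simps)
 show ?thesis unfolding hpt_def 1 2 using c by simp
qed

lemma hpt_infty: "p \<noteq> 0 ==> hpt p 0 = infty"
 by (simp add: hpt_def infty_def)

lemma hpt_stereo: "q \<noteq> 0 ==> hpt p q = stereo (p / q)"
 using hpt_scale[of q "p / q" 1] by (simp add: stereo_hpt)

lemma sum_sq_pos: "p \<noteq> 0 \<or> q \<noteq> 0 ==> (cmod p)\<^sup>2 + (cmod q)\<^sup>2 > 0"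
 by (cases "p = 0") (auto simp: add_pos_nonneg)

lemma mem_P1: "y \<in> P1 \<longleftrightarrow> (cmod (fst y))\<^sup>2 + (snd y)\<^sup>2 = 1"
 by (cases y) (simp add: P1_def norm_Pair)

lemma hpt_in_P1: "p \<noteq> 0 \<or> q \<noteq> 0 ==> hpt p q \<in> P1"
proof -
 assume "p \<noteq> 0 \<or> q \<noteq> 0"
 from sum_sq_pos[OF this] have pos: "(cmod p)\<^sup>2 + (cmod q)\<^sup>2 \<noteq> 0" by linarith
 have "(2 * (cmod p * cmod q))\<^sup>2 + ((cmod p)\<^sup>2 - (cmod q)\<^sup>2)\<^sup>2 = ((cmod p)\<^sup>2 + (cmod q)\<^sup>2)\<^sup>2"
  by (simp add: power2_eq_square algebra_simps)
 then show ?thesis using pos unfolding mem_P1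
  by (simp add: hpt_def norm_mult power_divide power_mult_distrib flip: add_divide_distrib)
qed

lemma continuous_on_hom [continuous_intros]:
 assumes "continuous_on S f" "continuous_on S g" "\<And>x. x \<in> S ==> f x \<noteq> 0 \<or> g x \<noteq> 0"
 shows "continuous_on S (\<lambda>x. hpt (f x) (g x))"
proof -
 have "\<forall>x\<in>S. (cmod (f x))\<^sup>2 + (cmod (g x))\<^sup>2 \<noteq> 0" using sum_sq_pos assms(3) by fastforce
 then show ?thesis unfolding hpt_def using assms(1,2) by (intro continuous_intros)
qed

lemma continuous_on_stereo [continuous_intros]:
 "continuous_on S f ==> continuous_on S (\<lambda>x. stereo (f x))"
 unfolding stereo_hpt by (intro continuous_intros) auto

lemma stereo_in_P1 [simp]: "stereo z \<in> P1"
 by (simp add: stereo_hpt hpt_in_P1)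

lemma infty_in_P1 [simp]: "infty \<in> P1"
 by (simp add: mem_P1 infty_def)

lemma stereo_ne_infty [simp]: "stereo z \<noteq> infty" "infty \<noteq> stereo z"
proof -
 have "(cmod z)\<^sup>2 - 1 \<noteq> (cmod z)\<^sup>2 + 1" "(cmod z)\<^sup>2 + 1 \<noteq> 0"
  using zero_le_power2[of "cmod z"] by linarith+
 then show "stereo z \<noteq> infty" "infty \<noteq> stereo z" by (auto simp: stereo_def infty_def)
qed

lemma affine_coord_stereo [simp]: "affine_coord (stereo z) = z"
proof -
 have pos: "(cmod z)\<^sup>2 + 1 \<noteq> 0" using zero_le_power2[of "cmod z"] by linarith
 have "1 - ((cmod z)\<^sup>2 - 1) / ((cmod z)\<^sup>2 + 1) = 2 / ((cmod z)\<^sup>2 + 1)" using pos by (simp add: field_simps)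
 moreover have "1 / (2 / ((cmod z)\<^sup>2 + 1)) * (2 / (1 + (cmod z)\<^sup>2)) = 1" using pos by (simp add: field_simps)
 ultimately show ?thesis unfolding affine_coord_def stereo_def fst_conv snd_conv scaleR_scaleR by (simp only: scaleR_one)
qed

lemma stereo_inj [simp]: "stereo z = stereo w \<longleftrightarrow> z = w"
 by (metis affine_coord_stereo)

lemma P1_snd_1: "y \<in> P1 ==> snd y = 1 \<longleftrightarrow> y = infty"
 by (cases y) (auto simp: mem_P1 infty_def)

lemma P1_hom_lower: "y \<in> P1 ==> snd y \<noteq> 1 ==> y = hpt (fst y) (of_real (1 - snd y))"
proof -
 assume y: "y \<in> P1" "snd y \<noteq> 1"
 obtain Z x where yZ: "y = (Z, x)" by (cases y)
 have x: "x \<noteq> 1" and eq: "(cmod Z)\<^sup>2 = (1 - x) * (1 + x)"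
  using y by (auto simp: yZ mem_P1 power2_eq_square algebra_simps)
 have 1: "(cmod Z)\<^sup>2 + (cmod (of_real (1 - x)))\<^sup>2 = 2 * (1 - x)"
  "(cmod Z)\<^sup>2 - (cmod (of_real (1 - x)))\<^sup>2 = 2 * (1 - x) * x"
  unfolding eq norm_of_real power2_abs by (auto simp: power2_eq_square algebra_simps)
 show ?thesis unfolding yZ fst_conv snd_conv hpt_def 1 using x by (simp add: scaleR_conv_of_real field_simps)
qed

text \<open>Homogeneous coordinates depending continuously on the point everywhere except at the
  image of zero, in particular near infinity; \<open>P1_hom_lower\<close> covers the complement of
  infinity.\<close>

lemma P1_hom_upper: "y \<in> P1 ==> snd y \<noteq> -1 ==> y = hpt (of_real (1 + snd y)) (cnj (fst y))"
proof -
 assume y: "y \<in> P1" "snd y \<noteq> -1"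
 obtain Z x where yZ: "y = (Z, x)" by (cases y)
 have x: "1 + x \<noteq> 0" and eq: "(cmod Z)\<^sup>2 = (1 + x) * (1 - x)"
  using y by (auto simp: yZ mem_P1 power2_eq_square algebra_simps)
 have 1: "(cmod (of_real (1 + x)))\<^sup>2 + (cmod (cnj Z))\<^sup>2 = 2 * (1 + x)"
  "(cmod (of_real (1 + x)))\<^sup>2 - (cmod (cnj Z))\<^sup>2 = 2 * (1 + x) * x"
  unfolding complex_mod_cnj eq norm_of_real power2_abs by (auto simp: power2_eq_square algebra_simps)
 have "(2 / (2 * (1 + x))) *\<^sub>R (complex_of_real (1 + x) * Z) = (2 / (2 * (1 + x)) * (1 + x)) *\<^sub>R Z"
  by (simp only: scaleR_conv_of_real of_real_mult mult.assoc)
 also have "2 / (2 * (1 + x)) * (1 + x) = 1" using x by (simp add: field_simps)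
 finally show ?thesis unfolding yZ fst_conv snd_conv hpt_def 1 complex_cnj_cnj using x by simp
qed

lemma stereo_affine_coord: "y \<in> P1 ==> y \<noteq> infty ==> stereo (affine_coord y) = y"
proof -
 assume y: "y \<in> P1" "y \<noteq> infty"
 then have "snd y \<noteq> 1" using P1_snd_1 by blast
 with P1_hom_lower[OF y(1) this] hpt_stereo[of "of_real (1 - snd y)" "fst y"] show ?thesis
  by (simp add: affine_coord_def scaleR_conv_of_real field_simps)
qed

lemma continuous_on_affine_coord [continuous_intros]:
 assumes "continuous_on S f" "\<And>x. x \<in> S ==> f x \<in> P1 - {infty}"
 shows "continuous_on S (\<lambda>x. affine_coord (f x))"
proof -
 have "\<forall>x\<in>S. 1 - snd (f x) \<noteq> 0"
 proof
  fix x assume "x \<in> S"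
  then have "snd (f x) \<noteq> 1" using assms(2)[of x] P1_snd_1[of "f x"] by blast
  then show "1 - snd (f x) \<noteq> 0" by simp
 qed
 then show ?thesis unfolding affine_coord_def using assms(1) by (intro continuous_intros)
qed

lemma P1_cases:
 assumes "y \<in> P1" obtains "y = infty" | z where "y = stereo z"
 using stereo_affine_coord[OF assms] by metis

section \<open>Paths with fixed endpoints up to homotopy\<close>

section \<open>The fundamental groupoid\<close>

abbreviation hp :: "'a::topological_space set => (real => 'a) => (real => 'a) => bool" where
 "hp \<equiv> homotopic_paths"

definition pin :: "'a::topological_space set => 'a => 'a => (real => 'a) => bool" where
 "pin Y a c p \<longleftrightarrow> path p \<and> path_image p \<subseteq> Y \<and> pathstart p = a \<and> pathfinish p = c"

lemma loops_at_pin: "loops_at Y b = {\<gamma>. pin Y b b \<gamma>}"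
 by (simp add: loops_at_def pin_def)

lemma pin_join: "pin Y a c p ==> pin Y c d q ==> pin Y a d (p +++ q)"
 by (auto simp: pin_def path_image_join)

lemma pin_rev: "pin Y a c p ==> pin Y c a (reversepath p)"
 by (auto simp: pin_def)

lemma pin_const: "b \<in> Y ==> pin Y b b (linepath b b)" for b :: "'a::real_normed_vector"
 by (auto simp: pin_def)

lemma pin_endpoints: "pin Y a c p ==> a \<in> Y \<and> c \<in> Y"
 unfolding pin_def using pathstart_in_path_image pathfinish_in_path_image by blast

lemma pin_mono: "pin Y a c p ==> Y \<subseteq> Z ==> pin Z a c p"
 by (auto simp: pin_def)

lemma pin_image:
 assumes "pin Y a c p" "continuous_on Y f" "f ` Y \<subseteq> Z" shows "pin Z (f a) (f c) (f \<circ> p)"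
 using assms continuous_on_subset[OF assms(2), of "path_image p"] unfolding pin_def
 by (auto simp: path_image_compose pathstart_compose pathfinish_compose
   intro!: path_continuous_image)

lemma hp_pin:
 assumes "hp Y p q" "pathstart p = a" "pathfinish p = c"
 shows "pin Y a c p" "pin Y a c q"
 using assms homotopic_paths_imp_path[OF assms(1)] homotopic_paths_imp_subset[OF assms(1)]
  homotopic_paths_imp_pathstart[OF assms(1)] homotopic_paths_imp_pathfinish[OF assms(1)] by (simp_all add: pin_def)

lemma hp_pinD: "hp Y p q ==> pin Y a c q ==> pin Y a c p"
 using hp_pin(2)[OF homotopic_paths_sym[of Y p q], of a c] by (simp add: pin_def)

lemma hp_pinD': "hp Y p q ==> pin Y a c p ==> pin Y a c q"
 using hp_pin(2)[of Y p q a c] by (simp add: pin_def)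

lemma hp_refl: "pin Y a c p ==> hp Y p p"
 by (simp add: pin_def)

lemma hp_sym: "hp Y p q ==> hp Y q p"
 by (rule homotopic_paths_sym)

lemmas hp_trans [trans] = homotopic_paths_trans

lemma hp_join:
 assumes "hp Y p p'" "hp Y q q'" "pathfinish p = pathstart q"
 shows "hp Y (p +++ q) (p' +++ q')"
 using homotopic_paths_join[OF assms] .

lemma hp_joinL: "hp Y p p' ==> pin Y a c p ==> pin Y c d q ==> hp Y (p +++ q) (p' +++ q)"
 by (rule hp_join) (auto intro: hp_refl simp: pin_def)

lemma hp_joinR: "pin Y a c p ==> hp Y q q' ==> pin Y c d q ==> hp Y (p +++ q) (p +++ q')"
 by (rule hp_join) (auto intro: hp_refl simp: pin_def)

lemma hp_assoc:
 assumes "pin Y a b p" "pin Y b c q" "pin Y c d r"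
 shows "hp Y ((p +++ q) +++ r) (p +++ (q +++ r))"
 using homotopic_paths_sym[OF homotopic_paths_assoc[of p Y q r]] assms by (auto simp: pin_def)

lemma hp_rev: "hp Y p q ==> hp Y (reversepath p) (reversepath q)"
 using homotopic_paths_reversepath by blast

lemma rev_join: "pin Y a b p ==> pin Y b c q ==> reversepath (p +++ q) = reversepath q +++ reversepath p"
 by (auto simp: pin_def intro: reversepath_joinpaths)

lemma hp_image:
 assumes "hp Y p q" "continuous_on Y f" "f ` Y \<subseteq> Z"
 shows "hp Z (f \<circ> p) (f \<circ> q)"
 using homotopic_paths_continuous_image[OF assms(1,2)] assms(3) by auto

context
 fixes Y :: "'a::real_normed_vector set"
begin

lemma hp_rid: "pin Y a b p ==> hp Y (p +++ linepath b b) p"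
 using homotopic_paths_rid[of p Y] by (auto simp: pin_def)

lemma hp_lid: "pin Y a b p ==> hp Y (linepath a a +++ p) p"
 using homotopic_paths_lid[of p Y] by (auto simp: pin_def)

lemma hp_rinv: "pin Y a b p ==> hp Y (p +++ reversepath p) (linepath a a)"
 using homotopic_paths_rinv[of p Y] by (auto simp: pin_def)

lemma hp_linv: "pin Y a b p ==> hp Y (reversepath p +++ p) (linepath b b)"
 using homotopic_paths_linv[of p Y] by (auto simp: pin_def)

lemma hp_cancel_left:
 assumes "pin Y a b p" "pin Y a c q"
 shows "hp Y (p +++ (reversepath p +++ q)) q"
proof -
 note r = pin_rev[OF assms(1)]
 have "hp Y (p +++ (reversepath p +++ q)) ((p +++ reversepath p) +++ q)"
  by (rule hp_sym[OF hp_assoc[OF assms(1) r assms(2)]])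
 also have "hp Y \<dots> (linepath a a +++ q)"
  by (rule hp_joinL[OF hp_rinv[OF assms(1)] pin_join[OF assms(1) r] assms(2)])
 also have "hp Y \<dots> q" by (rule hp_lid[OF assms(2)])
 finally show ?thesis .
qed

lemma hp_cancel_left':
 assumes "pin Y b a p" "pin Y a c q"
 shows "hp Y (reversepath p +++ (p +++ q)) q"
 using hp_cancel_left[OF pin_rev[OF assms(1)] assms(2)] by simp

lemma hp_cancel:
 assumes "pin Y a b p" "pin Y b c q" "pin Y b d r"
 shows "hp Y ((p +++ q) +++ (reversepath q +++ r)) (p +++ r)"
proof -
 note q' = pin_rev[OF assms(2)]
 have "hp Y ((p +++ q) +++ (reversepath q +++ r)) (p +++ (q +++ (reversepath q +++ r)))"
  by (rule hp_assoc[OF assms(1,2) pin_join[OF q' assms(3)]])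
 also have "hp Y \<dots> (p +++ r)"
  by (rule hp_joinR[OF assms(1) hp_cancel_left[OF assms(2,3)] pin_join[OF assms(2) pin_join[OF q' assms(3)]]])
 finally show ?thesis .
qed

definition cjp :: "(real => 'b::topological_space) => (real => 'b) => real => 'b" where
 "cjp \<delta> \<gamma> = \<delta> +++ \<gamma> +++ reversepath \<delta>"

lemma pin_cjp: "pin Z a c \<delta> ==> pin Z c c \<gamma> ==> pin Z a a (cjp \<delta> \<gamma>)"
 unfolding cjp_def by (blast intro: pin_join pin_rev)

lemma hp_cjp:
 assumes "hp Z \<gamma> \<gamma>'" "pin Z a c \<delta>" "pin Z c c \<gamma>"
 shows "hp Z (cjp \<delta> \<gamma>) (cjp \<delta> \<gamma>')"
 unfolding cjp_def
 by (rule hp_joinR[OF assms(2) hp_joinL[OF assms(1,3) pin_rev[OF assms(2)]] pin_join[OF assms(3) pin_rev[OF assms(2)]]])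

lemma hp_cjp_join:
 assumes "pin Y a c \<delta>" "pin Y c c \<gamma>" "pin Y c c \<gamma>'"
 shows "hp Y (cjp \<delta> (\<gamma> +++ \<gamma>')) (cjp \<delta> \<gamma> +++ cjp \<delta> \<gamma>')"
proof -
 note d' = pin_rev[OF assms(1)]
 note dg = pin_join[OF assms(1,2)] and g'd = pin_join[OF assms(3) d']
 have "hp Y (cjp \<delta> \<gamma> +++ cjp \<delta> \<gamma>')
   (((\<delta> +++ \<gamma>) +++ reversepath \<delta>) +++ (\<delta> +++ (\<gamma>' +++ reversepath \<delta>)))"
  unfolding cjp_def
  by (rule hp_joinL[OF hp_sym[OF hp_assoc[OF assms(1,2) d']] pin_join[OF assms(1) pin_join[OF assms(2) d']]
     pin_join[OF assms(1) g'd]])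
 also have "hp Y \<dots> ((\<delta> +++ \<gamma>) +++ (\<gamma>' +++ reversepath \<delta>))"
  using hp_cancel[OF dg d' g'd] by simp
 also have "hp Y \<dots> (\<delta> +++ (\<gamma> +++ (\<gamma>' +++ reversepath \<delta>)))"
  by (rule hp_assoc[OF assms(1,2) g'd])
 also have "hp Y \<dots> (\<delta> +++ ((\<gamma> +++ \<gamma>') +++ reversepath \<delta>))"
  by (rule hp_joinR[OF assms(1) hp_sym[OF hp_assoc[OF assms(2,3) d']] pin_join[OF assms(2) g'd]])
 finally show ?thesis unfolding cjp_def by (rule hp_sym)
qed

lemma hp_cjp_cjp:
 assumes "pin Y a c \<delta>" "pin Y c d \<delta>'" "pin Y d d \<gamma>"
 shows "hp Y (cjp (\<delta> +++ \<delta>') \<gamma>) (cjp \<delta> (cjp \<delta>' \<gamma>))"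
proof -
 note r = pin_rev[OF assms(1)] and r' = pin_rev[OF assms(2)]
 note rr = pin_join[OF r' r] and gr' = pin_join[OF assms(3) r']
 have "hp Y ((\<delta> +++ \<delta>') +++ (\<gamma> +++ (reversepath \<delta>' +++ reversepath \<delta>)))
   (\<delta> +++ (\<delta>' +++ (\<gamma> +++ (reversepath \<delta>' +++ reversepath \<delta>))))"
  by (rule hp_assoc[OF assms(1,2) pin_join[OF assms(3) rr]])
 also have "hp Y \<dots> (\<delta> +++ ((\<delta>' +++ (\<gamma> +++ reversepath \<delta>')) +++ reversepath \<delta>))"
 proof (rule hp_joinR[OF assms(1) _ pin_join[OF assms(2) pin_join[OF assms(3) rr]]])
  have "hp Y (\<delta>' +++ (\<gamma> +++ (reversepath \<delta>' +++ reversepath \<delta>)))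
    (\<delta>' +++ ((\<gamma> +++ reversepath \<delta>') +++ reversepath \<delta>))"
   by (rule hp_joinR[OF assms(2) hp_sym[OF hp_assoc[OF assms(3) r' r]] pin_join[OF assms(3) rr]])
  also have "hp Y \<dots> ((\<delta>' +++ (\<gamma> +++ reversepath \<delta>')) +++ reversepath \<delta>)"
   by (rule hp_sym[OF hp_assoc[OF assms(2) gr' r]])
  finally show "hp Y (\<delta>' +++ (\<gamma> +++ (reversepath \<delta>' +++ reversepath \<delta>)))
    ((\<delta>' +++ (\<gamma> +++ reversepath \<delta>')) +++ reversepath \<delta>)" .
 qed
 finally show ?thesis unfolding cjp_def rev_join[OF assms(1,2)] .
qed

lemma hp_cjp_const:
 assumes "pin Y a c \<delta>"
 shows "hp Y (cjp \<delta> (linepath c c)) (linepath a a)"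
proof -
 note r = pin_rev[OF assms]
 have c: "pin Y c c (linepath c c)" using assms pin_endpoints pin_const by blast
 have "hp Y (cjp \<delta> (linepath c c)) (\<delta> +++ reversepath \<delta>)"
  unfolding cjp_def by (rule hp_joinR[OF assms hp_lid[OF r] pin_join[OF c r]])
 also have "hp Y \<dots> (linepath a a)" by (rule hp_rinv[OF assms])
 finally show ?thesis .
qed

lemma hp_cjp_triv:
 assumes "pin Y a a \<gamma>" shows "hp Y (cjp (linepath a a) \<gamma>) \<gamma>"
proof -
 have a: "pin Y a a (linepath a a)" using assms pin_endpoints pin_const by blast
 have "hp Y (cjp (linepath a a) \<gamma>) (\<gamma> +++ linepath a a)"
  unfolding cjp_def reversepath_linepath by (rule hp_lid[OF pin_join[OF assms a]])
 also have "hp Y \<dots> \<gamma>" by (rule hp_rid[OF assms])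
 finally show ?thesis .
qed

lemma hp_cjp_rev:
 assumes "pin Y a c \<delta>" "pin Y a a \<gamma>"
 shows "hp Y (cjp \<delta> (cjp (reversepath \<delta>) \<gamma>)) \<gamma>"
proof -
 note r = pin_rev[OF assms(1)]
 note rr = pin_rev[OF pin_join[OF assms(1) r]]
 have a: "pin Y a a (linepath a a)" using assms pin_endpoints pin_const by blast
 have "hp Y (cjp \<delta> (cjp (reversepath \<delta>) \<gamma>)) (cjp (\<delta> +++ reversepath \<delta>) \<gamma>)"
  by (rule hp_sym[OF hp_cjp_cjp[OF assms(1) r assms(2)]])
 also have "hp Y \<dots> (linepath a a +++ \<gamma> +++ reversepath (\<delta> +++ reversepath \<delta>))"
  unfolding cjp_def by (rule hp_joinL[OF hp_rinv[OF assms(1)] pin_join[OF assms(1) r] pin_join[OF assms(2) rr]])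
 also have "hp Y \<dots> (cjp (linepath a a) \<gamma>)" unfolding cjp_def
  by (rule hp_joinR[OF a hp_joinR[OF assms(2) hp_rev[OF hp_rinv[OF assms(1)]] rr] pin_join[OF assms(2) rr]])
 also have "hp Y \<dots> \<gamma>" by (rule hp_cjp_triv[OF assms(2)])
 finally show ?thesis .
qed

lemma hp_rev_cjp:
 assumes "pin Y a c \<delta>" "pin Y c c \<gamma>"
 shows "hp Y (reversepath (cjp \<delta> \<gamma>)) (cjp \<delta> (reversepath \<gamma>))"
proof -
 note r = pin_rev[OF assms(1)] and r' = pin_rev[OF assms(2)]
 have "reversepath (cjp \<delta> \<gamma>) = (\<delta> +++ reversepath \<gamma>) +++ reversepath \<delta>"
  unfolding cjp_def rev_join[OF assms(1) pin_join[OF assms(2) r]] rev_join[OF assms(2) r] by simp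
 then show ?thesis unfolding cjp_def using hp_assoc[OF assms(1) r' r] by simp
qed

end

text \<open>The square is simply connected, so its side \<open>u = 0\<close> is homotopic to the way
  round along the other three sides, and by \<open>loop\<close> the sides \<open>x = 0\<close> and
  \<open>x = 1\<close> have the same image \<open>\<sigma>\<close>. Hence the track of the starting
  point conjugates one loop into the other. In this form deformations of small circles become
  statements about meridians.\<close>

lemma free_homotopy_cjp:
 fixes H :: "real \<times> real => 'a::real_normed_vector"
 assumes cont: "continuous_on ({0..1} \<times> {0..1}) H" and im: "H ` ({0..1} \<times> {0..1}) \<subseteq> Y"
  and loop: "\<And>u. u \<in> {0..1} ==> H (u, 1) = H (u, 0)"
 shows "\<exists>\<sigma>. pin Y (H (0, 0)) (H (1, 0)) \<sigma> \<and>
  hp Y (\<lambda>x. H (0, x)) (cjp \<sigma> (\<lambda>x. H (1, x)))"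
proof -
 let ?Q = "{0..1::real} \<times> {0..1::real}"
 define e where "e a c = (linepath a c :: real => real \<times> real)" for a c
 have e: "pin ?Q a c (e a c)" if "a \<in> ?Q" "c \<in> ?Q" for a c
 proof -
  have "convex ?Q" by (intro convex_Times) auto
  then have "closed_segment a c \<subseteq> ?Q" using closed_segment_subset[OF that] by blast
  then show ?thesis by (auto simp: pin_def e_def)
 qed
 define \<sigma> where "\<sigma> = H \<circ> e (0, 0) (1, 0)"
 have sc: "simply_connected ?Q" by (intro convex_imp_simply_connected convex_Times) auto
 have "hp ?Q (e (0, 0) (0, 1)) (e (0, 0) (1, 0) +++ e (1, 0) (1, 1) +++ e (1, 1) (0, 1))"
 proof -
  have "pin ?Q (0, 0) (0, 1) (e (0, 0) (0, 1))"
   "pin ?Q (0, 0) (0, 1) (e (0, 0) (1, 0) +++ e (1, 0) (1, 1) +++ e (1, 1) (0, 1))" by (auto intro!: e pin_join)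
  then show ?thesis using sc unfolding simply_connected_eq_homotopic_paths pin_def by metis
 qed
 from hp_image[OF this cont im]
 have *: "hp Y (H \<circ> e (0, 0) (0, 1))
   (\<sigma> +++ (H \<circ> e (1, 0) (1, 1)) +++ (H \<circ> e (1, 1) (0, 1)))"
  by (simp add: path_compose_join \<sigma>_def)
 have 1: "H \<circ> e (0, 0) (0, 1) = (\<lambda>x. H (0, x))" "H \<circ> e (1, 0) (1, 1) = (\<lambda>x. H (1, x))"
  by (auto simp: e_def linepath_def)
 have \<sigma>: "pin Y (H (0, 0)) (H (1, 0)) \<sigma>" unfolding \<sigma>_def by (rule pin_image[OF e cont im]) auto
 have p1: "pin Y (H (1, 0)) (H (1, 1)) (\<lambda>x. H (1, x))" using pin_image[OF e[of "(1, 0)" "(1, 1)"] cont im] 1 by auto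
 have 2: "hp Y (H \<circ> e (1, 1) (0, 1)) (reversepath \<sigma>)"
 proof (rule homotopic_paths_eq)
  show "path (H \<circ> e (1, 1) (0, 1))" "path_image (H \<circ> e (1, 1) (0, 1)) \<subseteq> Y"
   using pin_image[OF e[of "(1, 1)" "(0, 1)"] cont im] by (auto simp: pin_def)
  show "(H \<circ> e (1, 1) (0, 1)) t = reversepath \<sigma> t" if "t \<in> {0..1}" for t
   using that loop[of "1 - t"] by (simp add: e_def linepath_def \<sigma>_def reversepath_def)
 qed
 have p2: "pin Y (H (1, 1)) (H (0, 1)) (H \<circ> e (1, 1) (0, 1))"
  using pin_image[OF e[of "(1, 1)" "(0, 1)"] cont im] by auto
 have "hp Y (\<sigma> +++ (\<lambda>x. H (1, x)) +++ (H \<circ> e (1, 1) (0, 1))) (cjp \<sigma> (\<lambda>x. H (1, x)))"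
  unfolding cjp_def using hp_joinR[OF \<sigma> hp_joinR[OF p1 2 p2] pin_join[OF _ p2]] p1 loop[of 1] by simp
 with * show ?thesis using \<sigma> unfolding 1 by (meson hp_trans)
qed

section \<open>Homomorphisms from loops to the alternating group\<close>

section \<open>Monodromy homomorphisms\<close>

declare linepath_refl [simp del]

lemma pi1_hom_iff:
 "pi1_hom n Y b \<rho> \<longleftrightarrow>
  (\<forall>\<gamma>. pin Y b b \<gamma> \<longrightarrow> \<rho> \<gamma> \<in> carrier (alt_group n)) \<and>
  (\<forall>\<gamma> \<gamma>'. pin Y b b \<gamma> \<longrightarrow> hp Y \<gamma> \<gamma>' \<longrightarrow> \<rho> \<gamma> = \<rho> \<gamma>') \<and>
  (\<forall>\<gamma> \<gamma>'. pin Y b b \<gamma> \<longrightarrow> pin Y b b \<gamma>' \<longrightarrow> \<rho> (\<gamma> +++ \<gamma>') = \<rho> \<gamma>' \<circ> \<rho> \<gamma>)"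
 using hp_pinD'[of Y _ _ b b] unfolding pi1_hom_def loops_at_pin mem_Collect_eq Ball_def
  right_prod_Cons right_prod_Nil id_comp by blast

lemma pi1_carrier: "pi1_hom n Y b \<rho> ==> pin Y b b \<gamma> ==> \<rho> \<gamma> \<in> carrier (alt_group n)"
 unfolding pi1_hom_iff by blast

lemma pi1_hp: "pi1_hom n Y b \<rho> ==> pin Y b b \<gamma> ==> hp Y \<gamma> \<gamma>' ==> \<rho> \<gamma> = \<rho> \<gamma>'"
 unfolding pi1_hom_iff by blast

lemma pi1_join: "pi1_hom n Y b \<rho> ==> pin Y b b \<gamma> ==> pin Y b b \<gamma>' ==> \<rho> (\<gamma> +++ \<gamma>') = \<rho> \<gamma>' \<circ> \<rho> \<gamma>"
 unfolding pi1_hom_iff by blast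

lemma pi1_bij: "pi1_hom n Y b \<rho> ==> pin Y b b \<gamma> ==> bij (\<rho> \<gamma>)"
 using pi1_carrier[of n Y b \<rho> \<gamma>] permutes_bij by (auto simp: alt_group_carrier)

lemma bij_idem_id: "bij f ==> f \<circ> f = f ==> f = id"
 by (metis bij_is_inj fun.map_id inv_o_cancel o_assoc)

lemma bij_left_inverse: "bij f ==> g \<circ> f = id ==> g = inv' f"
 by (metis bij_is_surj comp_assoc comp_id id_comp surj_iff)

lemma pi1_const:
 fixes b :: "'a::real_normed_vector"
 assumes "pi1_hom n Y b \<rho>" "b \<in> Y" shows "\<rho> (linepath b b) = id"
proof -
 have p: "pin Y b b (linepath b b)" using assms(2) by (rule pin_const)
 have "\<rho> (linepath b b) = \<rho> (linepath b b +++ linepath b b)" using pi1_hp[OF assms(1) p hp_sym[OF hp_lid[OF p]]] .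
 then have "\<rho> (linepath b b) \<circ> \<rho> (linepath b b) = \<rho> (linepath b b)"
  using pi1_join[OF assms(1) p p] by simp
 then show ?thesis by (rule bij_idem_id[OF pi1_bij[OF assms(1) p]])
qed

lemma pi1_rev:
 fixes b :: "'a::real_normed_vector"
 assumes "pi1_hom n Y b \<rho>" "pin Y b b \<gamma>" shows "\<rho> (reversepath \<gamma>) = inv' (\<rho> \<gamma>)"
proof (rule bij_left_inverse[OF pi1_bij[OF assms]])
 note r = pin_rev[OF assms(2)]
 have b: "b \<in> Y" using pin_endpoints[OF assms(2)] by simp
 have "\<rho> (reversepath \<gamma>) \<circ> \<rho> \<gamma> = \<rho> (\<gamma> +++ reversepath \<gamma>)"
  using pi1_join[OF assms r] by simp
 also have "\<dots> = \<rho> (linepath b b)" by (rule pi1_hp[OF assms(1) pin_join[OF assms(2) r] hp_rinv[OF assms(2)]])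
 also have "\<dots> = id" by (rule pi1_const[OF assms(1) b])
 finally show "\<rho> (reversepath \<gamma>) \<circ> \<rho> \<gamma> = id" .
qed

lemma pi1_cjp:
 fixes b :: "'a::real_normed_vector"
 assumes "pi1_hom n Y b \<rho>" "pin Y b b \<eta>" "pin Y b b \<gamma>"
 shows "\<rho> (cjp \<eta> \<gamma>) = cj (inv' (\<rho> \<eta>)) (\<rho> \<gamma>)"
proof -
 note r = pin_rev[OF assms(2)]
 have "\<rho> (cjp \<eta> \<gamma>) = \<rho> (reversepath \<eta>) \<circ> \<rho> \<gamma> \<circ> \<rho> \<eta>"
  unfolding cjp_def using pi1_join[OF assms(1,2) pin_join[OF assms(3) r]] pi1_join[OF assms(1,3) r] by simp
 then show ?thesis using pi1_rev[OF assms(1,2)] pi1_bij[OF assms(1,2)] by (simp add: cj_def inv_inv_eq)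
qed

lemma alt_group_cj:
 assumes "s permutes {1..n}" "g \<in> carrier (alt_group n)" shows "cj s g \<in> carrier (alt_group n)"
proof -
 have p: "permutation s" "permutation g" "permutation (inv' s)"
  using assms permutes_inv[OF assms(1)] by (auto simp: permutation_permutes alt_group_carrier)
 then have "evenperm (cj s g)"
  using assms by (simp add: cj_def evenperm_comp evenperm_inv permutation_compose alt_group_carrier)
 moreover have "cj s g permutes {1..n}" using assms permutes_inv[OF assms(1)] unfolding cj_def alt_group_carrier
  by (intro permutes_compose) auto
 ultimately show ?thesis by (simp add: alt_group_carrier)
qed

lemma pi1_hom_cj:
 assumes "pi1_hom n Y b \<rho>" "s permutes {1..n}"
 shows "pi1_hom n Y b (\<lambda>\<gamma>. cj s (\<rho> \<gamma>))"
 unfolding pi1_hom_iff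
proof (intro conjI allI impI)
 fix \<gamma> assume g: "pin Y b b \<gamma>"
 show "cj s (\<rho> \<gamma>) \<in> carrier (alt_group n)" using alt_group_cj assms pi1_carrier g by blast
 show "cj s (\<rho> \<gamma>) = cj s (\<rho> \<gamma>')" if "hp Y \<gamma> \<gamma>'" for \<gamma>'
  using pi1_hp[OF assms(1) g that] by simp
 show "cj s (\<rho> (\<gamma> +++ \<gamma>')) = cj s (\<rho> \<gamma>') \<circ> cj s (\<rho> \<gamma>)" if "pin Y b b \<gamma>'" for \<gamma>'
  using pi1_join[OF assms(1) g that] cj_comp[OF permutes_bij[OF assms(2)]] by simp
qed

lemma pi1_hom_base:
 fixes b :: "'a::real_normed_vector"
 assumes "pi1_hom n Y b \<rho>" "pin Y b c \<delta>"
 shows "pi1_hom n Y c (\<lambda>\<gamma>. \<rho> (cjp \<delta> \<gamma>))"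
 unfolding pi1_hom_iff
proof (intro conjI allI impI)
 fix \<gamma> assume g: "pin Y c c \<gamma>"
 note cg = pin_cjp[OF assms(2) g]
 show "\<rho> (cjp \<delta> \<gamma>) \<in> carrier (alt_group n)" by (rule pi1_carrier[OF assms(1) cg])
 show "\<rho> (cjp \<delta> \<gamma>) = \<rho> (cjp \<delta> \<gamma>')" if "hp Y \<gamma> \<gamma>'" for \<gamma>'
  by (rule pi1_hp[OF assms(1) cg hp_cjp[OF that assms(2) g]])
 show "\<rho> (cjp \<delta> (\<gamma> +++ \<gamma>')) = \<rho> (cjp \<delta> \<gamma>') \<circ> \<rho> (cjp \<delta> \<gamma>)" if g': "pin Y c c \<gamma>'" for \<gamma>'
  using pi1_hp[OF assms(1) pin_cjp[OF assms(2) pin_join[OF g g']] hp_cjp_join[OF assms(2) g g']]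
   pi1_join[OF assms(1) cg pin_cjp[OF assms(2) g']] by simp
qed

section \<open>Generation by words, meridians, and change of base point\<close>

section \<open>Words in the generators\<close>

lemma path_prod_simps [simp]:
 "path_prod b [] = linepath b b" "path_prod b (w # ws) = w +++ path_prod b ws" by (simp_all add: path_prod_def)

lemma pin_path_prod: "\<forall>w\<in>set ws. pin Y b b w ==> b \<in> Y ==> pin Y b b (path_prod b ws)"
 by (induction ws) (auto intro: pin_const pin_join)

lemma pi1_path_prod:
 assumes "pi1_hom n Y b \<rho>" "b \<in> Y" "\<forall>w\<in>set ws. pin Y b b w"
 shows "\<rho> (path_prod b ws) = right_prod (map \<rho> ws)"
 using assms(3)
proof (induction ws)
 case Nil
 show ?case using pi1_const[OF assms(1,2)] unfolding path_prod_simps list.map right_prod_Nil .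
next
 case (Cons w ws)
 then show ?case using pi1_join[OF assms(1) _ pin_path_prod[OF _ assms(2)], of w ws] by simp
qed

lemma hp_path_prod_append:
 assumes "\<forall>w\<in>set xs. pin Y b b w" "\<forall>w\<in>set ys. pin Y b b w" "b \<in> Y"
 shows "hp Y (path_prod b (xs @ ys)) (path_prod b xs +++ path_prod b ys)"
 using assms(1)
proof (induction xs)
 case Nil
 show ?case using hp_sym[OF hp_lid[OF pin_path_prod[OF assms(2,3)]]] unfolding append_Nil path_prod_simps .
next
 case (Cons w xs)
 then have w: "pin Y b b w" and xs: "pin Y b b (path_prod b xs)" and ys: "pin Y b b (path_prod b ys)"
  and xsys: "pin Y b b (path_prod b (xs @ ys))"
  using assms by (auto intro!: pin_path_prod)
 have "hp Y (w +++ path_prod b (xs @ ys)) (w +++ (path_prod b xs +++ path_prod b ys))"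
  using hp_joinR[OF w _ xsys] Cons by simp
 also have "hp Y \<dots> ((w +++ path_prod b xs) +++ path_prod b ys)" by (rule hp_sym[OF hp_assoc[OF w xs ys]])
 finally show ?case by simp
qed

definition words :: "point set => point => (real => point) set => (real => point) set" where
 "words Y b G = {\<gamma>. \<exists>ws. set ws \<subseteq> G \<union> reversepath ` G \<and> hp Y \<gamma> (path_prod b ws)}"

lemma words_pin: "G \<subseteq> loops_at Y b ==> set ws \<subseteq> G \<union> reversepath ` G ==> \<forall>w\<in>set ws. pin Y b b w"
 unfolding loops_at_pin using pin_rev by blast

lemma words_hp: "\<gamma> \<in> words Y b G ==> hp Y \<gamma>' \<gamma> ==> \<gamma>' \<in> words Y b G"
 unfolding words_def using hp_trans by blast

lemma words_const: "b \<in> Y ==> linepath b b \<in> words Y b G"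
 unfolding words_def using hp_refl[OF pin_const] by (intro CollectI exI[of _ "[]"]) auto

lemma words_gen:
 assumes "G \<subseteq> loops_at Y b" "g \<in> G" shows "g \<in> words Y b G" "reversepath g \<in> words Y b G"
proof -
 have g: "pin Y b b g" using assms by (auto simp: loops_at_pin)
 show "g \<in> words Y b G"
  unfolding words_def using hp_sym[OF hp_rid[OF g]] assms(2) by (intro CollectI exI[of _ "[g]"]) auto
 show "reversepath g \<in> words Y b G" unfolding words_def using hp_sym[OF hp_rid[OF pin_rev[OF g]]] assms(2)
  by (intro CollectI exI[of _ "[reversepath g]"]) auto
qed

lemma words_join:
 assumes "G \<subseteq> loops_at Y b" "b \<in> Y" "\<gamma> \<in> words Y b G" "\<gamma>' \<in> words Y b G"
 shows "\<gamma> +++ \<gamma>' \<in> words Y b G"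
proof -
 obtain ws ws' where w: "set ws \<subseteq> G \<union> reversepath ` G" "hp Y \<gamma> (path_prod b ws)"
  "set ws' \<subseteq> G \<union> reversepath ` G" "hp Y \<gamma>' (path_prod b ws')"
  using assms unfolding words_def by blast
 have p: "\<forall>w\<in>set ws. pin Y b b w" "\<forall>w\<in>set ws'. pin Y b b w"
  using words_pin[OF assms(1) w(1)] words_pin[OF assms(1) w(3)] by auto
 note pp = pin_path_prod[OF p(1) assms(2)] pin_path_prod[OF p(2) assms(2)]
 have "hp Y (\<gamma> +++ \<gamma>') (path_prod b ws +++ path_prod b ws')"
  using hp_join[OF w(2,4)] hp_pinD[OF w(2) pp(1)] hp_pinD[OF w(4) pp(2)] by (simp add: pin_def)
 also have "hp Y \<dots> (path_prod b (ws @ ws'))" by (rule hp_sym[OF hp_path_prod_append[OF p assms(2)]])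
 finally show ?thesis unfolding words_def using w by (intro CollectI exI[of _ "ws @ ws'"]) auto
qed

lemma words_induct [consumes 3, case_names hp const gen rev]:
 assumes "\<gamma> \<in> words Y b G" "G \<subseteq> loops_at Y b" "b \<in> Y"
  and hp: "\<And>\<gamma> \<gamma>'. P \<gamma> ==> pin Y b b \<gamma> ==> hp Y \<gamma>' \<gamma> ==> P \<gamma>'"
  and const: "P (linepath b b)"
  and gen: "\<And>g \<gamma>. g \<in> G ==> pin Y b b g ==> pin Y b b \<gamma> ==> P \<gamma> ==> P (g +++ \<gamma>)"
  and rev: "\<And>g \<gamma>. g \<in> G ==> pin Y b b g ==> pin Y b b \<gamma> ==> P \<gamma> ==> P (reversepath g +++ \<gamma>)"
 shows "P \<gamma>"
proof -
 obtain ws where w: "set ws \<subseteq> G \<union> reversepath ` G" "hp Y \<gamma> (path_prod b ws)"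
  using assms unfolding words_def by blast
 have "P (path_prod b ws)" using w(1)
 proof (induction ws)
  case (Cons v vs)
  have pv: "pin Y b b (path_prod b vs)"
   using words_pin[OF assms(2), of vs] Cons.prems by (intro pin_path_prod[OF _ assms(3)]) auto
  have IH: "P (path_prod b vs)" using Cons by auto
  consider "v \<in> G" | g where "g \<in> G" "v = reversepath g" using Cons.prems by auto
  then show ?case
  proof cases
   case 1
   then show ?thesis using gen[OF 1 _ pv IH] assms(2) by (auto simp: loops_at_pin)
  next
   case 2
   then show ?thesis using rev[OF 2(1) _ pv IH] assms(2) by (auto simp: loops_at_pin)
  qed
 qed (use const in simp)
 then show ?thesis using hp w(2) pin_path_prod[OF words_pin[OF assms(2) w(1)] assms(3)] by blast
qed

lemma words_cjp:
 assumes "\<gamma> \<in> words Y b G" "G \<subseteq> loops_at Y b" "pin Y c b \<epsilon>"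
 shows "cjp \<epsilon> \<gamma> \<in> words Y c (cjp \<epsilon> ` G)"
proof -
 have b: "b \<in> Y" "c \<in> Y" using pin_endpoints[OF assms(3)] by auto
 have G': "cjp \<epsilon> ` G \<subseteq> loops_at Y c" using assms(2) pin_cjp[OF assms(3)] by (auto simp: loops_at_pin)
 from assms(1,2) b(1) show ?thesis
 proof (induction rule: words_induct)
  case (hp \<gamma> \<gamma>')
  then show ?case using words_hp hp_cjp[OF hp(3) assms(3) hp_pinD[OF hp(3,2)]] by blast
 next
  case const
  then show ?case using words_hp[OF words_const[OF b(2)] hp_cjp_const[OF assms(3)]] .
 next
  case (gen g \<gamma>)
  have "cjp \<epsilon> g +++ cjp \<epsilon> \<gamma> \<in> words Y c (cjp \<epsilon> ` G)"
   using words_join[OF G' b(2) words_gen(1)[OF G'] gen(4)] gen(1) by blast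
  then show ?case using words_hp hp_cjp_join[OF assms(3) gen(2,3)] by blast
 next
  case (rev g \<gamma>)
  have "reversepath (cjp \<epsilon> g) \<in> words Y c (cjp \<epsilon> ` G)" using rev by (intro words_gen[OF G']) auto
  then have "cjp \<epsilon> (reversepath g) \<in> words Y c (cjp \<epsilon> ` G)"
   using words_hp hp_sym[OF hp_rev_cjp[OF assms(3) rev(2)]] by blast
  then have "cjp \<epsilon> (reversepath g) +++ cjp \<epsilon> \<gamma> \<in> words Y c (cjp \<epsilon> ` G)"
   using words_join[OF G' b(2) _ rev(4)] by blast
  then show ?case using words_hp hp_cjp_join[OF assms(3) pin_rev[OF rev(2)] rev(3)] by blast
 qed
qed

lemma classical_generators_iff:
 "classical_generators S b \<gamma>s \<longleftrightarrow>
   set \<gamma>s \<subseteq> loops_at (P1 - S) b \<and>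
   (\<exists>ss. distinct ss \<and> set ss = S \<and> list_all2 (meridian S b) ss \<gamma>s) \<and>
   hp (P1 - S) (path_prod b \<gamma>s) (linepath b b) \<and>
   (\<forall>\<gamma>. pin (P1 - S) b b \<gamma> \<longrightarrow> \<gamma> \<in> words (P1 - S) b (set \<gamma>s))"
 unfolding classical_generators_def words_def loops_at_pin by blast

lemma meridian_cjp_iff:
 "meridian S b s \<gamma> \<longleftrightarrow> (\<exists>e \<delta>. e > 0 \<and> local_param s ` cball 0 e \<inter> S = {s} \<and>
   pin (P1 - S) b (pathstart (small_circle s e)) \<delta> \<and>
   hp (P1 - S) \<gamma> (cjp \<delta> (small_circle s e)))" unfolding meridian_def pin_def cjp_def by blast

text \<open>The conjugated loop lies in \<open>Y\<close> because it is the end of a homotopy in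
  \<open>Y\<close>; so its middle part lies there too. This recovers that the circle of a meridian
  avoids the branch points.\<close>

lemma cjp_end_pin:
 assumes "hp Y p (cjp \<delta> q)" "pin Y a c \<delta>" "pathstart q = c" "pathfinish q = c"
 shows "pin Y a a p" "pin Y c c q"
proof -
 have "pathstart (cjp \<delta> q) = a" "pathfinish (cjp \<delta> q) = a" using assms(2) by (auto simp: cjp_def pin_def)
 then have c: "pin Y a a (cjp \<delta> q)" using hp_pin(1)[OF hp_sym[OF assms(1)]] by blast
 then show "pin Y a a p" using hp_pinD assms(1) by blast
 have "path \<delta>" "path (\<delta> +++ q +++ reversepath \<delta>)" "path_image (\<delta> +++ q +++ reversepath \<delta>) \<subseteq> Y"
  using c assms(2) by (auto simp: cjp_def pin_def)
 moreover have "pathfinish \<delta> = pathstart q" "pathfinish q = pathstart (reversepath \<delta>)"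
  using assms by (auto simp: pin_def)
 ultimately show "pin Y c c q" using assms(3,4) by (simp add: pin_def path_image_join)
qed

lemma small_circle_ends: "pathfinish (small_circle s e) = pathstart (small_circle s e)"
 by (simp add: small_circle_def pathstart_compose pathfinish_compose)

lemma meridian_cjp:
 assumes "meridian S b s \<gamma>" "pin (P1 - S) c b \<epsilon>"
 shows "meridian S c s (cjp \<epsilon> \<gamma>)"
proof -
 obtain e \<delta> where e: "e > 0" "local_param s ` cball 0 e \<inter> S = {s}"
  "pin (P1 - S) b (pathstart (small_circle s e)) \<delta>"
  "hp (P1 - S) \<gamma> (cjp \<delta> (small_circle s e))" using assms(1) unfolding meridian_cjp_iff by blast
 note p = cjp_end_pin[OF e(4,3) refl small_circle_ends]
 have "hp (P1 - S) (cjp \<epsilon> \<gamma>) (cjp \<epsilon> (cjp \<delta> (small_circle s e)))"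
  by (rule hp_cjp[OF e(4) assms(2) p(1)])
 also have "hp (P1 - S) \<dots> (cjp (\<epsilon> +++ \<delta>) (small_circle s e))"
  by (rule hp_sym[OF hp_cjp_cjp[OF assms(2) e(3) p(2)]])
 finally show ?thesis unfolding meridian_cjp_iff using e(1,2) pin_join[OF assms(2) e(3)] by blast
qed

lemma hp_path_prod_cjp:
 assumes "pin Y c b \<epsilon>" "\<forall>w\<in>set ws. pin Y b b w"
 shows "hp Y (path_prod c (map (cjp \<epsilon>) ws)) (cjp \<epsilon> (path_prod b ws))"
 using assms(2)
proof (induction ws)
 case Nil
 show ?case using hp_sym[OF hp_cjp_const[OF assms(1)]] unfolding list.map path_prod_simps .
next
 case (Cons w ws)
 have b: "b \<in> Y" "c \<in> Y" using pin_endpoints[OF assms(1)] by auto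
 have w: "pin Y b b w" and ws: "pin Y b b (path_prod b ws)" and ws': "pin Y c c (path_prod c (map (cjp \<epsilon>) ws))"
  using Cons.prems pin_cjp[OF assms(1)] b by (auto intro!: pin_path_prod)
 have "hp Y (cjp \<epsilon> w +++ path_prod c (map (cjp \<epsilon>) ws)) (cjp \<epsilon> w +++ cjp \<epsilon> (path_prod b ws))"
  by (rule hp_joinR[OF pin_cjp[OF assms(1) w] _ ws']) (use Cons in auto)
 also have "hp Y \<dots> (cjp \<epsilon> (w +++ path_prod b ws))"
  by (rule hp_sym[OF hp_cjp_join[OF assms(1) w ws]])
 finally show ?case by simp
qed

lemma classical_generators_base:
 assumes "classical_generators S b \<gamma>s" "pin (P1 - S) c b \<epsilon>"
 shows "classical_generators S c (map (cjp \<epsilon>) \<gamma>s)"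
proof -
 let ?Y = "P1 - S"
 have G: "set \<gamma>s \<subseteq> loops_at ?Y b" and 1: "hp ?Y (path_prod b \<gamma>s) (linepath b b)"
  and W: "\<And>\<gamma>. pin ?Y b b \<gamma> ==> \<gamma> \<in> words ?Y b (set \<gamma>s)"
  using assms(1) unfolding classical_generators_iff by blast+
 obtain ss where ss: "distinct ss" "set ss = S" "list_all2 (meridian S b) ss \<gamma>s"
  using assms(1) unfolding classical_generators_iff by blast
 have Gp: "\<forall>w\<in>set \<gamma>s. pin ?Y b b w" using G by (auto simp: loops_at_pin)
 have b: "b \<in> ?Y" "c \<in> ?Y" using pin_endpoints[OF assms(2)] by auto
 have "list_all2 (meridian S c) ss (map (cjp \<epsilon>) \<gamma>s)"
  using ss(3) meridian_cjp[OF _ assms(2)] by (auto simp: list_all2_conv_all_nth)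
 moreover have "hp ?Y (path_prod c (map (cjp \<epsilon>) \<gamma>s)) (linepath c c)"
 proof -
  have "hp ?Y (path_prod c (map (cjp \<epsilon>) \<gamma>s)) (cjp \<epsilon> (path_prod b \<gamma>s))"
   by (rule hp_path_prod_cjp[OF assms(2) Gp])
  also have "hp ?Y \<dots> (cjp \<epsilon> (linepath b b))"
   by (rule hp_cjp[OF 1 assms(2) pin_path_prod[OF Gp b(1)]])
  also have "hp ?Y \<dots> (linepath c c)" by (rule hp_cjp_const[OF assms(2)])
  finally show ?thesis .
 qed
 moreover have "\<gamma> \<in> words ?Y c (set (map (cjp \<epsilon>) \<gamma>s))" if g: "pin ?Y c c \<gamma>" for \<gamma>
 proof -
  note r = pin_rev[OF assms(2)]
  have "cjp \<epsilon> (cjp (reversepath \<epsilon>) \<gamma>) \<in> words ?Y c (cjp \<epsilon> ` set \<gamma>s)"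
   by (rule words_cjp[OF W[OF pin_cjp[OF r g]] G assms(2)])
  then show ?thesis using words_hp hp_sym[OF hp_cjp_rev[OF assms(2) g]] by auto
 qed
 moreover have "set (map (cjp \<epsilon>) \<gamma>s) \<subseteq> loops_at ?Y c"
  using Gp pin_cjp[OF assms(2)] by (auto simp: loops_at_pin)
 ultimately show ?thesis unfolding classical_generators_iff using ss by blast
qed

lemma hurwitz_data_iff:
 "(S, b, \<rho>) \<in> hurwitz_data n r \<longleftrightarrow> S \<subseteq> P1 \<and> finite S \<and> card S = r \<and> b \<in> P1 - S \<and>
  pi1_hom n (P1 - S) b \<rho> \<and> (\<exists>\<gamma>s. classical_generators S b \<gamma>s \<and> map \<rho> \<gamma>s \<in> nielsen_class n r)"
 by (simp add: hurwitz_data_def)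

lemma classical_generators_pin: "classical_generators S b \<gamma>s ==> \<gamma> \<in> set \<gamma>s ==> pin (P1 - S) b b \<gamma>"
 unfolding classical_generators_iff loops_at_pin by blast

lemma hurwitz_data_base:
 assumes "(S, b, \<rho>) \<in> hurwitz_data n r" "pin (P1 - S) b c \<delta>"
 shows "(S, c, \<lambda>\<gamma>. \<rho> (cjp \<delta> \<gamma>)) \<in> hurwitz_data n r"
proof -
 have d: "S \<subseteq> P1" "finite S" "card S = r" "pi1_hom n (P1 - S) b \<rho>"
  using assms(1) unfolding hurwitz_data_iff by blast+
 obtain \<gamma>s where g: "classical_generators S b \<gamma>s" "map \<rho> \<gamma>s \<in> nielsen_class n r"
  using assms(1) unfolding hurwitz_data_iff by blast
 have "map (\<lambda>\<gamma>. \<rho> (cjp \<delta> \<gamma>)) (map (cjp (reversepath \<delta>)) \<gamma>s) = map \<rho> \<gamma>s"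
 proof (unfold map_map, rule map_cong[OF refl])
  fix \<gamma> assume "\<gamma> \<in> set \<gamma>s"
  then have p: "pin (P1 - S) b b \<gamma>" using classical_generators_pin g by blast
  have "hp (P1 - S) (cjp \<delta> (cjp (reversepath \<delta>) \<gamma>)) \<gamma>"
   by (rule hp_cjp_rev[OF assms(2) p])
  then show "((\<lambda>\<gamma>. \<rho> (cjp \<delta> \<gamma>)) \<circ> cjp (reversepath \<delta>)) \<gamma> = \<rho> \<gamma>"
   using pi1_hp[OF d(4) p hp_sym] by auto
 qed
 then show ?thesis unfolding hurwitz_data_iff using d pi1_hom_base[OF d(4) assms(2)] pin_endpoints[OF assms(2)] g(2)
   classical_generators_base[OF g(1) pin_rev[OF assms(2)]] by metis
qed

lemma hurwitz_data_cj:
 assumes "(S, b, \<rho>) \<in> hurwitz_data n r" "s permutes {1..n}" "n \<ge> 3"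
 shows "(S, b, \<lambda>\<gamma>. cj s (\<rho> \<gamma>)) \<in> hurwitz_data n r"
proof -
 have d: "S \<subseteq> P1" "finite S" "card S = r" "b \<in> P1 - S" "pi1_hom n (P1 - S) b \<rho>"
  using assms(1) unfolding hurwitz_data_iff by blast+
 obtain \<gamma>s where g: "classical_generators S b \<gamma>s" "map \<rho> \<gamma>s \<in> nielsen_class n r"
  using assms(1) unfolding hurwitz_data_iff by blast
 have "map (\<lambda>\<gamma>. cj s (\<rho> \<gamma>)) \<gamma>s \<in> nielsen_class n r"
  using nielsen_class_cj[OF assms(3,2) g(2)] by (simp add: comp_def)
 then show ?thesis unfolding hurwitz_data_iff using d pi1_hom_cj[OF d(5) assms(2)] g(1) by blast
qed

lemma pi1_surj:
 assumes "(S, b, \<rho>) \<in> hurwitz_data n r" "g \<in> carrier (alt_group n)"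
 obtains \<gamma> where "pin (P1 - S) b b \<gamma>" "\<rho> \<gamma> = g"
proof -
 have d: "b \<in> P1 - S" "pi1_hom n (P1 - S) b \<rho>" using assms(1) unfolding hurwitz_data_iff by blast+
 obtain \<gamma>s where gs: "classical_generators S b \<gamma>s" "map \<rho> \<gamma>s \<in> nielsen_class n r"
  using assms(1) unfolding hurwitz_data_iff by blast
 have p: "pin (P1 - S) b b \<gamma>" if "\<gamma> \<in> set \<gamma>s" for \<gamma>
  using classical_generators_pin gs(1) that by blast
 have "g \<in> generate (alt_group n) (set (map \<rho> \<gamma>s))" using gs(2) assms(2) by (simp add: nielsen_class_def)
 then have "\<exists>\<gamma>. pin (P1 - S) b b \<gamma> \<and> \<rho> \<gamma> = g"
 proof induction
  case one
  then show ?case using pi1_const[OF d(2,1)] pin_const[OF d(1)] unfolding alt_group_one by blast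
 next
  case (incl h)
  then show ?case using p by auto
 next
  case (inv h)
  then obtain \<gamma> where \<gamma>: "\<gamma> \<in> set \<gamma>s" "h = \<rho> \<gamma>" by auto
  then have "inv\<^bsub>alt_group n\<^esub> h = \<rho> (reversepath \<gamma>)"
   using alt_group_inv_equality pi1_carrier[OF d(2) p] pi1_rev[OF d(2) p] by metis
  then show ?case using pin_rev[OF p[OF \<gamma>(1)]] by metis
 next
  case (eng h1 h2)
  then obtain \<gamma>1 \<gamma>2 where "pin (P1 - S) b b \<gamma>1" "\<rho> \<gamma>1 = h1" "pin (P1 - S) b b \<gamma>2" "\<rho> \<gamma>2 = h2"
   by blast
  then show ?case using pi1_join[OF d(2)] pin_join unfolding alt_group_mult by metis
 qed
 then show ?thesis using that by blast
qed

section \<open>Inner and absolute equivalence, and the index of the alternating group\<close>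

section \<open>Equivalence of covers and the degree of the map to the absolute space\<close>

text \<open>Allows the inner and the absolute space to be treated at once, \<open>A\<close> being
  the alternating or the symmetric group.\<close>

definition perm_group :: "nat => (nat => nat) set => bool" where
 "perm_group n A \<longleftrightarrow> id \<in> A \<and> (\<forall>a\<in>A. a permutes {1..n} \<and> inv' a \<in> A) \<and> (\<forall>a\<in>A. \<forall>c\<in>A. a \<circ> c \<in> A)"

lemma perm_group_sym: "perm_group n (carrier (sym_group n))"
 by (auto simp: perm_group_def sym_group_carrier permutes_id permutes_inv permutes_compose)

lemma perm_group_alt: "perm_group n (carrier (alt_group n))"
 unfolding perm_group_def
proof (intro conjI ballI)
 show "id \<in> carrier (alt_group n)" by (simp add: alt_group_carrier permutes_id evenperm_id)
 show "a \<circ> c \<in> carrier (alt_group n)" if "a \<in> carrier (alt_group n)" "c \<in> carrier (alt_group n)" for a c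
  using that alt_group_carrier'[OF that(1)] alt_group_carrier'[OF that(2)]
  by (auto simp: alt_group_carrier evenperm_comp permutes_compose)
 show "a permutes {1..n}" if "a \<in> carrier (alt_group n)" for a using that unfolding alt_group_carrier by blast
qed (rule alt_group_inv_closed)

lemma cover_equiv_iff:
 "((S, b, \<rho>), (S', b', \<rho>')) \<in> cover_equiv n r A \<longleftrightarrow>
  (S, b, \<rho>) \<in> hurwitz_data n r \<and> (S', b', \<rho>') \<in> hurwitz_data n r \<and> S' = S \<and>
  (\<exists>\<delta> a. pin (P1 - S) b b' \<delta> \<and> a \<in> A \<and>
   (\<forall>\<gamma>. pin (P1 - S) b' b' \<gamma> \<longrightarrow> a \<circ> \<rho> (cjp \<delta> \<gamma>) = \<rho>' \<gamma> \<circ> a))"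
 unfolding cover_equiv_def loops_at_pin pin_def[of "P1 - S" b b'] cjp_def by auto

lemma hurwitz_dataD:
 assumes "(S, b, \<rho>) \<in> hurwitz_data n r"
 shows "b \<in> P1 - S" "pi1_hom n (P1 - S) b \<rho>" "finite S" "S \<subseteq> P1" "card S = r"
 using assms unfolding hurwitz_data_iff by blast+

lemma cover_equivI:
 assumes "(S, b, \<rho>) \<in> hurwitz_data n r" "(S, b', \<rho>') \<in> hurwitz_data n r" "pin (P1 - S) b b' \<delta>" "a \<in> A"
  "\<And>\<gamma>. pin (P1 - S) b' b' \<gamma> ==> a \<circ> \<rho> (cjp \<delta> \<gamma>) = \<rho>' \<gamma> \<circ> a"
 shows "((S, b, \<rho>), (S, b', \<rho>')) \<in> cover_equiv n r A"
 unfolding cover_equiv_iff using assms by blast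

lemma equiv_cover_equiv:
 assumes A: "perm_group n A" shows "equiv (hurwitz_data n r) (cover_equiv n r A)"
proof (rule equivI)
 show "cover_equiv n r A \<subseteq> hurwitz_data n r \<times> hurwitz_data n r" unfolding cover_equiv_def by auto
 show "refl_on (hurwitz_data n r) (cover_equiv n r A)"
 proof (rule refl_onI)
  fix d assume "d \<in> hurwitz_data n r"
  moreover obtain S b \<rho> where d: "d = (S, b, \<rho>)" by (cases d)
  ultimately have dd: "(S, b, \<rho>) \<in> hurwitz_data n r" by simp
  note D = hurwitz_dataD[OF dd]
  show "(d, d) \<in> cover_equiv n r A" unfolding d
  proof (rule cover_equivI[OF dd dd pin_const[OF D(1)]])
   show "id \<in> A" using A by (simp add: perm_group_def)
   show "id \<circ> \<rho> (cjp (linepath b b) \<gamma>) = \<rho> \<gamma> \<circ> id" if "pin (P1 - S) b b \<gamma>" for \<gamma>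
    using pi1_hp[OF D(2) that hp_sym[OF hp_cjp_triv[OF that]]] by simp
  qed
 qed
 show "sym (cover_equiv n r A)"
 proof (rule symI)
  fix d d' assume dd: "(d, d') \<in> cover_equiv n r A"
  obtain S b \<rho> where d: "d = (S, b, \<rho>)" by (cases d)
  obtain S' b' \<rho>' where d': "d' = (S', b', \<rho>')" by (cases d')
  obtain \<delta> a where *: "(S, b, \<rho>) \<in> hurwitz_data n r" "(S, b', \<rho>') \<in> hurwitz_data n r" "S' = S"
   "pin (P1 - S) b b' \<delta>" "a \<in> A"
   "\<And>\<gamma>. pin (P1 - S) b' b' \<gamma> ==> a \<circ> \<rho> (cjp \<delta> \<gamma>) = \<rho>' \<gamma> \<circ> a"
   using dd unfolding d d' cover_equiv_iff by blast
  have ba: "bij a" "inv' a \<in> A" using *(5) A permutes_bij by (auto simp: perm_group_def)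
  show "(d', d) \<in> cover_equiv n r A" unfolding d d' *(3)
  proof (rule cover_equivI[OF *(2,1) pin_rev[OF *(4)] ba(2)])
   fix \<gamma> assume g: "pin (P1 - S) b b \<gamma>"
   note D = hurwitz_dataD[OF *(1)]
   have "\<rho> \<gamma> = \<rho> (cjp \<delta> (cjp (reversepath \<delta>) \<gamma>))"
    by (rule pi1_hp[OF D(2) g hp_sym[OF hp_cjp_rev[OF *(4) g]]])
   then have "a \<circ> \<rho> \<gamma> = \<rho>' (cjp (reversepath \<delta>) \<gamma>) \<circ> a"
    using *(6)[OF pin_cjp[OF pin_rev[OF *(4)] g]] by simp
   then have "inv' a \<circ> (a \<circ> \<rho> \<gamma>) \<circ> inv' a = inv' a \<circ> (\<rho>' (cjp (reversepath \<delta>) \<gamma>) \<circ> a) \<circ> inv' a"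
    by simp
   then show "inv' a \<circ> \<rho>' (cjp (reversepath \<delta>) \<gamma>) = \<rho> \<gamma> \<circ> inv' a"
    using ba(1) by (auto simp: fun_eq_iff bij_is_inj bij_is_surj surj_f_inv_f)
  qed
 qed
 show "trans (cover_equiv n r A)"
 proof (rule transI)
  fix d d' d'' assume dd: "(d, d') \<in> cover_equiv n r A" "(d', d'') \<in> cover_equiv n r A"
  obtain S b \<rho> where d: "d = (S, b, \<rho>)" by (cases d)
  obtain S' b' \<rho>' where d': "d' = (S', b', \<rho>')" by (cases d')
  obtain S'' b'' \<rho>'' where d'': "d'' = (S'', b'', \<rho>'')" by (cases d'')
  obtain \<delta> a where *: "(S, b, \<rho>) \<in> hurwitz_data n r" "(S, b', \<rho>') \<in> hurwitz_data n r" "S' = S"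
   "pin (P1 - S) b b' \<delta>" "a \<in> A"
   "\<And>\<gamma>. pin (P1 - S) b' b' \<gamma> ==> a \<circ> \<rho> (cjp \<delta> \<gamma>) = \<rho>' \<gamma> \<circ> a"
   using dd(1) unfolding d d' cover_equiv_iff by blast
  obtain \<delta>' a' where **: "(S, b'', \<rho>'') \<in> hurwitz_data n r" "S'' = S"
   "pin (P1 - S) b' b'' \<delta>'" "a' \<in> A"
   "\<And>\<gamma>. pin (P1 - S) b'' b'' \<gamma> ==> a' \<circ> \<rho>' (cjp \<delta>' \<gamma>) = \<rho>'' \<gamma> \<circ> a'"
   using dd(2) unfolding d' d'' cover_equiv_iff *(3) by blast
  show "(d, d'') \<in> cover_equiv n r A" unfolding d d'' **(2)
  proof (rule cover_equivI[OF *(1) **(1) pin_join[OF *(4) **(3)]])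
   show "a' \<circ> a \<in> A" using A * ** by (simp add: perm_group_def)
   fix \<gamma> assume g: "pin (P1 - S) b'' b'' \<gamma>"
   note D = hurwitz_dataD[OF *(1)]
   note g' = pin_cjp[OF **(3) g]
   have "\<rho> (cjp (\<delta> +++ \<delta>') \<gamma>) = \<rho> (cjp \<delta> (cjp \<delta>' \<gamma>))"
    by (rule pi1_hp[OF D(2) pin_cjp[OF pin_join[OF *(4) **(3)] g] hp_cjp_cjp[OF *(4) **(3) g]])
   then have "a' \<circ> a \<circ> \<rho> (cjp (\<delta> +++ \<delta>') \<gamma>) = a' \<circ> (\<rho>' (cjp \<delta>' \<gamma>) \<circ> a)"
    using *(6)[OF g'] by (simp add: comp_assoc)
   also have "\<dots> = \<rho>'' \<gamma> \<circ> a' \<circ> a" using **(5)[OF g] by (simp add: o_assoc)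
   finally show "a' \<circ> a \<circ> \<rho> (cjp (\<delta> +++ \<delta>') \<gamma>) = \<rho>'' \<gamma> \<circ> (a' \<circ> a)"
    by (simp add: o_assoc)
  qed
 qed
qed

abbreviation cls :: "nat => nat => (nat => nat) set => datum => datum set" where
 "cls n r A d \<equiv> cover_equiv n r A `` {d}"

lemma cls_eq_iff:
 assumes "perm_group n A" "d \<in> hurwitz_data n r" "d' \<in> hurwitz_data n r"
 shows "cls n r A d = cls n r A d' \<longleftrightarrow> (d, d') \<in> cover_equiv n r A"
 using eq_equiv_class_iff[OF equiv_cover_equiv[OF assms(1)] assms(2,3)] .

lemma cls_base:
 assumes "perm_group n A" "(S, b, \<rho>) \<in> hurwitz_data n r" "pin (P1 - S) b c \<delta>"
 shows "cls n r A (S, c, \<lambda>\<gamma>. \<rho> (cjp \<delta> \<gamma>)) = cls n r A (S, b, \<rho>)"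
proof -
 have "((S, b, \<rho>), (S, c, \<lambda>\<gamma>. \<rho> (cjp \<delta> \<gamma>))) \<in> cover_equiv n r A"
  using assms(1) by (intro cover_equivI[OF assms(2) hurwitz_data_base[OF assms(2,3)] assms(3), of id])
   (auto simp: perm_group_def)
 then show ?thesis using cls_eq_iff[OF assms(1,2) hurwitz_data_base[OF assms(2,3)]] by simp
qed

lemma cover_equiv_same_base:
 assumes "(S, b, \<rho>) \<in> hurwitz_data n r" "(S, b, \<rho>') \<in> hurwitz_data n r" "a \<in> A"
  "\<And>\<gamma>. pin (P1 - S) b b \<gamma> ==> a \<circ> \<rho> \<gamma> = \<rho>' \<gamma> \<circ> a"
 shows "((S, b, \<rho>), (S, b, \<rho>')) \<in> cover_equiv n r A"
proof -
 note D = hurwitz_dataD[OF assms(1)]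
 show ?thesis
 proof (rule cover_equivI[OF assms(1,2) pin_const[OF D(1)] assms(3)])
  fix \<gamma> assume g: "pin (P1 - S) b b \<gamma>"
  show "a \<circ> \<rho> (cjp (linepath b b) \<gamma>) = \<rho>' \<gamma> \<circ> a"
   using pi1_hp[OF D(2) g hp_sym[OF hp_cjp_triv[OF g]]] assms(4)[OF g] by simp
 qed
qed

lemma cls_cj:
 assumes "perm_group n A" "(S, b, \<rho>) \<in> hurwitz_data n r" "s \<in> A" "n \<ge> 3"
 shows "cls n r A (S, b, \<lambda>\<gamma>. cj s (\<rho> \<gamma>)) = cls n r A (S, b, \<rho>)"
proof -
 have s: "s permutes {1..n}" using assms by (auto simp: perm_group_def)
 note d' = hurwitz_data_cj[OF assms(2) s assms(4)]
 have "((S, b, \<rho>), (S, b, \<lambda>\<gamma>. cj s (\<rho> \<gamma>))) \<in> cover_equiv n r A" using permutes_bij[OF s]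
  by (intro cover_equiv_same_base[OF assms(2) d' assms(3)]) (auto simp: cj_def fun_eq_iff bij_is_inj)
 then show ?thesis using cls_eq_iff[OF assms(1,2) d'] by simp
qed

lemma cls_cong:
 assumes "perm_group n A" "(S, b, \<rho>) \<in> hurwitz_data n r" "(S, b, \<rho>') \<in> hurwitz_data n r"
  "\<And>\<gamma>. pin (P1 - S) b b \<gamma> ==> \<rho> \<gamma> = \<rho>' \<gamma>"
 shows "cls n r A (S, b, \<rho>) = cls n r A (S, b, \<rho>')"
 using cover_equiv_same_base[OF assms(2,3), of id A] assms(4) assms(1)
 unfolding cls_eq_iff[OF assms(1,2,3)] by (simp add: perm_group_def)

text \<open>If \<open>c\<close> moved \<open>x\<close>, it would commute with a three-cycle
  \<open>(x y z)\<close> that fixes \<open>c x\<close>; evaluated at \<open>x\<close> this gives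
  \<open>c y = c x\<close>.\<close>

lemma alt_centralizer:
 assumes "n \<ge> 5" "c permutes {1..n}" "\<And>g. g \<in> carrier (alt_group n) ==> c \<circ> g = g \<circ> c"
 shows "c = id"
proof (rule ccontr)
 assume "c \<noteq> id"
 then obtain x where cx: "c x \<noteq> x" by (metis eq_id_iff)
 then have x: "x \<in> {1..n}" "c x \<in> {1..n}" using assms(2) permutes_not_in permutes_in_image by metis+
 have "card ({1..n} - {x, c x}) = n - 2" using x cx by (subst card_Diff_subset) auto
 then have "\<not> card ({1..n} - {x, c x}) \<le> Suc 0" using assms(1) by simp
 then obtain y z where yz: "y \<in> {1..n} - {x, c x}" "z \<in> {1..n} - {x, c x}" "y \<noteq> z"
  using card_le_Suc0_iff_eq[of "{1..n} - {x, c x}"] by blast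
 have "tc x y z \<in> tc3 {1..n}" using yz x by (intro tc3I) auto
 then have "tc x y z \<in> carrier (alt_group n)" using three_cycles_incl[of n] three_cycles_eq_tc3[of n] by blast
 then have "c (tc x y z x) = tc x y z (c x)" using assms(3) by (metis comp_apply)
 then have "c y = c x" using yz cx by (auto simp: tc_apply)
 then show False using yz permutes_inj[OF assms(2)] by (auto simp: inj_eq)
qed

text \<open>A fixed representative of the odd coset; conjugating the monodromy by it gives the other
  inner class in the same absolute class.\<close>

definition odd_swap :: "nat => nat" where
 "odd_swap = Transposition.transpose 1 2"

lemma odd_swap:
 assumes "n \<ge> 5"
 shows "odd_swap permutes {1..n}" "\<not> evenperm odd_swap" "permutation odd_swap" "bij odd_swap"
  "inv' odd_swap = odd_swap" "odd_swap \<circ> odd_swap = id"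
proof -
 show p: "odd_swap permutes {1..n}" unfolding odd_swap_def using assms by (intro permutes_swap_id) auto
 show "permutation odd_swap" using p by (auto simp: permutation_permutes)
 show "bij odd_swap" using p permutes_bij by blast
qed (auto simp: odd_swap_def evenperm_swap)

text \<open>An odd \<open>a\<close> factors through the fixed transposition: after the twist the
  identification is made by the even \<open>a \<circ> odd_swap\<close>.\<close>

lemma cover_equiv_sym_cases:
 assumes n: "n \<ge> 5" and eq: "((S, b, \<rho>), d') \<in> cover_equiv n r (carrier (sym_group n))"
 shows "((S, b, \<rho>), d') \<in> cover_equiv n r (carrier (alt_group n)) \<or>
  ((S, b, \<lambda>\<gamma>. cj odd_swap (\<rho> \<gamma>)), d') \<in> cover_equiv n r (carrier (alt_group n))"
proof -
 obtain S' b' \<rho>' where d': "d' = (S', b', \<rho>')" by (cases d')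
 obtain \<delta> a where *: "(S, b, \<rho>) \<in> hurwitz_data n r" "(S, b', \<rho>') \<in> hurwitz_data n r" "S' = S"
  "pin (P1 - S) b b' \<delta>" "a permutes {1..n}"
  "\<And>\<gamma>. pin (P1 - S) b' b' \<gamma> ==> a \<circ> \<rho> (cjp \<delta> \<gamma>) = \<rho>' \<gamma> \<circ> a"
  using eq unfolding d' cover_equiv_iff sym_group_carrier by blast
 note \<tau> = odd_swap[OF n]
 show ?thesis
 proof (cases "evenperm a")
  case True
  then have "((S, b, \<rho>), d') \<in> cover_equiv n r (carrier (alt_group n))"
   unfolding d' *(3) using * by (intro cover_equivI[OF *(1,2,4)]) (auto simp: alt_group_carrier)
  then show ?thesis ..
 next
  case False
  have pa: "permutation a" using *(5) by (auto simp: permutation_permutes)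
  have "((S, b, \<lambda>\<gamma>. cj odd_swap (\<rho> \<gamma>)), d') \<in> cover_equiv n r (carrier (alt_group n))"
   unfolding d' *(3)
  proof (rule cover_equivI[OF hurwitz_data_cj[OF *(1) \<tau>(1)] *(2,4)])
   show "a \<circ> odd_swap \<in> carrier (alt_group n)"
    using False pa \<tau> permutes_compose[OF \<tau>(1) *(5)] by (simp add: alt_group_carrier evenperm_comp)
   fix \<gamma> assume g: "pin (P1 - S) b' b' \<gamma>"
   have "a \<circ> odd_swap \<circ> cj odd_swap (\<rho> (cjp \<delta> \<gamma>)) = a \<circ> (odd_swap \<circ> odd_swap) \<circ> \<rho> (cjp \<delta> \<gamma>) \<circ> odd_swap"
    by (simp only: cj_def \<tau>(5) o_assoc)
   also have "\<dots> = \<rho>' \<gamma> \<circ> a \<circ> odd_swap" by (simp only: \<tau>(6) comp_id *(6)[OF g])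
   finally show "a \<circ> odd_swap \<circ> cj odd_swap (\<rho> (cjp \<delta> \<gamma>)) = \<rho>' \<gamma> \<circ> (a \<circ> odd_swap)"
    by (simp only: o_assoc)
  qed (use n in simp)
  then show ?thesis ..
 qed
qed

lemma cover_equiv_mono: "A \<subseteq> B ==> cover_equiv n r A \<subseteq> cover_equiv n r B"
 unfolding cover_equiv_def by fastforce

lemma alt_subset_sym: "carrier (alt_group n) \<subseteq> carrier (sym_group n)"
 by (auto simp: alt_group_carrier sym_group_carrier)

text \<open>Suppose an even \<open>a\<close> identified a datum with its twist along a loop with
  value \<open>p\<close>. Since the monodromy is surjective,
  \<open>odd_swap \<circ> a \<circ> inv' p\<close> centralizes the alternating group and is trivial.
  Then \<open>a = odd_swap \<circ> p\<close> is odd.\<close>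

lemma odd_swap_not_equiv:
 assumes n: "n \<ge> 5" and d: "(S, b, \<rho>) \<in> hurwitz_data n r"
 shows "((S, b, \<rho>), (S, b, \<lambda>\<gamma>. cj odd_swap (\<rho> \<gamma>))) \<notin> cover_equiv n r (carrier (alt_group n))"
proof
 assume "((S, b, \<rho>), (S, b, \<lambda>\<gamma>. cj odd_swap (\<rho> \<gamma>))) \<in> cover_equiv n r (carrier (alt_group n))"
 then obtain \<delta> a where *: "pin (P1 - S) b b \<delta>" "a permutes {1..n}" "evenperm a"
  "\<And>\<gamma>. pin (P1 - S) b b \<gamma> ==> a \<circ> \<rho> (cjp \<delta> \<gamma>) = cj odd_swap (\<rho> \<gamma>) \<circ> a"
  unfolding cover_equiv_iff alt_group_carrier by blast
 note \<tau> = odd_swap[OF n]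
 note D = hurwitz_dataD[OF d]
 define p where "p = \<rho> \<delta>"
 have p: "p permutes {1..n}" "evenperm p" "bij p"
  using pi1_carrier[OF D(2) *(1)] pi1_bij[OF D(2) *(1)] by (auto simp: p_def alt_group_carrier)
 define c where "c = odd_swap \<circ> a \<circ> inv' p"
 have cp: "c permutes {1..n}" unfolding c_def using p permutes_inv[OF p(1)] \<tau>(1) *(2) by (intro permutes_compose) auto
 have "c = id"
 proof (rule alt_centralizer[OF n cp])
  fix g assume "g \<in> carrier (alt_group n)"
  then obtain \<gamma> where g: "pin (P1 - S) b b \<gamma>" "\<rho> \<gamma> = g" using pi1_surj[OF d] by blast
  have "a \<circ> (inv' p \<circ> g \<circ> p) = odd_swap \<circ> g \<circ> odd_swap \<circ> a"
   using *(4)[OF g(1)] pi1_cjp[OF D(2) *(1) g(1)] g(2) p(3) by (simp add: p_def[symmetric] cj_def \<tau>(5) inv_inv_eq)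
  then have "odd_swap \<circ> (a \<circ> (inv' p \<circ> g \<circ> p)) \<circ> inv' p = odd_swap \<circ> (odd_swap \<circ> g \<circ> odd_swap \<circ> a) \<circ> inv' p"
   by simp
  then have "odd_swap \<circ> a \<circ> inv' p \<circ> g \<circ> (p \<circ> inv' p) = (odd_swap \<circ> odd_swap) \<circ> g \<circ> (odd_swap \<circ> a \<circ> inv' p)"
   by (simp only: o_assoc)
  moreover have "p \<circ> inv' p = id" using p(3) by (metis bij_is_surj surj_iff)
  ultimately show "c \<circ> g = g \<circ> c" unfolding c_def by (simp only: \<tau>(6) comp_id id_comp o_assoc)
 qed
 then have "odd_swap \<circ> (odd_swap \<circ> a \<circ> inv' p) \<circ> p = odd_swap \<circ> id \<circ> p"
  unfolding c_def by simp
 then have "(odd_swap \<circ> odd_swap) \<circ> a \<circ> (inv' p \<circ> p) = odd_swap \<circ> p"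
  by (simp only: o_assoc comp_id)
 moreover have "inv' p \<circ> p = id" using p(3) bij_is_inj by fastforce
 ultimately have "a = odd_swap \<circ> p" by (simp only: \<tau>(6) comp_id id_comp)
 moreover have "permutation p" using p(1) by (auto simp: permutation_permutes)
 ultimately show False using *(3) p(2) \<tau>(2,3) by (simp add: evenperm_comp)
qed

lemma psi_cls:
 assumes "d \<in> hurwitz_data n r"
 shows "psi_in_abs n r (cls n r (carrier (alt_group n)) d) = cls n r (carrier (sym_group n)) d"
proof -
 note es = equiv_cover_equiv[OF perm_group_sym, of n r] and ea = equiv_cover_equiv[OF perm_group_alt, of n r]
 show ?thesis unfolding psi_in_abs_def
 proof (rule subset_antisym)
  show "cover_equiv n r (carrier (sym_group n)) `` cls n r (carrier (alt_group n)) d \<subseteq> cls n r (carrier (sym_group n)) d"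
   using cover_equiv_mono[OF alt_subset_sym, of n r] es unfolding equiv_def trans_def by blast
  have "d \<in> cls n r (carrier (alt_group n)) d" using equiv_class_self[OF ea assms] .
  then show "cls n r (carrier (sym_group n)) d \<subseteq> cover_equiv n r (carrier (sym_group n)) `` cls n r (carrier (alt_group n)) d"
   by blast
 qed
qed

text \<open>An absolute class is the union of the inner classes of a datum and of its twist, and
  these are distinct. Continuity rests on the same splitting: the preimage of a basic neighbourhood
  is the union of the basic neighbourhoods of the datum and of its twist with the same
  discs.\<close>

lemma has_map_degree_psi:
 assumes n: "n \<ge> 5"
 shows "has_map_degree (hurwitz_in n r) (hurwitz_abs n r) (psi_in_abs n r) 2"
proof -
 let ?A = "carrier (alt_group n)" and ?S = "carrier (sym_group n)"
 note es = equiv_cover_equiv[OF perm_group_sym, of n r] and ea = equiv_cover_equiv[OF perm_group_alt, of n r]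
 note \<tau> = odd_swap[OF n]
 have n3: "n \<ge> 3" using n by simp
 define tw where "tw = (\<lambda>(S :: point set, b :: point, \<rho>). (S, b, \<lambda>\<gamma> :: real => point. cj odd_swap (\<rho> \<gamma>)))"
 have tw_data: "tw d \<in> hurwitz_data n r" if "d \<in> hurwitz_data n r" for d
  using that hurwitz_data_cj[OF _ \<tau>(1) n3] by (cases d) (auto simp: tw_def)
 have tw_sym: "cls n r ?S (tw d) = cls n r ?S d" if "d \<in> hurwitz_data n r" for d
  using that cls_cj[OF perm_group_sym _ _ n3, of _ _ _ r odd_swap] \<tau>(1)
  by (cases d) (auto simp: tw_def sym_group_carrier)
 have tw_ne: "cls n r ?A d \<noteq> cls n r ?A (tw d)" if "d \<in> hurwitz_data n r" for d
  using that odd_swap_not_equiv[OF n] tw_data[OF that] unfolding cls_eq_iff[OF perm_group_alt that tw_data[OF that]]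
  by (cases d) (auto simp: tw_def)
 have cases: "cls n r ?A d' = cls n r ?A d \<or> cls n r ?A d' = cls n r ?A (tw d)"
  if "d \<in> hurwitz_data n r" "d' \<in> hurwitz_data n r" "cls n r ?S d' = cls n r ?S d" for d d'
 proof -
  have "(d, d') \<in> cover_equiv n r ?S" using cls_eq_iff[OF perm_group_sym that(1,2)] that(3) by simp
  then have "(d, d') \<in> cover_equiv n r ?A \<or> (tw d, d') \<in> cover_equiv n r ?A"
   using cover_equiv_sym_cases[OF n] by (cases d) (auto simp: tw_def)
  then show ?thesis
  proof
   assume "(d, d') \<in> cover_equiv n r ?A"
   from iffD2[OF cls_eq_iff[OF perm_group_alt that(1,2)] this] show ?thesis by (rule disjI1[OF sym])
  next
   assume "(tw d, d') \<in> cover_equiv n r ?A"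
   from iffD2[OF cls_eq_iff[OF perm_group_alt tw_data[OF that(1)] that(2)] this] show ?thesis by (rule disjI2[OF sym])
  qed
 qed
 have ts: "topspace (hurwitz_in n r) = hurwitz_data n r // cover_equiv n r ?A"
  "topspace (hurwitz_abs n r) = hurwitz_data n r // cover_equiv n r ?S"
  by (simp_all add: hurwitz_in_def hurwitz_abs_def topspace_hurwitz_space)
 have fibre: "card {x \<in> topspace (hurwitz_in n r). psi_in_abs n r x = y} = 2"
  if y: "y \<in> topspace (hurwitz_abs n r)" for y
 proof -
  obtain d where d: "d \<in> hurwitz_data n r" "y = cls n r ?S d" using y unfolding ts by (rule quotientE)
  have "{x \<in> topspace (hurwitz_in n r). psi_in_abs n r x = y} = {cls n r ?A d, cls n r ?A (tw d)}"
  proof (rule subset_antisym; rule subsetI)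
   fix x assume "x \<in> {x \<in> topspace (hurwitz_in n r). psi_in_abs n r x = y}"
   then have x: "x \<in> hurwitz_data n r // cover_equiv n r ?A" "psi_in_abs n r x = y" using ts by auto
   obtain d' where d': "d' \<in> hurwitz_data n r" "x = cls n r ?A d'" using x(1) by (rule quotientE)
   then have "cls n r ?S d' = cls n r ?S d" using x(2) d(2) psi_cls by metis
   then show "x \<in> {cls n r ?A d, cls n r ?A (tw d)}" using cases[OF d(1) d'(1)] d'(2) by blast
  next
   fix x assume "x \<in> {cls n r ?A d, cls n r ?A (tw d)}"
   then show "x \<in> {x \<in> topspace (hurwitz_in n r). psi_in_abs n r x = y}"
    using d psi_cls[OF d(1)] psi_cls[OF tw_data[OF d(1)]] tw_sym[OF d(1)] tw_data[OF d(1)] by (auto simp: ts quotientI)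
  qed
  then show ?thesis using tw_ne[OF d(1)] by simp
 qed
 have "continuous_map (hurwitz_in n r) (hurwitz_abs n r) (psi_in_abs n r)"
 proof -
  let ?B = "\<lambda>A. {hurwitz_nbhd n r A d e | d e. d \<in> hurwitz_data n r \<and> admissible_radius d e}"
  have pre: "psi_in_abs n r -` hurwitz_nbhd n r ?S d e \<inter> topspace (hurwitz_in n r) =
   hurwitz_nbhd n r ?A d e \<union> hurwitz_nbhd n r ?A (tw d) e" if "d \<in> hurwitz_data n r" for d e
  proof -
   obtain S b \<rho> where d: "d = (S, b, \<rho>)" by (cases d)
   define C where "C S' \<rho>' \<longleftrightarrow> (S', b, \<rho>') \<in> hurwitz_data n r \<and> S' \<subseteq> (\<Union>s\<in>S. ball s e) \<and>
    (\<forall>s\<in>S. \<exists>!s'. s' \<in> S' \<inter> ball s e)" for S' \<rho>'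
   have nb: "hurwitz_nbhd n r A (S, b, \<rho>) e = {cls n r A (S', b, \<rho>') | S' \<rho>'. C S' \<rho>' \<and>
    (\<forall>\<gamma> \<in> loops_at (P1 - (\<Union>s\<in>S. ball s e)) b. \<rho>' \<gamma> = \<rho> \<gamma>)}" for A \<rho>
    unfolding hurwitz_nbhd_def C_def prod.case by (simp only: conj_assoc)
   have Cj: "C S' (\<lambda>\<gamma>. cj odd_swap (\<rho>' \<gamma>))" if "C S' \<rho>'" for S' \<rho>'
    using that hurwitz_data_cj[OF _ \<tau>(1) n3] unfolding C_def by blast
   show ?thesis
   proof (rule subset_antisym; rule subsetI)
    fix c assume "c \<in> psi_in_abs n r -` hurwitz_nbhd n r ?S d e \<inter> topspace (hurwitz_in n r)"
    then have c: "psi_in_abs n r c \<in> hurwitz_nbhd n r ?S (S, b, \<rho>) e" "c \<in> hurwitz_data n r // cover_equiv n r ?A"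
     using ts d by auto
    obtain d' where d': "d' \<in> hurwitz_data n r" "c = cls n r ?A d'" using c(2) by (rule quotientE)
    obtain S' \<rho>' where S': "psi_in_abs n r c = cls n r ?S (S', b, \<rho>')" "C S' \<rho>'"
     "\<forall>\<gamma> \<in> loops_at (P1 - (\<Union>s\<in>S. ball s e)) b. \<rho>' \<gamma> = \<rho> \<gamma>"
     using c(1) unfolding nb by blast
    have dd: "(S', b, \<rho>') \<in> hurwitz_data n r" using S'(2) by (simp add: C_def)
    have "cls n r ?S d' = cls n r ?S (S', b, \<rho>')" using S'(1) psi_cls[OF d'(1)] d'(2) by simp
    then have "c = cls n r ?A (S', b, \<rho>') \<or> c = cls n r ?A (S', b, \<lambda>\<gamma>. cj odd_swap (\<rho>' \<gamma>))"
     using cases[OF dd d'(1)] d'(2) by (simp add: tw_def)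
    moreover have "cls n r ?A (S', b, \<rho>') \<in> hurwitz_nbhd n r ?A d e" unfolding d nb using S'(2,3) by blast
    moreover have "cls n r ?A (S', b, \<lambda>\<gamma>. cj odd_swap (\<rho>' \<gamma>)) \<in> hurwitz_nbhd n r ?A (tw d) e"
     unfolding d tw_def prod.case nb
     by (intro CollectI exI[of _ S'] exI[of _ "\<lambda>\<gamma>. cj odd_swap (\<rho>' \<gamma>)"] conjI refl Cj[OF S'(2)])
      (use S'(3) in simp)
    ultimately show "c \<in> hurwitz_nbhd n r ?A d e \<union> hurwitz_nbhd n r ?A (tw d) e" by blast
   next
    fix c assume c: "c \<in> hurwitz_nbhd n r ?A d e \<union> hurwitz_nbhd n r ?A (tw d) e"
    have "\<exists>S' \<rho>'. c = cls n r ?A (S', b, \<rho>') \<and> C S' \<rho>' \<and>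
     (\<forall>\<gamma> \<in> loops_at (P1 - (\<Union>s\<in>S. ball s e)) b. \<rho>' \<gamma> = \<rho> \<gamma> \<or> False) \<or>
     c = cls n r ?A (S', b, \<rho>') \<and> C S' \<rho>' \<and>
     (\<forall>\<gamma> \<in> loops_at (P1 - (\<Union>s\<in>S. ball s e)) b. \<rho>' \<gamma> = cj odd_swap (\<rho> \<gamma>))"
     using c unfolding d tw_def prod.case nb by blast
    then obtain S' \<rho>' where S': "c = cls n r ?A (S', b, \<rho>')" "C S' \<rho>'"
     "(\<forall>\<gamma> \<in> loops_at (P1 - (\<Union>s\<in>S. ball s e)) b. \<rho>' \<gamma> = \<rho> \<gamma>) \<or>
      (\<forall>\<gamma> \<in> loops_at (P1 - (\<Union>s\<in>S. ball s e)) b. \<rho>' \<gamma> = cj odd_swap (\<rho> \<gamma>))"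
     by blast
    have dd: "(S', b, \<rho>') \<in> hurwitz_data n r" using S'(2) by (simp add: C_def)
    have psi: "psi_in_abs n r c = cls n r ?S (S', b, \<rho>')" using psi_cls[OF dd] S'(1) by simp
    have "psi_in_abs n r c \<in> hurwitz_nbhd n r ?S d e" using S'(3)
    proof
     assume "\<forall>\<gamma> \<in> loops_at (P1 - (\<Union>s\<in>S. ball s e)) b. \<rho>' \<gamma> = \<rho> \<gamma>"
     then show ?thesis unfolding d nb psi using S'(2) by blast
    next
     assume *: "\<forall>\<gamma> \<in> loops_at (P1 - (\<Union>s\<in>S. ball s e)) b. \<rho>' \<gamma> = cj odd_swap (\<rho> \<gamma>)"
     have "cls n r ?S (S', b, \<rho>') = cls n r ?S (S', b, \<lambda>\<gamma>. cj odd_swap (\<rho>' \<gamma>))"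
      using tw_sym[OF dd] by (simp add: tw_def)
     moreover have "\<forall>\<gamma> \<in> loops_at (P1 - (\<Union>s\<in>S. ball s e)) b. cj odd_swap (\<rho>' \<gamma>) = \<rho> \<gamma>"
      using * cj_cj[OF \<tau>(4,4)] \<tau>(6) by simp
     ultimately show ?thesis unfolding d nb psi using Cj[OF S'(2)] by blast
    qed
    moreover have "c \<in> topspace (hurwitz_in n r)" unfolding ts S'(1) using dd by (rule quotientI)
    ultimately show "c \<in> psi_in_abs n r -` hurwitz_nbhd n r ?S d e \<inter> topspace (hurwitz_in n r)" by blast
   qed
  qed
  have "continuous_map (hurwitz_in n r) (topology_generated_by (?B ?S)) (psi_in_abs n r)"
  proof (rule continuous_on_generated_topo)
   fix U assume "U \<in> ?B ?S"
   then obtain d e where U: "U = hurwitz_nbhd n r ?S d e" "d \<in> hurwitz_data n r" "admissible_radius d e" by blast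
   have "admissible_radius (tw d) e" using U(3) by (cases d) (simp add: tw_def admissible_radius_def)
   then have "openin (hurwitz_in n r) (hurwitz_nbhd n r ?A d e)" "openin (hurwitz_in n r) (hurwitz_nbhd n r ?A (tw d) e)"
    unfolding hurwitz_in_def hurwitz_space_def using U tw_data[OF U(2)] by (intro topology_generated_by_Basis; blast)+
   then show "openin (hurwitz_in n r) (psi_in_abs n r -` U \<inter> topspace (hurwitz_in n r))"
    unfolding U(1) pre[OF U(2)] by (rule openin_Un)
  next
   have "\<Union> (?B ?S) = topspace (hurwitz_abs n r)"
    unfolding hurwitz_abs_def hurwitz_space_def topology_generated_by_topspace ..
   moreover have "psi_in_abs n r ` topspace (hurwitz_in n r) \<subseteq> topspace (hurwitz_abs n r)"
    unfolding ts using psi_cls by (auto simp: quotient_def)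
   ultimately show "psi_in_abs n r ` topspace (hurwitz_in n r) \<subseteq> \<Union> (?B ?S)" by simp
  qed
  then show ?thesis by (simp add: hurwitz_abs_def hurwitz_space_def)
 qed
 then show ?thesis using fibre by (simp add: has_map_degree_def)
qed

section \<open>Transport of covers along isotopies that fix the base point\<close>

section \<open>Isotopies of the sphere\<close>

lemma circlepath_0: "circlepath 0 e x = complex_of_real e * exp (2 * of_real pi * \<i> * of_real x)"
 by (simp add: circlepath)

lemma norm_circle: "0 \<le> e ==> norm (complex_of_real e * exp (2 * of_real pi * \<i> * of_real x)) = e"
 by (simp add: norm_mult)

lemma small_circle_eq:
 "small_circle s e x = local_param s (complex_of_real e * exp (2 * of_real pi * \<i> * of_real x))"
 by (simp add: small_circle_def circlepath_0)

lemma local_param_finite: "s \<noteq> infty ==> local_param s w = stereo (affine_coord s + w)"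
 by (simp add: local_param_def)

lemma local_param_in_P1: "local_param s w \<in> P1"
 by (simp add: local_param_def)

lemma local_param_0: "s \<in> P1 ==> local_param s 0 = s"
 by (simp add: local_param_def stereo_affine_coord)

lemma local_param_ne: "s \<in> P1 ==> w \<noteq> 0 ==> local_param s w \<noteq> s"
 using stereo_inj[of "affine_coord s + w" "affine_coord s"] stereo_affine_coord[of s]
 by (cases "s = infty") (simp_all add: local_param_def)

lemma continuous_on_local_param:
 assumes "continuous_on T f" "\<And>x. x \<in> T ==> f x \<noteq> 0"
 shows "continuous_on T (\<lambda>x. local_param s (f x))"
proof (cases "s = infty")
 case True
 have "continuous_on T (\<lambda>x. stereo (1 / f x))" using assms by (intro continuous_intros) auto
 then show ?thesis by (rule continuous_on_eq) (use assms(2) in \<open>simp add: local_param_def True\<close>)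
next
 case False
 then show ?thesis using assms(1) unfolding local_param_def by (auto intro!: continuous_intros)
qed

lemma local_param_avoid:
 assumes "s \<in> P1" "local_param s ` cball 0 e \<inter> S = {s}" "w \<noteq> 0" "norm w \<le> e"
 shows "local_param s w \<in> P1 - S"
proof -
 have "local_param s w \<in> local_param s ` cball 0 e" using assms(4) by auto
 then show ?thesis using assms(2) local_param_ne[OF assms(1,3)] local_param_in_P1 by blast
qed

lemma circle_ne_0: "e > 0 ==> complex_of_real e * exp (2 * of_real pi * \<i> * of_real x) \<noteq> 0"
 by simp

lemma small_circle_pin:
 assumes "s \<in> P1" "local_param s ` cball 0 e \<inter> S = {s}" "e > 0"
 shows "pin (P1 - S) (local_param s (of_real e)) (local_param s (of_real e)) (small_circle s e)"
proof -
 have "path (small_circle s e)" unfolding path_def small_circle_eq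
  using assms(3) by (intro continuous_on_local_param continuous_intros) auto
 moreover have "path_image (small_circle s e) \<subseteq> P1 - S" unfolding path_image_def small_circle_eq
  using local_param_avoid[OF assms(1,2)] norm_circle[of e] assms(3) by (auto simp: circle_ne_0)
 moreover have "pathstart (small_circle s e) = local_param s (of_real e)" by (simp add: pathstart_def small_circle_eq)
 ultimately show ?thesis unfolding pin_def using small_circle_ends[of s e] by simp
qed

text \<open>The radius shrinks linearly; all circles stay in the punctured disc, which contains no
  point of \<open>S\<close>.\<close>

lemma small_circle_free:
 assumes s: "s \<in> P1" and e: "0 < e'" "e' \<le> e" and av: "local_param s ` cball 0 e \<inter> S = {s}"
 shows "\<exists>\<sigma>. pin (P1 - S) (local_param s (of_real e)) (local_param s (of_real e')) \<sigma> \<and>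
  hp (P1 - S) (small_circle s e) (cjp \<sigma> (small_circle s e'))"
proof -
 define rad where "rad u = (1 - u) * e + u * e'" for u
 have rad: "0 < rad u" "rad u \<le> e" if "u \<in> {0..1}" for u
 proof -
  have "rad u - e' = (1 - u) * (e - e')" "e - rad u = u * (e - e')" by (simp_all add: rad_def algebra_simps)
  moreover have "0 \<le> (1 - u) * (e - e')" "0 \<le> u * (e - e')" using that e by auto
  ultimately have "0 \<le> rad u - e'" "0 \<le> e - rad u" by simp_all
  then show "0 < rad u" "rad u \<le> e" using e by auto
 qed
 define H where "H = (\<lambda>p. local_param s (complex_of_real (rad (fst p)) * exp (2 * of_real pi * \<i> * of_real (snd p))))"
 have "\<exists>\<sigma>. pin (P1 - S) (H (0, 0)) (H (1, 0)) \<sigma> \<and>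
   hp (P1 - S) (\<lambda>x. H (0, x)) (cjp \<sigma> (\<lambda>x. H (1, x)))"
 proof (rule free_homotopy_cjp)
  show "continuous_on ({0..1} \<times> {0..1}) H"
  proof -
   have "continuous_on ({0..1} \<times> {0..1}) (\<lambda>p :: real \<times> real. rad (fst p))"
    unfolding rad_def by (intro continuous_intros)
   moreover have "complex_of_real (rad (fst p)) * exp (2 * of_real pi * \<i> * of_real (snd p)) \<noteq> 0"
    if "p \<in> {0..1} \<times> {0..1}" for p :: "real \<times> real"
    using rad(1)[of "fst p"] that by (intro circle_ne_0) auto
   ultimately show ?thesis unfolding H_def by (intro continuous_on_local_param continuous_intros)
  qed
  show "H ` ({0..1} \<times> {0..1}) \<subseteq> P1 - S"
  proof (rule image_subsetI)
   fix p assume "p \<in> {0..1::real} \<times> {0..1::real}"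
   then have "fst p \<in> {0..1}" by auto
   from rad[OF this] show "H p \<in> P1 - S" unfolding H_def using norm_circle[of "rad (fst p)" "snd p"]
    by (intro local_param_avoid[OF s av]) (auto simp: circle_ne_0)
  qed
  show "H (u, 1) = H (u, 0)" for u by (simp add: H_def)
 qed
 then show ?thesis by (simp add: H_def rad_def small_circle_eq[abs_def])
qed

lemma comp_cjp: "f \<circ> cjp \<delta> \<gamma> = cjp (f \<circ> \<delta>) (f \<circ> \<gamma>)"
 by (simp add: cjp_def path_compose_join path_compose_reversepath)

lemma comp_path_prod: "f b = b ==> f \<circ> path_prod b ws = path_prod b (map ((\<circ>) f) ws)"
proof (induction ws)
 case Nil
 have "f \<circ> linepath b b = linepath b b" using Nil by (auto simp: linepath_refl)
 then show ?case unfolding list.map path_prod_simps .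
next
 case (Cons w ws)
 show ?case unfolding list.map path_prod_simps path_compose_join Cons.IH[OF Cons.prems] ..
qed

lemma list_all2_eq_in: "list_all2 P xs ys ==> list_all2 (\<lambda>x y. x \<in> set xs \<and> P x y) xs ys"
 by (auto simp: list_all2_conv_all_nth)

text \<open>The inverses \<open>k t\<close> are part of the data, since monodromy is transported by
  pulling loops back, and joint continuity of \<open>k\<close> supplies the homotopies between
  pull-backs at different times.\<close>

locale isotopy =
 fixes h k :: "real => point => point" and b :: point
 assumes hc: "continuous_on ({0..1} \<times> P1) (\<lambda>x. h (fst x) (snd x))"
  and kc: "continuous_on ({0..1} \<times> P1) (\<lambda>x. k (fst x) (snd x))"
  and hP: "t \<in> {0..1} ==> y \<in> P1 ==> h t y \<in> P1"
  and kP: "t \<in> {0..1} ==> y \<in> P1 ==> k t y \<in> P1"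
  and kh: "t \<in> {0..1} ==> y \<in> P1 ==> k t (h t y) = y"
  and hk: "t \<in> {0..1} ==> y \<in> P1 ==> h t (k t y) = y"
  and h0: "y \<in> P1 ==> h 0 y = y"
  and hb: "t \<in> {0..1} ==> h t b = b"
  and bP: "b \<in> P1"
begin

lemma kb: "t \<in> {0..1} ==> k t b = b"
 using kh[of t b] hb bP by simp

lemma k0: "y \<in> P1 ==> k 0 y = y"
 using kh[of 0 y] h0 by simp

lemma h_cont_on:
 assumes "continuous_on T f" "continuous_on T g" "\<And>x. x \<in> T ==> f x \<in> {0..1}" "\<And>x. x \<in> T ==> g x \<in> P1"
 shows "continuous_on T (\<lambda>x. h (f x) (g x))"
proof -
 have "continuous_on T (\<lambda>x. (f x, g x))" using assms(1,2) by (rule continuous_on_Pair)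
 moreover have "(\<lambda>x. (f x, g x)) ` T \<subseteq> {0..1} \<times> P1" using assms(3,4) by auto
 ultimately show ?thesis using continuous_on_compose2[OF hc, of T "\<lambda>x. (f x, g x)"] by simp
qed

lemma k_cont_on:
 assumes "continuous_on T f" "continuous_on T g" "\<And>x. x \<in> T ==> f x \<in> {0..1}" "\<And>x. x \<in> T ==> g x \<in> P1"
 shows "continuous_on T (\<lambda>x. k (f x) (g x))"
proof -
 have "continuous_on T (\<lambda>x. (f x, g x))" using assms(1,2) by (rule continuous_on_Pair)
 moreover have "(\<lambda>x. (f x, g x)) ` T \<subseteq> {0..1} \<times> P1" using assms(3,4) by auto
 ultimately show ?thesis using continuous_on_compose2[OF kc, of T "\<lambda>x. (f x, g x)"] by simp
qed

lemma h_cont: "t \<in> {0..1} ==> continuous_on P1 (h t)"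
 using h_cont_on[of P1 "\<lambda>_. t" "\<lambda>y. y"] by (simp add: continuous_on_id)

lemma k_cont: "t \<in> {0..1} ==> continuous_on P1 (k t)"
 using k_cont_on[of P1 "\<lambda>_. t" "\<lambda>y. y"] by (simp add: continuous_on_id)

lemma h_inj: "t \<in> {0..1} ==> y \<in> P1 ==> y' \<in> P1 ==> h t y = h t y' \<longleftrightarrow> y = y'"
 using kh by metis

context
 fixes S :: "point set"
 assumes S: "S \<subseteq> P1" "finite S" "b \<notin> S"
begin

lemma h_maps: "t \<in> {0..1} ==> h t ` (P1 - S) \<subseteq> P1 - h t ` S"
 using S(1) hP h_inj by blast

lemma k_maps: "t \<in> {0..1} ==> k t ` (P1 - h t ` S) \<subseteq> P1 - S"
proof (rule image_subsetI)
 fix y assume "t \<in> {0..1}" "y \<in> P1 - h t ` S"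
 then show "k t y \<in> P1 - S" using kP[of t y] hk[of t y] by (metis Diff_iff imageI)
qed

lemma h_cont': "t \<in> {0..1} ==> continuous_on (P1 - S) (h t)"
 by (rule continuous_on_subset[OF h_cont]) blast+

lemma k_cont': "t \<in> {0..1} ==> continuous_on (P1 - h t ` S) (k t)"
 by (rule continuous_on_subset[OF k_cont]) blast+

lemma h_pin: "t \<in> {0..1} ==> pin (P1 - S) x y p ==> pin (P1 - h t ` S) (h t x) (h t y) (h t \<circ> p)"
 using pin_image[OF _ h_cont' h_maps] by blast

lemma k_pin: "t \<in> {0..1} ==> pin (P1 - h t ` S) x y p ==> pin (P1 - S) (k t x) (k t y) (k t \<circ> p)"
 using pin_image[OF _ k_cont' k_maps] by blast

lemma h_hp: "t \<in> {0..1} ==> hp (P1 - S) p q ==> hp (P1 - h t ` S) (h t \<circ> p) (h t \<circ> q)"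
 using hp_image[OF _ h_cont' h_maps] by blast

lemma k_hp: "t \<in> {0..1} ==> hp (P1 - h t ` S) p q ==> hp (P1 - S) (k t \<circ> p) (k t \<circ> q)"
 using hp_image[OF _ k_cont' k_maps] by blast

lemma kh_path:
 assumes "t \<in> {0..1}" "pin (P1 - S) x y p" shows "hp (P1 - S) (k t \<circ> (h t \<circ> p)) p"
proof (rule homotopic_paths_eq[THEN hp_sym])
 show "path p" "path_image p \<subseteq> P1 - S" using assms(2) by (auto simp: pin_def)
 fix u :: real assume "u \<in> {0..1}"
 then have "p u \<in> P1" using assms(2) unfolding pin_def path_image_def by blast
 then show "p u = (k t \<circ> (h t \<circ> p)) u" using kh[OF assms(1), of "p u"] by simp
qed

lemma hk_path:
 assumes "t \<in> {0..1}" "pin (P1 - h t ` S) x y p" shows "hp (P1 - h t ` S) (h t \<circ> (k t \<circ> p)) p"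
proof (rule homotopic_paths_eq[THEN hp_sym])
 show "path p" "path_image p \<subseteq> P1 - h t ` S" using assms(2) by (auto simp: pin_def)
 fix u :: real assume "u \<in> {0..1}"
 then have "p u \<in> P1" using assms(2) unfolding pin_def path_image_def by blast
 then show "p u = (h t \<circ> (k t \<circ> p)) u" using hk[OF assms(1), of "p u"] by simp
qed

text \<open>Pulling back the small circles around the moving branch point gives a free homotopy in the
 complement of the original branch points.\<close>

lemma meridian_transport:
 assumes t: "t \<in> {0..1}" and s: "s \<in> S" and fin: "\<And>u. u \<in> {0..1} ==> h u s \<noteq> infty"
  and mer: "meridian S b s \<gamma>"
 shows "meridian (h t ` S) b (h t s) (h t \<circ> \<gamma>)"
proof -
 have sP: "s \<in> P1" using s S by auto
 obtain e \<delta> where e: "e > 0" "local_param s ` cball 0 e \<inter> S = {s}"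
  "pin (P1 - S) b (pathstart (small_circle s e)) \<delta>"
  "hp (P1 - S) \<gamma> (cjp \<delta> (small_circle s e))" using mer unfolding meridian_cjp_iff by blast
 define a where "a u = affine_coord (h u s)" for u
 have a_cont: "continuous_on {0..1} a" unfolding a_def using fin hP sP
  by (intro continuous_on_affine_coord h_cont_on continuous_intros) auto
 have ast: "stereo (a u) = h u s" if "u \<in> {0..1}" for u using stereo_affine_coord hP fin sP that by (simp add: a_def)
 define K where "K = {0..1::real} \<times> cball (0::complex) 1"
 have K: "compact K" unfolding K_def by (intro compact_Times) auto
 define F where "F x = stereo (a (fst x) + snd x)" for x
 have F: "continuous_on K F" unfolding F_def K_def by (intro continuous_intros continuous_on_compose2[OF a_cont]) auto
 \<comment> \<open>Times and displacements at which the disc around the moving point meets another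
   moving branch point. By compactness the displacements stay away from zero, so one radius is safe
   during the whole isotopy.\<close>
 define bad where "bad s' = {x \<in> K. F x - h (fst x) s' = 0}" for s'
 have bad: "compact (bad s')" if "s' \<in> P1" for s'
 proof -
  have "continuous_on K (\<lambda>x. F x - h (fst x) s')"
   using that by (intro continuous_intros F h_cont_on) (auto simp: K_def)
  then have "closed (bad s')"
   unfolding bad_def using K compact_imp_closed by (intro continuous_closed_preimage_constant) auto
  moreover have "bad s' = K \<inter> bad s'" by (auto simp: bad_def)
  ultimately show ?thesis using K compact_Int_closed by metis
 qed
 define N where "N = (\<lambda>x. norm (snd x)) ` (\<Union>s'\<in>S - {s}. bad s')"
 have "compact N" unfolding N_def using bad S by (intro compact_continuous_image compact_UN continuous_intros) auto
 moreover have "0 \<notin> N"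
 proof
  assume "0 \<in> N"
  then obtain x where "x \<in> (\<Union>s'\<in>S - {s}. bad s')" "0 = norm (snd x)" unfolding N_def by blast
  then obtain s' where s': "s' \<in> S - {s}" "x \<in> bad s'" "snd x = 0" by auto
  have "fst x \<in> {0..1}" "F x = h (fst x) s'" using s'(2) by (auto simp: bad_def K_def)
  then have "h (fst x) s = h (fst x) s'" using ast[of "fst x"] s'(3) by (simp add: F_def)
  then show False using h_inj[OF \<open>fst x \<in> {0..1}\<close> sP, of s'] s'(1) S(1) by blast
 qed
 ultimately obtain d where d: "d > 0" "\<And>x. x \<in> N ==> d \<le> dist 0 x"
  using separate_point_closed[of N 0] compact_imp_closed by blast
 define e' where "e' = min (min (d / 2) 1) e"
 have e': "0 < e'" "e' < d" "e' \<le> 1" "e' \<le> e" using e(1) d(1) by (auto simp: e'_def)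
 have av: "stereo (a u + w) \<noteq> h u s'" if "u \<in> {0..1}" "norm w \<le> e'" "s' \<in> S" "s' \<noteq> s" for u w s'
 proof
  assume "stereo (a u + w) = h u s'"
  then have "(u, w) \<in> bad s'" using that e' by (auto simp: bad_def F_def K_def)
  then have "norm w \<in> N" unfolding N_def using that by force
  then show False using d(2)[of "norm w"] that e' by simp
 qed
 have lp: "local_param (h u s) w = stereo (a u + w)" if "u \<in> {0..1}" for u w
  using fin[OF that] by (simp add: local_param_finite a_def)
 have disc: "local_param (h t s) ` cball 0 e' \<inter> h t ` S = {h t s}"
 proof (rule subset_antisym; rule subsetI)
  fix y assume "y \<in> local_param (h t s) ` cball 0 e' \<inter> h t ` S"
  then obtain w s' where "norm w \<le> e'" "y = stereo (a t + w)" "s' \<in> S" "y = h t s'" using lp[OF t] by auto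
  then show "y \<in> {h t s}" using av[OF t, of w s'] by (cases "s' = s") auto
 next
  fix y assume "y \<in> {h t s}"
  moreover have "h t s \<in> local_param (h t s) ` cball 0 e'"
   using lp[OF t, of 0] ast[OF t] e' by (intro image_eqI[of _ _ 0]) auto
  ultimately show "y \<in> local_param (h t s) ` cball 0 e' \<inter> h t ` S" using s by auto
 qed
 define C where "C = small_circle (h t s) e'"
 have C: "C x = stereo (a t + complex_of_real e' * exp (2 * of_real pi * \<i> * of_real x))" for x
  by (simp add: C_def small_circle_eq lp[OF t])
 obtain \<sigma>1 where \<sigma>1: "pin (P1 - S) (local_param s (of_real e)) (local_param s (of_real e')) \<sigma>1"
  "hp (P1 - S) (small_circle s e) (cjp \<sigma>1 (small_circle s e'))"
  using small_circle_free[OF sP e'(1,4) e(2)] by blast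
 \<comment> \<open>For first coordinate 0 this is the circle around \<open>s\<close>, for 1 it is
   the pull-back of the circle around \<open>h t s\<close>.\<close>
 define H where "H = (\<lambda>p. k (t * fst p) (stereo (a (t * fst p) + complex_of_real e' * exp (2 * of_real pi * \<i> * of_real (snd p)))))"
 have tu: "t * u \<in> {0..1}" if "u \<in> {0..1}" for u using t that by (auto intro: mult_le_one)
 have "\<exists>\<sigma>. pin (P1 - S) (H (0, 0)) (H (1, 0)) \<sigma> \<and>
   hp (P1 - S) (\<lambda>x. H (0, x)) (cjp \<sigma> (\<lambda>x. H (1, x)))"
 proof (rule free_homotopy_cjp)
  show "continuous_on ({0..1} \<times> {0..1}) H" unfolding H_def using tu
   by (intro k_cont_on continuous_intros continuous_on_compose2[OF a_cont]) auto
  show "H ` ({0..1} \<times> {0..1}) \<subseteq> P1 - S"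
  proof (rule image_subsetI)
   fix p assume "p \<in> {0..1::real} \<times> {0..1::real}"
   then have u: "t * fst p \<in> {0..1}" using tu by auto
   define w where "w = complex_of_real e' * exp (2 * of_real pi * \<i> * of_real (snd p))"
   have w: "norm w = e'" "w \<noteq> 0" using norm_circle[of e' "snd p"] e' by (auto simp: w_def)
   have "k (t * fst p) (stereo (a (t * fst p) + w)) \<notin> S"
   proof
    assume in_S: "k (t * fst p) (stereo (a (t * fst p) + w)) \<in> S"
    define s' where "s' = k (t * fst p) (stereo (a (t * fst p) + w))"
    have "h (t * fst p) s' = stereo (a (t * fst p) + w)" unfolding s'_def using hk[OF u] by simp
    then have "s' = s" using av[OF u, of w s'] w in_S by (auto simp: s'_def)
    then have "stereo (a (t * fst p) + w) = stereo (a (t * fst p))"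
     using ast[OF u] \<open>h (t * fst p) s' = _\<close> by simp
    then show False using w by simp
   qed
   then show "H p \<in> P1 - S" using kP[OF u] by (simp add: H_def w_def)
  qed
  show "H (u, 1) = H (u, 0)" for u by (simp add: H_def)
 qed
 moreover have "(\<lambda>x. H (0, x)) = small_circle s e'" using lp[of 0] h0[OF sP] k0 by (auto simp: H_def small_circle_eq)
 moreover have "(\<lambda>x. H (1, x)) = k t \<circ> C" by (auto simp: H_def C)
 moreover have "H (0, 0) = local_param s (of_real e')" using lp[of 0] h0[OF sP] k0 by (simp add: H_def)
 moreover have "H (1, 0) = k t (pathstart C)" by (simp add: H_def C pathstart_def)
 ultimately obtain \<sigma>2 where \<sigma>2: "pin (P1 - S) (local_param s (of_real e')) (k t (pathstart C)) \<sigma>2"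
  "hp (P1 - S) (small_circle s e') (cjp \<sigma>2 (k t \<circ> C))" by auto
 have e'_disc: "local_param s ` cball 0 e' \<inter> S = {s}"
 proof -
  have "local_param s ` cball 0 e' \<subseteq> local_param s ` cball 0 e" using e' by (intro image_mono) auto
  moreover have "s \<in> local_param s ` cball 0 e'" using local_param_0[OF sP] e' by (intro image_eqI[of _ _ 0]) auto
  ultimately show ?thesis using e(2) s by blast
 qed
 have st: "pathstart (small_circle s e) = local_param s (of_real e)" by (simp add: pathstart_def small_circle_eq)
 note \<delta> = e(3)[unfolded st]
 note pe = small_circle_pin[OF sP e(2,1)] and pe' = small_circle_pin[OF sP e'_disc e'(1)]
 have pkC: "pin (P1 - S) (k t (pathstart C)) (k t (pathstart C)) (k t \<circ> C)"
  using cjp_end_pin(2)[OF \<sigma>2(2,1)] small_circle_ends[of "h t s" e']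
  by (simp add: pathstart_compose pathfinish_compose C_def)
 have "hp (P1 - S) \<gamma> (cjp \<delta> (small_circle s e))" by (rule e(4))
 also have "hp (P1 - S) \<dots> (cjp \<delta> (cjp \<sigma>1 (small_circle s e')))"
  by (rule hp_cjp[OF \<sigma>1(2) \<delta> pe])
 also have "hp (P1 - S) \<dots> (cjp \<delta> (cjp \<sigma>1 (cjp \<sigma>2 (k t \<circ> C))))"
  by (rule hp_cjp[OF hp_cjp[OF \<sigma>2(2) \<sigma>1(1) pe'] \<delta> pin_cjp[OF \<sigma>1(1) pe']])
 also have "hp (P1 - S) \<dots> (cjp \<delta> (cjp (\<sigma>1 +++ \<sigma>2) (k t \<circ> C)))"
  by (rule hp_cjp[OF hp_sym[OF hp_cjp_cjp[OF \<sigma>1(1) \<sigma>2(1) pkC]] \<delta> pin_cjp[OF \<sigma>1(1) pin_cjp[OF \<sigma>2(1) pkC]]])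
 also have "hp (P1 - S) \<dots> (cjp (\<delta> +++ (\<sigma>1 +++ \<sigma>2)) (k t \<circ> C))"
  by (rule hp_sym[OF hp_cjp_cjp[OF \<delta> pin_join[OF \<sigma>1(1) \<sigma>2(1)] pkC]])
 finally have "hp (P1 - h t ` S) (h t \<circ> \<gamma>) (h t \<circ> cjp (\<delta> +++ (\<sigma>1 +++ \<sigma>2)) (k t \<circ> C))"
  by (rule h_hp[OF t])
 moreover have "h t \<circ> (k t \<circ> C) = C"
 proof
  show "(h t \<circ> (k t \<circ> C)) x = C x" for x using hk[OF t, of "C x"] by (simp add: C)
 qed
 ultimately have "hp (P1 - h t ` S) (h t \<circ> \<gamma>) (cjp (h t \<circ> (\<delta> +++ (\<sigma>1 +++ \<sigma>2))) C)"
  by (simp add: comp_cjp)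
 moreover have "pin (P1 - h t ` S) b (pathstart C) (h t \<circ> (\<delta> +++ (\<sigma>1 +++ \<sigma>2)))"
  using h_pin[OF t pin_join[OF \<delta> pin_join[OF \<sigma>1(1) \<sigma>2(1)]]] hb[OF t] hk[OF t] by (simp add: C pathstart_def)
 ultimately show ?thesis unfolding meridian_cjp_iff using e'(1) disc C_def by blast
qed

end

text \<open>The transported monodromy evaluates a loop on its pull-back. Transport of meridians
  enters as a hypothesis because a branch point at infinity needs an argument of its own.\<close>

lemma hurwitz_data_transport:
 assumes d: "(S, b, \<rho>) \<in> hurwitz_data n r" and t: "t \<in> {0..1}"
  and mer: "\<And>s \<gamma>. s \<in> S ==> meridian S b s \<gamma> ==> meridian (h t ` S) b (h t s) (h t \<circ> \<gamma>)"
 shows "(h t ` S, b, \<lambda>\<gamma>. \<rho> (k t \<circ> \<gamma>)) \<in> hurwitz_data n r"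
proof -
 note D = hurwitz_dataD[OF d]
 have S: "S \<subseteq> P1" "finite S" "b \<notin> S" using D by auto
 let ?Y = "P1 - S" and ?Z = "P1 - h t ` S"
 have bZ: "b \<in> ?Z" using h_maps[OF S t] D(1) hb[OF t] by (metis imageI subsetD)
 have kpin: "pin ?Y b b (k t \<circ> \<gamma>)" if "pin ?Z b b \<gamma>" for \<gamma>
  using k_pin[OF S t that] kb[OF t] by simp
 have hpt: "pi1_hom n ?Z b (\<lambda>\<gamma>. \<rho> (k t \<circ> \<gamma>))" unfolding pi1_hom_iff
 proof (intro conjI allI impI)
  fix \<gamma> assume g: "pin ?Z b b \<gamma>"
  show "\<rho> (k t \<circ> \<gamma>) \<in> carrier (alt_group n)" by (rule pi1_carrier[OF D(2) kpin[OF g]])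
  show "\<rho> (k t \<circ> \<gamma>) = \<rho> (k t \<circ> \<gamma>')" if "hp ?Z \<gamma> \<gamma>'" for \<gamma>'
   by (rule pi1_hp[OF D(2) kpin[OF g] k_hp[OF S t that]])
  show "\<rho> (k t \<circ> (\<gamma> +++ \<gamma>')) = \<rho> (k t \<circ> \<gamma>') \<circ> \<rho> (k t \<circ> \<gamma>)" if "pin ?Z b b \<gamma>'" for \<gamma>'
   using pi1_join[OF D(2) kpin[OF g] kpin[OF that]] by (simp add: path_compose_join)
 qed
 obtain \<gamma>s where g: "classical_generators S b \<gamma>s" "map \<rho> \<gamma>s \<in> nielsen_class n r"
  using d unfolding hurwitz_data_iff by blast
 have gp: "pin ?Y b b \<gamma>" if "\<gamma> \<in> set \<gamma>s" for \<gamma>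
  using classical_generators_pin g(1) that by blast
 have hg: "pin ?Z b b (h t \<circ> \<gamma>)" if "pin ?Y b b \<gamma>" for \<gamma> using h_pin[OF S t that] hb[OF t] by simp
 have tuple: "map (\<lambda>\<gamma>. \<rho> (k t \<circ> \<gamma>)) (map ((\<circ>) (h t)) \<gamma>s) = map \<rho> \<gamma>s"
 proof (unfold map_map, rule map_cong[OF refl])
  fix \<gamma> assume "\<gamma> \<in> set \<gamma>s"
  from pi1_hp[OF D(2) gp[OF this] hp_sym[OF kh_path[OF S t gp[OF this]]]]
  show "((\<lambda>\<gamma>. \<rho> (k t \<circ> \<gamma>)) \<circ> (\<circ>) (h t)) \<gamma> = \<rho> \<gamma>" by simp
 qed
 have "classical_generators (h t ` S) b (map ((\<circ>) (h t)) \<gamma>s)" unfolding classical_generators_iff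
 proof (intro conjI allI impI)
  show loops: "set (map ((\<circ>) (h t)) \<gamma>s) \<subseteq> loops_at ?Z b" using gp hg by (auto simp: loops_at_pin)
  obtain ss where ss: "distinct ss" "set ss = S" "list_all2 (meridian S b) ss \<gamma>s"
   using g(1) unfolding classical_generators_iff by blast
  show "\<exists>ss. distinct ss \<and> set ss = h t ` S \<and> list_all2 (meridian (h t ` S) b) ss (map ((\<circ>) (h t)) \<gamma>s)"
  proof (intro exI[of _ "map (h t) ss"] conjI)
   show "distinct (map (h t) ss)" unfolding distinct_map
   proof (intro conjI inj_onI)
    show "x = y" if "x \<in> set ss" "y \<in> set ss" "h t x = h t y" for x y
     using that h_inj[OF t, of x y] ss(2) S(1) by blast
   qed (rule ss(1))
   show "list_all2 (meridian (h t ` S) b) (map (h t) ss) (map ((\<circ>) (h t)) \<gamma>s)"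
    unfolding list_all2_map1 list_all2_map2
   proof (rule list_all2_mono[OF list_all2_eq_in[OF ss(3)]])
    show "meridian (h t ` S) b (h t x) (h t \<circ> y)" if "x \<in> set ss \<and> meridian S b x y" for x y
     using mer[of x y] that ss(2) by blast
   qed
  qed (use ss in auto)
  have "hp ?Y (path_prod b \<gamma>s) (linepath b b)" using g(1) unfolding classical_generators_iff by blast
  from h_hp[OF S t this] show "hp ?Z (path_prod b (map ((\<circ>) (h t)) \<gamma>s)) (linepath b b)"
   using comp_path_prod[of "h t" b \<gamma>s] comp_path_prod[of "h t" b "[]"] hb[OF t] by (metis list.map(1) path_prod_simps(1))
  fix \<gamma> assume c: "pin ?Z b b \<gamma>"
  obtain ws where ws: "set ws \<subseteq> set \<gamma>s \<union> reversepath ` set \<gamma>s" "hp ?Y (k t \<circ> \<gamma>) (path_prod b ws)"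
   using g(1) kpin[OF c] unfolding classical_generators_iff words_def by blast
  have "hp ?Z (h t \<circ> (k t \<circ> \<gamma>)) (path_prod b (map ((\<circ>) (h t)) ws))"
   using h_hp[OF S t ws(2)] comp_path_prod[of "h t" b ws] hb[OF t] by simp
  then have "hp ?Z \<gamma> (path_prod b (map ((\<circ>) (h t)) ws))"
   using hp_trans[OF hp_sym[OF hk_path[OF S t c]]] by blast
  moreover have "set (map ((\<circ>) (h t)) ws) \<subseteq> set (map ((\<circ>) (h t)) \<gamma>s) \<union> reversepath ` set (map ((\<circ>) (h t)) \<gamma>s)"
  proof
   fix v assume "v \<in> set (map ((\<circ>) (h t)) ws)"
   then obtain w where w: "w \<in> set ws" "v = h t \<circ> w" by auto
   then consider "w \<in> set \<gamma>s" | g where "g \<in> set \<gamma>s" "w = reversepath g" using ws(1) by blast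
   then show "v \<in> set (map ((\<circ>) (h t)) \<gamma>s) \<union> reversepath ` set (map ((\<circ>) (h t)) \<gamma>s)"
    by cases (auto simp: w path_compose_reversepath)
  qed
  ultimately show "\<gamma> \<in> words ?Z b (set (map ((\<circ>) (h t)) \<gamma>s))" unfolding words_def by blast
 qed
 moreover have "card (h t ` S) = r" "h t ` S \<subseteq> P1" "finite (h t ` S)"
 proof -
  have "inj_on (h t) S" by (rule inj_onI) (use h_inj[OF t] S(1) in blast)
  then show "card (h t ` S) = r" using D(5) card_image by blast
 qed (use D hP[OF t] in blast)+
 ultimately show ?thesis unfolding hurwitz_data_iff using bZ hpt g(2) tuple by metis
qed

text \<open>The classes of the transported covers form a continuous path. The difficulty is that a
  basic neighbourhood is centred at a datum with another base point and another numbering, so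
  membership is tested after moving along \<open>\<delta>\<close> and conjugating by
  \<open>a\<close>.\<close>

lemma isotopy_component:
 assumes A: "perm_group n A" and n: "n \<ge> 3" and d: "(S, b, \<rho>) \<in> hurwitz_data n r"
  and mer: "\<And>t s \<gamma>. t \<in> {0..1} ==> s \<in> S ==> meridian S b s \<gamma> ==> meridian (h t ` S) b (h t s) (h t \<circ> \<gamma>)"
 shows "connected_component_of (hurwitz_space n r A) (cls n r A (S, b, \<rho>))
  (cls n r A (h 1 ` S, b, \<lambda>\<gamma>. \<rho> (k 1 \<circ> \<gamma>)))"
proof -
 let ?X = "hurwitz_space n r A"
 note D = hurwitz_dataD[OF d]
 have S: "S \<subseteq> P1" "finite S" "b \<notin> S" using D by auto
 define dt where "dt t = (h t ` S, b, \<lambda>\<gamma>. \<rho> (k t \<circ> \<gamma>))" for t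
 have dt: "dt t \<in> hurwitz_data n r" if "t \<in> {0..1}" for t
  unfolding dt_def using hurwitz_data_transport[OF d that mer[OF that]] by blast
 define f where "f t = cls n r A (dt t)" for t
 have f_top: "f t \<in> topspace ?X" if "t \<in> {0..1}" for t
  unfolding topspace_hurwitz_space f_def using dt[OF that] by (rule quotientI)
 let ?B = "{hurwitz_nbhd n r A d e | d e. d \<in> hurwitz_data n r \<and> admissible_radius d e}"
 have "continuous_map (top_of_set {0..1}) (topology_generated_by ?B) f"
 proof (rule continuous_on_generated_topo)
  show "f ` topspace (top_of_set {0..1}) \<subseteq> \<Union> ?B"
   using f_top unfolding hurwitz_space_def topology_generated_by_topspace by auto
  fix U assume "U \<in> ?B"
  then obtain d' e where U0: "U = hurwitz_nbhd n r A d' e" "d' \<in> hurwitz_data n r" "admissible_radius d' e" by blast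
  obtain S' c \<rho>' where d': "d' = (S', c, \<rho>')" by (cases d')
  have adm: "e > 0" "\<And>s s'. s \<in> S' ==> s' \<in> S' ==> s \<noteq> s' ==> 2 * e < dist s s'"
   using U0(3) unfolding d' admissible_radius_def by auto
  have disj: "s = s'" if "s \<in> S'" "s' \<in> S'" "y \<in> ball s e" "y \<in> ball s' e" for s s' y
  proof (rule ccontr)
   assume "s \<noteq> s'"
   then have "2 * e < dist s s'" using adm that by blast
   moreover have "dist s s' \<le> dist s y + dist s' y" using dist_triangle2 .
   ultimately show False using that by simp
  qed
  have "\<exists>\<epsilon>>0. \<forall>t'\<in>{0..1}. dist t' t < \<epsilon> \<longrightarrow> t' \<in> f -` U \<inter> {0..1}" if tU: "t \<in> f -` U \<inter> {0..1}" for t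
  proof -
   have t: "t \<in> {0..1}" and ft: "f t \<in> U" using tU by auto
   obtain S1 \<rho>1 where 1: "f t = cls n r A (S1, c, \<rho>1)" "(S1, c, \<rho>1) \<in> hurwitz_data n r"
    "S1 \<subseteq> (\<Union>s\<in>S'. ball s e)" "\<forall>s\<in>S'. \<exists>!s'. s' \<in> S1 \<inter> ball s e"
    "\<forall>\<gamma> \<in> loops_at (P1 - (\<Union>s\<in>S'. ball s e)) c. \<rho>1 \<gamma> = \<rho>' \<gamma>"
    using ft unfolding U0(1) d' hurwitz_nbhd_def prod.case by blast
   have "(dt t, (S1, c, \<rho>1)) \<in> cover_equiv n r A" using 1(1) cls_eq_iff[OF A dt[OF t] 1(2)] by (simp add: f_def)
   then obtain \<delta> a where 2: "S1 = h t ` S" "pin (P1 - h t ` S) b c \<delta>" "a \<in> A"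
    "\<And>\<gamma>. pin (P1 - h t ` S) c c \<gamma> ==> a \<circ> \<rho> (k t \<circ> cjp \<delta> \<gamma>) = \<rho>1 \<gamma> \<circ> a"
    unfolding dt_def cover_equiv_iff by blast
   have ap: "a permutes {1..n}" "bij a" using 2(3) A permutes_bij by (auto simp: perm_group_def)
   \<comment> \<open>Loops outside the discs, conjugated by \<open>\<delta>\<close>, run inside this
     closed set. For times close to \<open>t\<close> the moving branch points stay off it and inside
     their discs.\<close>
   define K where "K = (P1 - (\<Union>s\<in>S'. ball s e)) \<union> path_image \<delta>"
   have "closed K"
   proof -
    have "closed P1" "open (\<Union>s\<in>S'. ball s e)" by (auto simp: P1_def)
    moreover have "closed (path_image \<delta>)" using 2(2) by (auto simp: pin_def intro: closed_path_image)
    ultimately show ?thesis unfolding K_def by (intro closed_Un closed_Diff)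
   qed
   have KS: "h t s \<notin> K" if "s \<in> S" for s
   proof -
    have "h t s \<in> (\<Union>s\<in>S'. ball s e)" "h t s \<notin> path_image \<delta>"
     using that 1(3) 2(1,2) unfolding pin_def by blast+
    then show ?thesis unfolding K_def by blast
   qed
   have KP: "K \<subseteq> P1" using 2(2) by (auto simp: K_def pin_def)
   have "\<forall>s\<in>S. \<exists>s'\<in>S'. h t s \<in> ball s' e" using 1(3) 2(1) by blast
   then obtain ctr where ctr: "\<And>s. s \<in> S ==> ctr s \<in> S' \<and> h t s \<in> ball (ctr s) e"
    by metis
   have "\<forall>s\<in>S. \<forall>\<^sub>F u in at t within {0..1}. h u s \<in> ball (ctr s) e - K"
   proof
    fix s assume s: "s \<in> S"
    have "continuous_on {0..1} (\<lambda>u. h u s)" using S s by (intro h_cont_on continuous_intros) auto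
    then have "((\<lambda>u. h u s) \<longlongrightarrow> h t s) (at t within {0..1})"
     using t by (auto simp: continuous_on_def)
    moreover have "open (ball (ctr s) e - K)" "h t s \<in> ball (ctr s) e - K"
     using \<open>closed K\<close> ctr[OF s] KS[OF s] by auto
    ultimately show "\<forall>\<^sub>F u in at t within {0..1}. h u s \<in> ball (ctr s) e - K"
     by (rule topological_tendstoD)
   qed
   then have "\<forall>\<^sub>F u in at t within {0..1}. \<forall>s\<in>S. h u s \<in> ball (ctr s) e - K"
    using S(2) by (simp add: eventually_ball_finite)
   then obtain \<epsilon> where \<epsilon>: "\<epsilon> > 0" "\<And>u. u \<in> {0..1} ==> u \<noteq> t ==> dist u t < \<epsilon> ==> \<forall>s\<in>S. h u s \<in> ball (ctr s) e - K"
    unfolding eventually_at by blast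
   have near: "h u s \<in> ball (ctr s) e" "h u s \<notin> K" if "u \<in> {0..1}" "dist u t < \<epsilon>" "s \<in> S" for u s
    using \<epsilon>(2)[OF that(1) _ that(2)] ctr KS that by (cases "u = t"; blast)+
   have "t' \<in> f -` U \<inter> {0..1}" if t': "t' \<in> {0..1}" "dist t' t < \<epsilon>" for t'
   proof -
    have \<delta>': "pin (P1 - h t' ` S) b c \<delta>"
    proof -
     have "path_image \<delta> \<subseteq> P1 - h t' ` S" using near(2)[OF t'] KP by (auto simp: K_def)
     then show ?thesis using 2(2) by (simp add: pin_def)
    qed
    note dt' = dt[OF t'(1), unfolded dt_def]
    \<comment> \<open>A representative of \<open>f t'\<close> with the base point and the numbering
      of the centre, to which the conditions of the neighbourhood apply literally.\<close>
    define \<rho>2 where "\<rho>2 = (\<lambda>\<gamma>. cj a (\<rho> (k t' \<circ> cjp \<delta> \<gamma>)))"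
    note db = hurwitz_data_base[OF dt' \<delta>']
    have d2: "(h t' ` S, c, \<rho>2) \<in> hurwitz_data n r"
     unfolding \<rho>2_def by (rule hurwitz_data_cj[OF db ap(1) n])
    have eqf: "cls n r A (h t' ` S, c, \<rho>2) = f t'"
     unfolding \<rho>2_def f_def dt_def cls_cj[OF A db 2(3) n] by (rule cls_base[OF A dt' \<delta>'])
    have sub: "h t' ` S \<subseteq> (\<Union>s\<in>S'. ball s e)" using near(1)[OF t'] ctr by blast
    have ex1: "\<exists>!y. y \<in> h t' ` S \<inter> ball s' e" if s': "s' \<in> S'" for s'
    proof -
     have "\<exists>!y. y \<in> h t ` S \<inter> ball s' e" using 1(4) s' 2(1) by blast
     then obtain y where y: "y \<in> h t ` S" "y \<in> ball s' e" "\<And>z. z \<in> h t ` S ==> z \<in> ball s' e ==> z = y"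
      by blast
     then obtain s0 where s0: "s0 \<in> S" "y = h t s0" by blast
     have "ctr s0 = s'"
      by (rule disj[of _ _ "h t s0"]) (use ctr[OF s0(1)] s' y(2) s0(2) in \<open>simp_all del: mem_ball\<close>)
     then have in_ball: "h t' s0 \<in> ball s' e" using near(1)[OF t' s0(1)] by simp
     have uniq: "z = h t' s0" if z: "z \<in> h t' ` S \<inter> ball s' e" for z
     proof -
      obtain s1 where s1: "s1 \<in> S" "z = h t' s1" using z by blast
      have "ctr s1 = s'"
       by (rule disj[of _ _ z]) (use ctr[OF s1(1)] s' near(1)[OF t' s1(1)] s1(2) z in \<open>simp_all del: mem_ball\<close>)
      then have "h t s1 = y" using y(3)[OF imageI[OF s1(1)]] ctr[OF s1(1)] by simp
      then have "s1 = s0" using h_inj[OF t, of s1 s0] s0 s1(1) S(1) by auto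
      then show ?thesis using s1 by simp
     qed
     have "h t' s0 \<in> h t' ` S" using s0(1) by blast
     from ex1I[of "\<lambda>y. y \<in> h t' ` S \<inter> ball s' e", OF IntI[OF this in_ball] uniq] show ?thesis .
    qed
    have agree: "\<rho>2 \<gamma> = \<rho>' \<gamma>" if g: "\<gamma> \<in> loops_at (P1 - (\<Union>s\<in>S'. ball s e)) c" for \<gamma>
    proof -
     define \<eta> where "\<eta> = cjp \<delta> \<gamma>"
     have gp: "pin (P1 - (\<Union>s\<in>S'. ball s e)) c c \<gamma>" using g by (simp add: loops_at_pin)
     have \<eta>: "pin K b b \<eta>"
     proof -
      have "pin K b c \<delta>" using 2(2) by (auto simp: pin_def K_def)
      moreover have "pin K c c \<gamma>" by (rule pin_mono[OF gp]) (auto simp: K_def)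
      ultimately show ?thesis unfolding \<eta>_def by (rule pin_cjp)
     qed
     have gt: "pin (P1 - h t ` S) c c \<gamma>" by (rule pin_mono[OF gp]) (use 1(3) 2(1) in auto)
     have \<eta>x: "\<eta> x \<in> K" "\<eta> x \<in> P1" if "x \<in> {0..1}" for x
      using \<eta> KP that unfolding pin_def path_image_def by blast+
     have \<eta>c: "continuous_on {0..1} \<eta>" using \<eta> by (simp add: pin_def path_def)
     have um: "t + u * (t' - t) \<in> {0..1}" "dist (t + u * (t' - t)) t < \<epsilon>" if u: "u \<in> {0..1}" for u
     proof -
      have "t + u * (t' - t) = (1 - u) * t + u * t'" by (simp add: algebra_simps)
      then show "t + u * (t' - t) \<in> {0..1}" using convexD_alt[of "{0..1::real}" t t' u] t t' u by auto
      have "\<bar>u\<bar> * \<bar>t' - t\<bar> \<le> 1 * \<bar>t' - t\<bar>" using u by (intro mult_right_mono) auto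
      then show "dist (t + u * (t' - t)) t < \<epsilon>" using t'(2) by (simp add: dist_real_def abs_mult)
     qed
     \<comment> \<open>The homotopy pulls the fixed loop back at intermediate times; it avoids
       \<open>S\<close> because no branch point meets \<open>K\<close> meanwhile.\<close>
     have "hp (P1 - S) (k t \<circ> \<eta>) (k t' \<circ> \<eta>)" unfolding homotopic_paths
     proof (intro exI[of _ "\<lambda>p. k (t + fst p * (t' - t)) (\<eta> (snd p))"] conjI ballI)
      show "continuous_on ({0..1} \<times> {0..1}) (\<lambda>p. k (t + fst p * (t' - t)) (\<eta> (snd p)))"
       using um \<eta>x by (intro k_cont_on continuous_intros continuous_on_compose2[OF \<eta>c]) auto
      show "(\<lambda>p. k (t + fst p * (t' - t)) (\<eta> (snd p))) \<in> {0..1} \<times> {0..1} \<rightarrow> P1 - S"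
      proof
       fix p assume "p \<in> {0..1::real} \<times> {0..1::real}"
       then have p: "fst p \<in> {0..1}" "snd p \<in> {0..1}" by auto
       define u where "u = t + fst p * (t' - t)"
       have u: "u \<in> {0..1}" "dist u t < \<epsilon>" using um[OF p(1)] by (auto simp: u_def)
       have "k u (\<eta> (snd p)) \<notin> S"
        using near(2)[OF u] hk[OF u(1) \<eta>x(2)[OF p(2)]] \<eta>x(1)[OF p(2)] by metis
       then show "k (t + fst p * (t' - t)) (\<eta> (snd p)) \<in> P1 - S"
        using kP[OF u(1) \<eta>x(2)[OF p(2)]] by (simp add: u_def)
      qed
      fix u :: real assume u: "u \<in> {0..1}"
      have "\<eta> 0 = b" "\<eta> 1 = b" using \<eta> by (auto simp: pin_def pathstart_def pathfinish_def)
      then show "pathstart ((\<lambda>p. k (t + fst p * (t' - t)) (\<eta> (snd p))) \<circ> Pair u) = pathstart (k t \<circ> \<eta>)"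
       "pathfinish ((\<lambda>p. k (t + fst p * (t' - t)) (\<eta> (snd p))) \<circ> Pair u) = pathfinish (k t \<circ> \<eta>)"
       using kb[OF um(1)[OF u]] kb[OF t] by (auto simp: pathstart_def pathfinish_def)
     qed auto
     moreover have "pin (P1 - S) b b (k t \<circ> \<eta>)"
      unfolding \<eta>_def using k_pin[OF S t pin_cjp[OF 2(2) gt]] kb[OF t] by simp
     ultimately have "\<rho> (k t \<circ> \<eta>) = \<rho> (k t' \<circ> \<eta>)" using pi1_hp[OF D(2)] by blast
     then have "\<rho>2 \<gamma> = cj a (\<rho> (k t \<circ> cjp \<delta> \<gamma>))"
      by (simp add: \<rho>2_def \<eta>_def)
     also have "\<dots> = \<rho>1 \<gamma>"
      unfolding cj_def 2(4)[OF gt] using ap(2) by (auto simp: fun_eq_iff bij_is_surj surj_f_inv_f)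
     also have "\<dots> = \<rho>' \<gamma>" using 1(5) g by blast
     finally show ?thesis .
    qed
    have "f t' \<in> U" unfolding U0(1) d' hurwitz_nbhd_def prod.case
     by (intro CollectI exI[of _ "h t' ` S"] exI[of _ \<rho>2] conjI d2 sub ballI ex1 agree eqf[symmetric])
    then show ?thesis using t' by blast
   qed
   then show ?thesis using \<epsilon>(1) by blast
  qed
  then show "openin (top_of_set {0..1}) (f -` U \<inter> topspace (top_of_set {0..1}))"
   unfolding openin_euclidean_subtopology_iff by auto
 qed
 then have "continuous_map (top_of_set {0..1}) ?X f" by (simp add: hurwitz_space_def)
 then have "connectedin ?X (f ` {0..1})" by (rule connectedin_continuous_map_image) (simp add: connectedin_subtopology)
 moreover have "f 0 = cls n r A (S, b, \<rho>)"
 proof -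
  have "h 0 ` S = S" using h0 S by force
  moreover have "\<rho> (k 0 \<circ> \<gamma>) = \<rho> \<gamma>" if g: "pin (P1 - S) b b \<gamma>" for \<gamma>
  proof (rule sym, rule pi1_hp[OF D(2) g], rule homotopic_paths_eq)
   show "path \<gamma>" "path_image \<gamma> \<subseteq> P1 - S" using g by (auto simp: pin_def)
   fix u :: real assume "u \<in> {0..1}"
   then have "\<gamma> u \<in> P1" using g unfolding pin_def path_image_def by blast
   then show "\<gamma> u = (k 0 \<circ> \<gamma>) u" using k0[of "\<gamma> u"] by simp
  qed
  ultimately show ?thesis
   using cls_cong[OF A _ d, of "\<lambda>\<gamma>. \<rho> (k 0 \<circ> \<gamma>)"] dt[of 0] by (simp add: f_def dt_def)
 qed
 moreover have "f 1 = cls n r A (h 1 ` S, b, \<lambda>\<gamma>. \<rho> (k 1 \<circ> \<gamma>))" by (simp add: f_def dt_def)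
 ultimately show ?thesis unfolding connected_component_of_def by (metis atLeastAtMost_iff imageI order_refl zero_le_one)
qed

end

section \<open>Shears of the plane and the normalization of finite branch points\<close>

section \<open>Shears\<close>

lemma continuous_on_P1_charts:
 fixes f :: "real \<times> point => point"
 assumes "continuous_on (T \<times> (P1 - {infty})) f" "continuous_on (T \<times> (P1 - {stereo 0})) f"
 shows "continuous_on (T \<times> P1) f"
proof -
 have "openin (top_of_set (T \<times> P1)) (T \<times> (P1 - {y}))" for y
  by (intro openin_Times openin_delete openin_subtopology_self)
 moreover have "T \<times> P1 = T \<times> (P1 - {infty}) \<union> T \<times> (P1 - {stereo 0})"
  using stereo_ne_infty(1)[of 0] by blast
 ultimately show ?thesis using continuous_on_Un_local_open[OF _ _ assms] by metis
qed

lemma P1_upper_chart: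
 assumes "y \<in> P1 - {stereo 0}"
 shows "y = hpt (of_real (1 + snd y)) (cnj (fst y))" "complex_of_real (1 + snd y) \<noteq> 0"
  "y \<noteq> infty ==> fst y \<noteq> 0 \<and> affine_coord y = of_real (1 + snd y) / cnj (fst y)"
proof -
 have ne: "snd y \<noteq> -1"
 proof
  assume *: "snd y = -1"
  then have "fst y = 0" using assms by (simp add: mem_P1)
  then have "y = stereo 0" using * by (simp add: stereo_def prod_eq_iff)
  then show False using assms by simp
 qed
 then show eq: "y = hpt (of_real (1 + snd y)) (cnj (fst y))" using assms P1_hom_upper by blast
 have "1 + snd y \<noteq> 0" using ne by linarith
 then show ne0: "complex_of_real (1 + snd y) \<noteq> 0" using of_real_eq_0_iff by blast
 assume inf: "y \<noteq> infty"
 have "fst y \<noteq> 0"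
 proof
  assume "fst y = 0"
  then have "y = hpt (of_real (1 + snd y)) 0" using eq by simp
  then show False using inf hpt_infty[OF ne0] by simp
 qed
 moreover have "affine_coord y = of_real (1 + snd y) / cnj (fst y)"
  using eq hpt_stereo[of "cnj (fst y)" "of_real (1 + snd y)"] \<open>fst y \<noteq> 0\<close> by (metis affine_coord_stereo complex_cnj_zero_iff)
 ultimately show "fst y \<noteq> 0 \<and> affine_coord y = of_real (1 + snd y) / cnj (fst y)" ..
qed

definition flow :: "(complex => complex) => real => point => point" where
 "flow u t y = (if y = infty then infty else stereo (affine_coord y + of_real t * u (affine_coord y)))"

lemma flow_infty [simp]: "flow u t infty = infty"
 by (simp add: flow_def)

lemma flow_stereo [simp]: "flow u t (stereo z) = stereo (z + of_real t * u z)"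
 by (simp add: flow_def)

lemma flow_in_P1: "flow u t y \<in> P1"
 by (simp add: flow_def)

text \<open>A bounded displacement becomes negligible near infinity, so fixing infinity extends the
  map continuously, jointly in time and point.\<close>

lemma continuous_on_flow:
 assumes u: "continuous_on UNIV u" and bd: "\<And>z. norm (u z) \<le> M"
 shows "continuous_on (T \<times> P1) (\<lambda>x. flow u (fst x) (snd x))"
proof (rule continuous_on_P1_charts)
 have "continuous_on (T \<times> (P1 - {infty})) (\<lambda>x. stereo (affine_coord (snd x) + of_real (fst x) * u (affine_coord (snd x))))"
  by (intro continuous_intros continuous_on_compose2[OF u]) auto
 then show "continuous_on (T \<times> (P1 - {infty})) (\<lambda>x. flow u (fst x) (snd x))"
  by (rule continuous_on_eq) (auto simp: flow_def)
 \<comment> \<open>In the chart at infinity \<open>z = p / q\<close> with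
   \<open>q = cnj (fst y)\<close>, so the moved point has numerator \<open>p + t w\<close> over the
   same \<open>q\<close>; the bound on \<open>u\<close> makes \<open>w\<close> tend to zero together
   with \<open>q\<close>.\<close>
 define w where "w y = cnj (fst y) * u (affine_coord y)" for y :: point
 have w: "continuous_on P1 w" unfolding continuous_on_def
 proof
  fix y :: point assume y: "y \<in> P1"
  show "(w \<longlongrightarrow> w y) (at y within P1)"
  proof (cases "y = infty")
   case True
   have "((\<lambda>y :: point. M * norm (fst y)) \<longlongrightarrow> M * norm (fst infty)) (at infty within P1)"
    by (intro tendsto_intros)
   then have "((\<lambda>y :: point. M * norm (fst y)) \<longlongrightarrow> 0) (at infty within P1)"
    by (simp add: infty_def)
   moreover have "norm (w y) \<le> M * norm (fst y)" for y
    using mult_right_mono[OF bd[of "affine_coord y"], of "norm (fst y)"] by (simp add: w_def norm_mult mult.commute)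
   ultimately have "(w \<longlongrightarrow> 0) (at infty within P1)" by (intro Lim_null_comparison[of w]) auto
   then show ?thesis by (simp add: True w_def infty_def)
  next
   case False
   have "continuous_on (P1 - {infty}) w" unfolding w_def by (intro continuous_intros continuous_on_compose2[OF u]) auto
   then have "(w \<longlongrightarrow> w y) (at y within P1 - {infty})" using y False by (auto simp: continuous_on_def)
   moreover have "\<forall>\<^sub>F x in at y. (x \<in> P1 - {infty}) = (x \<in> P1)" unfolding eventually_at
   proof (intro exI[of _ "dist y infty"] conjI ballI impI)
    show "0 < dist y infty" using False by simp
    fix x assume "x \<noteq> y \<and> dist x y < dist y infty"
    then have "x \<noteq> infty" using dist_commute[of y infty] by auto
    then show "(x \<in> P1 - {infty}) = (x \<in> P1)" by simp
   qed
   ultimately show ?thesis using Lim_transform_within_set by blast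
  qed
 qed
 have "continuous_on (T \<times> (P1 - {stereo 0}))
   (\<lambda>x. hpt (of_real (1 + snd (snd x)) + of_real (fst x) * w (snd x)) (cnj (fst (snd x))))"
 proof (intro continuous_on_hom continuous_intros continuous_on_compose2[OF w])
  fix x assume "x \<in> T \<times> (P1 - {stereo 0})"
  then have x: "snd x \<in> P1 - {stereo 0}" by auto
  show "of_real (1 + snd (snd x)) + of_real (fst x) * w (snd x) \<noteq> 0 \<or> cnj (fst (snd x)) \<noteq> 0"
   using P1_upper_chart(2)[OF x] by (cases "fst (snd x) = 0") (auto simp: w_def)
 qed auto
 then show "continuous_on (T \<times> (P1 - {stereo 0})) (\<lambda>x. flow u (fst x) (snd x))"
 proof (rule continuous_on_eq)
  fix x assume "x \<in> T \<times> (P1 - {stereo 0})"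
  then have x: "snd x \<in> P1 - {stereo 0}" by auto
  note c = P1_upper_chart[OF x]
  show "hpt (of_real (1 + snd (snd x)) + of_real (fst x) * w (snd x)) (cnj (fst (snd x))) = flow u (fst x) (snd x)"
  proof (cases "snd x = infty")
   case True
   then show ?thesis by (simp add: w_def infty_def hpt_infty flow_def)
  next
   case False
   define q where "q = cnj (fst (snd x))"
   have q: "q \<noteq> 0" "affine_coord (snd x) = of_real (1 + snd (snd x)) / q" using c(3)[OF False] by (auto simp: q_def)
   have "(of_real (1 + snd (snd x)) + of_real (fst x) * w (snd x)) / q
     = affine_coord (snd x) + of_real (fst x) * u (affine_coord (snd x))"
    unfolding w_def q_def[symmetric] q(2)[symmetric] add_divide_distrib using q by simp
   then show ?thesis using hpt_stereo[OF q(1)] False by (simp add: flow_def q_def[symmetric])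
  qed
 qed
qed

text \<open>By \<open>inv\<close> the displacement is the same at the moved point, so time
  \<open>- t\<close> undoes time \<open>t\<close>. Shears have this property: their displacement
  depends only on the coordinate that they leave unchanged.\<close>

lemma flow_isotopy:
 assumes u: "continuous_on UNIV u" and bd: "\<And>z. norm (u z) \<le> M"
  and inv: "\<And>z t. u (z + of_real t * u z) = u z"
 shows "isotopy (flow u) (\<lambda>t. flow u (- t)) infty"
proof
 show "continuous_on ({0..1} \<times> P1) (\<lambda>x. flow u (fst x) (snd x))" by (rule continuous_on_flow[OF u bd])
 have "continuous_on ({0..1} \<times> P1) ((\<lambda>x. flow u (fst x) (snd x)) \<circ> (\<lambda>x. (- fst x, snd x)))"
  by (intro continuous_on_compose continuous_intros continuous_on_subset[OF continuous_on_flow[OF u bd, of UNIV]]) auto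
 then show "continuous_on ({0..1} \<times> P1) (\<lambda>x. flow u (- fst x) (snd x))" by (simp add: comp_def)
 show "flow u (- t) (flow u t y) = y" "flow u t (flow u (- t) y) = y" if "y \<in> P1" for t y
  using that inv[of _ t] inv[of _ "- t"] by (cases rule: P1_cases[OF that]; simp)+
 show "flow u 0 y = y" if "y \<in> P1" for y by (cases rule: P1_cases[OF that]) auto
qed (auto simp: flow_in_P1)

lemma flow_component:
 assumes A: "perm_group n A" "n \<ge> 3" and d: "(stereo ` T, infty, \<rho>) \<in> hurwitz_data n r"
  and u: "continuous_on UNIV u" and bd: "\<And>z. norm (u z) \<le> M" and inv: "\<And>z t. u (z + of_real t * u z) = u z"
 shows "(stereo ` (\<lambda>z. z + u z) ` T, infty, \<lambda>\<gamma>. \<rho> (flow u (- 1) \<circ> \<gamma>)) \<in> hurwitz_data n r"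
  "connected_component_of (hurwitz_space n r A) (cls n r A (stereo ` T, infty, \<rho>))
   (cls n r A (stereo ` (\<lambda>z. z + u z) ` T, infty, \<lambda>\<gamma>. \<rho> (flow u (- 1) \<circ> \<gamma>)))"
proof -
 interpret isotopy "flow u" "\<lambda>t. flow u (- t)" infty by (rule flow_isotopy[where u = u and M = M, OF u bd inv])
 note D = hurwitz_dataD[OF d]
 have S: "stereo ` T \<subseteq> P1" "finite (stereo ` T)" "infty \<notin> stereo ` T" using D(1,3,4) by blast+
 have mer: "meridian (flow u t ` stereo ` T) infty (flow u t s) (flow u t \<circ> \<gamma>)"
  if "t \<in> {0..1}" "s \<in> stereo ` T" "meridian (stereo ` T) infty s \<gamma>" for t s \<gamma>
  using meridian_transport[OF S that(1,2) _ that(3)] that(2) by auto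
 have eq: "flow u 1 ` stereo ` T = stereo ` (\<lambda>z. z + u z) ` T" by (auto simp: image_image)
 show "(stereo ` (\<lambda>z. z + u z) ` T, infty, \<lambda>\<gamma>. \<rho> (flow u (- 1) \<circ> \<gamma>)) \<in> hurwitz_data n r"
  using hurwitz_data_transport[OF d, of 1] mer[of 1] unfolding eq by simp
 show "connected_component_of (hurwitz_space n r A) (cls n r A (stereo ` T, infty, \<rho>))
   (cls n r A (stereo ` (\<lambda>z. z + u z) ` T, infty, \<lambda>\<gamma>. \<rho> (flow u (- 1) \<circ> \<gamma>)))"
  using isotopy_component[OF A d mer] unfolding eq by simp
qed

definition vshear :: "(real => real) => complex => complex" where
 "vshear f z = \<i> * of_real (f (Re z))"

definition hshear :: "(real => real) => complex => complex" where
 "hshear g z = of_real (g (Im z))"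

lemma vshear:
 assumes "continuous_on UNIV f" "\<And>x. \<bar>f x\<bar> \<le> M"
 shows "continuous_on UNIV (vshear f)" "norm (vshear f z) \<le> M" "vshear f (z + of_real t * vshear f z) = vshear f z"
 unfolding vshear_def by (auto intro!: continuous_intros continuous_on_compose2[OF assms(1)] simp: norm_mult assms(2))

lemma hshear:
 assumes "continuous_on UNIV f" "\<And>x. \<bar>f x\<bar> \<le> M"
 shows "continuous_on UNIV (hshear f)" "norm (hshear f z) \<le> M" "hshear f (z + of_real t * hshear f z) = hshear f z"
 unfolding hshear_def by (auto intro!: continuous_intros continuous_on_compose2[OF assms(1)] simp: assms(2))

text \<open>Only the values at finitely many branch points matter for a shear; Tietze extends them
  to a continuous function with the bound that continuity at infinity demands.\<close>

lemma bounded_interpolation: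
 fixes v :: "real => real"
 assumes "finite F"
 obtains f M where "continuous_on UNIV f" "\<And>x. \<bar>f x\<bar> \<le> M" "\<And>x. x \<in> F ==> f x = v x"
proof -
 define M where "M = (\<Sum>x\<in>F. \<bar>v x\<bar>)"
 have vM: "norm (v x) \<le> M" if "x \<in> F" for x
  using member_le_sum[OF that, of "\<lambda>x. \<bar>v x\<bar>"] assms by (simp add: M_def)
 have M0: "0 \<le> M" unfolding M_def by (intro sum_nonneg) auto
 have "continuous_on F v" "closedin (top_of_set UNIV) F" using assms by (auto simp: continuous_on_finite finite_imp_closed)
 from Tietze[OF this M0 vM] obtain f where "continuous_on UNIV f" "\<And>x. x \<in> F ==> f x = v x" "\<And>x. norm (f x) \<le> M"
  by auto
 then show ?thesis using that[of f M] by simp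
qed

text \<open>The base point is put at infinity and all branch points are finite, so every shear is an
  isotopy fixing the base point.\<close>

definition reach :: "nat => nat => (nat => nat) set => datum set => complex set => bool" where
 "reach n r A c T \<longleftrightarrow> (\<exists>\<rho>. (stereo ` T, infty, \<rho>) \<in> hurwitz_data n r \<and>
  connected_component_of (hurwitz_space n r A) c (cls n r A (stereo ` T, infty, \<rho>)))"

lemma reach_vertical:
 assumes "perm_group n A" "n \<ge> 3" "reach n r A c T"
 shows "reach n r A c ((\<lambda>z. z + \<i> * of_real (v (Re z))) ` T)"
proof -
 obtain \<rho> where \<rho>: "(stereo ` T, infty, \<rho>) \<in> hurwitz_data n r"
  "connected_component_of (hurwitz_space n r A) c (cls n r A (stereo ` T, infty, \<rho>))"
  using assms(3) unfolding reach_def by blast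
 have "finite (stereo ` T)" using hurwitz_dataD[OF \<rho>(1)] by blast
 then have "finite T" by (rule finite_imageD) (simp add: inj_on_def)
 then obtain f M where f: "continuous_on UNIV f" "\<And>x. \<bar>f x\<bar> \<le> M" "\<And>x. x \<in> Re ` T ==> f x = v x"
  using bounded_interpolation[of "Re ` T" v] by auto
 have "(\<lambda>z. z + \<i> * of_real (v (Re z))) ` T = (\<lambda>z. z + vshear f z) ` T"
  using f(3) by (intro image_cong) (auto simp: vshear_def)
 then show ?thesis
  unfolding reach_def using flow_component[where u = "vshear f" and M = M, OF assms(1,2) \<rho>(1) vshear[OF f(1,2)]] connected_component_of_trans[OF \<rho>(2)]
  by auto
qed

lemma reach_horizontal:
 assumes "perm_group n A" "n \<ge> 3" "reach n r A c T"
 shows "reach n r A c ((\<lambda>z. z + of_real (v (Im z))) ` T)"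
proof -
 obtain \<rho> where \<rho>: "(stereo ` T, infty, \<rho>) \<in> hurwitz_data n r"
  "connected_component_of (hurwitz_space n r A) c (cls n r A (stereo ` T, infty, \<rho>))"
  using assms(3) unfolding reach_def by blast
 have "finite (stereo ` T)" using hurwitz_dataD[OF \<rho>(1)] by blast
 then have "finite T" by (rule finite_imageD) (simp add: inj_on_def)
 then obtain f M where f: "continuous_on UNIV f" "\<And>x. \<bar>f x\<bar> \<le> M" "\<And>x. x \<in> Im ` T ==> f x = v x"
  using bounded_interpolation[of "Im ` T" v] by auto
 have "(\<lambda>z. z + of_real (v (Im z))) ` T = (\<lambda>z. z + hshear f z) ` T"
  using f(3) by (intro image_cong) (auto simp: hshear_def)
 then show ?thesis
  unfolding reach_def using flow_component[where u = "hshear f" and M = M, OF assms(1,2) \<rho>(1) hshear[OF f(1,2)]] connected_component_of_trans[OF \<rho>(2)]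
  by auto
qed

definition std_branch :: "nat => complex set" where
 "std_branch r = of_nat ` {1..r}"

text \<open>A generic horizontal shear makes the real parts distinct. From then on each coordinate
  can be changed at will as a function of the other: with numbers \<open>k\<close> assigned to the
  points, they pass through \<open>(x, k)\<close> and \<open>(k, k)\<close> to
  \<open>(k, 0)\<close>.\<close>

lemma reach_std:
 assumes "perm_group n A" "n \<ge> 3" "reach n r A c T"
 shows "reach n r A c (std_branch r)"
proof -
 have fin: "finite T'" "card T' = r" if R: "reach n r A c T'" for T'
 proof -
  obtain \<rho> where \<rho>: "(stereo ` T', infty, \<rho>) \<in> hurwitz_data n r" using R unfolding reach_def by blast
  have inj: "inj_on stereo T'" by (simp add: inj_on_def)
  have "finite (stereo ` T')" "card (stereo ` T') = r" using hurwitz_dataD[OF \<rho>] by auto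
  then show "finite T'" "card T' = r" using finite_imageD[OF _ inj] card_image[OF inj] by auto
 qed
 \<comment> \<open>The slopes for which two points would get the same real part. Pairs with equal
   imaginary parts contribute just the value 0.\<close>
 define bad where "bad = (\<lambda>(z, z'). (Re z - Re z') / (Im z' - Im z)) ` (T \<times> T)"
 have "finite bad" unfolding bad_def using fin[OF assms(3)] by auto
 then obtain lam :: real where lam: "lam \<notin> bad" using ex_new_if_finite[OF infinite_UNIV_char_0] by blast
 define T1 where "T1 = (\<lambda>z. z + of_real (lam * Im z)) ` T"
 have R1: "reach n r A c T1" unfolding T1_def using reach_horizontal[OF assms, of "\<lambda>y. lam * y"] by simp
 have inj1: "inj_on Re T1"
 proof (rule inj_onI)
  fix a a' assume "a \<in> T1" "a' \<in> T1" "Re a = Re a'"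
  then obtain z z' where z: "z \<in> T" "z' \<in> T" "a = z + of_real (lam * Im z)" "a' = z' + of_real (lam * Im z')"
   "Re z + lam * Im z = Re z' + lam * Im z'" by (auto simp: T1_def)
  have "Im z = Im z'"
  proof (rule ccontr)
   assume "Im z \<noteq> Im z'"
   then have "lam = (Re z - Re z') / (Im z' - Im z)" using z(5) by (simp add: field_simps)
   then have "lam \<in> bad" unfolding bad_def using z(1,2) by force
   then show False using lam by blast
  qed
  then show "a = a'" using z by (auto simp: complex_eq_iff)
 qed
 obtain \<nu> :: "complex => nat" where \<nu>: "bij_betw \<nu> T1 {1..r}"
  using finite_same_card_bij[of T1 "{1..r}"] fin[OF R1] by auto
 define rr where "rr z = real (\<nu> z)" for z
 define T2 where "T2 = (\<lambda>z. Complex (Re z) (rr z)) ` T1"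
 have R2: "reach n r A c T2"
 proof -
  define v where "v x = rr (the_inv_into T1 Re x) - Im (the_inv_into T1 Re x)" for x
  have "z + \<i> * of_real (v (Re z)) = Complex (Re z) (rr z)" if "z \<in> T1" for z
   unfolding v_def the_inv_into_f_f[OF inj1 that] by (simp add: complex_eq_iff)
  then have "T2 = (\<lambda>z. z + \<i> * of_real (v (Re z))) ` T1" unfolding T2_def by (intro image_cong) auto
  then show ?thesis using reach_vertical[OF assms(1,2) R1, of v] by simp
 qed
 define T3 where "T3 = (\<lambda>z. Complex (rr z) (rr z)) ` T1"
 have inj_rr: "inj_on rr T1" using bij_betw_imp_inj_on[OF \<nu>] by (simp add: inj_on_def rr_def)
 have R3: "reach n r A c T3"
 proof -
  define v where "v y = y - Re (the_inv_into T1 rr y)" for y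
  have "Complex (Re z) (rr z) + of_real (v (Im (Complex (Re z) (rr z)))) = Complex (rr z) (rr z)" if "z \<in> T1" for z
   unfolding v_def complex.sel the_inv_into_f_f[OF inj_rr that] by (simp add: complex_eq_iff)
  then have "T3 = (\<lambda>z. z + of_real (v (Im z))) ` T2" unfolding T2_def T3_def image_image by (intro image_cong) auto
  then show ?thesis using reach_horizontal[OF assms(1,2) R2, of v] by simp
 qed
 have "std_branch r = (\<lambda>z. z + \<i> * of_real (- Re z)) ` T3"
 proof -
  have "Complex (rr z) (rr z) + \<i> * of_real (- Re (Complex (rr z) (rr z))) = of_nat (\<nu> z)" for z
   by (simp add: complex_eq_iff rr_def)
  then have "(\<lambda>z. z + \<i> * of_real (- Re z)) ` T3 = of_nat ` \<nu> ` T1"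
   unfolding T3_def image_image by (intro image_cong) auto
  then show ?thesis using bij_betw_imp_surj_on[OF \<nu>] by (simp add: std_branch_def)
 qed
 then show ?thesis using reach_vertical[OF assms(1,2) R3, of uminus] by simp
qed

section \<open>Parabolic Moebius maps that move a branch point away from infinity\<close>

section \<open>Moving a branch point away from infinity\<close>

text \<open>In the coordinate \<open>w = z - \<beta>\<close> this is
  \<open>w / (1 + \<epsilon> w)\<close>, the parabolic map that fixes \<open>\<beta>\<close>, has
  its inverse at \<open>- \<epsilon>\<close>, and takes infinity to
  \<open>\<beta> + 1 / \<epsilon>\<close>.\<close>

definition mob :: "complex => complex => point => point" where
 "mob \<beta> \<epsilon> y = (if y = infty then hpt (\<beta> * \<epsilon> + 1) \<epsilon>
  else hpt (\<beta> * (1 + \<epsilon> * (affine_coord y - \<beta>)) + (affine_coord y - \<beta>)) (1 + \<epsilon> * (affine_coord y - \<beta>)))"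

lemma mob_hom:
 assumes "p \<noteq> 0 \<or> q \<noteq> 0"
 shows "mob \<beta> \<epsilon> (hpt p q) = hpt (\<beta> * (q + \<epsilon> * (p - \<beta> * q)) + (p - \<beta> * q)) (q + \<epsilon> * (p - \<beta> * q))"
proof (cases "q = 0")
 case True
 then have p: "p \<noteq> 0" using assms by simp
 have "mob \<beta> \<epsilon> (hpt p q) = hpt (\<beta> * \<epsilon> + 1) \<epsilon>"
  using True p by (simp add: mob_def hpt_infty)
 also have "\<dots> = hpt (p * (\<beta> * \<epsilon> + 1)) (p * \<epsilon>)" using hpt_scale[OF p] by simp
 finally show ?thesis using True by (simp add: algebra_simps)
next
 case False
 define z where "z = p / q"
 have p: "p = q * z" using False by (simp add: z_def)
 have "mob \<beta> \<epsilon> (hpt p q) = hpt (\<beta> * (1 + \<epsilon> * (z - \<beta>)) + (z - \<beta>)) (1 + \<epsilon> * (z - \<beta>))"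
  using False by (simp add: hpt_stereo mob_def z_def)
 also have "\<dots> = hpt (q * (\<beta> * (1 + \<epsilon> * (z - \<beta>)) + (z - \<beta>))) (q * (1 + \<epsilon> * (z - \<beta>)))"
  using hpt_scale[OF False] by simp
 finally show ?thesis by (simp add: p algebra_simps)
qed

lemma mob_ne: "p \<noteq> 0 \<or> q \<noteq> 0 ==>
  \<beta> * (q + \<epsilon> * (p - \<beta> * q)) + (p - \<beta> * q) \<noteq> 0 \<or> q + \<epsilon> * (p - \<beta> * q) \<noteq> (0::complex)"
 by auto

lemma P1_hom: "y \<in> P1 ==> \<exists>p q. (p \<noteq> 0 \<or> q \<noteq> 0) \<and> y = hpt p q"
proof -
 assume "y \<in> P1"
 then show ?thesis
 proof (cases rule: P1_cases)
  case 1
  then show ?thesis by (intro exI[of _ 1] exI[of _ 0]) (simp add: hpt_infty)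
 next
  case (2 z)
  then show ?thesis by (intro exI[of _ z] exI[of _ 1]) (simp add: stereo_hpt)
 qed
qed

lemma mob_in_P1: "y \<in> P1 ==> mob \<beta> \<epsilon> y \<in> P1"
 using P1_hom[of y] mob_hom hpt_in_P1 mob_ne by metis

lemma mob_inverse: "y \<in> P1 ==> mob \<beta> (- \<epsilon>) (mob \<beta> \<epsilon> y) = y"
proof -
 assume "y \<in> P1"
 then obtain p q where pq: "p \<noteq> 0 \<or> q \<noteq> 0" "y = hpt p q" using P1_hom by blast
 define q' where "q' = q + \<epsilon> * (p - \<beta> * q)"
 define p' where "p' = \<beta> * q' + (p - \<beta> * q)"
 have 1: "mob \<beta> \<epsilon> y = hpt p' q'" "p' \<noteq> 0 \<or> q' \<noteq> 0"
  using mob_hom[OF pq(1)] mob_ne[OF pq(1)] by (auto simp: pq(2) p'_def q'_def)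
 have 2: "q' + - \<epsilon> * (p' - \<beta> * q') = q" by (simp add: p'_def q'_def)
 have "mob \<beta> (- \<epsilon>) (hpt p' q') = hpt (\<beta> * q + (p' - \<beta> * q')) q"
  using mob_hom[OF 1(2), of \<beta> "- \<epsilon>"] unfolding 2 .
 also have "\<beta> * q + (p' - \<beta> * q') = p" by (simp add: p'_def)
 finally show ?thesis using 1 pq by simp
qed

lemma mob_0: "y \<in> P1 ==> mob \<beta> 0 y = y"
 using P1_hom[of y] mob_hom[of _ _ \<beta> 0] by auto

lemma continuous_on_mob:
 fixes T :: "real set"
 assumes c: "continuous_on T c"
 shows "continuous_on (T \<times> P1) (\<lambda>x. mob \<beta> (c (fst x)) (snd x))"
proof (rule continuous_on_P1_charts)
 have "continuous_on (T \<times> (P1 - {infty})) (\<lambda>x. hpt (\<beta> * (1 + c (fst x) * (affine_coord (snd x) - \<beta>)) + (affine_coord (snd x) - \<beta>))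
   (1 + c (fst x) * (affine_coord (snd x) - \<beta>)))" by (intro continuous_intros continuous_on_compose2[OF c]) auto
 then show "continuous_on (T \<times> (P1 - {infty})) (\<lambda>x. mob \<beta> (c (fst x)) (snd x))"
  by (rule continuous_on_eq) (auto simp: mob_def)
 define p where "p y = complex_of_real (1 + snd y)" for y :: point
 define q where "q y = cnj (fst y)" for y :: point
 have pq: "y = hpt (p y) (q y)" "p y \<noteq> 0" if "y \<in> P1 - {stereo 0}" for y
  using P1_upper_chart[OF that] by (auto simp: p_def q_def)
 have "continuous_on (T \<times> (P1 - {stereo 0})) (\<lambda>x. hpt (\<beta> * (q (snd x) + c (fst x) * (p (snd x) - \<beta> * q (snd x))) + (p (snd x) - \<beta> * q (snd x)))
   (q (snd x) + c (fst x) * (p (snd x) - \<beta> * q (snd x))))"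
 proof (intro continuous_on_hom)
  show "\<beta> * (q (snd x) + c (fst x) * (p (snd x) - \<beta> * q (snd x))) + (p (snd x) - \<beta> * q (snd x)) \<noteq> 0 \<or>
   q (snd x) + c (fst x) * (p (snd x) - \<beta> * q (snd x)) \<noteq> 0" if "x \<in> T \<times> (P1 - {stereo 0})" for x
   using that pq(2)[of "snd x"] by (intro mob_ne) auto
 qed (unfold p_def q_def, (intro continuous_intros continuous_on_compose2[OF c]; auto)+)
 then show "continuous_on (T \<times> (P1 - {stereo 0})) (\<lambda>x. mob \<beta> (c (fst x)) (snd x))"
 proof (rule continuous_on_eq)
  fix x assume "x \<in> T \<times> (P1 - {stereo 0})"
  then have x: "snd x \<in> P1 - {stereo 0}" by auto
  show "hpt (\<beta> * (q (snd x) + c (fst x) * (p (snd x) - \<beta> * q (snd x))) + (p (snd x) - \<beta> * q (snd x)))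
   (q (snd x) + c (fst x) * (p (snd x) - \<beta> * q (snd x))) = mob \<beta> (c (fst x)) (snd x)"
   using mob_hom[of "p (snd x)" "q (snd x)" \<beta> "c (fst x)"] pq[OF x] by simp
 qed
qed

lemma mob_isotopy: "isotopy (\<lambda>t. mob \<beta> (of_real t * \<epsilon>)) (\<lambda>t. mob \<beta> (- (of_real t * \<epsilon>))) (stereo \<beta>)"
proof
 show "continuous_on ({0..1} \<times> P1) (\<lambda>x. mob \<beta> (of_real (fst x) * \<epsilon>) (snd x))"
  by (rule continuous_on_mob[of _ "\<lambda>t. of_real t * \<epsilon>"]) (intro continuous_intros)
 show "continuous_on ({0..1} \<times> P1) (\<lambda>x. mob \<beta> (- (of_real (fst x) * \<epsilon>)) (snd x))"
  by (rule continuous_on_mob[of _ "\<lambda>t. - (of_real t * \<epsilon>)"]) (intro continuous_intros)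
 show "mob \<beta> (of_real t * \<epsilon>) (mob \<beta> (- (of_real t * \<epsilon>)) y) = y" if "y \<in> P1" for t y
  using mob_inverse[OF that, of \<beta> "- (of_real t * \<epsilon>)"] by simp
 show "mob \<beta> (of_real t * \<epsilon>) (stereo \<beta>) = stereo \<beta>" for t
  by (simp add: mob_def stereo_hpt[symmetric])
qed (auto simp: mob_in_P1 mob_inverse mob_0)

lemma finite_isolated:
 assumes "finite S" "stereo a \<in> S"
 obtains e where "e > 0" "\<And>w. norm w \<le> e ==> stereo (a + w) \<in> S ==> w = 0"
proof -
 have "finite (affine_coord ` S)" using assms by simp
 from finite_set_avoid[OF this, of a] obtain d where d: "d > 0" "\<forall>x\<in>affine_coord ` S. x \<noteq> a \<longrightarrow> d \<le> dist a x"
  by auto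
 have "w = 0" if "norm w \<le> d / 2" "stereo (a + w) \<in> S" for w
 proof (rule ccontr)
  assume "w \<noteq> 0"
  have "a + w \<in> affine_coord ` S" using that(2) by (intro image_eqI[of _ _ "stereo (a + w)"]) auto
  then have "d \<le> dist a (a + w)" using d(2) \<open>w \<noteq> 0\<close> by auto
  then show False using that(1) d(1) by (simp add: dist_norm)
 qed
 then show ?thesis using that[of "d / 2"] d(1) by auto
qed

lemma meridian_hp: "meridian S b s \<gamma> ==> hp (P1 - S) \<gamma>' \<gamma> ==> meridian S b s \<gamma>'"
 unfolding meridian_cjp_iff using hp_trans by blast

text \<open>In the coordinate at the image \<open>c\<close> of infinity, the image of a small circle around
 infinity is \<open>c - w / (E (E + \<kappa> w))\<close> with \<open>w\<close> on a small circle around zero; letting \<open>\<kappa>\<close> tend to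
 zero deforms it into a round circle.\<close>

lemma meridian_mob_infty:
 assumes S: "S \<subseteq> P1" "finite S" "stereo \<beta> \<notin> S" "infty \<in> S" and mer: "meridian S (stereo \<beta>) infty \<gamma>"
  and E: "E = \<i> * of_real \<eta>" "\<eta> > 0"
  and iso: "isotopy h k (stereo \<beta>)" and t: "t \<in> {0..1}" and ht: "h t = mob \<beta> E"
 shows "meridian (h t ` S) (stereo \<beta>) (h t infty) (h t \<circ> \<gamma>)"
proof -
 interpret isotopy h k "stereo \<beta>" by (rule iso)
 \<comment> \<open>\<open>E\<close> is taken purely imaginary so that \<open>- 1 / E\<^sup>2\<close>
   is a positive real: the deformed circle then ends as a standard small circle, without a rotation
   of its starting point.\<close>
 have E0: "E \<noteq> 0" "norm E = \<eta>" "E\<^sup>2 = - of_real (\<eta>\<^sup>2)"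
  using E by (auto simp: norm_mult power_mult_distrib)
 define a where "a = \<beta> + 1 / E"
 define S' where "S' = h t ` S"
 have hinf: "h t infty = stereo a" using E0 by (simp add: ht mob_def hpt_stereo a_def add_divide_distrib)
 have S': "finite S'" "stereo a \<in> S'" using S hinf by (auto simp: S'_def intro!: image_eqI[of _ _ infty])
 obtain e0 where e0: "e0 > 0" "\<And>w. norm w \<le> e0 ==> stereo (a + w) \<in> S' ==> w = 0"
  using finite_isolated[OF S'] by blast
 obtain e \<delta> where e: "e > 0" "local_param infty ` cball 0 e \<inter> S = {infty}"
  "pin (P1 - S) (stereo \<beta>) (pathstart (small_circle infty e)) \<delta>"
  "hp (P1 - S) \<gamma> (cjp \<delta> (small_circle infty e))" using mer unfolding meridian_cjp_iff by blast
 define \<kappa> where "\<kappa> = 1 - E * \<beta>"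
 \<comment> \<open>The second bound keeps \<open>E + \<tau> \<kappa> w\<close> at modulus at least
   \<open>\<eta> / 2\<close>; with this the third one keeps the displacement
   \<open>D \<tau> w\<close> within the isolating radius \<open>e0\<close>.\<close>
 define e' where "e' = min e (min (\<eta> / (2 * (1 + norm \<kappa>))) (e0 * \<eta>\<^sup>2 / 2))"
 have kpos: "1 + norm \<kappa> > 0" using norm_ge_zero[of \<kappa>] by linarith
 have e': "0 < e'" "e' \<le> e" "e' \<le> \<eta> / (2 * (1 + norm \<kappa>))" "e' \<le> e0 * \<eta>\<^sup>2 / 2"
 proof -
  show "0 < e'" using e(1) E(2) e0(1) kpos by (auto simp: e'_def)
  show "e' \<le> e" "e' \<le> \<eta> / (2 * (1 + norm \<kappa>))" "e' \<le> e0 * \<eta>\<^sup>2 / 2"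
   unfolding e'_def by (meson min.cobounded1 min.cobounded2 order_trans)+
 qed
 have \<kappa>e': "norm \<kappa> * e' \<le> \<eta> / 2"
 proof -
  have "norm \<kappa> * e' \<le> (1 + norm \<kappa>) * (\<eta> / (2 * (1 + norm \<kappa>)))"
   using e' by (intro mult_mono) auto
  also have "\<dots> = \<eta> / 2" using kpos by (simp add: field_simps)
  finally show ?thesis .
 qed
 have den: "norm (E + of_real \<tau> * \<kappa> * w) \<ge> \<eta> / 2" if "norm w = e'" "\<tau> \<in> {0..1}" for w \<tau>
 proof -
  have "norm (of_real \<tau> * \<kappa> * w) \<le> 1 * (norm \<kappa> * e')"
   using that unfolding norm_mult norm_of_real mult.assoc by (intro mult_mono) auto
  then have "norm (of_real \<tau> * \<kappa> * w) \<le> \<eta> / 2" using \<kappa>e' by linarith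
  then show ?thesis using norm_diff_ineq[of E "of_real \<tau> * \<kappa> * w"] E0 by linarith
 qed
 define D where "D \<tau> w = - w / (E * (E + of_real \<tau> * \<kappa> * w))" for \<tau> w
 have D: "D \<tau> w \<noteq> 0" "norm (D \<tau> w) \<le> e0" if w: "norm w = e'" "\<tau> \<in> {0..1}" for w \<tau>
 proof -
  have pos: "norm (E + of_real \<tau> * \<kappa> * w) > 0" using den[OF w] E(2) by linarith
  then show "D \<tau> w \<noteq> 0" using E0 w e'(1) by (auto simp: D_def)
  have "norm (D \<tau> w) = e' / (\<eta> * norm (E + of_real \<tau> * \<kappa> * w))"
   using w E0 by (simp add: D_def norm_divide norm_mult)
  also have "\<dots> \<le> e' / (\<eta> * (\<eta> / 2))"
   using den[OF w] E(2) e'(1) pos by (intro divide_left_mono mult_left_mono mult_pos_pos) auto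
  also have "\<dots> = 2 * e' / \<eta>\<^sup>2" by (simp add: power2_eq_square)
  also have "\<dots> \<le> e0" using e'(4) E(2) by (simp add: field_simps)
  finally show "norm (D \<tau> w) \<le> e0" .
 qed
 define w where "w x = complex_of_real e' * exp (2 * of_real pi * \<i> * of_real x)" for x
 have wn: "norm (w x) = e'" for x unfolding w_def using norm_circle[of e'] e'(1) by simp
 define H where "H = (\<lambda>p. stereo (a + D (1 - fst p) (w (snd p))))"
 have "\<exists>\<sigma>. pin (P1 - S') (H (0, 0)) (H (1, 0)) \<sigma> \<and>
   hp (P1 - S') (\<lambda>x. H (0, x)) (cjp \<sigma> (\<lambda>x. H (1, x)))"
 proof (rule free_homotopy_cjp)
  have ne: "E + of_real (1 - fst p) * \<kappa> * w (snd p) \<noteq> 0" if "p \<in> {0..1} \<times> {0..1}" for p :: "real \<times> real"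
   using den[OF wn[of "snd p"], of "1 - fst p"] that E(2) by force
  show "continuous_on ({0..1} \<times> {0..1}) H"
   unfolding H_def D_def using ne E0 by (intro continuous_intros) (auto simp: w_def intro!: continuous_intros)
  show "H ` ({0..1} \<times> {0..1}) \<subseteq> P1 - S'"
  proof (rule image_subsetI)
   fix p :: "real \<times> real" assume "p \<in> {0..1} \<times> {0..1}"
   then have "1 - fst p \<in> {0..1}" by auto
   from D[OF wn this] e0(2) show "H p \<in> P1 - S'" unfolding H_def by auto
  qed
  show "H (u, 1) = H (u, 0)" for u by (simp add: H_def w_def)
 qed
 then obtain \<sigma>2 where \<sigma>2: "pin (P1 - S') (H (0, 0)) (H (1, 0)) \<sigma>2"
  "hp (P1 - S') (\<lambda>x. H (0, x)) (cjp \<sigma>2 (\<lambda>x. H (1, x)))" by blast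
 have inf: "infty \<in> P1" by simp
 obtain \<sigma>1 where \<sigma>1: "pin (P1 - S) (local_param infty (of_real e)) (local_param infty (of_real e')) \<sigma>1"
  "hp (P1 - S) (small_circle infty e) (cjp \<sigma>1 (small_circle infty e'))"
  using small_circle_free[OF inf e'(1,2) e(2)] by blast
 have H0: "(\<lambda>x. H (0, x)) = h t \<circ> small_circle infty e'"
 proof
  fix x
  have w0: "w x \<noteq> 0" using wn[of x] e'(1) by auto
  have q: "w x + E * (1 - \<beta> * w x) = E + of_real 1 * \<kappa> * w x" by (simp add: \<kappa>_def algebra_simps)
  have q0: "E + of_real 1 * \<kappa> * w x \<noteq> 0" using den[OF wn[of x], of 1] E(2) by force
  have "(h t \<circ> small_circle infty e') x = mob \<beta> E (hpt 1 (w x))"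
   using w0 by (simp add: ht small_circle_eq local_param_def hpt_stereo w_def)
  also have "\<dots> = stereo ((\<beta> * (w x + E * (1 - \<beta> * w x)) + (1 - \<beta> * w x)) / (w x + E * (1 - \<beta> * w x)))"
   using mob_hom[of 1 "w x" \<beta> E] q0 q hpt_stereo by simp
  also have "(\<beta> * (w x + E * (1 - \<beta> * w x)) + (1 - \<beta> * w x)) / (w x + E * (1 - \<beta> * w x)) = a + D 1 (w x)"
  proof -
   define Q where "Q = E + of_real 1 * \<kappa> * w x"
   have Q: "Q \<noteq> 0" "w x + E * (1 - \<beta> * w x) = Q" using q q0 by (auto simp: Q_def)
   have "E * (1 - \<beta> * w x) = Q - w x" using Q(2) by (simp add: algebra_simps)
   then have k: "1 - \<beta> * w x = (Q - w x) / E" using E0 by (simp add: field_simps)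
   show ?thesis unfolding Q(2) k a_def D_def Q_def[symmetric] using Q(1) E0(1) by (simp add: field_simps)
  qed
  finally show "H (0, x) = (h t \<circ> small_circle infty e') x" by (simp add: H_def)
 qed
 define rad where "rad = e' / \<eta>\<^sup>2"
 have rad: "0 < rad" "rad \<le> e0" using e' E(2) e0(1) by (auto simp: rad_def field_simps)
 have H1: "(\<lambda>x. H (1, x)) = small_circle (h t infty) rad"
 proof
  fix x
  have "D 0 (w x) = - w x / E\<^sup>2" by (simp add: D_def power2_eq_square)
  also have "\<dots> = of_real rad * exp (2 * of_real pi * \<i> * of_real x)" unfolding E0(3) by (simp add: w_def rad_def)
  finally show "H (1, x) = small_circle (h t infty) rad x" by (simp add: H_def small_circle_eq hinf local_param_finite)
 qed
 have disc: "local_param (h t infty) ` cball 0 rad \<inter> h t ` S = {h t infty}"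
 proof (rule subset_antisym; rule subsetI)
  fix y assume "y \<in> local_param (h t infty) ` cball 0 rad \<inter> h t ` S"
  then obtain v where v: "norm v \<le> rad" "y = stereo (a + v)" "y \<in> S'" by (auto simp: hinf local_param_finite S'_def)
  then show "y \<in> {h t infty}" using e0(2)[of v] rad hinf by auto
 next
  fix y assume "y \<in> {h t infty}"
  moreover have "h t infty \<in> local_param (h t infty) ` cball 0 rad"
   using rad by (intro image_eqI[of _ _ 0]) (auto simp: hinf local_param_finite)
  ultimately show "y \<in> local_param (h t infty) ` cball 0 rad \<inter> h t ` S" using S(4) by auto
 qed
 have st: "pathstart (small_circle infty e) = local_param infty (of_real e)" by (simp add: pathstart_def small_circle_eq)
 note \<delta> = e(3)[unfolded st]
 have e'_disc: "local_param infty ` cball 0 e' \<inter> S = {infty}"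
 proof -
  have "local_param infty ` cball 0 e' \<subseteq> local_param infty ` cball 0 e" using e' by (intro image_mono) auto
  moreover have "infty \<in> local_param infty ` cball 0 e'"
   using local_param_0[OF inf] e' by (intro image_eqI[of _ _ 0]) auto
  ultimately show ?thesis using e(2) S(4) by blast
 qed
 note pe = small_circle_pin[OF inf e(2,1)] and pe' = small_circle_pin[OF inf e'_disc e'(1)]
 have "hp (P1 - S) \<gamma> (cjp \<delta> (small_circle infty e))" by (rule e(4))
 also have "hp (P1 - S) \<dots> (cjp \<delta> (cjp \<sigma>1 (small_circle infty e')))"
  by (rule hp_cjp[OF \<sigma>1(2) \<delta> pe])
 also have "hp (P1 - S) \<dots> (cjp (\<delta> +++ \<sigma>1) (small_circle infty e'))"
  by (rule hp_sym[OF hp_cjp_cjp[OF \<delta> \<sigma>1(1) pe']])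
 finally have "hp (P1 - h t ` S) (h t \<circ> \<gamma>) (h t \<circ> cjp (\<delta> +++ \<sigma>1) (small_circle infty e'))"
  by (rule h_hp[OF S(1-3) t])
 then have 1: "hp (P1 - S') (h t \<circ> \<gamma>) (cjp (h t \<circ> (\<delta> +++ \<sigma>1)) (h t \<circ> small_circle infty e'))"
  by (simp add: comp_cjp S'_def)
 define \<delta>' where "\<delta>' = h t \<circ> (\<delta> +++ \<sigma>1)"
 have "h t (local_param infty (of_real e')) = H (0, 0)" using fun_cong[OF H0, of 0] by (simp add: small_circle_eq)
 then have \<delta>': "pin (P1 - S') (stereo \<beta>) (H (0, 0)) \<delta>'"
  using h_pin[OF S(1-3) t pin_join[OF \<delta> \<sigma>1(1)]] hb[OF t] by (simp add: \<delta>'_def S'_def)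
 have ends: "pathstart (\<lambda>x. H (0, x)) = H (0, 0)" "pathfinish (\<lambda>x. H (0, x)) = H (0, 0)"
  "pathstart (\<lambda>x. H (1, x)) = H (1, 0)" "pathfinish (\<lambda>x. H (1, x)) = H (1, 0)"
  by (auto simp: pathstart_def pathfinish_def H_def w_def)
 have pH0: "pin (P1 - S') (H (0, 0)) (H (0, 0)) (\<lambda>x. H (0, x))"
  and pH1: "pin (P1 - S') (H (1, 0)) (H (1, 0)) (\<lambda>x. H (1, x))"
  using hp_pin(1)[OF \<sigma>2(2) ends(1,2)] cjp_end_pin(2)[OF \<sigma>2(2,1) ends(3,4)] by auto
 note 1
 also have "hp (P1 - S') (cjp (h t \<circ> (\<delta> +++ \<sigma>1)) (h t \<circ> small_circle infty e'))
   (cjp \<delta>' (cjp \<sigma>2 (\<lambda>x. H (1, x))))"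
  unfolding H0[symmetric] \<delta>'_def[symmetric] by (rule hp_cjp[OF \<sigma>2(2) \<delta>' pH0])
 also have "hp (P1 - S') \<dots> (cjp (\<delta>' +++ \<sigma>2) (\<lambda>x. H (1, x)))"
  by (rule hp_sym[OF hp_cjp_cjp[OF \<delta>' \<sigma>2(1) pH1]])
 finally have 2: "hp (P1 - S') (h t \<circ> \<gamma>) (cjp (\<delta>' +++ \<sigma>2) (small_circle (h t infty) rad))"
  unfolding H1 .
 have "pathstart (small_circle (h t infty) rad) = H (1, 0)" using ends(3) unfolding H1 .
 then have "pin (P1 - S') (stereo \<beta>) (pathstart (small_circle (h t infty) rad)) (\<delta>' +++ \<sigma>2)"
  using pin_join[OF \<delta>' \<sigma>2(1)] by simp
 then show ?thesis unfolding meridian_cjp_iff using rad(1) disc 2 unfolding S'_def by blast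
qed

text \<open>Only the base point has to move: through the plane to a real number that is not the real
  part of a branch point, then straight up to infinity.\<close>

lemma reach_finite:
 assumes A: "perm_group n A" "n \<ge> 3" and d: "(S, b, \<rho>) \<in> hurwitz_data n r" and inf: "infty \<notin> S"
 shows "\<exists>T. reach n r A (cls n r A (S, b, \<rho>)) T"
proof -
 note D = hurwitz_dataD[OF d]
 define T where "T = affine_coord ` S"
 have finT: "finite T" using D(3) by (simp add: T_def)
 have ST: "S = stereo ` T"
 proof -
  have "stereo (affine_coord y) = y" if "y \<in> S" for y using stereo_affine_coord[of y] that D(4) inf by blast
  then show ?thesis by (simp add: T_def image_image)
 qed
 have "\<exists>\<delta>. pin (P1 - S) b infty \<delta>"
 proof -
  have "b \<in> P1" using D(1) by blast
  then show ?thesis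
 proof (cases rule: P1_cases)
  case 1
  then show ?thesis using pin_const[OF D(1)] by metis
 next
  case (2 z)
  obtain c :: real where c: "c \<notin> Re ` T" using ex_new_if_finite[OF infinite_UNIV_char_0, of "Re ` T"] finT by blast
  have zT: "z \<notin> T" using D(1) 2 ST by auto
  have "path_connected (UNIV - T)" by (rule path_connected_open_diff_countable) (auto simp: finT countable_finite)
  moreover have "z \<in> UNIV - T" "complex_of_real c \<in> UNIV - T" using zT c by force+
  ultimately obtain g where g: "path g" "path_image g \<subseteq> UNIV - T" "pathstart g = z" "pathfinish g = of_real c"
   unfolding path_connected_def by blast
  have "pin (P1 - S) (stereo z) (stereo (of_real c)) (stereo \<circ> g)"
  proof (rule pin_image)
   show "pin (UNIV - T) z (of_real c) g" using g by (simp add: pin_def)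
   show "continuous_on (UNIV - T) stereo" using continuous_on_stereo[OF continuous_on_id] by simp
   show "stereo ` (UNIV - T) \<subseteq> P1 - S" using ST by auto
  qed
  \<comment> \<open>The point \<open>c + i \<tau> / (1 - \<tau>)\<close> in homogeneous coordinates,
    which reaches infinity at \<open>\<tau> = 1\<close>.\<close>
  moreover define l where "l \<tau> = hpt (of_real c * of_real (1 - \<tau>) + \<i> * of_real \<tau>) (of_real (1 - \<tau>))" for \<tau> :: real
  have ne: "of_real c * of_real (1 - \<tau>) + \<i> * of_real \<tau> \<noteq> 0 \<or> complex_of_real (1 - \<tau>) \<noteq> 0" for \<tau> :: real
   by (cases "\<tau> = 1") auto
  have "pin (P1 - S) (stereo (of_real c)) infty l" unfolding pin_def
  proof (intro conjI)
   show "path l" unfolding path_def l_def using ne by (intro continuous_intros) auto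
   show "path_image l \<subseteq> P1 - S"
   proof
    fix y assume "y \<in> path_image l"
    then obtain \<tau> where y: "y = l \<tau>" by (auto simp: path_image_def)
    have "y \<in> P1" unfolding y l_def using ne by (intro hpt_in_P1) auto
    moreover have "y \<notin> S"
    proof (cases "\<tau> = 1")
     case True
     then show ?thesis using inf y by (simp add: l_def hpt_infty)
    next
     case False
     define q where "q = complex_of_real (1 - \<tau>)"
     have q: "q \<noteq> 0" using False unfolding q_def of_real_eq_0_iff by simp
     have "y = stereo (of_real c + \<i> * (of_real \<tau> / q))"
      unfolding y l_def q_def[symmetric] hpt_stereo[OF q] using q by (simp add: add_divide_distrib)
     moreover have "of_real \<tau> / q = of_real (\<tau> / (1 - \<tau>))" by (simp add: q_def)
     then have "Re (of_real c + \<i> * (of_real \<tau> / q)) = c" by (simp only:) simp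
     ultimately show ?thesis using c ST by force
    qed
    ultimately show "y \<in> P1 - S" by blast
   qed
  qed (auto simp: pathstart_def pathfinish_def l_def stereo_hpt hpt_infty)
  ultimately show ?thesis using 2 pin_join by blast
 qed
 qed
 then obtain \<delta> where \<delta>: "pin (P1 - S) b infty \<delta>" ..
 have "cls n r A (S, infty, \<lambda>\<gamma>. \<rho> (cjp \<delta> \<gamma>)) = cls n r A (S, b, \<rho>)"
  by (rule cls_base[OF A(1) d \<delta>])
 moreover have "cls n r A (S, b, \<rho>) \<in> topspace (hurwitz_space n r A)"
  unfolding topspace_hurwitz_space using d by (rule quotientI)
 ultimately have "reach n r A (cls n r A (S, b, \<rho>)) T"
  unfolding reach_def ST[symmetric] using hurwitz_data_base[OF d \<delta>] connected_component_of_refl by metis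
 then show ?thesis ..
qed

lemma reach_std_all:
 assumes A: "perm_group n A" "n \<ge> 3" and d: "d \<in> hurwitz_data n r"
 shows "reach n r A (cls n r A d) (std_branch r)"
proof -
 obtain S b \<rho> where dd: "d = (S, b, \<rho>)" by (cases d)
 note d = d[unfolded dd]
 note D = hurwitz_dataD[OF d]
 have "\<exists>T. reach n r A (cls n r A (S, b, \<rho>)) T"
 proof (cases "infty \<in> S")
  case False
  then show ?thesis using reach_finite[OF A d] by blast
 next
  case True
  have "b \<noteq> infty" using D(1) True by blast
  then obtain \<beta> where b: "b = stereo \<beta>" using P1_cases[of b] D(1) by blast
  \<comment> \<open>\<open>m\<close> exceeds the distance of every finite branch point from
    \<open>\<beta>\<close>. With \<open>\<epsilon>\<close> of modulus \<open>1 / m\<close> none of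
    them reaches infinity during the isotopy, while the one at infinity leaves at once.\<close>
  define m where "m = 1 + (\<Sum>y\<in>S. norm (affine_coord y - \<beta>))"
  have m: "m > 0" "\<And>y. y \<in> S ==> norm (affine_coord y - \<beta>) < m"
  proof -
   show "m > 0" unfolding m_def by (intro add_pos_nonneg sum_nonneg) auto
   show "norm (affine_coord y - \<beta>) < m" if "y \<in> S" for y
    using member_le_sum[OF that, of "\<lambda>y. norm (affine_coord y - \<beta>)"] D(3) by (simp add: m_def)
  qed
  define \<eta> where "\<eta> = 1 / m"
  define \<epsilon> where "\<epsilon> = \<i> * of_real \<eta>"
  define h where "h t = mob \<beta> (of_real t * \<epsilon>)" for t :: real
  define k where "k t = mob \<beta> (- (of_real t * \<epsilon>))" for t :: real
  have iso: "isotopy h k (stereo \<beta>)" unfolding h_def k_def by (rule mob_isotopy)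
  interpret isotopy h k "stereo \<beta>" by (rule iso)
  have S: "S \<subseteq> P1" "finite S" "stereo \<beta> \<notin> S" using D b by auto
  have fin: "h t s \<noteq> infty" if "t \<in> {0..1}" "s \<in> S" "s \<noteq> infty" for t s
  proof -
   define z where "z = affine_coord s"
   have "norm (of_real t * \<epsilon> * (z - \<beta>)) < 1"
   proof -
    have "norm \<epsilon> = 1 / m" using m(1) by (simp add: \<epsilon>_def \<eta>_def norm_mult norm_divide)
    then have "norm (of_real t * \<epsilon> * (z - \<beta>)) \<le> 1 * (1 / m) * norm (z - \<beta>)"
     using that(1) m(1) unfolding norm_mult norm_of_real by (intro mult_right_mono mult_mono) auto
    also have "\<dots> < 1" using m(1) m(2)[OF that(2)] by (simp add: z_def field_simps)
    finally show ?thesis .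
   qed
   then have "1 + of_real t * \<epsilon> * (z - \<beta>) \<noteq> 0"
    by (metis add.inverse_inverse add_eq_0_iff less_irrefl norm_minus_cancel norm_one)
   then show ?thesis using that(3) by (simp add: h_def mob_def z_def[symmetric] hpt_stereo)
  qed
  have hinf: "h t infty \<noteq> infty" if "t \<in> {0..1}" "t \<noteq> 0" for t
   using that m(1) by (simp add: h_def mob_def hpt_stereo \<epsilon>_def \<eta>_def)
  have mer: "meridian (h t ` S) (stereo \<beta>) (h t s) (h t \<circ> \<gamma>)"
   if t: "t \<in> {0..1}" and s: "s \<in> S" and mr: "meridian S (stereo \<beta>) s \<gamma>" for t s \<gamma>
  proof (cases "s = infty")
   case False
   then show ?thesis using meridian_transport[OF S t s _ mr] fin[OF _ s] by blast
  next
   case True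
   show ?thesis
   proof (cases "t = 0")
    case True
    have "h 0 ` S = S" using h0 S(1) by force
    moreover have "h 0 s = s" using h0 S(1) s by blast
    moreover have "pin (P1 - S) (stereo \<beta>) (stereo \<beta>) \<gamma>"
     using mr cjp_end_pin(1)[OF _ _ refl small_circle_ends] unfolding meridian_cjp_iff by blast
    then have "hp (P1 - S) (h 0 \<circ> \<gamma>) \<gamma>" using h_hp[OF S, of 0] kh_path[OF S, of 0]
    proof -
     assume g: "pin (P1 - S) (stereo \<beta>) (stereo \<beta>) \<gamma>"
     show ?thesis
     proof (rule hp_sym, rule homotopic_paths_eq)
      show "path \<gamma>" "path_image \<gamma> \<subseteq> P1 - S" using g by (auto simp: pin_def)
      fix u :: real assume "u \<in> {0..1}"
      then have "\<gamma> u \<in> P1" using g unfolding pin_def path_image_def by blast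
      then show "\<gamma> u = (h 0 \<circ> \<gamma>) u" using h0 by simp
     qed
    qed
    ultimately show ?thesis using meridian_hp[OF mr] \<open>t = 0\<close> by simp
   next
    case False
    show ?thesis unfolding \<open>s = infty\<close>
    proof (rule meridian_mob_infty[OF S _ _ _ _ iso t])
     show "infty \<in> S" "meridian S (stereo \<beta>) infty \<gamma>" using s mr \<open>s = infty\<close> by auto
     show "of_real t * \<epsilon> = \<i> * of_real (t * \<eta>)" "t * \<eta> > 0"
      using False t m(1) by (auto simp: \<epsilon>_def \<eta>_def)
     show "h t = mob \<beta> (of_real t * \<epsilon>)" by (simp add: h_def)
    qed
   qed
  qed
  have d1: "(h 1 ` S, b, \<lambda>\<gamma>. \<rho> (k 1 \<circ> \<gamma>)) \<in> hurwitz_data n r"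
   using hurwitz_data_transport[OF d[unfolded b], of 1] mer[of 1] b by simp
  have cc: "connected_component_of (hurwitz_space n r A) (cls n r A (S, b, \<rho>)) (cls n r A (h 1 ` S, b, \<lambda>\<gamma>. \<rho> (k 1 \<circ> \<gamma>)))"
   using isotopy_component[OF A d[unfolded b] mer] b by simp
  have "infty \<notin> h 1 ` S"
  proof
   assume "infty \<in> h 1 ` S"
   then obtain s where "s \<in> S" "h 1 s = infty" by force
   then show False using fin[of 1 s] hinf[of 1] by (cases "s = infty") auto
  qed
  from reach_finite[OF A d1 this] obtain T where "reach n r A (cls n r A (h 1 ` S, b, \<lambda>\<gamma>. \<rho> (k 1 \<circ> \<gamma>))) T" ..
  then show ?thesis unfolding reach_def using connected_component_of_trans[OF cc] by blast
 qed
 then show ?thesis unfolding dd using reach_std[OF A] by blast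
qed

section \<open>Loops along vertical lines, and half twists composed of shears\<close>

section \<open>Vertical lines and the braid move\<close>

text \<open>From infinity along a vertical half line to the real point \<open>c\<close>, from above
  for \<open>\<sigma> = 1\<close> and from below for \<open>\<sigma> = - 1\<close>; the homogeneous
  form includes infinity as the parameter 0.\<close>

definition tp :: "real => real => real => point" where
 "tp c \<sigma> t = hpt (of_real (c * t) + \<i> * of_real (\<sigma> * (1 - t))) (of_real t)"

lemma tp_pos: "t \<noteq> 0 ==> tp c \<sigma> t = stereo (Complex c (\<sigma> * (1 - t) / t))"
 by (simp add: tp_def hpt_stereo complex_eq_iff field_simps)

lemma tp_0: "\<sigma> \<noteq> 0 ==> tp c \<sigma> 0 = infty"
 by (simp add: tp_def hpt_infty)

lemma tp_1: "tp c \<sigma> 1 = stereo (of_real c)"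
 by (simp add: tp_def hpt_stereo)

lemma tp_pt:
 assumes "\<sigma> \<noteq> 0" "t \<in> {0..1}"
 shows "(\<forall>c. tp c \<sigma> t = infty) \<or> (\<exists>y. \<sigma> * y \<ge> 0 \<and> (\<forall>c. tp c \<sigma> t = stereo (Complex c y)))"
proof (cases "t = 0")
 case False
 have "\<sigma> * (\<sigma> * (1 - t) / t) \<ge> 0" using assms(2) by (simp add: mult.assoc[symmetric])
 then show ?thesis using tp_pos[OF False] by blast
qed (simp add: tp_0 assms)

lemma continuous_on_tp: "\<sigma> \<noteq> 0 ==> continuous_on A (tp c \<sigma>)"
 unfolding tp_def by (intro continuous_intros) (auto simp: complex_eq_iff)

lemma pin_tp:
 assumes "\<sigma> \<noteq> 0" "\<And>y. \<sigma> * y \<ge> 0 ==> Complex c y \<notin> T"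
 shows "pin (P1 - stereo ` T) infty (stereo (of_real c)) (tp c \<sigma>)"
 unfolding pin_def
proof (intro conjI)
 show "path (tp c \<sigma>)" unfolding path_def by (rule continuous_on_tp[OF assms(1)])
 show "path_image (tp c \<sigma>) \<subseteq> P1 - stereo ` T" unfolding path_image_def
 proof (intro image_subsetI)
  fix t :: real assume "t \<in> {0..1}"
  from tp_pt[OF assms(1) this] show "tp c \<sigma> t \<in> P1 - stereo ` T" using assms(2) by force
 qed
 show "pathstart (tp c \<sigma>) = infty" "pathfinish (tp c \<sigma>) = stereo (of_real c)"
  by (auto simp: pathstart_def pathfinish_def tp_0 tp_1 assms(1))
qed

text \<open>The whole vertical line run downwards, as a loop based at infinity.\<close>

definition ell :: "real => real => point" where
 "ell c = tp c 1 +++ reversepath (tp c (- 1))"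

lemma ell_pt:
 assumes "t \<in> {0..1}"
 shows "(\<forall>c. ell c t = infty) \<or> (\<exists>y. \<forall>c. ell c t = stereo (Complex c y))"
proof (cases "t \<le> 1 / 2")
 case True
 then show ?thesis using tp_pt[of 1 "2 * t"] assms by (auto simp: ell_def joinpaths_def)
next
 case False
 then show ?thesis using tp_pt[of "- 1" "2 - 2 * t"] assms by (auto simp: ell_def joinpaths_def reversepath_def)
qed

lemma pin_ell:
 assumes "\<And>y. Complex c y \<notin> T" shows "pin (P1 - stereo ` T) infty infty (ell c)"
 unfolding ell_def by (rule pin_join[where c = "stereo (of_real c)"]) (intro pin_rev pin_tp; use assms in simp)+

lemma flow_hp:
 assumes u: "continuous_on UNIV u" and bd: "\<And>z. norm (u z) \<le> M"
  and g: "pin (P1 - S) infty infty \<gamma>"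
  and av: "\<And>s t. s \<in> {0..1} ==> t \<in> {0..1} ==> flow u (a * s) (\<gamma> t) \<notin> S"
 shows "hp (P1 - S) \<gamma> (flow u a \<circ> \<gamma>)"
 unfolding homotopic_paths
proof (intro exI conjI ballI)
 let ?h = "\<lambda>x. flow u (a * fst x) (\<gamma> (snd x))"
 have P: "\<gamma> t \<in> P1" if "t \<in> {0..1}" for t using g that unfolding pin_def path_image_def by blast
 have gc: "continuous_on {0..1} \<gamma>" using g by (simp add: pin_def path_def)
 have "continuous_on ({0..1} \<times> {0..1}) ((\<lambda>x. flow u (fst x) (snd x)) \<circ> (\<lambda>x. (a * fst x, \<gamma> (snd x))))"
  using P by (intro continuous_on_compose continuous_intros continuous_on_compose2[OF gc]
    continuous_on_subset[OF continuous_on_flow[where u = u and T = UNIV, OF u bd]]) auto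
 then show "continuous_on ({0..1} \<times> {0..1}) ?h" by (simp add: comp_def)
 show "?h \<in> {0..1} \<times> {0..1} \<rightarrow> P1 - S"
 proof
  fix x :: "real \<times> real" assume "x \<in> {0..1} \<times> {0..1}"
  then show "?h x \<in> P1 - S" using av[of "fst x" "snd x"] flow_in_P1 by (auto simp: mem_Times_iff)
 qed
 show "?h (0, t) = \<gamma> t" if "t \<in> {0..1}" for t using P[OF that] by (cases rule: P1_cases) auto
qed (use g in \<open>auto simp: pin_def pathstart_def pathfinish_def\<close>)

text \<open>The curve with real part \<open>g y\<close> at height \<open>y\<close>, obtained from
  the imaginary axis by a horizontal shear.\<close>

definition gr :: "(real => real) => real => point" where
 "gr g = flow (hshear g) 1 \<circ> ell 0"

lemma gr_pt:
 assumes "t \<in> {0..1}"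
 shows "(\<forall>c g. gr g t = infty \<and> ell c t = infty) \<or>
  (\<exists>y. \<forall>c g. gr g t = stereo (Complex (g y) y) \<and> ell c t = stereo (Complex c y))"
 using ell_pt[OF assms]
proof
 assume "\<exists>y. \<forall>c. ell c t = stereo (Complex c y)"
 then obtain y where y: "\<And>c. ell c t = stereo (Complex c y)" by blast
 have "gr g t = stereo (Complex (g y) y)" for g by (simp add: gr_def y hshear_def complex_eq_iff)
 then show ?thesis using y by blast
qed (simp add: gr_def)

lemma pin_gr:
 assumes "continuous_on UNIV g" "\<And>y. \<bar>g y\<bar> \<le> M" "\<And>y. Complex (g y) y \<notin> T"
 shows "pin (P1 - stereo ` T) infty infty (gr g)"
proof -
 have c: "continuous_on P1 (flow (hshear g) 1)"
 proof -
  have "continuous_on P1 ((\<lambda>x. flow (hshear g) (fst x) (snd x)) \<circ> (\<lambda>x. (1, x)))"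
   by (intro continuous_on_compose continuous_intros
     continuous_on_subset[OF continuous_on_flow[where u = "hshear g" and M = M and T = UNIV, OF hshear(1,2)[OF assms(1,2)]]]) auto
  then show ?thesis by (simp add: comp_def)
 qed
 have "pin (P1 - stereo ` {}) infty infty (ell 0)" by (rule pin_ell) auto
 then have e: "pin P1 infty infty (ell 0)" by simp
 have "pin P1 infty infty (gr g)" using pin_image[OF e c image_subsetI[OF flow_in_P1]] by (simp add: gr_def)
 moreover have "gr g t \<notin> stereo ` T" if "t \<in> {0..1}" for t using gr_pt[OF that] assms(3) by force
 then have "path_image (gr g) \<inter> stereo ` T = {}" unfolding path_image_def by blast
 ultimately show ?thesis unfolding pin_def by blast
qed

text \<open>Interpolating horizontally at each height is again a shear, so the homotopy only has to
  avoid \<open>T\<close> pointwise.\<close>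

lemma hp_gr:
 assumes g: "continuous_on UNIV g" "\<And>y. \<bar>g y\<bar> \<le> M" and h: "continuous_on UNIV h" "\<And>y. \<bar>h y\<bar> \<le> M'"
  and av: "\<And>s y. s \<in> {0..1} ==> Complex ((1 - s) * g y + s * h y) y \<notin> T"
 shows "hp (P1 - stereo ` T) (gr g) (gr h)"
proof -
 let ?u = "hshear (\<lambda>y. h y - g y)"
 have "continuous_on UNIV (\<lambda>y. h y - g y)" using g(1) h(1) by (intro continuous_intros)
 moreover have "\<bar>h y - g y\<bar> \<le> M + M'" for y using g(2)[of y] h(2)[of y] by linarith
 ultimately have u: "continuous_on UNIV ?u" "\<And>z. norm (?u z) \<le> M + M'"
  using hshear[of "\<lambda>y. h y - g y" "M + M'"] by auto
 have pg: "pin (P1 - stereo ` T) infty infty (gr g)" using av[of 0] by (intro pin_gr[where M = M, OF g]) auto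
 have fl: "flow ?u s (gr g t) = infty \<and> gr h t = infty \<or>
   (\<exists>y. flow ?u s (gr g t) = stereo (Complex ((1 - s) * g y + s * h y) y) \<and> gr h t = stereo (Complex (h y) y))"
  if "t \<in> {0..1}" for s t using gr_pt[OF that]
 proof
  assume "\<exists>y. \<forall>c g. gr g t = stereo (Complex (g y) y) \<and> ell c t = stereo (Complex c y)"
  then obtain y where y: "\<And>g. gr g t = stereo (Complex (g y) y)" by blast
  have "flow ?u s (gr g t) = stereo (Complex ((1 - s) * g y + s * h y) y)"
   unfolding y by (simp add: hshear_def complex_eq_iff algebra_simps)
  then show ?thesis using y by blast
 qed auto
 have "hp (P1 - stereo ` T) (gr g) (flow ?u 1 \<circ> gr g)"
 proof (rule flow_hp[where M = "M + M'", OF u pg])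
  fix s t :: real assume "s \<in> {0..1}" "t \<in> {0..1}"
  then show "flow ?u (1 * s) (gr g t) \<notin> stereo ` T" using fl[of t s] av[of s] by force
 qed
 also have "hp (P1 - stereo ` T) (flow ?u 1 \<circ> gr g) (gr h)"
 proof (rule homotopic_paths_eq)
  show "path (flow ?u 1 \<circ> gr g)" "path_image (flow ?u 1 \<circ> gr g) \<subseteq> P1 - stereo ` T"
   using homotopic_paths_imp_path[OF calculation] homotopic_paths_imp_subset[OF calculation] by auto
  show "(flow ?u 1 \<circ> gr g) t = gr h t" if "t \<in> {0..1}" for t using fl[OF that, of 1] by auto
 qed
 finally show ?thesis .
qed

lemma hp_ell_gr:
 assumes "\<And>y. Complex c y \<notin> T"
 shows "hp (P1 - stereo ` T) (ell c) (gr (\<lambda>_. c))"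
proof (rule homotopic_paths_eq)
 show "path (ell c)" "path_image (ell c) \<subseteq> P1 - stereo ` T" using pin_ell[OF assms] by (auto simp: pin_def)
 show "ell c t = gr (\<lambda>_. c) t" if "t \<in> {0..1}" for t using gr_pt[OF that] by auto
qed

lemma gr_split: "gr g = (flow (hshear g) 1 \<circ> tp 0 1) +++ reversepath (flow (hshear g) 1 \<circ> tp 0 (- 1))"
 by (simp add: gr_def ell_def path_compose_join path_compose_reversepath)

text \<open>The choices above and below height 0 are independent, so one of the four paths is a word in the
 other three. This is where the braid move comes from.\<close>

lemma gr_cross:
 fixes a b :: "real => real"
 defines "mix \<equiv> \<lambda>(a :: real => real) b y. if y \<ge> 0 then a y else b y"
 assumes a: "continuous_on UNIV a" "\<And>y. \<bar>a y\<bar> \<le> M" "\<And>y. Complex (a y) y \<notin> T"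
  and b: "continuous_on UNIV b" "\<And>y. \<bar>b y\<bar> \<le> M" "\<And>y. Complex (b y) y \<notin> T" and ab: "a 0 = b 0"
 shows "hp (P1 - stereo ` T) (gr a) (gr (mix a b) +++ (reversepath (gr b) +++ gr (mix b a)))"
proof -
 let ?Y = "P1 - stereo ` T"
 define H where "H g \<sigma> = flow (hshear g) 1 \<circ> tp 0 \<sigma>" for g \<sigma>
 have gH: "gr g = H g 1 +++ reversepath (H g (- 1))" for g unfolding gr_split H_def ..
 have piece: "pin ?Y infty (stereo (of_real (b 0))) (H g \<sigma>)"
  if "g = a \<or> g = b" "\<sigma> = 1 \<or> \<sigma> = -1" for g \<sigma>
 proof -
  have pg: "pin ?Y infty infty (gr g)" using that(1) pin_gr[OF a] pin_gr[OF b] by blast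
  have ends: "pathstart (H g s) = infty" "pathfinish (H g s) = stereo (of_real (g 0))" if "s \<noteq> 0" for s
   using that by (auto simp: H_def pathstart_def pathfinish_def tp_0 tp_1 hshear_def)
  have "path (H g 1) \<and> path (reversepath (H g (- 1)))"
   using pg ends path_join[of "H g 1" "reversepath (H g (- 1))"] unfolding gH pin_def by auto
  moreover have "path_image (H g 1) \<union> path_image (H g (- 1)) \<subseteq> ?Y"
   using pg ends unfolding gH pin_def by (auto simp: path_image_join)
  ultimately show ?thesis using that ends ab unfolding pin_def by auto
 qed
 have same: "hp ?Y (H g \<sigma>) (H g' \<sigma>)"
  if "g = a \<or> g = b" and sg: "\<sigma> = 1 \<or> \<sigma> = -1" and "\<And>y. \<sigma> * y \<ge> 0 ==> g' y = g y" for g g' \<sigma>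
 proof (rule homotopic_paths_eq)
  show "path (H g \<sigma>)" "path_image (H g \<sigma>) \<subseteq> ?Y" using piece[OF that(1) sg] by (auto simp: pin_def)
  show "H g \<sigma> t = H g' \<sigma> t" if t: "t \<in> {0..1}" for t
  proof -
   have "(\<forall>c. tp c \<sigma> t = infty) \<or> (\<exists>y. \<sigma> * y \<ge> 0 \<and> (\<forall>c. tp c \<sigma> t = stereo (Complex c y)))"
    using tp_pt[where \<sigma> = \<sigma>, OF _ t] sg by force
   then show ?thesis
    using \<open>\<And>y. \<sigma> * y \<ge> 0 ==> g' y = g y\<close> by (auto simp: H_def hshear_def)
  qed
 qed
 let ?\<alpha> = "H a 1" and ?\<alpha>' = "H b 1" and ?\<beta> = "H a (- 1)" and ?\<beta>' = "H b (- 1)"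
 note p = piece[of a 1, simplified] piece[of b 1, simplified] piece[of a "-1", simplified] piece[of b "-1", simplified]
 note q = p(1,2) p(3,4)[THEN pin_rev]
 have mix: "hp ?Y (?\<alpha> +++ reversepath ?\<beta>') (gr (mix a b))"
  "hp ?Y (?\<alpha>' +++ reversepath ?\<beta>) (gr (mix b a))"
  unfolding gH by (intro hp_join hp_rev same; use ab p in \<open>auto simp: mix_def pin_def\<close>)+
 have "hp ?Y (reversepath (gr b) +++ (?\<alpha>' +++ reversepath ?\<beta>)) (?\<beta>' +++ reversepath ?\<beta>)"
 proof -
  have "reversepath (gr b) = ?\<beta>' +++ reversepath ?\<alpha>'" unfolding gH rev_join[OF p(2) q(4)] by simp
  then show ?thesis using hp_cancel[OF p(4) pin_rev[OF p(2)] q(3)] by simp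
 qed
 then have "hp ?Y ((?\<alpha> +++ reversepath ?\<beta>') +++ (reversepath (gr b) +++ (?\<alpha>' +++ reversepath ?\<beta>)))
  ((?\<alpha> +++ reversepath ?\<beta>') +++ (?\<beta>' +++ reversepath ?\<beta>))"
  by (rule hp_joinR[OF pin_join[OF q(1,4)] _ pin_join[OF pin_rev[OF pin_gr[OF b]] pin_join[OF q(2,3)]]])
 also have "hp ?Y \<dots> (gr a)" unfolding gH using hp_cancel[OF q(1,4) q(3)] by simp
 finally have 1: "hp ?Y ((?\<alpha> +++ reversepath ?\<beta>') +++ (reversepath (gr b) +++ (?\<alpha>' +++ reversepath ?\<beta>))) (gr a)" .
 have rb: "pin ?Y infty infty (reversepath (gr b))" by (rule pin_rev[OF pin_gr[OF b]])
 have "hp ?Y ((?\<alpha> +++ reversepath ?\<beta>') +++ (reversepath (gr b) +++ (?\<alpha>' +++ reversepath ?\<beta>)))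
  (gr (mix a b) +++ (reversepath (gr b) +++ gr (mix b a)))"
  by (intro hp_join mix hp_refl[OF rb]) (use q rb in \<open>auto simp: pin_def\<close>)
 then show ?thesis using 1 hp_sym hp_trans by blast
qed

text \<open>A vertical shear slides the line along itself, and no branch point lies on it.\<close>

lemma vshear_ell:
 assumes "(stereo ` T, infty, \<rho>) \<in> hurwitz_data n r" "continuous_on UNIV f" "\<And>x. \<bar>f x\<bar> \<le> M" "c \<notin> Re ` T"
 shows "\<rho> (flow (vshear f) (- 1) \<circ> ell c) = \<rho> (ell c)"
proof -
 have c: "Complex c y \<notin> T" for y using assms(4) by (metis complex.sel(1) imageI)
 note e = pin_ell[where c = c, OF c]
 have "hp (P1 - stereo ` T) (ell c) (flow (vshear f) (- 1) \<circ> ell c)"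
 proof (rule flow_hp[where M = M, OF vshear(1,2)[OF assms(2,3)] e])
  fix s t :: real assume t: "t \<in> {0..1}"
  show "flow (vshear f) (- 1 * s) (ell c t) \<notin> stereo ` T" using ell_pt[OF t]
  proof
   assume "\<exists>y. \<forall>c. ell c t = stereo (Complex c y)"
   then obtain y where y: "ell c t = stereo (Complex c y)" by blast
   have "flow (vshear f) (- 1 * s) (ell c t) = stereo (Complex c (y - s * f c))" by (simp add: y vshear_def complex_eq_iff)
   then show ?thesis using c by auto
  qed auto
 qed
 then show ?thesis using pi1_hp[OF _ e] assms(1) unfolding hurwitz_data_iff by metis
qed

text \<open>A half twist made of three shears: raise point \<open>i\<close> and lower point
  \<open>i + 1\<close>, shift them horizontally past each other, and return to the real axis. Pulled
  back, the line between them passes left of the raised point and right of the lowered one;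
  \<open>gr_cross\<close> expresses it by the neighbouring lines.\<close>

lemma braid_move:
 assumes A: "perm_group n A" "n \<ge> 3" and d: "(stereo ` std_branch r, infty, \<rho>) \<in> hurwitz_data n r"
  and i: "1 \<le> i" "i < r"
 obtains \<rho>' where "(stereo ` std_branch r, infty, \<rho>') \<in> hurwitz_data n r"
  "connected_component_of (hurwitz_space n r A) (cls n r A (stereo ` std_branch r, infty, \<rho>))
    (cls n r A (stereo ` std_branch r, infty, \<rho>'))"
  "\<And>m. m \<noteq> i ==> \<rho>' (ell (real m + 1 / 2)) = \<rho> (ell (real m + 1 / 2))"
  "\<rho>' (ell (real i + 1 / 2)) =
    \<rho> (ell (real (i + 1) + 1 / 2)) \<circ> inv' (\<rho> (ell (real i + 1 / 2))) \<circ> \<rho> (ell (real (i - 1) + 1 / 2))"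
proof -
 define v :: "nat => real" where "v m = (if m = i then 1 else if m = i + 1 then - 1 else 0)" for m
 define w where "w x = v (nat \<lfloor>x\<rfloor>)" for x :: real
 obtain f M where f: "continuous_on UNIV f" "\<And>x. \<bar>f x\<bar> \<le> M" "\<And>x. x \<in> real ` {1..r} ==> f x = w x"
  using bounded_interpolation[of "real ` {1..r}" w] by auto
 have fv: "f (real m) = v m" if "m \<in> {1..r}" for m using f(3)[of "real m"] that by (simp add: w_def)
 \<comment> \<open>Equal to \<open>y\<close> between the heights -1 and 1 of the two displaced
   points, and cut off beyond them to be bounded.\<close>
 define g :: "real => real" where "g y = max (- 1) (min 1 y)" for y
 have g: "continuous_on UNIV g" "\<And>y. \<bar>g y\<bar> \<le> 1" unfolding g_def by (auto intro!: continuous_intros)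
 define \<tau> where "\<tau> = Transposition.transpose i (i + 1)"
 have \<tau>: "\<tau> ` {1..r} = {1..r}" unfolding \<tau>_def using i by (intro transpose_image_eq) auto
 define T1 where "T1 = (\<lambda>z. z + vshear f z) ` std_branch r"
 define T2 where "T2 = (\<lambda>z. z + hshear g z) ` T1"
 have T1: "T1 = (\<lambda>m. Complex (real m) (v m)) ` {1..r}" unfolding T1_def std_branch_def image_image using fv
  by (intro image_cong) (auto simp: vshear_def complex_eq_iff)
 have T2: "T2 = (\<lambda>m. Complex (real (\<tau> m)) (v m)) ` {1..r}" unfolding T2_def T1 image_image
  by (intro image_cong) (auto simp: hshear_def complex_eq_iff v_def g_def \<tau>_def Transposition.transpose_def)
 \<comment> \<open>The same vertical shear also brings the points back: after the exchange each
   stands over the place where the shear has the opposite sign.\<close>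
 have T3: "(\<lambda>z. z + vshear f z) ` T2 = std_branch r"
 proof -
  have "(\<lambda>z. z + vshear f z) ` T2 = (\<lambda>m. of_nat (\<tau> m)) ` {1..r}" unfolding T2 image_image
  proof (intro image_cong refl)
   fix m assume "m \<in> {1..r}"
   then have "f (real (\<tau> m)) = v (\<tau> m)" using \<tau> by (intro fv) blast
   then show "Complex (real (\<tau> m)) (v m) + vshear f (Complex (real (\<tau> m)) (v m)) = of_nat (\<tau> m)"
    by (simp add: vshear_def complex_eq_iff) (simp add: v_def \<tau>_def Transposition.transpose_def)
  qed
  also have "\<dots> = of_nat ` \<tau> ` {1..r}" by (simp add: image_image)
  finally show ?thesis unfolding \<tau> std_branch_def .
 qed
 define \<rho>1 where "\<rho>1 = (\<lambda>\<gamma>. \<rho> (flow (vshear f) (- 1) \<circ> \<gamma>))"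
 define \<rho>2 where "\<rho>2 = (\<lambda>\<gamma>. \<rho>1 (flow (hshear g) (- 1) \<circ> \<gamma>))"
 define \<rho>3 where "\<rho>3 = (\<lambda>\<gamma>. \<rho>2 (flow (vshear f) (- 1) \<circ> \<gamma>))"
 note c1 = flow_component[where u = "vshear f" and M = M, OF A d vshear[OF f(1,2)], folded \<rho>1_def T1_def]
 note c2 = flow_component[where u = "hshear g" and M = 1, OF A c1(1) hshear[OF g], folded \<rho>2_def T2_def]
 note c3 = flow_component[where u = "vshear f" and M = M, OF A c2(1) vshear[OF f(1,2)], folded \<rho>3_def, unfolded T3]
 have half: "real m + 1 / 2 \<noteq> real k" for m k
 proof
  assume "real m + 1 / 2 = real k"
  then have "real (2 * m + 1) = real (2 * k)" by simp
  then show False by (metis of_nat_eq_iff even_mult_iff even_numeral odd_two_times_div_two_succ even_plus_one_iff)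
 qed
 let ?c = "\<lambda>m. real m + 1 / 2"
 have \<rho>1: "\<rho>1 (ell (?c m)) = \<rho> (ell (?c m))" for m
  unfolding \<rho>1_def using half by (intro vshear_ell[where M = M, OF d f(1,2)]) (auto simp: std_branch_def)
 have \<rho>3: "\<rho>3 (ell (?c m)) = \<rho>2 (ell (?c m))" for m
  unfolding \<rho>3_def using half by (intro vshear_ell[where M = M, OF c2(1) f(1,2)]) (auto simp: T2)
 let ?Y = "P1 - stereo ` T1"
 have hom1: "pi1_hom n ?Y infty \<rho>1" using c1(1) unfolding hurwitz_data_iff by blast
 have e1: "Complex (?c m) y \<notin> T1" for m y using half by (auto simp: T1)
 have pe: "pin ?Y infty infty (ell (?c m))" for m by (rule pin_ell[OF e1])
 have eg: "hp ?Y (flow (hshear g) (- 1) \<circ> ell (?c m)) (gr (\<lambda>y. ?c m - g y))"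
  if "\<And>y. Complex (?c m - g y) y \<notin> T1" for m
 proof (rule hp_sym, rule homotopic_paths_eq)
  have "pin ?Y infty infty (gr (\<lambda>y. ?c m - g y))"
  proof (rule pin_gr[where M = "?c m + 1", OF _ _ that])
   show "continuous_on UNIV (\<lambda>y. ?c m - g y)" using g(1) by (intro continuous_intros)
   show "\<bar>?c m - g y\<bar> \<le> ?c m + 1" for y using g(2)[of y] by linarith
  qed
  then show "path (gr (\<lambda>y. ?c m - g y))" "path_image (gr (\<lambda>y. ?c m - g y)) \<subseteq> ?Y"
   by (auto simp: pin_def)
  show "gr (\<lambda>y. ?c m - g y) t = (flow (hshear g) (- 1) \<circ> ell (?c m)) t" if "t \<in> {0..1}" for t
   using gr_pt[OF that] by (auto simp: hshear_def complex_eq_iff)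
 qed
 have gc: "continuous_on UNIV (\<lambda>y. ?c i - g y)" "continuous_on UNIV (\<lambda>y. if y \<ge> 0 then ?c i - g y else ?c i)"
  "continuous_on UNIV (\<lambda>y. if y \<ge> 0 then ?c i else ?c i - g y)"
 proof -
  have "(\<lambda>y. if y \<ge> 0 then ?c i - g y else ?c i) = (\<lambda>y. ?c i - max 0 (g y))"
   "(\<lambda>y. if y \<ge> 0 then ?c i else ?c i - g y) = (\<lambda>y. ?c i - min 0 (g y))" by (auto simp: g_def)
  moreover have "continuous_on UNIV (\<lambda>y. ?c i - g y)" "continuous_on UNIV (\<lambda>y. ?c i - max 0 (g y))"
   "continuous_on UNIV (\<lambda>y. ?c i - min 0 (g y))" using g(1) by (auto intro!: continuous_intros)
  ultimately show "continuous_on UNIV (\<lambda>y. ?c i - g y)" "continuous_on UNIV (\<lambda>y. if y \<ge> 0 then ?c i - g y else ?c i)"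
   "continuous_on UNIV (\<lambda>y. if y \<ge> 0 then ?c i else ?c i - g y)" by (simp_all only:)
 qed
 have gb: "\<bar>?c i - g y\<bar> \<le> ?c i + 1" "\<bar>?c i\<bar> \<le> ?c i + 1"
  "\<bar>if y \<ge> 0 then ?c i - g y else ?c i\<bar> \<le> ?c i + 1" "\<bar>if y \<ge> 0 then ?c i else ?c i - g y\<bar> \<le> ?c i + 1" for y
  using g(2)[of y] by auto
 have goal4: "\<rho>3 (ell (?c i)) = \<rho> (ell (?c (i + 1))) \<circ> inv' (\<rho> (ell (?c i))) \<circ> \<rho> (ell (?c (i - 1)))"
 proof -
  have avD: "Complex (?c i - g y) y \<notin> T1" for y using half[of i] by (auto simp: T1 v_def g_def split: if_splits)
  note D = eg[OF avD]
  \<comment> \<open>Bent to the left above the axis only, the curve leaves the raised point on its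
    right, and no branch point separates it from the line through \<open>i - 1 / 2\<close>.\<close>
  have A': "hp ?Y (gr (\<lambda>y. if y \<ge> 0 then ?c i - g y else ?c i)) (gr (\<lambda>y. ?c (i - 1)))"
  proof (rule hp_gr[where M = "?c i + 1" and M' = "?c (i - 1)", OF gc(2) gb(3)])
   fix s y :: real assume s: "s \<in> {0..1}"
   show "Complex ((1 - s) * (if 0 \<le> y then ?c i - g y else ?c i) + s * ?c (i - 1)) y \<notin> T1"
   proof
    assume "Complex ((1 - s) * (if 0 \<le> y then ?c i - g y else ?c i) + s * ?c (i - 1)) y \<in> T1"
    then obtain k where k: "(1 - s) * (if 0 \<le> y then ?c i - g y else ?c i) + s * (?c i - 1) = real k" "y = v k"
     using i by (auto simp: T1 algebra_simps)
    consider "k = i" | "k = i + 1" | "v k = 0" "k \<noteq> i" "k \<noteq> i + 1" unfolding v_def by presburger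
    then show False
    proof cases
     case 3
     then have "(1 - s) * ?c i + s * (?c i - 1) = real k" using k by (simp add: g_def)
     moreover have "(1 - s) * ?c i + s * (?c i - 1) = ?c i - s" by (simp only: algebra_simps)
     ultimately have "?c i - s = real k" by simp
     then have "real i < real k + 1" "real k < real i + 1" using s by auto
     then show False using 3 by linarith
    qed (use k s in \<open>auto simp: v_def g_def field_simps\<close>)
   qed
  qed auto
  \<comment> \<open>The mirror case: bent to the right below the axis, the curve has passed the
    lowered point \<open>i + 1\<close>.\<close>
  have C': "hp ?Y (gr (\<lambda>y. if y \<ge> 0 then ?c i else ?c i - g y)) (gr (\<lambda>y. ?c (i + 1)))"
  proof (rule hp_gr[where M = "?c i + 1" and M' = "?c (i + 1)", OF gc(3) gb(4)])
   fix s y :: real assume s: "s \<in> {0..1}"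
   show "Complex ((1 - s) * (if 0 \<le> y then ?c i else ?c i - g y) + s * ?c (i + 1)) y \<notin> T1"
   proof
    assume "Complex ((1 - s) * (if 0 \<le> y then ?c i else ?c i - g y) + s * ?c (i + 1)) y \<in> T1"
    then obtain k where k: "(1 - s) * (if 0 \<le> y then ?c i else ?c i - g y) + s * (?c i + 1) = real k" "y = v k"
     using i by (auto simp: T1 algebra_simps)
    consider "k = i" | "k = i + 1" | "v k = 0" "k \<noteq> i" "k \<noteq> i + 1" unfolding v_def by presburger
    then show False
    proof cases
     case 3
     then have "(1 - s) * ?c i + s * (?c i + 1) = real k" using k by (simp add: g_def)
     moreover have "(1 - s) * ?c i + s * (?c i + 1) = ?c i + s" by (simp only: algebra_simps)
     ultimately have "?c i + s = real k" by simp
     then have "real i < real k" "real k < real i + 2" using s by auto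
     then show False using 3 by linarith
    qed (use k s in \<open>auto simp: v_def g_def field_simps\<close>)
   qed
  qed auto
  have "hp ?Y (gr (\<lambda>y. ?c i - g y))
   (gr (\<lambda>y. if y \<ge> 0 then ?c i - g y else ?c i) +++ (reversepath (gr (\<lambda>y. ?c i)) +++ gr (\<lambda>y. if y \<ge> 0 then ?c i else ?c i - g y)))"
   using gr_cross[where a = "\<lambda>y. ?c i - g y" and b = "\<lambda>y. ?c i" and M = "?c i + 1", OF gc(1) gb(1) avD _ gb(2) e1]
   by (simp add: g_def)
  note 1 = hp_trans[OF D this]
  have pins: "pin ?Y infty infty (gr (\<lambda>y. ?c m))" for m using hp_pinD'[OF hp_ell_gr[OF e1] pe] .
  have gr_ell: "\<rho>1 (gr (\<lambda>y. ?c m)) = \<rho> (ell (?c m))" for m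
   using pi1_hp[OF hom1 pe hp_ell_gr[OF e1]] \<rho>1 by metis
  note p = hp_pinD[OF A' pins] hp_pinD[OF C' pins] pin_rev[OF pins[of i]]
  have "\<rho>3 (ell (?c i)) = \<rho>1 (flow (hshear g) (- 1) \<circ> ell (?c i))"
   unfolding \<rho>3 by (simp add: \<rho>2_def)
  also have "\<dots> = \<rho>1 (gr (\<lambda>y. if y \<ge> 0 then ?c i - g y else ?c i) +++ (reversepath (gr (\<lambda>y. ?c i)) +++ gr (\<lambda>y. if y \<ge> 0 then ?c i else ?c i - g y)))"
   by (rule pi1_hp[OF hom1 hp_pinD[OF 1 pin_join[OF p(1) pin_join[OF p(3,2)]]] 1])
  also have "\<dots> = \<rho>1 (gr (\<lambda>y. ?c (i + 1))) \<circ> inv' (\<rho>1 (gr (\<lambda>y. ?c i))) \<circ> \<rho>1 (gr (\<lambda>y. ?c (i - 1)))"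
   unfolding pi1_join[OF hom1 p(1) pin_join[OF p(3,2)]] pi1_join[OF hom1 p(3,2)] pi1_rev[OF hom1 pins]
    pi1_hp[OF hom1 p(1) A'] pi1_hp[OF hom1 p(2) C'] ..
  finally show ?thesis unfolding gr_ell .
 qed
 have goal3: "\<rho>3 (ell (?c m)) = \<rho> (ell (?c m))" if "m \<noteq> i" for m
 proof -
  have "hp ?Y (ell (?c m)) (flow (hshear g) (- 1) \<circ> ell (?c m))"
  proof (rule flow_hp[where M = 1, OF hshear(1,2)[OF g] pe])
   fix s t :: real assume s: "s \<in> {0..1}" and t: "t \<in> {0..1}"
   show "flow (hshear g) (- 1 * s) (ell (?c m) t) \<notin> stereo ` T1" using ell_pt[OF t]
   proof
    assume "\<exists>y. \<forall>c. ell c t = stereo (Complex c y)"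
    then obtain y where y: "ell (?c m) t = stereo (Complex (?c m) y)" by blast
    have "flow (hshear g) (- 1 * s) (ell (?c m) t) = stereo (Complex (?c m - s * g y) y)"
     by (simp add: y hshear_def complex_eq_iff)
    moreover have "Complex (?c m - s * g y) y \<notin> T1"
    proof
     assume "Complex (?c m - s * g y) y \<in> T1"
     then obtain k where k: "?c m - s * g y = real k" "y = v k" by (auto simp: T1)
     consider "k = i" | "k = i + 1" | "v k = 0" unfolding v_def by presburger
     then show False
     proof cases
      case 1
      then have "?c m = real i + s" using k by (simp add: v_def g_def)
      then have "real i < real m + 1" "real m < real i + 1" using s by auto
      then show False using that by linarith
     next
      case 2
      then have "?c m = real i + 1 - s" using k by (simp add: v_def g_def)
      then have "real i < real m + 1" "real m < real i + 1" using s by auto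
      then show False using that by linarith
     next
      case 3
      then show False using k half[of m k] by (simp add: g_def)
     qed
    qed
    ultimately show ?thesis by auto
   qed auto
  qed
  from pi1_hp[OF hom1 pe this] show ?thesis unfolding \<rho>3 by (simp add: \<rho>2_def \<rho>1)
 qed
 show ?thesis
  by (rule that[OF c3(1) connected_component_of_trans[OF connected_component_of_trans[OF c1(2) c2(2)] c3(2)] goal3 goal4])
qed

section \<open>Simply connected pieces and a local-to-global principle for paths\<close>

section \<open>Simply connected pieces of the sphere\<close>

lemma sc_hp:
 fixes U :: "'a::real_normed_vector set"
 assumes "simply_connected U" "U \<subseteq> Y" "pin U a c p" "pin U a c q"
 shows "hp Y p q"
proof -
 have "hp U p q" using assms(1,3,4) unfolding simply_connected_eq_homotopic_paths pin_def by metis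
 then show ?thesis by (rule homotopic_paths_subset[OF _ assms(2)])
qed

lemma sc_path:
 fixes U :: "'a::real_normed_vector set"
 assumes "simply_connected U" "a \<in> U" "c \<in> U"
 obtains p where "pin U a c p"
 using simply_connected_imp_path_connected[OF assms(1)] assms(2,3) unfolding path_connected_def pin_def by metis

text \<open>The Moebius map \<open>(z - a) / (z - b)\<close> takes the segment to the nonpositive
  real axis together with infinity, and infinity to 1. The complement thus becomes the slit plane,
  which is starlike.\<close>

lemma sc_slit_sphere:
 fixes a b :: real
 assumes "a < b"
 shows "simply_connected (P1 - stereo ` of_real ` {a..b})" (is "simply_connected ?U")
proof (rule simply_connected_retraction_gen)
 let ?Z = "- (complex_of_real ` {..0})"
 let ?h = "\<lambda>w. hpt (of_real b * w - of_real a) (w - 1)"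
 define k where "k y = (if y = infty then 1 else (affine_coord y - of_real a) / (affine_coord y - of_real b))" for y
 show "simply_connected ?Z" by (rule starlike_imp_simply_connected[OF starlike_slotted_complex_plane_left])
 have ne: "of_real b * w - of_real a \<noteq> 0 \<or> w - 1 \<noteq> 0" for w :: complex
  using assms by (cases "w = 1") (auto simp flip: of_real_diff)
 show "continuous_on ?Z ?h" by (intro continuous_intros ne)
 have hk: "?h (k y) = y" and kZ: "k y \<in> ?Z" if y: "y \<in> ?U" for y
 proof -
  have "y \<in> P1" using y by blast
  then have "?h (k y) = y \<and> k y \<in> ?Z"
  proof (cases rule: P1_cases)
   case 1
   then show ?thesis using assms ne[of 1] by (auto simp: k_def hpt_infty)
  next
   case (2 z)
   have zb: "z \<noteq> of_real b" using y 2 assms by auto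
   have k: "k y = (z - of_real a) / (z - of_real b)" by (simp add: k_def 2)
   have "k y - 1 = of_real (b - a) / (z - of_real b)" unfolding k using zb by (simp add: field_simps)
   moreover have "of_real b * k y - of_real a = of_real (b - a) / (z - of_real b) * z"
    unfolding k using zb by (simp add: field_simps)
   ultimately have "?h (k y) = hpt (of_real (b - a) / (z - of_real b) * z) (of_real (b - a) / (z - of_real b) * 1)" by simp
   also have "\<dots> = y" using assms zb 2 by (subst hpt_scale) (auto simp: stereo_hpt simp flip: of_real_diff)
   finally have 1: "?h (k y) = y" .
   have "k y \<noteq> of_real x" if "x \<le> 0" for x
   proof
    assume "k y = of_real x"
    then have "z - of_real a = of_real x * (z - of_real b)" using k zb by (simp add: field_simps)
    then have "z * of_real (1 - x) = of_real (a - x * b)" by (simp add: algebra_simps)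
    then have "z = of_real (a - x * b) / of_real (1 - x)" using that by (simp add: field_simps del: of_real_diff)
    then have z: "z = of_real ((a - x * b) / (1 - x))" by simp
    have "a \<le> (a - x * b) / (1 - x)" "(a - x * b) / (1 - x) \<le> b"
     using that assms mult_left_mono_neg[of a b x] by (auto simp: field_simps)
    then have "y \<in> stereo ` of_real ` {a..b}" unfolding 2 z by (intro imageI) simp
    then show False using y by blast
   qed
   then show ?thesis using 1 by auto
  qed
  then show "?h (k y) = y" "k y \<in> ?Z" by auto
 qed
 then show "k \<in> ?U \<rightarrow> ?Z" by blast
 show "?h (k y) = y" if "y \<in> ?U" for y by (rule hk[OF that])
 show "?h ` ?Z = ?U"
 proof
  show "?U \<subseteq> ?h ` ?Z" using hk kZ by (metis (no_types, lifting) imageI subsetI)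
  show "?h ` ?Z \<subseteq> ?U"
  proof (intro image_subsetI DiffI hpt_in_P1 ne notI)
   fix w assume w: "w \<in> ?Z" and "?h w \<in> stereo ` of_real ` {a..b}"
   then obtain x where x: "a \<le> x" "x \<le> b" "?h w = stereo (of_real x)" by auto
   have w1: "w \<noteq> 1" using x(3) hpt_infty ne[of w] by auto
   then have "(of_real b * w - of_real a) / (w - 1) = of_real x"
    using x(3) hpt_stereo[of "w - 1" "of_real b * w - of_real a"] by simp
   then have "of_real b * w - of_real a = of_real x * (w - 1)" using w1 by (simp add: field_simps)
   then have eq: "w * of_real (b - x) = of_real (a - x)" by (simp add: algebra_simps)
   have "x \<noteq> b" using eq assms by auto
   then have "w = of_real ((a - x) / (b - x))" using eq by (simp add: field_simps)
   moreover have "(a - x) / (b - x) \<le> 0" using x \<open>x \<noteq> b\<close> by (simp add: divide_nonpos_pos)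
   ultimately have "w \<in> complex_of_real ` {..0}" by blast
   then show False using w by blast
  qed
 qed
 have op: "openin (top_of_set ?U) (?U - {y})" for y by (intro openin_delete openin_subtopology_self)
 have c1: "continuous_on (?U - {infty}) k"
 proof -
  have "affine_coord y - of_real b \<noteq> 0" if "y \<in> ?U - {infty}" for y
   using that stereo_affine_coord[of y] assms by auto
  then have "continuous_on (?U - {infty}) (\<lambda>y. (affine_coord y - of_real a) / (affine_coord y - of_real b))"
   by (intro continuous_intros) auto
  then show ?thesis by (rule continuous_on_eq) (auto simp: k_def)
 qed
 have c2: "continuous_on (?U - {stereo 0}) k"
 proof -
  let ?n = "\<lambda>y c. complex_of_real (1 + snd y) - of_real c * cnj (fst y)"
  have key: "?n y b \<noteq> 0 \<and> ?n y a / ?n y b = k y" if y: "y \<in> ?U - {stereo 0}" for y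
  proof -
   have y': "y \<in> P1 - {stereo 0}" using y by blast
   note u = P1_upper_chart[OF y']
   show ?thesis
   proof (cases "y = infty")
    case True
    then show ?thesis by (simp add: k_def infty_def)
   next
    case False
    have Z: "fst y \<noteq> 0" "affine_coord y = of_real (1 + snd y) / cnj (fst y)" using u(3)[OF False] by auto
    have "affine_coord y \<noteq> of_real b" using y stereo_affine_coord[of y] False assms by auto
    moreover have n: "?n y c = (affine_coord y - of_real c) * cnj (fst y)" for c
     unfolding Z(2) using Z(1) by (simp add: field_simps)
    ultimately show ?thesis using Z(1) False unfolding n by (simp add: k_def)
   qed
  qed
  have "continuous_on (?U - {stereo 0}) (\<lambda>y. ?n y a / ?n y b)" using key by (intro continuous_intros) auto
  then show ?thesis by (rule continuous_on_eq) (use key in blast)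
 qed
 have "A = (A - {x}) \<union> (A - {y})" if "x \<noteq> y" for A :: "point set" and x y using that by auto
 from this[OF stereo_ne_infty(2)[of 0], of ?U] show "continuous_on ?U k"
  using continuous_on_Un_local_open[OF _ _ c1 c2] op by metis
qed

lemma sc_stereo_convex: "convex C ==> simply_connected (stereo ` C)"
 by (rule simply_connected_retraction_gen[of C stereo _ affine_coord])
  (auto intro!: convex_imp_simply_connected continuous_intros)

lemma openin_stereo:
 assumes "open C" shows "openin (top_of_set P1) (stereo ` C)"
proof -
 have "openin (top_of_set (P1 - {infty})) ((P1 - {infty}) \<inter> affine_coord -` C)"
  by (intro continuous_openin_preimage_gen continuous_intros assms) auto
 moreover have "(P1 - {infty}) \<inter> affine_coord -` C = stereo ` C"
 proof (intro subset_antisym subsetI)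
  fix y assume "y \<in> (P1 - {infty}) \<inter> affine_coord -` C"
  then show "y \<in> stereo ` C" using stereo_affine_coord[of y] by (metis DiffE IntE imageI insertI1 vimageD)
 qed auto
 ultimately show ?thesis using openin_trans openin_delete openin_subtopology_self by metis
qed

definition hemi :: "real => point set" where
 "hemi \<sigma> = {y \<in> P1. \<sigma> * Im (fst y) \<ge> 0}"

lemma hemi_infty [simp]: "infty \<in> hemi \<sigma>"
 by (simp add: hemi_def) (simp add: infty_def)

lemma hemi_stereo [simp]: "stereo z \<in> hemi \<sigma> \<longleftrightarrow> \<sigma> * Im z \<ge> 0"
proof -
 have "1 + (cmod z)\<^sup>2 > 0" by (simp add: add_pos_nonneg)
 moreover have "Im (fst (stereo z)) = 2 / (1 + (cmod z)\<^sup>2) * Im z" by (simp add: stereo_def)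
 ultimately show ?thesis by (simp add: hemi_def zero_le_mult_iff zero_le_divide_iff divide_le_0_iff mult_le_0_iff)
qed

text \<open>Forgetting the coordinate \<open>Im (fst y)\<close> flattens the half sphere to the
  closed disc. Points of \<open>S\<close> land on the boundary circle, and a disc without some
  boundary points is still convex.\<close>

lemma sc_hemi:
 assumes "\<sigma> = 1 \<or> \<sigma> = - 1" "\<And>y. y \<in> S ==> Im (fst y) = 0"
 shows "simply_connected (hemi \<sigma> - S)"
proof (rule simply_connected_retraction_gen)
 define k where "k y = Complex (Re (fst y)) (snd y)" for y :: point
 let ?Z = "cball 0 1 - k ` (S \<inter> P1)"
 define h where "h w = (Complex (Re w) (\<sigma> * sqrt (1 - (cmod w)\<^sup>2)), Im w)" for w
 have kn: "(cmod (k y))\<^sup>2 = 1 - (Im (fst y))\<^sup>2" if "y \<in> P1" for y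
  using that by (simp add: mem_P1 k_def cmod_power2)
 have "ball 0 1 \<subseteq> ?Z"
 proof -
  have "cmod (k y) = 1" if "y \<in> S \<inter> P1" for y
  proof -
   have "(cmod (k y))\<^sup>2 = 1" using kn[of y] assms(2)[of y] that by simp
   then show ?thesis using norm_ge_zero[of "k y"] by (simp add: power2_eq_1_iff)
  qed
  then show ?thesis by auto
 qed
 then show "simply_connected ?Z" by (intro convex_imp_simply_connected convex_intermediate_ball[of 0 1]) auto
 show "continuous_on ?Z h" unfolding h_def Complex_eq by (intro continuous_intros)
 show "continuous_on (hemi \<sigma> - S) k" unfolding k_def Complex_eq by (intro continuous_intros)
 have kh: "k (h w) = w" for w by (simp add: k_def h_def)
 show hk: "h (k y) = y" if "y \<in> hemi \<sigma> - S" for y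
 proof -
  have "sqrt (1 - (cmod (k y))\<^sup>2) = \<bar>Im (fst y)\<bar>" using that kn[of y] by (simp add: hemi_def)
  moreover have "\<sigma> * \<bar>Im (fst y)\<bar> = Im (fst y)" using that assms(1) by (auto simp: hemi_def)
  ultimately show ?thesis by (simp add: h_def) (simp add: k_def prod_eq_iff complex_eq_iff)
 qed
 have inj: "y \<in> S" if y: "y \<in> hemi \<sigma>" and s: "s \<in> S \<inter> P1" "k y = k s" for y s
 proof -
  have "(Im (fst y))\<^sup>2 = (Im (fst s))\<^sup>2" using kn[of y] kn[of s] s y by (simp add: hemi_def)
  then have "y = s" using s assms(2)[of s] by (simp add: k_def prod_eq_iff complex_eq_iff)
  then show ?thesis using s by blast
 qed
 have kZ: "k y \<in> ?Z" if y: "y \<in> hemi \<sigma> - S" for y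
 proof -
  have "(cmod (k y))\<^sup>2 \<le> 1\<^sup>2" using kn[of y] y by (simp add: hemi_def)
  then have "cmod (k y) \<le> 1" by (rule power2_le_imp_le) simp
  moreover have "k y \<notin> k ` (S \<inter> P1)" using inj[of y] y by blast
  ultimately show ?thesis by simp
 qed
 then show "k \<in> hemi \<sigma> - S \<rightarrow> ?Z" by blast
 have hZ: "h w \<in> hemi \<sigma> - S" if w: "w \<in> ?Z" for w
 proof -
  have "cmod w \<le> 1" using w by auto
  then have "(cmod w)\<^sup>2 \<le> 1" by (simp add: power_le_one)
  moreover have "\<sigma>\<^sup>2 = 1" "\<sigma> * \<sigma> = 1" using assms(1) by auto
  ultimately have "h w \<in> hemi \<sigma>"
   by (simp add: hemi_def mem_P1 h_def cmod_power2 power_mult_distrib mult.assoc[symmetric])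
  moreover have "h w \<notin> S"
   using kh[of w] w \<open>h w \<in> hemi \<sigma>\<close> unfolding hemi_def by (metis (no_types, lifting) DiffD2 IntI imageI mem_Collect_eq)
  ultimately show ?thesis by blast
 qed
 show "h ` ?Z = hemi \<sigma> - S" using hZ hk kZ by (intro subset_antisym image_subsetI subsetI) (metis imageI)+
qed

text \<open>The parameters joined by a good subpath are related by an equivalence with open classes,
  and the interval is connected. This takes the place of a subdivision of the path.\<close>

lemma path_local_induct:
 fixes \<gamma> :: "real => 'a::real_normed_vector"
 assumes g: "pin Y a b \<gamma>"
  and loc: "\<And>y. y \<in> Y ==> \<exists>U. openin (top_of_set Y) U \<and> y \<in> U \<and> (\<forall>u v p. pin U u v p \<longrightarrow> N p)"
  and hp: "\<And>p q. N p ==> hp Y p q ==> N q"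
  and join: "\<And>p q u v w. pin Y u v p ==> pin Y v w q ==> N p ==> N q ==> N (p +++ q)"
  and rev: "\<And>p u v. pin Y u v p ==> N p ==> N (reversepath p)"
 shows "N \<gamma>"
proof -
 have path: "path \<gamma>" "path_image \<gamma> \<subseteq> Y" using g by (auto simp: pin_def)
 have sub: "pin Y (\<gamma> s) (\<gamma> t) (subpath s t \<gamma>)" if "s \<in> {0..1}" "t \<in> {0..1}" for s t
  using that path path_image_subpath_subset[of s t \<gamma>] unfolding pin_def by auto
 have "N (subpath 0 1 \<gamma>)"
 proof (rule connected_equivalence_relation[of "{0..1 :: real}" 0 1 "\<lambda>s t. N (subpath s t \<gamma>)"])
  fix s t :: real assume st: "N (subpath s t \<gamma>)" "s \<in> {0..1}" "t \<in> {0..1}"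
  show "N (subpath t s \<gamma>)" using rev[OF sub[OF st(2,3)] st(1)] by (simp add: reversepath_subpath)
 next
  fix s t u :: real assume N: "N (subpath s t \<gamma>)" "N (subpath t u \<gamma>)" and st: "s \<in> {0..1}" "t \<in> {0..1}" "u \<in> {0..1}"
  show "N (subpath s u \<gamma>)"
   by (rule hp[OF join[OF sub[OF st(1,2)] sub[OF st(2,3)] N] homotopic_join_subpaths[OF path st]])
 next
  fix t :: real assume t: "t \<in> {0..1}"
  then have "\<gamma> t \<in> Y" using path unfolding path_image_def by blast
  from loc[OF this] obtain U where U: "openin (top_of_set Y) U" "\<gamma> t \<in> U" "\<And>u v p. pin U u v p ==> N p"
   by blast
  have "openin (top_of_set {0..1}) ({0..1} \<inter> \<gamma> -` U)"
   using path U(1) unfolding path_def path_image_def by (intro continuous_openin_preimage[of _ _ Y]) auto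
  then obtain e where e: "e > 0" "ball t e \<inter> {0..1} \<subseteq> {0..1} \<inter> \<gamma> -` U"
   using t U(2) unfolding openin_contains_ball by blast
  show "\<exists>T. openin (top_of_set {0..1}) T \<and> t \<in> T \<and> (\<forall>x\<in>T. N (subpath t x \<gamma>))"
  proof (intro exI conjI ballI)
   show "openin (top_of_set {0..1}) ({0..1} \<inter> ball t e)" by (intro openin_open_Int) auto
   show "t \<in> {0..1} \<inter> ball t e" using t e by simp
   fix x assume x: "x \<in> {0..1} \<inter> ball t e"
   have "closed_segment t x \<subseteq> ball t e \<inter> {0..1}"
    using t x e(1) by (intro closed_segment_subset convex_Int) auto
   then have "\<gamma> ` closed_segment t x \<subseteq> U" using e(2) by blast
   then have "pin U (\<gamma> t) (\<gamma> x) (subpath t x \<gamma>)"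
    using sub[of t x] t x unfolding pin_def path_image_subpath_gen by auto
   then show "N (subpath t x \<gamma>)" by (rule U(3))
  qed
 qed auto
 then show ?thesis by simp
qed

section \<open>Classical generators for the branch points \<open>1, \<dots>, r\<close>\<close>

section \<open>Standard generators\<close>

abbreviation std_pts :: "nat => point set" where
 "std_pts r \<equiv> stereo ` std_branch r"

abbreviation std_slit :: "nat => point set" where
 "std_slit r \<equiv> P1 - stereo ` of_real ` {1..real r}"

definition lv :: "nat => real => point" where
 "lv m = ell (real m + 1 / 2)"

text \<open>Down on the left of the branch point \<open>j + 1\<close> and up on its right, a
  counterclockwise turn. As quotients of consecutive lines these loops telescope in
  products.\<close>

definition gen :: "nat => real => point" where
 "gen j = lv j +++ reversepath (lv (Suc j))"

definition gens :: "nat => (real => point) list" where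
 "gens r = map gen [0..<r]"

lemma half_ne: "real m + 1 / 2 \<noteq> real k"
proof
 assume "real m + 1 / 2 = real k"
 then have "real (2 * m + 1) = real (2 * k)" by simp
 then show False by (metis of_nat_eq_iff even_mult_iff even_numeral odd_two_times_div_two_succ even_plus_one_iff)
qed

lemma std_branch_iff: "z \<in> std_branch r \<longleftrightarrow> (\<exists>k. 1 \<le> k \<and> k \<le> r \<and> z = Complex (real k) 0)"
 by (auto simp: std_branch_def complex_eq_iff intro!: image_eqI)

lemma std_pts_sub_real: "std_pts r \<subseteq> stereo ` of_real ` {1..real r}"
 by (auto simp: std_branch_def intro!: imageI image_eqI[of _ of_real "real _"])

lemma std_slit_sub: "std_slit r \<subseteq> P1 - std_pts r"
 using std_pts_sub_real by blast

lemma infty_slit: "infty \<in> std_slit r" "infty \<in> P1 - std_pts r"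
 by auto

lemma Im_stereo_real: "y \<in> stereo ` of_real ` A ==> Im (fst y) = 0"
 by (auto simp: stereo_def)

lemma sc_slit: "r \<ge> 2 ==> simply_connected (std_slit r)"
 by (rule sc_slit_sphere) simp

lemma sc_hemi_std: "\<sigma> = 1 \<or> \<sigma> = - 1 ==> simply_connected (hemi \<sigma> - std_pts r)"
 using std_pts_sub_real by (intro sc_hemi) (blast intro: Im_stereo_real)+

lemma hemi_sub: "hemi \<sigma> - S \<subseteq> P1 - S"
 by (auto simp: hemi_def)

lemma pin_tp_hemi:
 assumes "\<sigma> \<noteq> 0" "complex_of_real c \<notin> T" "\<And>z. z \<in> T ==> Im z = 0"
 shows "pin (hemi \<sigma> - stereo ` T) infty (stereo (of_real c)) (tp c \<sigma>)"
proof -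
 have "Complex c y \<notin> T" for y
 proof
  assume *: "Complex c y \<in> T"
  then have "Complex c y = of_real c" using assms(3)[OF *] by (simp add: complex_eq_iff)
  then show False using * assms(2) by simp
 qed
 then have p: "pin (P1 - stereo ` T) infty (stereo (of_real c)) (tp c \<sigma>)" by (intro pin_tp assms(1))
 have "tp c \<sigma> t \<in> hemi \<sigma>" if "t \<in> {0..1}" for t using tp_pt[OF assms(1) that] by auto
 then have "path_image (tp c \<sigma>) \<subseteq> hemi \<sigma>" unfolding path_image_def by blast
 then show ?thesis using p unfolding pin_def by blast
qed

lemma half_std: "complex_of_real (real m + 1 / 2) \<notin> std_branch r"
 using half_ne[of m] by (auto simp: std_branch_iff complex_eq_iff)

lemma Im_std: "z \<in> std_branch r ==> Im z = 0"
 by (auto simp: std_branch_iff)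

lemma pin_lv: "pin (P1 - std_pts r) infty infty (lv m)"
 unfolding lv_def using half_ne[of m] by (intro pin_ell) (auto simp: std_branch_iff complex_eq_iff)

lemma pin_gen: "pin (P1 - std_pts r) infty infty (gen j)"
 unfolding gen_def by (intro pin_join[OF pin_lv pin_rev[OF pin_lv]])

text \<open>The lines through \<open>1 / 2\<close> and through points beyond \<open>r\<close> miss
  the segment that contains all branch points, whose complement is simply connected.\<close>

lemma lv_null:
 assumes "r \<ge> 2" "m = 0 \<or> m \<ge> r"
 shows "hp (P1 - std_pts r) (lv m) (linepath infty infty)"
proof (rule sc_hp[OF sc_slit[OF assms(1)] std_slit_sub])
 have "Complex (real m + 1 / 2) y \<notin> of_real ` {1..real r}" for y using assms by (auto simp: complex_eq_iff)
 then show "pin (std_slit r) infty infty (lv m)" unfolding lv_def by (rule pin_ell)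
 show "pin (std_slit r) infty infty (linepath infty infty)" by (intro pin_const infty_slit)
qed

text \<open>The circle of radius \<open>1 / 2\<close> passes through the points where the two
  neighbouring lines cross the real axis. Its two halves can be exchanged for detours through
  infinity inside closed half planes, which remain simply connected without the branch points on
  their boundary.\<close>

lemma meridian_gen:
 assumes "j < r" shows "meridian (std_pts r) infty (stereo (of_nat (Suc j))) (gen j)"
proof -
 let ?S = "std_pts r" and ?z = "of_nat (Suc j) :: complex"
 let ?Y = "P1 - ?S"
 define c where "c = small_circle (stereo ?z) (1 / 2)"
 have cx: "c x = stereo (Complex (real (Suc j) + 1 / 2 * cos (2 * pi * x)) (1 / 2 * sin (2 * pi * x)))" for x
  unfolding c_def small_circle_eq local_param_finite[OF stereo_ne_infty(1)] by (simp add: complex_eq_iff Re_exp Im_exp)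
 have av: "local_param (stereo ?z) ` cball 0 (1 / 2) \<inter> ?S = {stereo ?z}"
 proof (intro subset_antisym subsetI)
  fix y assume "y \<in> local_param (stereo ?z) ` cball 0 (1 / 2) \<inter> ?S"
  then obtain w k where w: "norm w \<le> 1 / 2" "y = stereo (?z + w)" "?z + w = of_nat k"
   by (auto simp: local_param_finite std_branch_def)
  have "w = of_int (int k - int (Suc j))" using w(3) by (simp add: algebra_simps)
  then have "\<bar>real_of_int (int k - int (Suc j))\<bar> \<le> 1 / 2" using w(1) by (metis norm_of_int)
  then have "k = Suc j" by linarith
  then show "y \<in> {stereo ?z}" using w(2,3) by simp
 next
  fix y assume y: "y \<in> {stereo ?z}"
  have "local_param (stereo ?z) 0 \<in> local_param (stereo ?z) ` cball 0 (1 / 2)" by (intro imageI) simp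
  then have "stereo ?z \<in> local_param (stereo ?z) ` cball 0 (1 / 2)" by (simp only: local_param_0[OF stereo_in_P1])
  moreover have "stereo ?z \<in> ?S" unfolding std_branch_def using assms by (intro imageI) simp
  ultimately show "y \<in> local_param (stereo ?z) ` cball 0 (1 / 2) \<inter> ?S" using y by blast
 qed
 have e: "local_param (stereo ?z) (of_real (1 / 2)) = stereo (of_real (real (Suc j) + 1 / 2))"
  by (simp add: local_param_finite)
 have cp: "pin ?Y (stereo (of_real (real (Suc j) + 1 / 2))) (stereo (of_real (real (Suc j) + 1 / 2))) c"
  using small_circle_pin[OF _ av] unfolding c_def e[symmetric] by simp
 have ends: "c 0 = stereo (of_real (real (Suc j) + 1 / 2))" "c 1 = stereo (of_real (real (Suc j) + 1 / 2))"
  "c (1 / 2) = stereo (of_real (real j + 1 / 2))" by (simp_all add: cx complex_eq_iff)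
 let ?p = "stereo (of_real (real (Suc j) + 1 / 2))" and ?q = "stereo (of_real (real j + 1 / 2))"
 have half: "pin (hemi \<sigma> - ?S) (c s) (c t) (subpath s t c)"
  if "s \<in> {0..1}" "t \<in> {0..1}" "\<And>x. x \<in> closed_segment s t ==> \<sigma> * sin (2 * pi * x) \<ge> 0" for \<sigma> s t
 proof -
  have "path_image (subpath s t c) \<subseteq> hemi \<sigma>"
   unfolding path_image_subpath_gen using that(3) by (auto simp: cx)
  moreover have "path_image (subpath s t c) \<subseteq> ?Y" "path (subpath s t c)"
   using cp path_image_subpath_subset[of s t c] that(1,2) by (auto simp: pin_def)
  ultimately show ?thesis unfolding pin_def by (auto simp: pathstart_def pathfinish_def subpath_def)
 qed
 define k1 k2 where "k1 = subpath 0 (1 / 2) c" and "k2 = subpath (1 / 2) 1 c"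
 have c1: "pin (hemi 1 - ?S) ?p ?q k1"
  unfolding ends[symmetric] k1_def by (rule half) (auto simp: closed_segment_eq_real_ivl intro!: sin_ge_zero)
 have c2: "pin (hemi (- 1) - ?S) ?q ?p k2" unfolding ends(2,3)[symmetric] k2_def
 proof (rule half)
  fix x :: real assume "x \<in> closed_segment (1 / 2) 1"
  then have x: "1 / 2 \<le> x" "x \<le> 1" by (auto simp: closed_segment_eq_real_ivl)
  have "0 \<le> sin (2 * pi * x - pi)" using x by (intro sin_ge_zero) (auto simp: field_simps)
  then show "- 1 * sin (2 * pi * x) \<ge> 0" by (simp add: sin_diff)
 qed auto
 have cc: "c = k1 +++ k2" by (auto simp: k1_def k2_def joinpaths_def subpath_def fun_eq_iff field_simps)
 have t: "pin (hemi \<sigma> - ?S) infty (stereo (of_real (real m + 1 / 2))) (tp (real m + 1 / 2) \<sigma>)" if "\<sigma> \<noteq> 0" for \<sigma> m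
  by (rule pin_tp_hemi[OF that half_std Im_std])
 let ?\<delta> = "tp (real (Suc j) + 1 / 2) 1" and ?\<delta>' = "tp (real (Suc j) + 1 / 2) (- 1)"
 have d: "pin ?Y infty ?p ?\<delta>" "pin ?Y infty ?p ?\<delta>'" by (rule pin_mono[OF t hemi_sub], simp)+
 have c1Y: "pin ?Y ?p ?q k1" and c2Y: "pin ?Y ?q ?p k2" using pin_mono[OF c1 hemi_sub] pin_mono[OF c2 hemi_sub] by auto
 have h1: "hp ?Y (tp (real j + 1 / 2) 1) (?\<delta> +++ k1)"
  by (rule sc_hp[OF sc_hemi_std hemi_sub t pin_join[OF t c1]]) auto
 have h2: "hp ?Y (reversepath (tp (real j + 1 / 2) (- 1))) (k2 +++ reversepath ?\<delta>')"
  by (rule sc_hp[OF sc_hemi_std hemi_sub pin_rev[OF t] pin_join[OF c2 pin_rev[OF t]]]) auto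
 have "hp ?Y (lv j) ((?\<delta> +++ k1) +++ (k2 +++ reversepath ?\<delta>'))"
  unfolding lv_def ell_def by (rule hp_join[OF h1 h2]) (simp add: pathfinish_def pathstart_def reversepath_def tp_1)
 also have "hp ?Y \<dots> (?\<delta> +++ (k1 +++ (k2 +++ reversepath ?\<delta>')))"
  by (rule hp_assoc[OF d(1) c1Y pin_join[OF c2Y pin_rev[OF d(2)]]])
 also have "hp ?Y \<dots> (?\<delta> +++ (c +++ reversepath ?\<delta>'))"
  unfolding cc by (rule hp_joinR[OF d(1) hp_sym[OF hp_assoc[OF c1Y c2Y pin_rev[OF d(2)]]] pin_join[OF c1Y pin_join[OF c2Y pin_rev[OF d(2)]]]])
 also have "hp ?Y \<dots> ((?\<delta> +++ c) +++ reversepath ?\<delta>')"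
  by (rule hp_sym[OF hp_assoc[OF d(1) cp pin_rev[OF d(2)]]])
 finally have "hp ?Y (gen j) (((?\<delta> +++ c) +++ reversepath ?\<delta>') +++ reversepath (lv (Suc j)))"
  unfolding gen_def by (rule hp_joinL[OF _ pin_lv pin_rev[OF pin_lv]])
 moreover have "reversepath (lv (Suc j)) = ?\<delta>' +++ reversepath ?\<delta>"
  unfolding lv_def ell_def rev_join[OF d(1) pin_rev[OF d(2)]] by simp
 ultimately have "hp ?Y (gen j) (((?\<delta> +++ c) +++ reversepath ?\<delta>') +++ (?\<delta>' +++ reversepath ?\<delta>))"
  by simp
 also have "hp ?Y \<dots> ((?\<delta> +++ c) +++ reversepath ?\<delta>)"
  using hp_cancel[OF pin_join[OF d(1) cp] pin_rev[OF d(2)] pin_rev[OF d(1)]] by simp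
 also have "hp ?Y \<dots> (cjp ?\<delta> c)" unfolding cjp_def by (rule hp_assoc[OF d(1) cp pin_rev[OF d(1)]])
 finally show ?thesis unfolding meridian_cjp_iff using d(1) av cp
  by (intro exI[of _ "1 / 2"] exI[of _ ?\<delta>]) (simp add: c_def pin_def)
qed

lemma gens_prod:
 "hp (P1 - std_pts r) (path_prod infty (map gen [0..<m])) (lv 0 +++ reversepath (lv m))"
proof (induction m)
 case 0
 show ?case unfolding upt_0 list.map path_prod_simps by (rule hp_sym[OF hp_rinv[OF pin_lv]])
next
 case (Suc m)
 let ?Y = "P1 - std_pts r"
 note p = pin_lv[of r]
 have g: "\<forall>w\<in>set (map gen xs). pin ?Y infty infty w" for xs using pin_gen by auto
 have "hp ?Y (path_prod infty (map gen [0..<m] @ map gen [m])) (path_prod infty (map gen [0..<m]) +++ path_prod infty (map gen [m]))"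
  by (rule hp_path_prod_append[OF g g infty_slit(2)])
 also have "hp ?Y \<dots> ((lv 0 +++ reversepath (lv m)) +++ gen m)"
  using hp_rid[OF pin_gen] by (intro hp_join[OF Suc.IH]) (use pin_path_prod[OF g infty_slit(2)] pin_gen in \<open>auto simp: pin_def\<close>)
 also have "hp ?Y \<dots> (lv 0 +++ reversepath (lv (Suc m)))"
  unfolding gen_def using hp_cancel[OF p pin_rev[OF p[of m]] pin_rev[OF p[of "Suc m"]], of 0] by simp
 finally show ?case by simp
qed

lemma lv_words:
 assumes "r \<ge> 2" "m \<le> r" shows "lv m \<in> words (P1 - std_pts r) infty (set (gens r))"
 using assms(2)
proof (induction m)
 case 0
 show ?case by (rule words_hp[OF words_const[OF infty_slit(2)] lv_null[OF assms(1)]]) simp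
next
 case (Suc m)
 let ?Y = "P1 - std_pts r"
 note p = pin_lv[of r]
 have G: "set (gens r) \<subseteq> loops_at ?Y infty" unfolding gens_def loops_at_pin using pin_gen by auto
 have g: "gen m \<in> set (gens r)" using Suc by (simp add: gens_def)
 have 1: "reversepath (gen m) +++ lv m \<in> words ?Y infty (set (gens r))"
  using Suc by (intro words_join[OF G infty_slit(2) words_gen(2)[OF G g]]) simp
 have "hp ?Y (reversepath (gen m) +++ lv m) (lv (Suc m) +++ (reversepath (lv m) +++ lv m))"
  unfolding gen_def rev_join[OF p pin_rev[OF p]] reversepath_reversepath by (rule hp_assoc[OF p pin_rev[OF p] p])
 also have "hp ?Y \<dots> (lv (Suc m) +++ linepath infty infty)"
  by (rule hp_joinR[OF p hp_linv[OF p] pin_join[OF pin_rev[OF p] p]])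
 also have "hp ?Y \<dots> (lv (Suc m))" by (rule hp_rid[OF p])
 finally show ?case using words_hp[OF 1] hp_sym by blast
qed

lemma hemi_open:
 assumes "pin (hemi \<sigma> - stereo ` range of_real) infty v p"
 shows "pin (std_slit r) infty v p" "pin (hemi \<sigma> - std_pts r) infty v p"
proof -
 have "stereo ` of_real ` {1..real r} \<subseteq> stereo ` range of_real" by blast
 then have "hemi \<sigma> - stereo ` range of_real \<subseteq> std_slit r"
  "hemi \<sigma> - stereo ` range of_real \<subseteq> hemi \<sigma> - std_pts r"
  using hemi_sub[of \<sigma> "stereo ` range of_real"] std_pts_sub_real[of r] by blast+
 then show "pin (std_slit r) infty v p" "pin (hemi \<sigma> - std_pts r) infty v p" using pin_mono[OF assms] by blast+
qed

text \<open>One path per point that serves at once in the relevant simply connected pieces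
  containing the point. Off the real axis it stays within an open half plane apart from infinity,
  and to a real point it descends from above.\<close>

lemma std_spider:
 assumes "v \<in> P1 - std_pts r"
 obtains p where "pin (P1 - std_pts r) infty v p" "v \<in> std_slit r ==> pin (std_slit r) infty v p"
  "v \<in> hemi 1 ==> pin (hemi 1 - std_pts r) infty v p" "v \<notin> hemi 1 ==> pin (hemi (- 1) - std_pts r) infty v p"
proof -
 have hp: "\<exists>p. pin (hemi \<sigma> - stereo ` range of_real) infty v p"
  if "v \<in> hemi \<sigma>" "v \<notin> stereo ` range of_real" "\<sigma> = 1 \<or> \<sigma> = - 1" for \<sigma>
  using sc_path[OF sc_hemi[OF that(3), of "stereo ` range of_real"], of infty v] that(1,2)
  by (metis DiffI Im_stereo_real hemi_infty image_iff stereo_ne_infty(2))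
 have "v \<in> P1" using assms by blast
 then show thesis
 proof (cases rule: P1_cases)
  case 1
  show thesis by (rule that[of "linepath infty infty"]) (unfold 1, auto intro!: pin_const)
 next
  case (2 z)
  show thesis
  proof (cases "Im z = 0")
   case False
   then have nr: "v \<notin> stereo ` range of_real" unfolding 2 by auto
   show thesis
   proof (cases "v \<in> hemi 1")
    case True
    then obtain p where "pin (hemi 1 - stereo ` range of_real) infty v p" using hp[OF _ nr] by blast
    from hemi_open[OF this, of r] show thesis using that[of p] True pin_mono[OF _ std_slit_sub] by blast
   next
    case False
    then have "v \<in> hemi (- 1)" unfolding 2 by simp
    then obtain p where "pin (hemi (- 1) - stereo ` range of_real) infty v p" using hp[OF _ nr] by blast
    from hemi_open[OF this, of r] show thesis using that[of p] False pin_mono[OF _ std_slit_sub] by blast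
   qed
  next
   case True
   define x where "x = Re z"
   have v: "v = stereo (of_real x)" unfolding 2 x_def using True by (simp add: complex_eq_iff)
   have xn: "complex_of_real x \<notin> std_branch r" using assms v by auto
   have h: "pin (hemi 1 - std_pts r) infty v (tp x 1)" unfolding v by (rule pin_tp_hemi[OF _ xn Im_std]) simp
   have "pin (std_slit r) infty v (tp x 1)" if "v \<in> std_slit r"
   proof -
    have "complex_of_real x \<notin> of_real ` {1..real r}" using that unfolding v by blast
    then have "pin (hemi 1 - stereo ` of_real ` {1..real r}) infty v (tp x 1)" unfolding v by (intro pin_tp_hemi) auto
    then show ?thesis by (rule pin_mono[OF _ hemi_sub])
   qed
   then show thesis using that[of "tp x 1"] h pin_mono[OF h hemi_sub] True unfolding 2 by simp
  qed
 qed
qed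

text \<open>A van Kampen argument: \<open>N p\<close> says that \<open>p\<close>, closed up by the
  chosen paths from infinity, is a word. Locally a path lies in the slit sphere, where the closed
  path contracts, or in a strip that crosses the segment between branch points, where only
  \<open>lv j\<close> and its inverse can arise as factors. The property then spreads along every
  path.\<close>

lemma gens_generate:
 assumes r: "r \<ge> 2" and \<gamma>: "pin (P1 - std_pts r) infty infty \<gamma>"
 shows "\<gamma> \<in> words (P1 - std_pts r) infty (set (gens r))"
proof -
 let ?Y = "P1 - std_pts r"
 define W where "W = words ?Y infty (set (gens r))"
 have G: "set (gens r) \<subseteq> loops_at ?Y infty" unfolding gens_def loops_at_pin using pin_gen by auto
 note Whp = words_hp[of _ ?Y infty "set (gens r)", folded W_def]
 note Wjoin = words_join[OF G infty_slit(2), folded W_def]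
 have Wc: "linepath infty infty \<in> W" unfolding W_def by (rule words_const[OF infty_slit(2)])
 have Wrev: "reversepath w \<in> W" if "w \<in> W" for w using that[unfolded W_def] G infty_slit(2)
 proof (induction rule: words_induct)
  case (hp \<gamma> \<gamma>')
  then show ?case using Whp hp_rev by blast
 next
  case const
  show ?case unfolding reversepath_linepath by (rule Wc)
 next
  case (gen g \<gamma>)
  then show ?case unfolding rev_join[OF gen(2,3)] using words_gen(2)[OF G gen(1), folded W_def] by (intro Wjoin) auto
 next
  case (rev g \<gamma>)
  then show ?case
   unfolding rev_join[OF pin_rev[OF rev(2)] rev(3)] using words_gen(1)[OF G rev(1), folded W_def] by (intro Wjoin) auto
 qed
 have "\<forall>v. \<exists>p. v \<in> ?Y \<longrightarrow> pin ?Y infty v p \<and> (v \<in> std_slit r \<longrightarrow> pin (std_slit r) infty v p) \<and>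
  (v \<in> hemi 1 \<longrightarrow> pin (hemi 1 - std_pts r) infty v p) \<and> (v \<notin> hemi 1 \<longrightarrow> pin (hemi (- 1) - std_pts r) infty v p)"
  by (meson std_spider)
 from choice[OF this] obtain e where e0: "\<And>v. v \<in> ?Y ==> pin ?Y infty v (e v) \<and> (v \<in> std_slit r \<longrightarrow> pin (std_slit r) infty v (e v)) \<and>
  (v \<in> hemi 1 \<longrightarrow> pin (hemi 1 - std_pts r) infty v (e v)) \<and> (v \<notin> hemi 1 \<longrightarrow> pin (hemi (- 1) - std_pts r) infty v (e v))"
  by blast
 have e: "pin ?Y infty v (e v)" "v \<in> hemi 1 ==> pin (hemi 1 - std_pts r) infty v (e v)"
  "v \<notin> hemi 1 ==> pin (hemi (- 1) - std_pts r) infty v (e v)" if "v \<in> ?Y" for v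
  using e0[OF that] by simp_all
 have eU: "pin (std_slit r) infty v (e v)" if "v \<in> std_slit r" for v
  using e0[OF subsetD[OF std_slit_sub that]] that by simp
 define N where "N p \<longleftrightarrow> e (pathstart p) +++ (p +++ reversepath (e (pathfinish p))) \<in> W" for p
 have Ne: "N p \<longleftrightarrow> e u +++ (p +++ reversepath (e v)) \<in> W" if "pin X u v p" for X u v p
  using that by (simp add: N_def pin_def)
 have pe: "pin ?Y infty u (e u)" "pin ?Y infty v (e v)" "pin ?Y v infty (reversepath (e v))" if "pin ?Y u v p" for u v p
  using pin_endpoints[OF that] by (auto intro: e(1) pin_rev)
 have Nhp: "N q" if N: "N p" and pq: "hp ?Y p q" for p q
 proof -
  let ?u = "pathstart p" and ?v = "pathfinish p"
  have p: "pin ?Y ?u ?v p" "pin ?Y ?u ?v q" using hp_pin[OF pq] by auto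
  have "hp ?Y (e ?u +++ (q +++ reversepath (e ?v))) (e ?u +++ (p +++ reversepath (e ?v)))"
   by (rule hp_joinR[OF pe(1)[OF p(1)] hp_joinL[OF hp_sym[OF pq] p(2) pe(3)[OF p(1)]] pin_join[OF p(2) pe(3)[OF p(1)]]])
  then show ?thesis using N unfolding Ne[OF p(1)] Ne[OF p(2)] by (rule Whp[rotated])
 qed
 have Njoin: "N (p +++ q)" if p: "pin ?Y u v p" and q: "pin ?Y v w q" and N: "N p" "N q" for p q u v w
 proof -
  note ev = pe(2)[OF p] and eu = pe(1)[OF p] and ew = pe(3)[OF q]
  have "hp ?Y ((e u +++ (p +++ reversepath (e v))) +++ (e v +++ (q +++ reversepath (e w))))
   (((e u +++ p) +++ reversepath (e v)) +++ (e v +++ (q +++ reversepath (e w))))"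
   by (rule hp_joinL[OF hp_sym[OF hp_assoc[OF eu p pin_rev[OF ev]]] pin_join[OF eu pin_join[OF p pin_rev[OF ev]]] pin_join[OF ev pin_join[OF q ew]]])
  also have "hp ?Y \<dots> ((e u +++ p) +++ (q +++ reversepath (e w)))"
   using hp_cancel[OF pin_join[OF eu p] pin_rev[OF ev] pin_join[OF q ew]] by simp
  also have "hp ?Y \<dots> (e u +++ (p +++ (q +++ reversepath (e w))))"
   by (rule hp_assoc[OF eu p pin_join[OF q ew]])
  also have "hp ?Y \<dots> (e u +++ ((p +++ q) +++ reversepath (e w)))"
   by (rule hp_joinR[OF eu hp_sym[OF hp_assoc[OF p q ew]] pin_join[OF p pin_join[OF q ew]]])
  finally show ?thesis
   using Whp[OF Wjoin[OF N(1)[unfolded Ne[OF p]] N(2)[unfolded Ne[OF q]]] hp_sym] unfolding Ne[OF pin_join[OF p q]] by blast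
 qed
 have Nrev: "N (reversepath p)" if p: "pin ?Y u v p" and N: "N p" for p u v
 proof -
  note eu = pe(1)[OF p] and ev = pe(2)[OF p]
  have "reversepath (e u +++ (p +++ reversepath (e v))) = (e v +++ reversepath p) +++ reversepath (e u)"
   unfolding rev_join[OF eu pin_join[OF p pin_rev[OF ev]]] rev_join[OF p pin_rev[OF ev]] by simp
  then have "(e v +++ reversepath p) +++ reversepath (e u) \<in> W" using Wrev[OF N[unfolded Ne[OF p]]] by simp
  from Whp[OF this hp_sym[OF hp_assoc[OF ev pin_rev[OF p] pin_rev[OF eu]]]] show ?thesis unfolding Ne[OF pin_rev[OF p]] .
 qed
 have Nsc: "N p" if "simply_connected U" "U \<subseteq> ?Y" "pin U u v p" "pin U infty u (e u)" "pin U infty v (e v)" for U u v p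
 proof -
  have "infty \<in> U" using pin_endpoints that(4) by blast
  then have "hp ?Y (e u +++ (p +++ reversepath (e v))) (linepath infty infty)"
   by (intro sc_hp[OF that(1,2) pin_join[OF that(4) pin_join[OF that(3) pin_rev[OF that(5)]]]] pin_const)
  then show ?thesis unfolding Ne[OF that(3)] by (rule Whp[OF Wc])
 qed
 have NU: "N p" if "pin (std_slit r) u v p" for u v p
  using Nsc[OF sc_slit[OF r] std_slit_sub that] eU pin_endpoints[OF that] by blast
 \<comment> \<open>The strip strictly between the vertical lines through \<open>j\<close> and
   \<open>j + 1\<close>: it may cross the segment but contains no branch point.\<close>
 define V where "V j = {z. real j < Re z \<and> Re z < real j + 1}" for j
 have cV: "convex (V j)" "open (V j)" for j
 proof -
  have "V j = {z. Re z > real j} \<inter> {z. Re z < real j + 1}" by (auto simp: V_def)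
  then show "convex (V j)" "open (V j)"
   by (auto intro!: convex_Int convex_halfspace_Re_gt convex_halfspace_Re_lt open_Int open_halfspace_Re_gt open_halfspace_Re_lt)
 qed
 have Vstd: "V j \<inter> std_branch r = {}" for j
 proof -
  have False if "real j < real k" "real k < real j + 1" for k
  proof -
   have "real k < real (Suc j)" using that by simp
   then show False using that(1) unfolding of_nat_less_iff by simp
  qed
  then show ?thesis by (auto simp: V_def std_branch_iff)
 qed
 have VY: "stereo ` V j \<subseteq> ?Y" for j using Vstd by fastforce
 let ?c = "\<lambda>j. stereo (of_real (real j + 1 / 2))"
 have cinV: "complex_of_real (real j + 1 / 2) \<in> V j" for j by (simp add: V_def)
 have seg: "N (stereo \<circ> linepath (of_real (real j + 1 / 2)) z) \<and> pin (stereo ` V j) (?c j) (stereo z) (stereo \<circ> linepath (of_real (real j + 1 / 2)) z)"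
  if z: "z \<in> V j" and j: "j \<le> r" for j z
 proof -
  let ?l = "stereo \<circ> linepath (of_real (real j + 1 / 2)) z"
  have sub: "closed_segment (of_real (real j + 1 / 2)) z \<subseteq> V j" by (rule closed_segment_subset[OF cinV z cV(1)])
  have path: "path ?l" "pathstart ?l = ?c j" "pathfinish ?l = stereo z"
   by (auto simp: pathstart_compose pathfinish_compose intro!: path_continuous_image continuous_intros)
  have pV: "pin (stereo ` V j) (?c j) (stereo z) ?l"
   using sub path unfolding pin_def path_image_compose path_image_linepath by blast
  have pH: "pin (hemi \<sigma> - std_pts r) (?c j) (stereo z) ?l" if "\<sigma> * Im z \<ge> 0" for \<sigma>
  proof -
   have "{w. \<sigma> * Im w \<ge> 0} = {w. inner (Complex 0 \<sigma>) w \<ge> 0}" by (simp add: inner_complex_def)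
   then have "convex {w. \<sigma> * Im w \<ge> 0}" by (simp only: convex_halfspace_ge)
   then have "closed_segment (of_real (real j + 1 / 2)) z \<subseteq> {w. \<sigma> * Im w \<ge> 0}"
    by (rule closed_segment_subset[rotated 2]) (use that in simp_all)
   then have "stereo ` closed_segment (of_real (real j + 1 / 2)) z \<subseteq> hemi \<sigma>"
    by (intro image_subsetI) (use hemi_stereo in blast)
   then have "path_image ?l \<subseteq> hemi \<sigma>" by (simp only: path_image_compose path_image_linepath)
   then show ?thesis using pV VY unfolding pin_def by blast
  qed
  have zY: "stereo z \<in> ?Y" and cY: "?c j \<in> ?Y" using VY z cinV by blast+
  have ch: "?c j \<in> hemi 1" by (simp only: hemi_stereo) simp
  have "N ?l"
  proof (cases "Im z \<ge> 0")
   case True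
   then have "stereo z \<in> hemi 1" by simp
   then show ?thesis using True by (intro Nsc[OF sc_hemi_std hemi_sub pH e(2)[OF cY ch] e(2)[OF zY]]) auto
  next
   \<comment> \<open>The centre is reached from above and the end point from below, so the closed
     path follows the whole vertical line and equals \<open>lv j\<close> up to homotopy.\<close>
   case False
   let ?ec = "tp (real j + 1 / 2) 1" and ?ec' = "tp (real j + 1 / 2) (- 1)"
   have t: "pin (hemi \<sigma> - std_pts r) infty (?c j) (tp (real j + 1 / 2) \<sigma>)" if "\<sigma> \<noteq> 0" for \<sigma>
    by (rule pin_tp_hemi[OF that half_std Im_std])
   have m: "pin (hemi (- 1) - std_pts r) (?c j) (stereo z) ?l" using False by (intro pH) simp
   have ez: "pin (hemi (- 1) - std_pts r) infty (stereo z) (e (stereo z))" using False by (intro e(3)[OF zY]) simp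
   have h1: "hp ?Y (e (?c j)) ?ec" by (rule sc_hp[OF sc_hemi_std hemi_sub e(2)[OF cY ch] t]) auto
   have h2: "hp ?Y (?l +++ reversepath (e (stereo z))) (reversepath ?ec')"
    by (rule sc_hp[OF sc_hemi_std hemi_sub pin_join[OF m pin_rev[OF ez]] pin_rev[OF t]]) auto
   have "hp ?Y (e (?c j) +++ (?l +++ reversepath (e (stereo z)))) (lv j)" unfolding lv_def ell_def
    by (rule hp_join[OF h1 h2]) (use e(1)[OF cY] path in \<open>auto simp: pin_def\<close>)
   from Whp[OF lv_words[OF r j, folded W_def] this] show ?thesis unfolding Ne[OF pV] .
  qed
  then show ?thesis using pV by blast
 qed
 have NV: "N p" if p: "pin (stereo ` V j) u v p" and j: "j \<le> r" for u v p j
 proof -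
  obtain z z' where z: "z \<in> V j" "u = stereo z" "z' \<in> V j" "v = stereo z'" using pin_endpoints[OF p] by blast
  note s = seg[OF z(1) j, folded z(2)] seg[OF z(3) j, folded z(4)]
  note s' = s[THEN conjunct2]
  have "N (reversepath (stereo \<circ> linepath (of_real (real j + 1 / 2)) z) +++ (stereo \<circ> linepath (of_real (real j + 1 / 2)) z'))"
   using s pin_mono[OF s'(1) VY] pin_mono[OF s'(2) VY] by (intro Njoin[OF pin_rev] Nrev) auto
  then show ?thesis by (rule Nhp[OF _ sc_hp[OF sc_stereo_convex[OF cV(1)] VY pin_join[OF pin_rev[OF s'(1)] s'(2)] p]])
 qed
 have "N \<gamma>"
 proof (rule path_local_induct[OF \<gamma> _ Nhp Njoin Nrev])
  fix y assume y: "y \<in> ?Y"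
  show "\<exists>U. openin (top_of_set ?Y) U \<and> y \<in> U \<and> (\<forall>u v p. pin U u v p \<longrightarrow> N p)"
  proof (cases "y \<in> std_slit r")
   case True
   have "closed (stereo ` complex_of_real ` {1..real r})"
    by (intro compact_imp_closed compact_continuous_image continuous_intros compact_Icc)
   then have "openin (top_of_set P1) (std_slit r)" by (intro openin_diff closed_subset openin_subtopology_self) auto
   then have "openin (top_of_set ?Y) (std_slit r)" by (rule openin_subset_trans[OF _ std_slit_sub]) blast
   then show ?thesis using True NU by blast
  next
   case False
   then have "y \<in> stereo ` of_real ` {1..real r}" using y by simp
   then obtain x where x: "1 \<le> x" "x \<le> real r" "y = stereo (of_real x)" by (elim imageE) (metis atLeastAtMost_iff)
   define j where "j = nat \<lfloor>x\<rfloor>"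
   have jx: "real j \<le> x" "x < real j + 1" using x(1) by (auto simp: j_def)
   have "x \<noteq> real j"
   proof
    assume "x = real j"
    then have "of_real x \<in> std_branch r" using x by (auto simp: std_branch_iff complex_eq_iff)
    then show False using y x(3) by blast
   qed
   then have "y \<in> stereo ` V j" using jx x(3) by (auto simp: V_def)
   moreover have "openin (top_of_set ?Y) (stereo ` V j)" by (rule openin_subset_trans[OF openin_stereo[OF cV(2)] VY]) blast
   moreover have "j \<le> r" using jx x by linarith
   ultimately show ?thesis using NV by blast
  qed
 qed
 then have "e infty +++ (\<gamma> +++ reversepath (e infty)) \<in> W" unfolding Ne[OF \<gamma>] .
 moreover have "hp ?Y \<gamma> (e infty +++ (\<gamma> +++ reversepath (e infty)))"
 proof -
  have c: "hp ?Y (e infty) (linepath infty infty)"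
   by (rule sc_hp[OF sc_slit[OF r] std_slit_sub eU[OF infty_slit(1)] pin_const[OF infty_slit(1)]])
  have "hp ?Y (e infty +++ (\<gamma> +++ reversepath (e infty))) (cjp (linepath infty infty) \<gamma>)"
   unfolding cjp_def using \<gamma> e(1)[OF infty_slit(2)]
   by (intro hp_join c hp_rev hp_refl[OF \<gamma>]) (auto simp: pin_def)
  also have "hp ?Y \<dots> \<gamma>" by (rule hp_cjp_triv[OF \<gamma>])
  finally show ?thesis by (rule hp_sym)
 qed
 ultimately show ?thesis unfolding W_def by (rule words_hp)
qed

lemma classical_generators_std:
 assumes "r \<ge> 2" shows "classical_generators (std_pts r) infty (gens r)"
 unfolding classical_generators_iff
proof (intro conjI allI impI)
 let ?Y = "P1 - std_pts r"
 show "set (gens r) \<subseteq> loops_at ?Y infty" unfolding gens_def loops_at_pin using pin_gen by auto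
 let ?ss = "map (\<lambda>j. stereo (of_nat (Suc j))) [0..<r]"
 have "set ?ss = std_pts r"
  unfolding std_branch_def image_Suc_lessThan[symmetric] by (auto simp: image_image atLeast0LessThan)
 moreover have "List.distinct ?ss" by (simp add: distinct_map inj_on_def)
 moreover have "list_all2 (meridian (std_pts r) infty) ?ss (gens r)"
  by (simp add: gens_def list_all2_conv_all_nth meridian_gen del: of_nat_Suc)
 ultimately show "\<exists>ss. List.distinct ss \<and> set ss = std_pts r \<and> list_all2 (meridian (std_pts r) infty) ss (gens r)"
  by blast
 have "hp ?Y (path_prod infty (gens r)) (lv 0 +++ reversepath (lv r))" unfolding gens_def by (rule gens_prod)
 also have "hp ?Y \<dots> (linepath infty infty +++ reversepath (linepath infty infty))"
  using pin_lv[of r] by (intro hp_join hp_rev lv_null[OF assms]) (auto simp: pin_def)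
 also have "hp ?Y \<dots> (linepath infty infty)" by (rule hp_rinv[OF pin_const[OF infty_slit(2)]])
 finally show "hp ?Y (path_prod infty (gens r)) (linepath infty infty)" .
 show "\<gamma> \<in> words ?Y infty (set (gens r))" if "pin ?Y infty infty \<gamma>" for \<gamma>
  by (rule gens_generate[OF assms that])
qed

section \<open>Covering spaces by gluing, and permutations from path lifting\<close>

section \<open>Monodromy of a covering space\<close>

text \<open>Path lifting with the fibre numbered by \<open>f\<close>; homotopic loops have lifts
  with the same end. The last clause permits values to be computed from any explicit lift.\<close>

lemma covering_monodromy:
 fixes p :: "'a::real_normed_vector => 'b::real_normed_vector" and f :: "nat => 'a"
 assumes cov: "covering_space E p Y" and K: "finite K" and inj: "inj_on f K"
  and fib: "\<And>x. x \<in> E \<and> p x = b \<longleftrightarrow> x \<in> f ` K"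
 shows "\<exists>\<rho>. (\<forall>\<gamma>. pin Y b b \<gamma> \<longrightarrow> \<rho> \<gamma> permutes K) \<and>
  (\<forall>\<gamma> \<gamma>'. pin Y b b \<gamma> \<longrightarrow> hp Y \<gamma> \<gamma>' \<longrightarrow> \<rho> \<gamma> = \<rho> \<gamma>') \<and>
  (\<forall>\<gamma> \<gamma>'. pin Y b b \<gamma> \<longrightarrow> pin Y b b \<gamma>' \<longrightarrow> \<rho> (\<gamma> +++ \<gamma>') = \<rho> \<gamma>' \<circ> \<rho> \<gamma>) \<and>
  (\<forall>\<gamma> k m h. pin Y b b \<gamma> \<longrightarrow> k \<in> K \<longrightarrow> m \<in> K \<longrightarrow> pin E (f k) (f m) h \<longrightarrow>
    (\<forall>t\<in>{0..1}. p (h t) = \<gamma> t) \<longrightarrow> \<rho> \<gamma> k = m)"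
proof -
 define L where "L \<gamma> k m \<longleftrightarrow> m \<in> K \<and> (\<exists>h. pin E (f k) (f m) h \<and> (\<forall>t\<in>{0..1}. p (h t) = \<gamma> t))" for \<gamma> k m
 have ex: "\<exists>m. L \<gamma> k m" if g: "pin Y b b \<gamma>" and k: "k \<in> K" for \<gamma> k
 proof -
  have fk: "f k \<in> E" "p (f k) = b" using fib k by blast+
  obtain h where h: "path h" "path_image h \<subseteq> E" "pathstart h = f k" "\<And>t. t \<in> {0..1} ==> p (h t) = \<gamma> t"
   using covering_space_lift_path_strong[OF cov fk(1), of \<gamma>] g fk(2) unfolding pin_def by metis
  have "p (pathfinish h) = b" using h(4)[of 1] g by (simp add: pathfinish_def pin_def)
  moreover have "pathfinish h \<in> E" using h(2) pathfinish_in_path_image by blast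
  ultimately obtain m where "m \<in> K" "pathfinish h = f m" using fib by blast
  then show ?thesis unfolding L_def pin_def using h by blast
 qed
 have uniq: "m = m'" if hp: "hp Y \<gamma> \<gamma>'" and LL: "L \<gamma> k m" "L \<gamma>' k m'" for \<gamma> \<gamma>' k m m'
 proof -
  obtain h h' where h: "pin E (f k) (f m) h" "\<And>t. t \<in> {0..1} ==> p (h t) = \<gamma> t"
   "pin E (f k) (f m') h'" "\<And>t. t \<in> {0..1} ==> p (h' t) = \<gamma>' t"
   using LL unfolding L_def by blast
  have "pathfinish h = pathfinish h'"
   using covering_space_monodromy[OF cov, of \<gamma> \<gamma>' h h'] hp h homotopic_paths_imp_path[OF hp]
    homotopic_paths_imp_subset[OF hp] unfolding pin_def by metis
  then show ?thesis using h inj LL unfolding pin_def L_def by (metis inj_onD)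
 qed
 have Ljoin: "L (\<gamma> +++ \<gamma>') k l" if LL: "L \<gamma> k m" "L \<gamma>' m l" for \<gamma> \<gamma>' k m l
 proof -
  obtain h h' where h: "pin E (f k) (f m) h" "\<And>t. t \<in> {0..1} ==> p (h t) = \<gamma> t"
   "pin E (f m) (f l) h'" "\<And>t. t \<in> {0..1} ==> p (h' t) = \<gamma>' t"
   using LL unfolding L_def by blast
  have "p ((h +++ h') t) = (\<gamma> +++ \<gamma>') t" if "t \<in> {0..1}" for t
   using that h(2,4) by (auto simp: joinpaths_def)
  then show ?thesis using pin_join[OF h(1,3)] LL unfolding L_def by blast
 qed
 have Lrev: "L (reversepath \<gamma>) m k" if LL: "L \<gamma> k m" "k \<in> K" for \<gamma> k m
 proof -
  obtain h where h: "pin E (f k) (f m) h" "\<And>t. t \<in> {0..1} ==> p (h t) = \<gamma> t"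
   using LL unfolding L_def by blast
  have "p (reversepath h t) = reversepath \<gamma> t" if "t \<in> {0..1}" for t
   using that h(2)[of "1 - t"] by (simp add: reversepath_def)
  then show ?thesis using pin_rev[OF h(1)] LL unfolding L_def by blast
 qed
 define \<rho> where "\<rho> \<gamma> k = (if k \<in> K then THE m. L \<gamma> k m else k)" for \<gamma> k
 have \<rho>L: "\<rho> \<gamma> k = m" if "pin Y b b \<gamma>" "k \<in> K" "L \<gamma> k m" for \<gamma> k m
  unfolding \<rho>_def using that uniq[OF hp_refl[OF that(1)]] by (auto intro!: the_equality)
 have L\<rho>: "L \<gamma> k (\<rho> \<gamma> k)" if "pin Y b b \<gamma>" "k \<in> K" for \<gamma> k
  using ex[OF that] \<rho>L[OF that] by blast
 have KK: "\<rho> \<gamma> k \<in> K" if "pin Y b b \<gamma>" "k \<in> K" for \<gamma> k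
  using L\<rho>[OF that] by (simp add: L_def)
 show ?thesis
 proof (intro exI[of _ \<rho>] conjI allI impI)
  fix \<gamma> assume g: "pin Y b b \<gamma>"
  have "inj_on (\<rho> \<gamma>) K"
  proof (rule inj_onI)
   fix k k' assume k: "k \<in> K" "k' \<in> K" "\<rho> \<gamma> k = \<rho> \<gamma> k'"
   show "k = k'"
    using uniq[OF hp_refl[OF pin_rev[OF g]] Lrev[OF L\<rho>[OF g k(1)] k(1)]] Lrev[OF L\<rho>[OF g k(2)] k(2)] k(3) by metis
  qed
  moreover from this have "\<rho> \<gamma> ` K = K" using KK[OF g] by (intro endo_inj_surj[OF K]) auto
  ultimately show "\<rho> \<gamma> permutes K" by (intro bij_imp_permutes) (auto simp: bij_betw_def \<rho>_def)
 next
  fix \<gamma> \<gamma>' assume g: "pin Y b b \<gamma>" and hp: "hp Y \<gamma> \<gamma>'"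
  show "\<rho> \<gamma> = \<rho> \<gamma>'"
  proof
   fix k
   show "\<rho> \<gamma> k = \<rho> \<gamma>' k"
    using uniq[OF hp L\<rho>[OF g] L\<rho>[OF hp_pinD'[OF hp g]]] by (cases "k \<in> K") (auto simp: \<rho>_def)
  qed
 next
  fix \<gamma> \<gamma>' assume g: "pin Y b b \<gamma>" "pin Y b b \<gamma>'"
  show "\<rho> (\<gamma> +++ \<gamma>') = \<rho> \<gamma>' \<circ> \<rho> \<gamma>"
  proof
   fix k
   show "\<rho> (\<gamma> +++ \<gamma>') k = (\<rho> \<gamma>' \<circ> \<rho> \<gamma>) k"
   proof (cases "k \<in> K")
    case True
    then show ?thesis
     using \<rho>L[OF pin_join[OF g] True Ljoin[OF L\<rho>[OF g(1) True] L\<rho>[OF g(2) KK[OF g(1) True]]]] by simp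
   qed (simp add: \<rho>_def)
  qed
 next
  fix \<gamma> k m h assume "pin Y b b \<gamma>" "k \<in> K" "m \<in> K" "pin E (f k) (f m) h" "\<forall>t\<in>{0..1}. p (h t) = \<gamma> t"
  then show "\<rho> \<gamma> k = m" by (intro \<rho>L) (auto simp: L_def)
 qed
qed

text \<open>The sheets are told apart by a continuous function \<open>c\<close> with integer values,
  so each is open as the preimage of a ball of radius one.\<close>

lemma covering_chart:
 fixes p :: "'a::topological_space => 'b::topological_space" and s :: "'b => nat => 'a" and c :: "'a => real"
 assumes U: "openin (top_of_set Y) U" and p: "continuous_on E p" "p ` E \<subseteq> Y"
  and s: "\<And>k. k \<in> K ==> continuous_on U (\<lambda>y. s y k)" "\<And>y k. p (s y k) = y"
  and E: "E \<inter> p -` U = {s y k |y k. y \<in> U \<and> k \<in> K}"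
  and c: "continuous_on (E \<inter> p -` U) c" "\<And>y k. y \<in> U ==> c (s y k) = real k"
 shows "\<exists>v. \<Union>v = E \<inter> p -` U \<and> (\<forall>u\<in>v. openin (top_of_set E) u) \<and> pairwise disjnt v \<and>
  (\<forall>u\<in>v. \<exists>q. homeomorphism u U p q)"
proof (rule exI[of _ "(\<lambda>k. (\<lambda>y. s y k) ` U) ` K"], intro conjI ballI)
 let ?F = "\<lambda>k. (\<lambda>y. s y k) ` U"
 show "\<Union> (?F ` K) = E \<inter> p -` U" unfolding E by auto
 have EU: "openin (top_of_set E) (E \<inter> p -` U)" using p U by (intro continuous_openin_preimage[of _ _ Y]) auto
 fix u assume "u \<in> ?F ` K"
 then obtain k where k: "k \<in> K" "u = ?F k" by blast
 have "u = (E \<inter> p -` U) \<inter> c -` ball (real k) 1"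
 proof (intro subset_antisym subsetI)
  fix x assume "x \<in> u"
  then show "x \<in> (E \<inter> p -` U) \<inter> c -` ball (real k) 1" unfolding E using k c(2) by auto
 next
  fix x assume "x \<in> (E \<inter> p -` U) \<inter> c -` ball (real k) 1"
  then obtain y m where x: "x = s y m" "y \<in> U" "dist (real k) (real m) < 1" unfolding E using c(2) by auto
  then have "m = k" by (simp add: dist_real_def)
  then show "x \<in> u" using x k by blast
 qed
 then show "openin (top_of_set E) u" using openin_trans[OF continuous_openin_preimage_gen[OF c(1) open_ball] EU] by simp
 show "\<exists>q. homeomorphism u U p q"
 proof (intro exI homeomorphismI)
  have "u \<subseteq> E" using k E by auto
  then show "continuous_on u p" by (rule continuous_on_subset[OF p(1)])
  show "continuous_on U (\<lambda>y. s y k)" by (rule s(1)[OF k(1)])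
 qed (use k s(2) in auto)
next
 show "pairwise disjnt ((\<lambda>k. (\<lambda>y. s y k) ` U) ` K)"
 proof (rule pairwise_imageI)
  fix k m :: nat assume "k \<noteq> m"
  then show "disjnt ((\<lambda>y. s y k) ` U) ((\<lambda>y. s y m) ` U)"
   unfolding disjnt_def using c(2) by (auto simp: image_iff) (metis of_nat_eq_iff)
 qed
qed

lemma continuous_on_locally_constant:
 assumes "\<And>y. y \<in> A ==> \<exists>W. openin (top_of_set A) W \<and> y \<in> W \<and> (\<forall>y'\<in>W. g y' = g y)"
 shows "continuous_on A g"
 unfolding continuous_openin_preimage_eq
proof (intro allI impI)
 fix T :: "'b set"
 show "openin (top_of_set A) (A \<inter> g -` T)" unfolding openin_subopen[of _ "A \<inter> g -` T"]
 proof
  fix y assume y: "y \<in> A \<inter> g -` T"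
  then obtain W where W: "openin (top_of_set A) W" "y \<in> W" "\<forall>y'\<in>W. g y' = g y" using assms by blast
  have "x \<in> A \<inter> g -` T" if "x \<in> W" for x
  proof -
   have "g x = g y" "x \<in> A" using W(3) openin_imp_subset[OF W(1)] that by blast+
   then show ?thesis using y by simp
  qed
  then show "\<exists>W. openin (top_of_set A) W \<and> y \<in> W \<and> W \<subseteq> A \<inter> g -` T" using W by blast
 qed
qed

text \<open>A bounded function that is continuous only over a piece becomes continuous everywhere
  when multiplied by one that vanishes off the piece.\<close>

lemma continuous_on_cutoff:
 fixes l g :: "'a::metric_space => real"
 assumes l: "continuous_on U l" "\<And>y. y \<in> U - V ==> l y = 0" and V: "openin (top_of_set U) (U \<inter> V)"
  and g: "continuous_on (U \<inter> V) g" "\<And>y. \<bar>g y\<bar> \<le> M"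
 shows "continuous_on U (\<lambda>y. l y * g y)"
 unfolding continuous_on_def
proof
 fix y assume y: "y \<in> U"
 show "((\<lambda>y. l y * g y) \<longlongrightarrow> l y * g y) (at y within U)"
 proof (cases "y \<in> V")
  case True
  have "continuous_on (U \<inter> V) (\<lambda>y. l y * g y)"
   using l(1) g(1) by (intro continuous_intros continuous_on_subset[OF l(1)]) auto
  then have "((\<lambda>y. l y * g y) \<longlongrightarrow> l y * g y) (at y within U \<inter> V)"
   using y True by (auto simp: continuous_on_def)
  moreover have "at y within U \<inter> V = at y within U"
  proof -
   obtain B where B: "open B" "U \<inter> V = U \<inter> B" using V by (auto simp: openin_open)
   then have "y \<in> B" using y True by blast
   then show ?thesis using B by (intro at_within_nhd[of y B]) auto
  qed
  ultimately show ?thesis by simp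
 next
  case False
  have "((\<lambda>y. \<bar>l y\<bar> * M) \<longlongrightarrow> \<bar>l y\<bar> * M) (at y within U)"
   using l(1) y by (intro tendsto_intros) (auto simp: continuous_on_def)
  then have lim: "((\<lambda>y. \<bar>l y\<bar> * M) \<longlongrightarrow> 0) (at y within U)"
   using l(2)[of y] y False by simp
  have "norm (l x * g x) \<le> \<bar>l x\<bar> * M" for x by (simp add: abs_mult mult_left_mono g(2))
  then have "\<forall>\<^sub>F x in at y within U. norm (l x * g x) \<le> \<bar>l x\<bar> * M"
   by (intro always_eventually allI)
  from Lim_null_comparison[OF this lim] have "((\<lambda>y. l y * g y) \<longlongrightarrow> 0) (at y within U)" .
  then show ?thesis using l(2)[of y] y False by simp
 qed
qed

lemma openin_restrict:
 assumes "openin (top_of_set P) W" "A \<subseteq> P" shows "openin (top_of_set A) (A \<inter> W)"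
proof -
 obtain B where "open B" "W = P \<inter> B" using assms(1) by (auto simp: openin_open)
 moreover have "A \<inter> (P \<inter> B) = A \<inter> B" using assms(2) by blast
 ultimately show ?thesis by (auto simp: openin_open)
qed

text \<open>The glued cover is realized as a subset of the sphere times a plane. Sheets over the
  slit sphere are recorded in the second coordinate and sheets over the strips in the third; the
  factors \<open>l1\<close> and \<open>l2\<close>, distances to the slit and to the complement of
  the strips, make each record fade out where its labelling ends. The change of labels
  \<open>\<psi>\<close> is trivial above the axis and \<open>u j\<close> below it in strip
  \<open>j\<close>, so the line through that strip leads from sheet \<open>k\<close> to sheet
  \<open>u j k\<close>.\<close>

lemma std_monodromy_exists:
 fixes u :: "nat => nat => nat"
 assumes r: "r \<ge> 2" and n: "n \<ge> 1" and u: "\<And>j. u j permutes {1..n}" "u 0 = id" "u r = id"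
 shows "\<exists>\<rho>. (\<forall>\<gamma>. pin (P1 - std_pts r) infty infty \<gamma> \<longrightarrow> \<rho> \<gamma> permutes {1..n}) \<and>
  (\<forall>\<gamma> \<gamma>'. pin (P1 - std_pts r) infty infty \<gamma> \<longrightarrow> hp (P1 - std_pts r) \<gamma> \<gamma>' \<longrightarrow> \<rho> \<gamma> = \<rho> \<gamma>') \<and>
  (\<forall>\<gamma> \<gamma>'. pin (P1 - std_pts r) infty infty \<gamma> \<longrightarrow> pin (P1 - std_pts r) infty infty \<gamma>' \<longrightarrow> \<rho> (\<gamma> +++ \<gamma>') = \<rho> \<gamma>' \<circ> \<rho> \<gamma>) \<and>
  (\<forall>j. j \<le> r \<longrightarrow> \<rho> (lv j) = u j)"
proof -
 let ?Y = "P1 - std_pts r" and ?U = "std_slit r"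
 define VV where "VV = {z. \<exists>j. 1 \<le> j \<and> j < r \<and> real j < Re z \<and> Re z < real j + 1}"
 define V where "V = stereo ` VV"
 define jj where "jj y = nat \<lfloor>Re (affine_coord y)\<rfloor>" for y
 define \<psi> where "\<psi> y = (if Im (affine_coord y) > 0 then id else u (jj y))" for y
 define l1 where "l1 y = infdist y (stereo ` complex_of_real ` {1..real r})" for y
 define l2 where "l2 y = infdist y (P1 - V)" for y
 have jV: "jj (stereo z) = j" if "real j < Re z" "Re z < real j + 1" for z j
  unfolding jj_def using that by (simp add: floor_eq_iff nat_eq_iff)
 have opV: "openin (top_of_set P1) V"
 proof -
  have "VV = (\<Union>j\<in>{1..<r}. {z. Re z > real j} \<inter> {z. Re z < real j + 1})" by (auto simp: VV_def)
  then have "open VV" by (auto intro!: open_halfspace_Re_gt open_halfspace_Re_lt)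
  then show ?thesis unfolding V_def by (rule openin_stereo)
 qed
 have VY: "V \<subseteq> ?Y"
 proof -
  have "z \<notin> std_branch r" if zV: "z \<in> VV" for z
  proof
   assume "z \<in> std_branch r"
   then obtain k j where "real j < real k" "real k < real j + 1" using zV by (auto simp: VV_def std_branch_iff)
   then have "real j < real k" "real k < real (Suc j)" by auto
   then show False unfolding of_nat_less_iff by simp
  qed
  then show ?thesis unfolding V_def by auto
 qed
 have cl1: "closed (stereo ` complex_of_real ` {1..real r})"
  by (intro compact_imp_closed compact_continuous_image continuous_intros compact_Icc)
 have cl2: "closed (P1 - V)"
 proof -
  have "closedin (top_of_set P1) (P1 - V)" using opV by (intro closedin_diff closedin_subtopology_refl[THEN iffD2]) auto
  moreover have "closed P1" by (simp add: P1_def)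
  ultimately show ?thesis using closedin_closed_trans by blast
 qed
 have infV: "infty \<notin> V" by (auto simp: V_def)
 have l1: "l1 y = 0 \<longleftrightarrow> y \<in> stereo ` complex_of_real ` {1..real r}" for y
  unfolding l1_def using in_closed_iff_infdist_zero[OF cl1, of y] r by auto
 have l2: "l2 y = 0 \<longleftrightarrow> y \<in> P1 - V" for y
  unfolding l2_def using in_closed_iff_infdist_zero[OF cl2, of y] infV infty_in_P1 by blast
 have cont: "continuous_on A l1" "continuous_on A l2" for A unfolding l1_def l2_def by (intro continuous_intros)+
 have UV: "?Y = ?U \<union> V"
 proof
  show "?U \<union> V \<subseteq> ?Y" using std_slit_sub VY by blast
  show "?Y \<subseteq> ?U \<union> V"
  proof
   fix y assume y: "y \<in> ?Y"
   show "y \<in> ?U \<union> V"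
   proof (rule ccontr)
    assume n: "y \<notin> ?U \<union> V"
    then have "y \<in> stereo ` of_real ` {1..real r}" using y by simp
    then obtain x where x: "1 \<le> x" "x \<le> real r" "y = stereo (of_real x)"
     by (elim imageE) (metis atLeastAtMost_iff)
    define j where "j = nat \<lfloor>x\<rfloor>"
    have jx: "real j \<le> x" "x < real j + 1" using x(1) by (auto simp: j_def)
    have xr: "x \<noteq> real k" if "1 \<le> k" "k \<le> r" for k
    proof
     assume "x = real k"
     then have "of_real x \<in> std_branch r" using that by (auto simp: std_branch_iff complex_eq_iff)
     then show False using y x(3) by blast
    qed
    have "1 \<le> j" "j \<le> r" using jx x by linarith+
    then have "j \<noteq> r" "x \<noteq> real j" using xr[of j] xr[of r] jx x r by auto
    then have "of_real x \<in> VV"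
     unfolding VV_def using jx \<open>1 \<le> j\<close> \<open>j \<le> r\<close> by (auto intro!: exI[of _ j])
    then show False using n x(3) unfolding V_def by blast
   qed
  qed
 qed
 have opU: "openin (top_of_set ?Y) ?U"
 proof -
  have "openin (top_of_set P1) ?U" using cl1 by (intro openin_diff closed_subset openin_subtopology_self) auto
  then show ?thesis by (rule openin_subset_trans[OF _ std_slit_sub]) blast
 qed
 have opV': "openin (top_of_set ?Y) V" by (rule openin_subset_trans[OF opV VY]) blast
 have \<psi>p: "\<psi> y permutes {1..n}" for y unfolding \<psi>_def using u(1) by (simp add: permutes_id)
 have loc: "\<exists>W. openin (top_of_set (?U \<inter> V)) W \<and> y \<in> W \<and> (\<forall>y'\<in>W. \<psi> y' = \<psi> y)" if y: "y \<in> ?U \<inter> V" for y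
 proof -
  obtain z j where z: "y = stereo z" "1 \<le> j" "j < r" "real j < Re z" "Re z < real j + 1"
   using y unfolding V_def VV_def by blast
  have Imz: "Im z \<noteq> 0"
  proof
   assume "Im z = 0"
   then have "z = of_real (Re z)" by (simp add: complex_eq_iff)
   moreover have "1 \<le> Re z" "Re z \<le> real r" using z by linarith+
   ultimately have "y \<in> stereo ` of_real ` {1..real r}" unfolding z(1) by (metis atLeastAtMost_iff imageI)
   then show False using y by blast
  qed
  let ?B = "{w. Re w > real j} \<inter> {w. Re w < real j + 1} \<inter> (if Im z > 0 then {w. Im w > 0} else {w. Im w < 0})"
  have "open ?B"
   by (auto intro!: open_Int open_halfspace_Re_gt open_halfspace_Re_lt open_halfspace_Im_gt open_halfspace_Im_lt)
  then have "openin (top_of_set (?U \<inter> V)) ((?U \<inter> V) \<inter> stereo ` ?B)"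
   by (intro openin_restrict[OF openin_stereo]) auto
  moreover have "y \<in> (?U \<inter> V) \<inter> stereo ` ?B" using y z Imz by auto
  moreover have "\<psi> y' = \<psi> y" if y': "y' \<in> (?U \<inter> V) \<inter> stereo ` ?B" for y'
  proof -
   obtain w where w: "y' = stereo w" "w \<in> ?B" using y' by blast
   have "jj y' = j" "jj y = j" unfolding w(1) z(1) using w(2) z(4,5) by (intro jV; simp)+
   moreover have "Im w > 0 \<longleftrightarrow> Im z > 0" using w(2) by (auto split: if_splits)
   ultimately show ?thesis unfolding \<psi>_def by (simp add: w(1) z(1))
  qed
  ultimately show ?thesis by blast
 qed
 have c\<psi>: "continuous_on (?U \<inter> V) (\<lambda>y. F (\<psi> y))" for F :: "(nat => nat) => real"
 proof (rule continuous_on_locally_constant)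
  fix y assume "y \<in> ?U \<inter> V"
  from loc[OF this] show "\<exists>W. openin (top_of_set (?U \<inter> V)) W \<and> y \<in> W \<and> (\<forall>y'\<in>W. F (\<psi> y') = F (\<psi> y))"
   by metis
 qed
 \<comment> \<open>Two parametrizations of the same points: \<open>s1\<close> by the label over the
   slit sphere, \<open>s2\<close> by the label over the strips.\<close>
 define s1 where "s1 y k = (y, l1 y * real k, l2 y * real (inv' (\<psi> y) k))" for y k
 define s2 where "s2 y k = (y, l1 y * real (\<psi> y k), l2 y * real k)" for y k
 define E where "E = {s1 y k |y k. y \<in> ?Y \<and> k \<in> {1..n}}"
 have s12: "s2 y k = s1 y (\<psi> y k)" for y k using permutes_inverses(2)[OF \<psi>p] by (simp add: s1_def s2_def)
 have s21: "s1 y k = s2 y (inv' (\<psi> y) k)" for y k using permutes_inverses(1)[OF \<psi>p] by (simp add: s1_def s2_def)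
 have inK: "\<psi> y k \<in> {1..n} \<longleftrightarrow> k \<in> {1..n}" "inv' (\<psi> y) k \<in> {1..n} \<longleftrightarrow> k \<in> {1..n}" for y k
  using permutes_in_image[OF \<psi>p] permutes_in_image[OF permutes_inv[OF \<psi>p]] by blast+
 have E1: "E \<inter> fst -` ?U = {s1 y k |y k. y \<in> ?U \<and> k \<in> {1..n}}"
 proof (intro subset_antisym subsetI)
  fix x assume "x \<in> E \<inter> fst -` ?U"
  then obtain y k where x: "x = s1 y k" "k \<in> {1..n}" "fst x \<in> ?U" unfolding E_def by blast
  have "fst x = y" by (simp add: x(1) s1_def)
  then show "x \<in> {s1 y k |y k. y \<in> ?U \<and> k \<in> {1..n}}" using x by blast
 next
  fix x assume "x \<in> {s1 y k |y k. y \<in> ?U \<and> k \<in> {1..n}}"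
  then obtain y k where x: "x = s1 y k" "k \<in> {1..n}" "y \<in> ?U" by blast
  have "fst x = y" by (simp add: x(1) s1_def)
  then show "x \<in> E \<inter> fst -` ?U" using x subsetD[OF std_slit_sub x(3)] unfolding E_def by blast
 qed
 have E2: "E \<inter> fst -` V = {s2 y k |y k. y \<in> V \<and> k \<in> {1..n}}"
 proof (intro subset_antisym subsetI)
  fix x assume "x \<in> E \<inter> fst -` V"
  then obtain y k where x: "x = s1 y k" "k \<in> {1..n}" "fst x \<in> V" unfolding E_def by blast
  have "fst x = y" by (simp add: x(1) s1_def)
  with x have "x = s1 y k" "y \<in> V" "k \<in> {1..n}" by auto
  then show "x \<in> {s2 y k |y k. y \<in> V \<and> k \<in> {1..n}}" using s21 inK(2) by blast
 next
  fix x assume "x \<in> {s2 y k |y k. y \<in> V \<and> k \<in> {1..n}}"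
  then obtain y k where x: "x = s1 y (\<psi> y k)" "y \<in> V" "\<psi> y k \<in> {1..n}" using s12 inK(1) by blast
  have "fst x = y" by (simp add: x(1) s1_def)
  then show "x \<in> E \<inter> fst -` V" using x VY unfolding E_def by blast
 qed
 have cont_s1: "continuous_on ?U (\<lambda>y. s1 y k)" if k: "k \<in> {1..n}" for k
 proof -
  have "continuous_on ?U (\<lambda>y. l2 y * real (inv' (\<psi> y) k))"
  proof (rule continuous_on_cutoff[where V = V and M = "real n", OF cont(2)])
   show "l2 y = 0" if "y \<in> ?U - V" for y using that l2 by blast
   show "openin (top_of_set ?U) (?U \<inter> V)" by (rule openin_restrict[OF opV Diff_subset])
   show "continuous_on (?U \<inter> V) (\<lambda>y. real (inv' (\<psi> y) k))" by (rule c\<psi>)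
   show "\<bar>real (inv' (\<psi> y) k)\<bar> \<le> real n" for y using inK(2)[of y k] k by simp
  qed
  moreover have "continuous_on ?U (\<lambda>y. l1 y * real k)" by (intro continuous_intros cont)
  ultimately show ?thesis unfolding s1_def by (intro continuous_on_Pair continuous_on_id)
 qed
 have cont_s2: "continuous_on V (\<lambda>y. s2 y k)" if k: "k \<in> {1..n}" for k
 proof -
  have "continuous_on V (\<lambda>y. l1 y * real (\<psi> y k))"
  proof (rule continuous_on_cutoff[where V = ?U and M = "real n", OF cont(1)])
   show "l1 y = 0" if "y \<in> V - ?U" for y using that l1 VY by blast
   show "openin (top_of_set V) (V \<inter> ?U)" by (rule openin_restrict[OF opU VY])
   show "continuous_on (V \<inter> ?U) (\<lambda>y. real (\<psi> y k))"
    using c\<psi>[of "\<lambda>f. real (f k)"] by (simp only: Int_commute)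
   show "\<bar>real (\<psi> y k)\<bar> \<le> real n" for y using inK(1)[of y k] k by simp
  qed
  moreover have "continuous_on V (\<lambda>y. l2 y * real k)" by (intro continuous_intros cont)
  ultimately show ?thesis unfolding s2_def by (intro continuous_on_Pair continuous_on_id)
 qed
 have pE: "fst ` E \<subseteq> ?Y"
 proof (rule image_subsetI)
  fix x assume "x \<in> E"
  then obtain y k where x: "x = s1 y k" "y \<in> ?Y" unfolding E_def by blast
  have "fst x = y" by (simp add: x(1) s1_def)
  then show "fst x \<in> ?Y" using x(2) by simp
 qed
 have cov: "covering_space E fst ?Y" unfolding covering_space_def
 proof (intro conjI ballI)
  show "continuous_on E fst" by (intro continuous_intros)
  show "fst ` E = ?Y"
  proof
   show "?Y \<subseteq> fst ` E"
   proof
    fix y assume y: "y \<in> ?Y"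
    have "1 \<in> {1..n}" using n by simp
    with y have "s1 y 1 \<in> E" unfolding E_def by blast
    then show "y \<in> fst ` E" by (rule image_eqI[rotated]) (simp add: s1_def)
   qed
  qed (rule pE)
  fix y assume y: "y \<in> ?Y"
  have A1: "\<exists>v. \<Union>v = E \<inter> fst -` ?U \<and> (\<forall>u\<in>v. openin (top_of_set E) u) \<and> pairwise disjnt v \<and> (\<forall>u\<in>v. \<exists>q. homeomorphism u ?U fst q)"
  proof (rule covering_chart[where s = s1 and K = "{1..n}" and c = "\<lambda>e. fst (snd e) / l1 (fst e)", OF opU _ pE cont_s1 _ E1])
   show "continuous_on (E \<inter> fst -` ?U) (\<lambda>e. fst (snd e) / l1 (fst e))"
    using l1 by (intro continuous_intros continuous_on_compose2[OF cont(1)[of UNIV]]) auto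
  qed (use l1 in \<open>auto simp: s1_def intro!: continuous_intros\<close>)
  have A2: "\<exists>v. \<Union>v = E \<inter> fst -` V \<and> (\<forall>u\<in>v. openin (top_of_set E) u) \<and> pairwise disjnt v \<and> (\<forall>u\<in>v. \<exists>q. homeomorphism u V fst q)"
  proof (rule covering_chart[where s = s2 and K = "{1..n}" and c = "\<lambda>e. snd (snd e) / l2 (fst e)", OF opV' _ pE cont_s2 _ E2])
   show "continuous_on (E \<inter> fst -` V) (\<lambda>e. snd (snd e) / l2 (fst e))"
    using l2 by (intro continuous_intros continuous_on_compose2[OF cont(2)[of UNIV]]) auto
  qed (use l2 in \<open>auto simp: s2_def intro!: continuous_intros\<close>)
  show "\<exists>T. y \<in> T \<and> openin (top_of_set ?Y) T \<and>
   (\<exists>v. \<Union>v = E \<inter> fst -` T \<and> (\<forall>u\<in>v. openin (top_of_set E) u) \<and> pairwise disjnt v \<and> (\<forall>u\<in>v. \<exists>q. homeomorphism u T fst q))"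
  proof (cases "y \<in> ?U")
   case True
   show ?thesis by (rule exI[of _ ?U]) (intro conjI True opU A1)
  next
   case False
   then have "y \<in> V" using y unfolding UV by (simp only: Un_iff simp_thms)
   then show ?thesis by (intro exI[of _ V] conjI opV' A2)
  qed
 qed
 have inf1: "l1 infty \<noteq> 0" and inf2: "l2 infty = 0" using l1 l2 infV by auto
 have fib: "x \<in> E \<and> fst x = infty \<longleftrightarrow> x \<in> s1 infty ` {1..n}" for x
 proof
  assume "x \<in> E \<and> fst x = infty"
  then obtain y k where x: "x = s1 y k" "k \<in> {1..n}" "fst x = infty" unfolding E_def by blast
  have "fst x = y" by (simp add: x(1) s1_def)
  then have "x = s1 infty k" using x(1,3) by simp
  then show "x \<in> s1 infty ` {1..n}" using x(2) by (rule image_eqI)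
 next
  assume "x \<in> s1 infty ` {1..n}"
  then obtain k where x: "x = s1 infty k" "k \<in> {1..n}" by blast
  then have "x \<in> E" using infty_slit(2) unfolding E_def by blast
  then show "x \<in> E \<and> fst x = infty" by (simp add: x(1) s1_def)
 qed
 have inj: "inj_on (s1 infty) {1..n}" using inf1 by (auto simp: inj_on_def s1_def)
 from covering_monodromy[OF cov finite_atLeastAtMost inj fib] obtain \<rho> where R:
  "\<forall>\<gamma>. pin ?Y infty infty \<gamma> \<longrightarrow> \<rho> \<gamma> permutes {1..n}"
  "\<forall>\<gamma> \<gamma>'. pin ?Y infty infty \<gamma> \<longrightarrow> hp ?Y \<gamma> \<gamma>' \<longrightarrow> \<rho> \<gamma> = \<rho> \<gamma>'"
  "\<forall>\<gamma> \<gamma>'. pin ?Y infty infty \<gamma> \<longrightarrow> pin ?Y infty infty \<gamma>' \<longrightarrow> \<rho> (\<gamma> +++ \<gamma>') = \<rho> \<gamma>' \<circ> \<rho> \<gamma>"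
  "\<forall>\<gamma> k m h. pin ?Y infty infty \<gamma> \<longrightarrow> k \<in> {1..n} \<longrightarrow> m \<in> {1..n} \<longrightarrow> pin E (s1 infty k) (s1 infty m) h \<longrightarrow>
    (\<forall>t\<in>{0..1}. fst (h t) = \<gamma> t) \<longrightarrow> \<rho> \<gamma> k = m" by (elim exE conjE)
 note \<rho> = R[rule_format]
 have "\<rho> (lv j) k = u j k" if j: "1 \<le> j" "j < r" and k: "k \<in> {1..n}" for j k
 proof -
  let ?c = "real j + 1 / 2"
  have uk: "u j k \<in> {1..n}" using permutes_in_image[OF u(1)] k by blast
  \<comment> \<open>Along the line the strip label stays \<open>k\<close>, while the label over the
    slit sphere is \<open>k\<close> above and \<open>u j k\<close> below. At the crossing
    \<open>l1\<close> vanishes, so the two halves of the lift meet.\<close>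
  define H where "H m y = (y, l1 y * real m, l2 y * real k)" for m and y :: point
  have piece: "pin E (s1 infty m) (H k (stereo (of_real ?c))) (H m \<circ> tp ?c \<sigma>)"
   if \<sigma>: "\<sigma> = 1 \<and> m = k \<or> \<sigma> = -1 \<and> m = u j k" for \<sigma> m
  proof -
   have s0: "\<sigma> \<noteq> 0" using \<sigma> by auto
   have t: "pin (hemi \<sigma> - std_pts r) infty (stereo (of_real ?c)) (tp ?c \<sigma>)"
    by (rule pin_tp_hemi[OF s0 half_std Im_std])
   have cV: "stereo (of_real ?c) \<in> V" unfolding V_def VV_def using j by (intro imageI) auto
   have c0: "l1 (stereo (of_real ?c)) = 0" unfolding l1 using j by (intro imageI) auto
   have HE: "H m (tp ?c \<sigma> x) \<in> E" if x: "x \<in> {0..1}" for x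
   proof (cases "x = 0 \<or> x = 1")
    case True
    then show ?thesis
    proof
     assume "x = 0"
     have "H m infty = s1 infty m" by (simp add: H_def s1_def inf2)
     moreover have "m \<in> {1..n}" using \<sigma> k uk by blast
     ultimately have "H m infty \<in> E" using infty_slit(2) unfolding E_def by blast
     then show ?thesis using \<open>x = 0\<close> by (simp add: tp_0[OF s0])
    next
     assume "x = 1"
     have "H m (stereo (of_real ?c)) = s2 (stereo (of_real ?c)) k" by (simp only: H_def s2_def c0 mult_zero_left)
     then have "H m (stereo (of_real ?c)) \<in> E \<inter> fst -` V" unfolding E2 using cV k by blast
     then show ?thesis using \<open>x = 1\<close> by (simp add: tp_1)
    qed
   next
    case False
    define y where "y = tp ?c \<sigma> x"
    have x0: "x \<noteq> 0" "0 < (1 - x) / x" using False x by auto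
    have y: "y = stereo (Complex ?c (\<sigma> * ((1 - x) / x)))" unfolding y_def using tp_pos[OF x0(1)] by simp
    have "jj y = j" unfolding y by (rule jV) auto
    moreover have "Im (affine_coord y) > 0 \<longleftrightarrow> \<sigma> = 1"
     unfolding y affine_coord_stereo using \<sigma> x0 by auto
    ultimately have "\<psi> y = (if \<sigma> = 1 then id else u j)" by (simp add: \<psi>_def)
    then have "\<psi> y k = m" using \<sigma> by auto
    then have "H m y = s2 y k" by (simp add: H_def s2_def)
    moreover have "y \<in> V" unfolding y V_def VV_def using j by (intro imageI) auto
    ultimately have "H m y \<in> E \<inter> fst -` V" unfolding E2 using k by blast
    then show ?thesis by (simp add: y_def)
   qed
   show ?thesis unfolding pin_def
   proof (intro conjI)
    have "continuous_on UNIV (H m)" unfolding H_def by (intro continuous_intros cont)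
    then show "path (H m \<circ> tp ?c \<sigma>)"
     using t unfolding pin_def by (intro path_continuous_image) (auto intro: continuous_on_subset)
    show "path_image (H m \<circ> tp ?c \<sigma>) \<subseteq> E" unfolding path_image_def using HE by auto
    show "pathstart (H m \<circ> tp ?c \<sigma>) = s1 infty m" by (simp add: pathstart_def tp_0[OF s0] H_def s1_def inf2)
    show "pathfinish (H m \<circ> tp ?c \<sigma>) = H k (stereo (of_real ?c))"
     unfolding pathfinish_def comp_apply tp_1 by (simp only: H_def c0 mult_zero_left)
   qed
  qed
  note p = pin_join[OF piece[of 1 k] pin_rev[OF piece[of "-1" "u j k"]]]
  show ?thesis
  proof (rule \<rho>(4)[OF pin_lv k uk p])
   fix t :: real
   show "fst (((H k \<circ> tp ?c 1) +++ reversepath (H (u j k) \<circ> tp ?c (- 1))) t) = lv j t"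
    by (simp add: lv_def ell_def joinpaths_def reversepath_def H_def)
  qed auto
 qed
 then have "\<rho> (lv j) = u j" if "1 \<le> j" "j < r" for j
 proof -
  have "\<rho> (lv j) k = u j k" for k
   using \<open>\<And>k j. 1 \<le> j ==> j < r ==> k \<in> {1..n} ==> \<rho> (lv j) k = u j k\<close>[OF that, of k]
    permutes_not_in[OF u(1)] permutes_not_in[OF \<rho>(1)[OF pin_lv]] by (cases "k \<in> {1..n}") auto
  then show ?thesis by blast
 qed
 moreover have "\<rho> (lv j) = id" if "j = 0 \<or> j = r" for j
 proof -
  let ?i = "linepath infty infty"
  have i: "pin ?Y infty infty ?i" by (rule pin_const[OF infty_slit(2)])
  have "\<rho> ?i \<circ> \<rho> ?i = \<rho> ?i" using \<rho>(3)[OF i i] \<rho>(2)[OF pin_join[OF i i] hp_lid[OF i]] by simp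
  then have "\<rho> ?i = id" using permutes_bij[OF \<rho>(1)[OF i]] bij_idem_id by blast
  moreover have "\<rho> (lv j) = \<rho> ?i" using that by (intro \<rho>(2)[OF pin_lv] lv_null[OF r]) auto
  ultimately show ?thesis by simp
 qed
 ultimately have lv: "\<rho> (lv j) = u j" if "j \<le> r" for j
  using that u(2,3) by (metis One_nat_def Suc_leI le_neq_implies_less neq0_conv)
 show ?thesis by (rule exI[of _ \<rho>]) (intro conjI R(1-3) allI impI lv)
qed

section \<open>Branch cycles with respect to arbitrary and to standard generators\<close>

section \<open>Branch cycle descriptions\<close>

text \<open>Both loops are conjugated circles around the same point. Once the larger circle is
  shrunk to the smaller one, they differ only in the connecting path.\<close>

lemma meridian_conj_le:
 assumes "s \<in> P1" and e: "0 < e'" "e' \<le> e" "local_param s ` cball 0 e \<inter> S = {s}"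
  and d: "pin (P1 - S) b (local_param s (of_real e)) \<delta>" "pin (P1 - S) b (local_param s (of_real e')) \<delta>'"
  and g: "hp (P1 - S) \<gamma> (cjp \<delta> (small_circle s e))"
   "hp (P1 - S) \<gamma>' (cjp \<delta>' (small_circle s e'))"
 shows "\<exists>\<eta>. pin (P1 - S) b b \<eta> \<and> hp (P1 - S) \<gamma> (cjp \<eta> \<gamma>')"
proof -
 let ?Y = "P1 - S" and ?c = "small_circle s e'"
 from small_circle_free[OF assms(1) e] obtain \<sigma> where \<sigma>:
  "pin ?Y (local_param s (of_real e)) (local_param s (of_real e')) \<sigma>"
  "hp ?Y (small_circle s e) (cjp \<sigma> ?c)" by blast
 have c: "pin ?Y (local_param s (of_real e)) (local_param s (of_real e)) (small_circle s e)"
  using e by (intro small_circle_pin[OF assms(1)]) auto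
 have c': "pin ?Y (local_param s (of_real e')) (local_param s (of_real e')) ?c"
 proof (rule small_circle_pin[OF assms(1) _ e(1)])
  have "s \<in> local_param s ` cball 0 e'" using local_param_0[OF assms(1)] e(1) by (intro image_eqI[of _ _ 0]) auto
  moreover have "local_param s ` cball 0 e' \<subseteq> local_param s ` cball 0 e" using e(2) by (intro image_mono) auto
  ultimately show "local_param s ` cball 0 e' \<inter> S = {s}" using e(3) by blast
 qed
 let ?\<mu> = "\<delta> +++ \<sigma>"
 have \<mu>: "pin ?Y b (local_param s (of_real e')) ?\<mu>" by (rule pin_join[OF d(1) \<sigma>(1)])
 have g': "pin ?Y b b \<gamma>'" by (rule hp_pinD[OF g(2) pin_cjp[OF d(2) c']])
 note r' = pin_rev[OF d(2)]
 have "hp ?Y \<gamma> (cjp \<delta> (cjp \<sigma> ?c))"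
  by (rule hp_trans[OF g(1) hp_cjp[OF \<sigma>(2) d(1) c]])
 also have "hp ?Y \<dots> (cjp ?\<mu> ?c)" by (rule hp_sym[OF hp_cjp_cjp[OF d(1) \<sigma>(1) c']])
 also have "hp ?Y \<dots> (cjp ?\<mu> (cjp (reversepath \<delta>') (cjp \<delta>' ?c)))"
  using hp_cjp[OF hp_sym[OF hp_cjp_rev[OF r' c']] \<mu> c'] by simp
 also have "hp ?Y \<dots> (cjp ?\<mu> (cjp (reversepath \<delta>') \<gamma>'))"
  by (rule hp_sym[OF hp_cjp[OF hp_cjp[OF g(2) r' g'] \<mu> pin_cjp[OF r' g']]])
 also have "hp ?Y \<dots> (cjp (?\<mu> +++ reversepath \<delta>') \<gamma>')"
  by (rule hp_sym[OF hp_cjp_cjp[OF \<mu> r' g']])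
 finally show ?thesis using pin_join[OF \<mu> r'] by blast
qed

lemma meridian_conj:
 assumes \<rho>: "pi1_hom n (P1 - S) b \<rho>" and "s \<in> P1" "meridian S b s \<gamma>" "meridian S b s \<gamma>'"
 shows "\<exists>a. a permutes {1..n} \<and> \<rho> \<gamma>' = cj a (\<rho> \<gamma>)"
proof -
 have start: "pathstart (small_circle s e) = local_param s (of_real e)" for e by (simp add: pathstart_def small_circle_eq)
 obtain e \<delta> e' \<delta>' where e: "e > 0" "local_param s ` cball 0 e \<inter> S = {s}" "pin (P1 - S) b (local_param s (of_real e)) \<delta>"
  "hp (P1 - S) \<gamma> (cjp \<delta> (small_circle s e))"
  and e': "e' > 0" "local_param s ` cball 0 e' \<inter> S = {s}" "pin (P1 - S) b (local_param s (of_real e')) \<delta>'"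
  "hp (P1 - S) \<gamma>' (cjp \<delta>' (small_circle s e'))"
  using assms(3,4) unfolding meridian_cjp_iff start by blast
 have g: "pin (P1 - S) b b \<gamma>" "pin (P1 - S) b b \<gamma>'"
  using hp_pinD[OF e(4) pin_cjp[OF e(3) small_circle_pin[OF assms(2) e(2,1)]]]
   hp_pinD[OF e'(4) pin_cjp[OF e'(3) small_circle_pin[OF assms(2) e'(2,1)]]] by auto
 have perm: "\<rho> \<eta> permutes {1..n}" if "pin (P1 - S) b b \<eta>" for \<eta>
  using pi1_carrier[OF \<rho> that] alt_group_carrier by blast
 show ?thesis
 proof (cases "e' \<le> e")
  case True
  from meridian_conj_le[OF assms(2) e'(1) True e(2,3) e'(3) e(4) e'(4)] obtain \<eta> where
   \<eta>: "pin (P1 - S) b b \<eta>" "hp (P1 - S) \<gamma> (cjp \<eta> \<gamma>')" by blast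
  have "\<rho> \<gamma> = cj (inv' (\<rho> \<eta>)) (\<rho> \<gamma>')"
   using pi1_hp[OF \<rho> g(1) \<eta>(2)] pi1_cjp[OF \<rho> \<eta>(1) g(2)] by simp
  then have "\<rho> \<gamma>' = cj (\<rho> \<eta>) (\<rho> \<gamma>)" using permutes_bij[OF perm[OF \<eta>(1)]] by simp
  then show ?thesis using perm[OF \<eta>(1)] by blast
 next
  case False
  then have "e \<le> e'" by simp
  from meridian_conj_le[OF assms(2) e(1) this e'(2,3) e(3) e'(4) e(4)] obtain \<eta> where
   \<eta>: "pin (P1 - S) b b \<eta>" "hp (P1 - S) \<gamma>' (cjp \<eta> \<gamma>)" by blast
  have "\<rho> \<gamma>' = cj (inv' (\<rho> \<eta>)) (\<rho> \<gamma>)"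
   using pi1_hp[OF \<rho> g(2) \<eta>(2)] pi1_cjp[OF \<rho> \<eta>(1) g(1)] by simp
  then show ?thesis using permutes_inv[OF perm[OF \<eta>(1)]] by blast
 qed
qed

lemma words_image:
 assumes \<rho>: "pi1_hom n Y b \<rho>" and G: "G \<subseteq> loops_at Y b" "b \<in> Y" and "\<gamma> \<in> words Y b G"
 shows "\<rho> \<gamma> \<in> generate (alt_group n) (\<rho> ` G)"
 using assms(4) G
proof (induction rule: words_induct)
 case (hp \<gamma> \<gamma>')
 then show ?case using pi1_hp[OF \<rho> hp(2) hp_sym[OF hp(3)]] by simp
next
 case const
 then show ?case using generate.one[of "alt_group n" "\<rho> ` G"] pi1_const[OF \<rho> G(2)] by (simp only: alt_group_one)
next
 case (gen g \<gamma>)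
 show ?case using generate.eng[OF gen(4) generate.incl[OF imageI[OF gen(1), of \<rho>]]]
  unfolding pi1_join[OF \<rho> gen(2,3)] alt_group_mult .
next
 case (rev g \<gamma>)
 show ?case using generate.eng[OF rev(4) generate.inv[OF imageI[OF rev(1), of \<rho>]]]
  unfolding pi1_join[OF \<rho> pin_rev[OF rev(2)] rev(3)] pi1_rev[OF \<rho> rev(2)] alt_group_mult
   alt_group_inv_equality[OF pi1_carrier[OF \<rho> rev(2)]] .
qed

text \<open>A datum guarantees only some classical generators with branch cycles in the Nielsen
  class. For any other system, conjugacy of meridians gives three-cycles, and the product relation
  and generation follow from the monodromy homomorphism.\<close>

lemma classical_generators_nielsen:
 assumes d: "(S, b, \<rho>) \<in> hurwitz_data n r" and g: "classical_generators S b \<gamma>s"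
 shows "map \<rho> \<gamma>s \<in> nielsen_class n r"
proof -
 note D = hurwitz_dataD[OF d]
 obtain \<gamma>s' where g': "classical_generators S b \<gamma>s'" "map \<rho> \<gamma>s' \<in> nielsen_class n r"
  using d unfolding hurwitz_data_iff by blast
 obtain ss where ss: "List.distinct ss" "set ss = S" "list_all2 (meridian S b) ss \<gamma>s"
  using g unfolding classical_generators_iff by blast
 obtain ss' where ss': "List.distinct ss'" "set ss' = S" "list_all2 (meridian S b) ss' \<gamma>s'"
  using g'(1) unfolding classical_generators_iff by blast
 have len: "length \<gamma>s = r" using list_all2_lengthD[OF ss(3)] distinct_card[OF ss(1)] ss(2) D(5) by simp
 have three: "\<rho> \<gamma> \<in> three_cycles n" if "\<gamma> \<in> set \<gamma>s" for \<gamma>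
 proof -
  obtain i where i: "i < length \<gamma>s" "\<gamma> = \<gamma>s ! i"
   using \<open>\<gamma> \<in> set \<gamma>s\<close> by (metis in_set_conv_nth)
  have m: "meridian S b (ss ! i) \<gamma>" "ss ! i \<in> S"
   using ss i list_all2_lengthD[OF ss(3)] list_all2_nthD2[OF ss(3) i(1)] nth_mem by auto
  then obtain k where k: "k < length ss'" "ss' ! k = ss ! i" using ss'(2) by (metis in_set_conv_nth)
  have m': "meridian S b (ss ! i) (\<gamma>s' ! k)" "\<gamma>s' ! k \<in> set \<gamma>s'"
   using list_all2_nthD[OF ss'(3) k(1)] k list_all2_lengthD[OF ss'(3)] by auto
  have "ss ! i \<in> P1" using m(2) D(4) by blast
  from meridian_conj[OF D(2) this m'(1) m(1)] obtain a where a: "a permutes {1..n}" "\<rho> \<gamma> = cj a (\<rho> (\<gamma>s' ! k))"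
   by blast
  have "\<rho> (\<gamma>s' ! k) \<in> three_cycles n" using g'(2) m'(2) by (auto simp: nielsen_class_def)
  then show ?thesis using cj_tc3[OF a(1)] a(2) unfolding three_cycles_eq_tc3 by simp
 qed
 have G: "set \<gamma>s \<subseteq> loops_at (P1 - S) b" and prod: "hp (P1 - S) (path_prod b \<gamma>s) (linepath b b)"
  and gen: "\<And>\<gamma>. pin (P1 - S) b b \<gamma> ==> \<gamma> \<in> words (P1 - S) b (set \<gamma>s)"
  using g unfolding classical_generators_iff by blast+
 have pins: "\<forall>w\<in>set \<gamma>s. pin (P1 - S) b b w" using G by (auto simp: loops_at_pin)
 have "right_prod (map \<rho> \<gamma>s) = \<rho> (path_prod b \<gamma>s)" by (rule pi1_path_prod[OF D(2,1) pins, symmetric])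
 also have "\<dots> = \<rho> (linepath b b)" by (rule pi1_hp[OF D(2) pin_path_prod[OF pins D(1)] prod])
 also have "\<dots> = id" by (rule pi1_const[OF D(2,1)])
 finally have rp: "right_prod (map \<rho> \<gamma>s) = id" .
 have car: "set (map \<rho> \<gamma>s) \<subseteq> carrier (alt_group n)" using pi1_carrier[OF D(2)] pins by auto
 have "generate (alt_group n) (set (map \<rho> \<gamma>s)) = carrier (alt_group n)"
 proof
  show "generate (alt_group n) (set (map \<rho> \<gamma>s)) \<subseteq> carrier (alt_group n)"
   by (rule group.generate_incl[OF alt_group_is_group car])
  show "carrier (alt_group n) \<subseteq> generate (alt_group n) (set (map \<rho> \<gamma>s))"
  proof
   fix h assume "h \<in> carrier (alt_group n)"
   from pi1_surj[OF d this] obtain \<gamma> where \<gamma>: "pin (P1 - S) b b \<gamma>" "\<rho> \<gamma> = h" .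
   show "h \<in> generate (alt_group n) (set (map \<rho> \<gamma>s))"
    using words_image[OF D(2) G D(1) gen[OF \<gamma>(1)]] \<gamma>(2) by simp
  qed
 qed
 then show ?thesis unfolding nielsen_class_def using len three rp by auto
qed

lemma std_unique:
 assumes r: "r \<ge> 2" and \<rho>: "pi1_hom n (P1 - std_pts r) infty \<rho>" "pi1_hom n (P1 - std_pts r) infty \<rho>'"
  and eq: "map \<rho> (gens r) = map \<rho>' (gens r)" and \<gamma>: "pin (P1 - std_pts r) infty infty \<gamma>"
 shows "\<rho> \<gamma> = \<rho>' \<gamma>"
proof -
 let ?Y = "P1 - std_pts r"
 have G: "set (gens r) \<subseteq> loops_at ?Y infty"
  using classical_generators_std[OF r] unfolding classical_generators_iff by blast
 have eq': "\<rho> g = \<rho>' g" if "g \<in> set (gens r)" for g using eq that by (simp add: map_eq_conv)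
 from gens_generate[OF r \<gamma>] G infty_slit(2) show ?thesis
 proof (induction rule: words_induct)
  case (hp \<gamma> \<gamma>')
  then show ?case using pi1_hp[OF \<rho>(1) hp(2) hp_sym[OF hp(3)]] pi1_hp[OF \<rho>(2) hp(2) hp_sym[OF hp(3)]] by simp
 next
  case const
  show ?case using pi1_const[OF \<rho>(1) infty_slit(2)] pi1_const[OF \<rho>(2) infty_slit(2)] by metis
 next
  case (gen g \<gamma>)
  then show ?case unfolding pi1_join[OF \<rho>(1) gen(2,3)] pi1_join[OF \<rho>(2) gen(2,3)] using eq' by simp
 next
  case (rev g \<gamma>)
  then show ?case
   unfolding pi1_join[OF \<rho>(1) pin_rev[OF rev(2)] rev(3)] pi1_join[OF \<rho>(2) pin_rev[OF rev(2)] rev(3)]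
    pi1_rev[OF \<rho>(1) rev(2)] pi1_rev[OF \<rho>(2) rev(2)] using eq' by simp
 qed
qed

lemma right_prod_permutes: "\<forall>g\<in>set t. g permutes A ==> right_prod t permutes A"
proof (induction t)
 case Nil
 show ?case unfolding right_prod_Nil by (rule permutes_id)
next
 case (Cons g t)
 then show ?case unfolding right_prod_Cons by (intro permutes_compose) auto
qed

lemma std_datum_exists:
 assumes n: "n \<ge> 3" and r: "r \<ge> 2" and t: "t \<in> nielsen_class n r"
 obtains \<rho> where "(std_pts r, infty, \<rho>) \<in> hurwitz_data n r" "map \<rho> (gens r) = t"
proof -
 let ?Y = "P1 - std_pts r"
 have len: "length t = r" and rp: "right_prod t = id" and tc: "set t \<subseteq> three_cycles n"
  using t by (auto simp: nielsen_class_def)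
 have alt: "set t \<subseteq> carrier (alt_group n)" using tc three_cycles_incl by blast
 have tp: "\<forall>g\<in>set (take j t). g permutes {1..n}" for j
  using alt set_take_subset[of j t] alt_group_carrier by blast
 \<comment> \<open>The line \<open>lv j\<close> has to carry the inverse of the partial product
   \<open>P j\<close>: then \<open>gen j\<close>, the quotient of two consecutive lines, gets
   \<open>P (Suc j) \<circ> inv' (P j)\<close>, which is \<open>t ! j\<close>.\<close>
 define P where "P j = right_prod (take j t)" for j
 have P: "P j permutes {1..n}" for j unfolding P_def by (rule right_prod_permutes[OF tp])
 have "P 0 = id" "P r = id" using rp len by (simp_all add: P_def)
 then have u: "\<And>j. inv' (P j) permutes {1..n}" "inv' (P 0) = id" "inv' (P r) = id"
  using permutes_inv[OF P] by (simp_all add: inv_id)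
 have n1: "n \<ge> 1" using n by simp
 from std_monodromy_exists[where u = "\<lambda>j. inv' (P j)", OF r n1 u] obtain \<rho> where R:
  "\<forall>\<gamma>. pin ?Y infty infty \<gamma> \<longrightarrow> \<rho> \<gamma> permutes {1..n}"
  "\<forall>\<gamma> \<gamma>'. pin ?Y infty infty \<gamma> \<longrightarrow> hp ?Y \<gamma> \<gamma>' \<longrightarrow> \<rho> \<gamma> = \<rho> \<gamma>'"
  "\<forall>\<gamma> \<gamma>'. pin ?Y infty infty \<gamma> \<longrightarrow> pin ?Y infty infty \<gamma>' \<longrightarrow> \<rho> (\<gamma> +++ \<gamma>') = \<rho> \<gamma>' \<circ> \<rho> \<gamma>"
  "\<forall>j. j \<le> r \<longrightarrow> \<rho> (lv j) = inv' (P j)" by (elim exE conjE)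
 note \<rho> = R[rule_format]
 have const: "\<rho> (linepath infty infty) = id"
 proof -
  have i: "pin ?Y infty infty (linepath infty infty)" by (rule pin_const[OF infty_slit(2)])
  have "\<rho> (linepath infty infty) \<circ> \<rho> (linepath infty infty) = \<rho> (linepath infty infty)"
   using \<rho>(3)[OF i i] \<rho>(2)[OF pin_join[OF i i] hp_lid[OF i]] by metis
  then show ?thesis using permutes_bij[OF \<rho>(1)[OF i]] bij_idem_id by blast
 qed
 have rev: "\<rho> (reversepath \<gamma>) = inv' (\<rho> \<gamma>)" if \<gamma>: "pin ?Y infty infty \<gamma>" for \<gamma>
 proof (rule bij_left_inverse[OF permutes_bij[OF \<rho>(1)[OF \<gamma>]]])
  show "\<rho> (reversepath \<gamma>) \<circ> \<rho> \<gamma> = id"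
   using \<rho>(3)[OF \<gamma> pin_rev[OF \<gamma>]] \<rho>(2)[OF pin_join[OF \<gamma> pin_rev[OF \<gamma>]] hp_rinv[OF \<gamma>]] const by metis
 qed
 have gen: "\<rho> (gen j) = t ! j" if j: "j < r" for j
 proof -
  have "\<rho> (gen j) = inv' (inv' (P (Suc j))) \<circ> inv' (P j)"
   unfolding gen_def using \<rho>(3)[OF pin_lv pin_rev[OF pin_lv]] rev[OF pin_lv] \<rho>(4) j by simp
  also have "inv' (inv' (P (Suc j))) = P (Suc j)" by (rule inv_inv_eq[OF permutes_bij[OF P]])
  also have "P (Suc j) = t ! j \<circ> P j" using j len by (simp add: P_def take_Suc_conv_app_nth)
  also have "t ! j \<circ> P j \<circ> inv' (P j) = t ! j" by (simp add: comp_assoc permutes_inv_o(1)[OF P])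
  finally show ?thesis .
 qed
 have tuple: "map \<rho> (gens r) = t" using len gen by (intro nth_equalityI) (auto simp: gens_def)
 note cg = classical_generators_std[OF r]
 have G: "set (gens r) \<subseteq> loops_at ?Y infty" using cg unfolding classical_generators_iff by blast
 have galt: "\<rho> g \<in> carrier (alt_group n)" if "g \<in> set (gens r)" for g
  using that tuple alt by (metis image_eqI list.set_map subsetD)
 have A: "id \<in> carrier (alt_group n)" "\<And>a c. a \<in> carrier (alt_group n) ==> c \<in> carrier (alt_group n) ==> a \<circ> c \<in> carrier (alt_group n)"
  using perm_group_alt[of n] unfolding perm_group_def by blast+
 have "\<rho> \<gamma> \<in> carrier (alt_group n)" if \<gamma>: "pin ?Y infty infty \<gamma>" for \<gamma>
  using gens_generate[OF r \<gamma>] G infty_slit(2)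
 proof (induction rule: words_induct)
  case (hp \<gamma> \<gamma>')
  then show ?case using \<rho>(2)[OF hp(2) hp_sym[OF hp(3)]] by simp
 next
  case const
  show ?case unfolding \<open>\<rho> (linepath infty infty) = id\<close> by (rule A(1))
 next
  case (gen g \<gamma>)
  show ?case unfolding \<rho>(3)[OF gen(2,3)] by (rule A(2)[OF gen(4) galt[OF gen(1)]])
 next
  case (rev g \<gamma>)
  show ?case
   unfolding \<rho>(3)[OF pin_rev[OF rev(2)] rev(3)] \<open>\<And>\<gamma>. pin ?Y infty infty \<gamma> ==> \<rho> (reversepath \<gamma>) = inv' (\<rho> \<gamma>)\<close>[OF rev(2)]
   by (rule A(2)[OF rev(4) alt_group_inv_closed[OF galt[OF rev(1)]]])
 qed
 then have hpt: "pi1_hom n ?Y infty \<rho>" unfolding pi1_hom_iff using \<rho>(2,3) by blast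
 have "card (std_pts r) = r" unfolding std_branch_def image_image by (subst card_image) (auto simp: inj_on_def)
 moreover have "std_pts r \<subseteq> P1" "finite (std_pts r)" by (auto simp: std_branch_def)
 ultimately have "(std_pts r, infty, \<rho>) \<in> hurwitz_data n r"
  unfolding hurwitz_data_iff using hpt cg tuple t infty_slit(2) by blast
 then show thesis using that tuple by blast
qed

section \<open>From braids of tuples to components of the Hurwitz space\<close>

section \<open>Connectedness\<close>

abbreviation hin :: "nat => nat => datum set topology" where
 "hin n r \<equiv> hurwitz_space n r (carrier (alt_group n))"

abbreviation hcls :: "nat => nat => ((real => point) => nat => nat) => datum set" where
 "hcls n r \<rho> \<equiv> cls n r (carrier (alt_group n)) (std_pts r, infty, \<rho>)"

text \<open>All data with the given branch cycles are considered; they have the same class by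
  \<open>hcls_unique\<close>. That such data exist at all is what makes the relation transitive on
  the Nielsen class.\<close>

definition linked :: "nat => nat => (nat => nat) list => (nat => nat) list => bool" where
 "linked n r t t' \<longleftrightarrow> (\<forall>\<rho> \<rho>'. (std_pts r, infty, \<rho>) \<in> hurwitz_data n r \<longrightarrow> map \<rho> (gens r) = t \<longrightarrow>
   (std_pts r, infty, \<rho>') \<in> hurwitz_data n r \<longrightarrow> map \<rho>' (gens r) = t' \<longrightarrow>
   connected_component_of (hin n r) (hcls n r \<rho>) (hcls n r \<rho>'))"

lemma linked_sym: "linked n r t t' ==> linked n r t' t"
 unfolding linked_def using connected_component_of_sym by metis

lemma hcls_unique:
 assumes "r \<ge> 2" "(std_pts r, infty, \<rho>) \<in> hurwitz_data n r" "(std_pts r, infty, \<rho>') \<in> hurwitz_data n r"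
  "map \<rho> (gens r) = map \<rho>' (gens r)" shows "hcls n r \<rho> = hcls n r \<rho>'"
 by (rule cls_cong[OF perm_group_alt assms(2,3) std_unique[OF assms(1) hurwitz_dataD(2)[OF assms(2)] hurwitz_dataD(2)[OF assms(3)] assms(4)]])

lemma linked_refl: "r \<ge> 2 ==> linked n r t t"
 unfolding linked_def
proof (intro allI impI)
 fix \<rho> \<rho>' assume r: "r \<ge> 2" and d: "(std_pts r, infty, \<rho>) \<in> hurwitz_data n r" "map \<rho> (gens r) = t"
  "(std_pts r, infty, \<rho>') \<in> hurwitz_data n r" "map \<rho>' (gens r) = t"
 have "hcls n r \<rho> \<in> topspace (hin n r)" unfolding topspace_hurwitz_space using d(1) by (rule quotientI)
 then show "connected_component_of (hin n r) (hcls n r \<rho>) (hcls n r \<rho>')"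
  using hcls_unique[OF r d(1,3)] d(2,4) by (simp add: connected_component_of_refl)
qed

lemma linked_trans:
 assumes "n \<ge> 3" "r \<ge> 2" "t' \<in> nielsen_class n r" "linked n r t t'" "linked n r t' t''"
 shows "linked n r t t''"
proof -
 obtain \<rho> where "(std_pts r, infty, \<rho>) \<in> hurwitz_data n r" "map \<rho> (gens r) = t'"
  using std_datum_exists[OF assms(1-3)] .
 note \<rho> = this
 show ?thesis unfolding linked_def
 proof (intro allI impI)
  fix \<rho>1 \<rho>2 assume d: "(std_pts r, infty, \<rho>1) \<in> hurwitz_data n r" "map \<rho>1 (gens r) = t"
   "(std_pts r, infty, \<rho>2) \<in> hurwitz_data n r" "map \<rho>2 (gens r) = t''"
  show "connected_component_of (hin n r) (hcls n r \<rho>1) (hcls n r \<rho>2)"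
   by (rule connected_component_of_trans[OF assms(4)[unfolded linked_def, rule_format, OF d(1,2) \<rho>]
      assms(5)[unfolded linked_def, rule_format, OF \<rho> d(3,4)]])
 qed
qed

text \<open>\<open>x\<close>, \<open>y\<close>, \<open>z\<close> are the values on three consecutive
  lines and \<open>a = inv' y \<circ> x\<close>, \<open>c = inv' z \<circ> y\<close> the two branch
  cycles between them. Replacing \<open>y\<close> by \<open>z \<circ> inv' y \<circ> x\<close> turns
  \<open>(a, c)\<close> into \<open>(cj (inv' a) c, a)\<close>, the elementary move.\<close>

lemma braid_algebra:
 assumes "bij x" "bij y" "bij z"
 shows "inv' (z \<circ> inv' y \<circ> x) \<circ> x = cj (inv' (inv' y \<circ> x)) (inv' z \<circ> y)"
  "inv' z \<circ> (z \<circ> inv' y \<circ> x) = inv' y \<circ> x"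
 using assms by (auto simp: cj_def o_inv_distrib bij_comp bij_imp_bij_inv inv_inv_eq fun_eq_iff
   bij_is_inj bij_is_surj surj_f_inv_f)

lemma linked_bstep:
 assumes n: "n \<ge> 3" and r: "r \<ge> 2" and t: "t \<in> nielsen_class n r" and b: "bstep t t'"
 shows "linked n r t t'"
 unfolding linked_def
proof (intro allI impI)
 fix \<rho> \<rho>' assume d: "(std_pts r, infty, \<rho>) \<in> hurwitz_data n r" "map \<rho> (gens r) = t"
  and d': "(std_pts r, infty, \<rho>') \<in> hurwitz_data n r" "map \<rho>' (gens r) = t'"
 obtain xs a c ys where ac: "t = xs @ a # c # ys" "t' = xs @ cj (inv' a) c # a # ys" using b by (auto elim: bstep.cases)
 have len: "length t = r" using t by (simp add: nielsen_class_def)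
 \<comment> \<open>List positions start at 0 and branch points at 1: the entries \<open>a\<close>
   and \<open>c\<close> stand at positions \<open>i - 1\<close> and \<open>i\<close> and are
   separated by the line \<open>lv i\<close>.\<close>
 define i where "i = Suc (length xs)"
 have i: "1 \<le> i" "i < r" using len ac(1) by (auto simp: i_def)
 obtain \<tau> where \<tau>: "(std_pts r, infty, \<tau>) \<in> hurwitz_data n r"
  "connected_component_of (hin n r) (hcls n r \<rho>) (hcls n r \<tau>)"
  "\<And>m. m \<noteq> i ==> \<tau> (ell (real m + 1 / 2)) = \<rho> (ell (real m + 1 / 2))"
  "\<tau> (ell (real i + 1 / 2)) =
    \<rho> (ell (real (i + 1) + 1 / 2)) \<circ> inv' (\<rho> (ell (real i + 1 / 2))) \<circ> \<rho> (ell (real (i - 1) + 1 / 2))"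
  by (rule braid_move[OF perm_group_alt n d(1) i]) blast
 have lv: "\<tau> (lv m) = \<rho> (lv m)" if "m \<noteq> i" for m using \<tau>(3)[OF that] by (simp only: lv_def)
 have lvi: "\<tau> (lv i) = \<rho> (lv (Suc i)) \<circ> inv' (\<rho> (lv i)) \<circ> \<rho> (lv (i - 1))"
  using \<tau>(4) by (simp only: lv_def Suc_eq_plus1)
 have gen: "\<sigma> (gen j) = inv' (\<sigma> (lv (Suc j))) \<circ> \<sigma> (lv j)" if "(std_pts r, infty, \<sigma>) \<in> hurwitz_data n r" for \<sigma> j
  using pi1_join[OF hurwitz_dataD(2)[OF that] pin_lv pin_rev[OF pin_lv]] pi1_rev[OF hurwitz_dataD(2)[OF that] pin_lv]
  by (simp add: gen_def)
 have bij: "bij (\<rho> (lv m))" for m by (rule pi1_bij[OF hurwitz_dataD(2)[OF d(1)] pin_lv])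
 have nth: "\<rho> (gen j) = t ! j" if "j < r" for j using d(2) that by (auto simp: gens_def)
 have ta: "t ! (i - 1) = a" "t ! i = c" unfolding ac(1) i_def by (simp_all add: nth_append)
 have im: "Suc (i - 1) = i" using i by simp
 have a: "a = inv' (\<rho> (lv i)) \<circ> \<rho> (lv (i - 1))"
  using nth[of "i - 1"] gen[OF d(1), of "i - 1"] ta i unfolding im by simp
 have c: "c = inv' (\<rho> (lv (Suc i))) \<circ> \<rho> (lv i)" using nth[of i] gen[OF d(1), of i] ta i by simp
 have 1: "\<tau> (gen (i - 1)) = cj (inv' a) c"
  unfolding gen[OF \<tau>(1)] im lvi a c using lv[of "i - 1"] i braid_algebra(1)[OF bij bij bij] by simp
 have 2: "\<tau> (gen i) = a" unfolding gen[OF \<tau>(1)] lvi a using lv[of "Suc i"] braid_algebra(2)[OF bij bij bij] by simp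
 have 3: "\<tau> (gen j) = t ! j" if "j < r" "j \<noteq> i" "j \<noteq> i - 1" for j
  using gen[OF \<tau>(1)] gen[OF d(1)] lv[of j] lv[of "Suc j"] nth[OF that(1)] that(2,3) by auto
 have "map \<tau> (gens r) = t'"
 proof (rule nth_equalityI)
  show "length (map \<tau> (gens r)) = length t'" using len ac by (simp add: gens_def)
  fix j assume "j < length (map \<tau> (gens r))"
  then have j: "j < r" by (simp add: gens_def)
  have m: "map \<tau> (gens r) ! j = \<tau> (gen j)" using j by (simp add: gens_def)
  consider "j = i - 1" | "j = i" | "j \<noteq> i" "j \<noteq> i - 1" by blast
  then show "map \<tau> (gens r) ! j = t' ! j"
  proof cases
   case 1
   then show ?thesis
    unfolding m using \<open>\<tau> (gen (i - 1)) = cj (inv' a) c\<close> by (simp add: ac(2) i_def nth_append)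
  next
   case 2
   then show ?thesis unfolding m using \<open>\<tau> (gen i) = a\<close> by (simp add: ac(2) i_def nth_append)
  next
   case 3
   then have "t ! j = t' ! j" unfolding ac i_def by (auto simp: nth_append nth_Cons' not_less)
   then show ?thesis
    unfolding m using \<open>\<And>j. j < r ==> j \<noteq> i ==> j \<noteq> i - 1 ==> \<tau> (gen j) = t ! j\<close>[OF j 3] by simp
  qed
 qed
 then have "hcls n r \<tau> = hcls n r \<rho>'" using hcls_unique[OF r \<tau>(1) d'(1)] d'(2) by simp
 then show "connected_component_of (hin n r) (hcls n r \<rho>) (hcls n r \<rho>')" using \<tau>(2) by simp
qed

lemma linked_braid:
 assumes n: "n \<ge> 3" and r: "r \<ge> 2" and t: "t \<in> nielsen_class n r" and b: "t \<sim>\<^sub>b t'"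
 shows "linked n r t t'"
 using b
proof (induction rule: equivclp_induct)
 case base
 show ?case by (rule linked_refl[OF r])
next
 case (step y z)
 have yz: "y \<in> nielsen_class n r" "z \<in> nielsen_class n r"
  using nielsen_class_braid[OF n t] step(1,2) equivclp_into_equivclp by metis+
 have "linked n r y z" using step(2) linked_bstep[OF n r yz(1)] linked_sym[OF linked_bstep[OF n r yz(2)]] by blast
 then show ?case by (rule linked_trans[OF n r yz(1) step(3)])
qed

text \<open>Every class is joined to one over the standard branch points. There two tuples agree up
  to a braid, which stays in the component, and an even conjugation, which does not change the inner
  class.\<close>

lemma hurwitz_in_connected:
 assumes n: "n \<ge> 5" and r: "r = n - 1"
 shows "connected_space (hurwitz_in n r)" "topspace (hurwitz_in n r) \<noteq> {}"
proof -
 have n3: "n \<ge> 3" and r2: "r \<ge> 2" using n r by auto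
 have std: "connected_component_of (hin n r) (hcls n r \<rho>) (hcls n r \<rho>')"
  if d: "(std_pts r, infty, \<rho>) \<in> hurwitz_data n r" "(std_pts r, infty, \<rho>') \<in> hurwitz_data n r" for \<rho> \<rho>'
 proof -
  have t: "map \<rho> (gens r) \<in> nielsen_class n r" "map \<rho>' (gens r) \<in> nielsen_class n r"
   using classical_generators_nielsen[OF _ classical_generators_std[OF r2]] d by blast+
  from nielsen_transitive[OF n t[unfolded r]] obtain s where
   s: "s \<in> carrier (alt_group n)" "map \<rho> (gens r) \<sim>\<^sub>b map (cj s) (map \<rho>' (gens r))"
   unfolding r by blast
  have "s permutes {1..n}" using s(1) alt_group_carrier by blast
  note d'' = hurwitz_data_cj[OF d(2) this n3]
  have "map (cj s) (map \<rho>' (gens r)) = map (\<lambda>\<gamma>. cj s (\<rho>' \<gamma>)) (gens r)" by simp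
  with linked_braid[OF n3 r2 t(1) s(2)] d(1) d''
  have "connected_component_of (hin n r) (hcls n r \<rho>) (hcls n r (\<lambda>\<gamma>. cj s (\<rho>' \<gamma>)))"
   unfolding linked_def by metis
  then show ?thesis using cls_cj[OF perm_group_alt d(2) s(1) n3] by simp
 qed
 show "connected_space (hurwitz_in n r)"
  unfolding connected_space_iff_connected_component hurwitz_in_def topspace_hurwitz_space
 proof (intro ballI)
  fix x y assume "x \<in> hurwitz_data n r // cover_equiv n r (carrier (alt_group n))"
   "y \<in> hurwitz_data n r // cover_equiv n r (carrier (alt_group n))"
  then obtain d d' where d: "d \<in> hurwitz_data n r" "x = cls n r (carrier (alt_group n)) d"
   "d' \<in> hurwitz_data n r" "y = cls n r (carrier (alt_group n)) d'" by (elim quotientE)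
  obtain \<rho> \<rho>' where \<rho>: "(std_pts r, infty, \<rho>) \<in> hurwitz_data n r"
   "connected_component_of (hin n r) x (hcls n r \<rho>)" "(std_pts r, infty, \<rho>') \<in> hurwitz_data n r"
   "connected_component_of (hin n r) y (hcls n r \<rho>')"
   using reach_std_all[OF perm_group_alt n3 d(1)] reach_std_all[OF perm_group_alt n3 d(3)]
   unfolding reach_def d(2,4) by blast
  show "connected_component_of (hin n r) x y"
   using \<rho>(2,4) std[OF \<rho>(1,3)] by (meson connected_component_of_trans connected_component_of_sym)
 qed
 obtain t where "t \<in> nielsen_class n r" using nielsen_class_nonempty[OF n3] r by blast
 from std_datum_exists[OF n3 r2 this] obtain \<rho> where "(std_pts r, infty, \<rho>) \<in> hurwitz_data n r" .
 then have "hcls n r \<rho> \<in> topspace (hurwitz_in n r)"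
  unfolding hurwitz_in_def topspace_hurwitz_space by (rule quotientI)
 then show "topspace (hurwitz_in n r) \<noteq> {}" by blast
qed

theorem theorem1p2:
 fixes n r :: nat
 assumes "n \<ge> 5" and "r = n - 1"
 shows "card (connected_components_of (hurwitz_in n r)) = 1 \<and>
  has_map_degree (hurwitz_in n r) (hurwitz_abs n r) (psi_in_abs n r) 2"
proof
 \<comment> \<open>The empty space is connected but has no component, so nonemptiness enters the
   count.\<close>
 have "hurwitz_in n r \<noteq> trivial_topology" using hurwitz_in_connected(2)[OF assms] by simp
 then have "connected_components_of (hurwitz_in n r) = {topspace (hurwitz_in n r)}"
  using hurwitz_in_connected(1)[OF assms] by (simp add: connected_components_of_eq_singleton)
 then show "card (connected_components_of (hurwitz_in n r)) = 1" by simp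
 show "has_map_degree (hurwitz_in n r) (hurwitz_abs n r) (psi_in_abs n r) 2" by (rule has_map_degree_psi[OF assms(1)])
qed

end
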